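(* Let $p>0$ be an integer, let $\gamma\ge 0$, let $\boldsymbol\alpha\in\mathbb A$ be fixed, and assume that $h=h_n\to 0$, $nh^{2p+1}\to\infty$, and $nh^{2p+3}<\infty$ (i.e. $nh^{2p+3}$ stays bounded) as $n\to\infty$. Assume conditions (A1)–(A5) listed in the context. (i) If $x_0$ is a fixed point in the interior of $\mathrm{supp}(f_X)$ satisfying $\eta(x_0,\boldsymbol\alpha)\neq 0$, then $$\frac{\sqrt{nh}}{\sigma_{0,0,p}(x_0;K)}\left[\hat\eta_u(x_0;p,h,\boldsymbol\alpha)-\eta_0(x_0)-\mathrm{Bias}\right]\xrightarrow{\mathcal D}N(0,1),\qquad( * )$$ where the term $\mathrm{Bias}$ is $\mathrm{Bias}_o$ for odd $p$ and $\mathrm{Bias}_e$ for even $p$, defined, with $\phi(x)=\{\eta_0(x)-\eta(x,\boldsymbol\alpha)\}/\eta(x,\boldsymbol\alpha)^\gamma$, by $$\mathrm{Bias}_o=\frac{\eta(x_0,\boldsymbol\alpha)^\gamma}{(p+1)!}\,\phi^{(p+1)}(x_0)\,h^{p+1}\left(\int z^{p+1}K_{0,p}(z)\,dz\right)\{1+O(h)\}$$ and $$\mathrm{Bias}_e=\left\{\int z^{p+2}K_{0,p}(z)\,dz\,\frac{1}{(p+2)!}\phi^{(p+2)}(x_0)\,\eta(x_0,\boldsymbol\alpha)^\gamma+\frac{1}{(p+1)!}\phi^{(p+1)}(x_0)\,\frac{(\rho\,\eta(\cdot,\boldsymbol\alpha)^{2\gamma}f_X)'(x_0)}{(\rho\,\eta(\cdot,\boldsymbol\alpha)^{\gamma}f_X)(x_0)}\int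 z^{p+2}K_{0,p}(z)\,dz\right\}h^{p+2}\{1+O(h)\}.$$ (ii) If $x_0=x_n$ is of the form $x_0=x_\delta+ch$ satisfying $\eta(x_0,\boldsymbol\alpha)\ne0$, where $x_\delta$ is a point on the boundary of $\mathrm{supp}(f_X)$ and $c\in[-1,1]$, then $( * )$ holds (with $\mathrm{Bias}$ again $\mathrm{Bias}_o$ for odd $p$ and $\mathrm{Bias}_e$ for even $p$) with $\sigma^2_{0,0,p}(x_0;K)$ and $\int z^{p+1}K_{0,p}(z)\,dz$ replaced by $\sigma^2_{0,0,p}(x_0;K,\mathcal D_{x_0,h})$ and $\int_{\mathcal D_{x_0,h}}z^{p+1}K_{0,p}(z;\mathcal D_{x_0,h})\,dz$, respectively.
   Context: Model. $(X_1,Y_1),\dots,(X_n,Y_n)$ are i.i.d. real random pairs distributed as $(X,Y)$; $X$ has density $f_X$ with support $\mathrm{supp}(f_X)\subseteq\mathbb R$. Put $\mu(x)=E(Y|X=x)$, let $g$ be a known monotone link function, and let $\eta_0(x)=g(\mu(x))$ be the true unknown function. $V$ is a known positive function (the variance function modelling the conditional variance as $V(\mu(x))$); $\mathrm{var}(Y|X=x)$ denotes the conditional variance of $Y$. The quasi-log-likelihood $Q(w,y)$ satisfies $\frac{\partial}{\partial w}Q(w,y)=\frac{y-w}{V(w)}$. Put $q_i(x,y)=\frac{\partial^i}{\partial x^i}Q(g^{-1}(x),y)$ and $\rho(x)=\{g'(\mu(x))^2V(\mu(x))\}^{-1}$. Parametric guide. $\{\eta(\cdot,\boldsymbol\alpha):\boldsymbol\alpha\in\mathbb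 A\subset\mathbb R^q\}$ is a parametric family of real functions; here $\boldsymbol\alpha\in\mathbb A$ is fixed (non-random). Estimator. $K$ is a kernel, $K_h(u)=K(u/h)/h$, $\mathbf X_i=(1,X_i-x_0,\dots,(X_i-x_0)^p)^T$, $\boldsymbol\beta=(\beta_0,\dots,\beta_p)^T$. Let $\hat{\boldsymbol\beta}=(\hat\beta_0,\dots,\hat\beta_p)^T$ be the maximizer over $\boldsymbol\beta$ of $$Q_u(\boldsymbol\beta;h,x_0,\boldsymbol\alpha)=\sum_{i=1}^nQ\Big(g^{-1}\big(\eta(X_i,\boldsymbol\alpha)+(\mathbf X_i^T\boldsymbol\beta-\eta(x_0,\boldsymbol\alpha))\,\eta(X_i,\boldsymbol\alpha)^\gamma/\eta(x_0,\boldsymbol\alpha)^\gamma\big),Y_i\Big)K_h(X_i-x_0),$$ and $\hat\eta_u(x_0;p,h,\boldsymbol\alpha)=\hat\beta_0$. Kernel constants. For measurable $\mathcal A\subset\mathbb R$: $\nu_l(\mathcal A)=\int_{\mathcal A}z^lK(z)\,dz$; $\mathbf N_p(\mathcal A)$ is the $(p+1)\times(p+1)$ matrix with $(i,j)$ entry $\nu_{i+j-2}(\mathcal A)$; $\mathbf M_{r,p}(z;\mathcal A)$ is $\mathbf N_p(\mathcal A)$ with its $(r+1)$th column replaced by $(1,z,\dots,z^p)^T$; if $|\mathbf N_p(\mathcal A)|\ne0$, $K_{r,p}(z;\mathcal A)=r!\{|\mathbf M_{r,p}(z;\mathcal A)|/|\mathbf N_p(\mathcal A)|\}K(z)$ ($|\cdot|$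 is the determinant). Further $$\sigma^2_{r,s,p}(x_0;K,\mathcal A)=\mathrm{var}(Y|X=x_0)\,g'(\mu(x_0))^2f_X(x_0)^{-1}\int_{\mathcal A}K_{r,p}(z;\mathcal A)K_{s,p}(z;\mathcal A)\,dz.$$ The argument $\mathcal A$ is suppressed when $\mathcal A\supseteq[-1,1]$. $\mathcal D_{x_0,h}=\{z:x_0-hz\in\mathrm{supp}(f_X)\}\cap[-1,1]$. Conditions. (A1) $q_2(x,y)<0$ for $x\in\mathbb R$ and $y$ in the range of the response variable. (A2) The functions $f_X'$, $\eta_0^{(p+2)}$, $\frac{\partial^{p+2}}{\partial x^{p+2}}\eta(x,\boldsymbol\alpha)$, $\mathrm{var}(Y|X=\cdot)$, $V''$ and $g'''$ are continuous. (A3) For each $x\in\mathrm{supp}(f_X)$, $\rho(x)$, $\mathrm{var}(Y|X=x)$ and $g'(\mu(x))$ are nonzero. (A4) $K$ is a symmetric probability density with support $[-1,1]$. (A5) For each point $x_\delta$ on the boundary of $\mathrm{supp}(f_X)$ there is an interval $\mathcal C$ containing $x_\delta$, with nonempty interior, such that $\inf_{x\in\mathcal C}f_X(x)>0$.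
   Formalization: Adds: K square integrable; f_X(x_0)>0 in (i); local uniform integrability of (Y-μ(X))² given X; in (ii) the segment from x_δ to x_0 lies in supp(f_X), η(x_δ,α)≠0 if γ≠0, and for even p √(nh) times the h^{p+1} boundary bias tends to 0; f_X' is taken within supp(f_X). *)

theory Defs
  imports "HOL-Probability.Probability" "Jordan_Normal_Form.Determinant"
begin

section \<open>Supports and smoothness\<close>

definition supp :: "(real \<Rightarrow> real) \<Rightarrow> real set" where
  "supp f = closure {x. f x \<noteq> 0}"

text \<open>Meant for open \<open>S\<close>, where the two-sided derivatives are the right ones.\<close>

definition times_cont_diff_on :: "nat \<Rightarrow> (real \<Rightarrow> real) \<Rightarrow> real set \<Rightarrow> bool" where
  "times_cont_diff_on k f S \<longleftrightarrow>
     (\<forall>j<k. \<forall>x\<in>S. (deriv ^^ j) f differentiable (at x)) \<and> continuous_on S ((deriv ^^ k) f)"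

text \<open>A density bounded away from zero up to a boundary point of its support jumps there, so
  its derivative is taken relative to the support (one-sided at boundary points).\<close>

definition cont_diff_within :: "(real \<Rightarrow> real) \<Rightarrow> real set \<Rightarrow> bool" where
  "cont_diff_within f S \<longleftrightarrow>
     (\<exists>f'. (\<forall>x\<in>S. (f has_real_derivative f' x) (at x within S)) \<and> continuous_on S f')"


section \<open>Sample, regression function and conditional variance\<close>

definition iid_pairs ::
  "'a measure \<Rightarrow> (nat \<Rightarrow> 'a \<Rightarrow> real) \<Rightarrow> (nat \<Rightarrow> 'a \<Rightarrow> real) \<Rightarrow> bool" where
  "iid_pairs M X Y \<longleftrightarrow>
     prob_space.indep_vars M (\<lambda>_. borel :: (real \<times> real) measure) (\<lambda>i \<omega>. (X i \<omega>, Y i \<omega>)) UNIV \<and>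
     (\<forall>i. distr M (borel :: (real \<times> real) measure) (\<lambda>\<omega>. (X i \<omega>, Y i \<omega>))
        = distr M borel (\<lambda>\<omega>. (X 0 \<omega>, Y 0 \<omega>)))"

definition sigma_gen :: "'a measure \<Rightarrow> ('a \<Rightarrow> real) \<Rightarrow> 'a measure" where
  "sigma_gen M X = vimage_algebra (space M) X borel"

definition regression_function ::
  "'a measure \<Rightarrow> ('a \<Rightarrow> real) \<Rightarrow> ('a \<Rightarrow> real) \<Rightarrow> (real \<Rightarrow> real) \<Rightarrow> bool" where
  "regression_function M X Y \<mu> \<longleftrightarrow>
     integrable M Y \<and> \<mu> \<in> borel_measurable borel \<and>
     (AE \<omega> in M. real_cond_exp M (sigma_gen M X) Y \<omega> = \<mu> (X \<omega>))"

definition conditional_variance ::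
  "'a measure \<Rightarrow> ('a \<Rightarrow> real) \<Rightarrow> ('a \<Rightarrow> real) \<Rightarrow> (real \<Rightarrow> real) \<Rightarrow> (real \<Rightarrow> real) \<Rightarrow> bool" where
  "conditional_variance M X Y \<mu> v \<longleftrightarrow>
     v \<in> borel_measurable borel \<and> (\<forall>x. 0 \<le> v x) \<and>
     (AE \<omega> in M. nn_cond_exp M (sigma_gen M X) (\<lambda>\<omega>. ennreal ((Y \<omega> - \<mu> (X \<omega>))\<^sup>2)) \<omega>
        = ennreal (v (X \<omega>)))"

text \<open>Local Lindeberg condition: near \<open>x\<close>, the squared deviations are uniformly integrable
  under the conditional laws of \<open>Y\<close> given \<open>X\<close>. It holds, for example, when some conditional
  absolute moment of order greater than two is bounded near \<open>x\<close>.\<close>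

definition lindeberg_at ::
  "'a measure \<Rightarrow> ('a \<Rightarrow> real) \<Rightarrow> ('a \<Rightarrow> real) \<Rightarrow> (real \<Rightarrow> real) \<Rightarrow> real \<Rightarrow> bool" where
  "lindeberg_at M X Y \<mu> x \<longleftrightarrow>
     (\<forall>\<epsilon>>0. \<exists>\<delta>>0. \<exists>B. AE \<omega> in M. \<bar>X \<omega> - x\<bar> < \<delta> \<longrightarrow>
        nn_cond_exp M (sigma_gen M X)
          (\<lambda>\<omega>. if \<bar>Y \<omega> - \<mu> (X \<omega>)\<bar> > B then ennreal ((Y \<omega> - \<mu> (X \<omega>))\<^sup>2) else 0) \<omega>
        \<le> ennreal \<epsilon>)"


section \<open>Guided local quasi-likelihood estimator\<close>

definition quasi_deriv ::
  "(real \<Rightarrow> real \<Rightarrow> real) \<Rightarrow> (real \<Rightarrow> real) \<Rightarrow> nat \<Rightarrow> real \<Rightarrow> real \<Rightarrow> real" where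
  "quasi_deriv Q ginv i x y = (deriv ^^ i) (\<lambda>t. Q (ginv t) y) x"

text \<open>The power \<open>t\<^sup>\<gamma>\<close> for \<open>t\<close> of either sign: the usual power when \<open>\<gamma>\<close> is a natural number
  (in particular it is 1 for \<open>\<gamma> = 0\<close>), and the power of the absolute value otherwise. Only
  ratios of such powers matter below, and near a point where the guide is nonzero these do not
  depend on the convention.\<close>

definition guide_power :: "real \<Rightarrow> real \<Rightarrow> real" where
  "guide_power \<gamma> t = (if \<gamma> \<in> \<nat> then t ^ nat \<lfloor>\<gamma>\<rfloor> else \<bar>t\<bar> powr \<gamma>)"

definition kernel_scaled :: "(real \<Rightarrow> real) \<Rightarrow> real \<Rightarrow> real \<Rightarrow> real" where
  "kernel_scaled K h u = K (u / h) / h"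

text \<open>Coefficient vectors are functions on \<open>nat\<close> of which only the entries \<open>0, \<dots>, p\<close> are used;
  \<open>e\<close> is the guide for the fixed parameter, and \<open>xs\<close>, \<open>ys\<close> are the observed data.\<close>

definition guided_quasi_lik ::
  "(real \<Rightarrow> real \<Rightarrow> real) \<Rightarrow> (real \<Rightarrow> real) \<Rightarrow> (real \<Rightarrow> real) \<Rightarrow> (real \<Rightarrow> real) \<Rightarrow> real \<Rightarrow> nat
    \<Rightarrow> nat \<Rightarrow> real \<Rightarrow> real \<Rightarrow> (nat \<Rightarrow> real) \<Rightarrow> (nat \<Rightarrow> real) \<Rightarrow> (nat \<Rightarrow> real) \<Rightarrow> real" where
  "guided_quasi_lik Q ginv K e \<gamma> p n h x0 xs ys \<beta> =
     (\<Sum>i<n. Q (ginv (e (xs i) + ((\<Sum>j\<le>p. \<beta> j * (xs i - x0) ^ j) - e x0)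
                        * guide_power \<gamma> (e (xs i)) / guide_power \<gamma> (e x0))) (ys i)
             * kernel_scaled K h (xs i - x0))"

text \<open>\<open>bhat n\<close> is a random vector that maximizes the criterion based on the first \<open>n\<close>
  observations whenever a maximizer exists. For finite \<open>n\<close> a maximizer may be missing (logistic
  regression with all responses in the window equal) or not unique (too few observations in the
  window), so existence and uniqueness for every sample are not demanded.\<close>

definition guided_estimator ::
  "'a measure \<Rightarrow> (nat \<Rightarrow> 'a \<Rightarrow> real) \<Rightarrow> (nat \<Rightarrow> 'a \<Rightarrow> real)
    \<Rightarrow> (real \<Rightarrow> real \<Rightarrow> real) \<Rightarrow> (real \<Rightarrow> real) \<Rightarrow> (real \<Rightarrow> real) \<Rightarrow> (real \<Rightarrow> real) \<Rightarrow> real \<Rightarrow> nat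
    \<Rightarrow> (nat \<Rightarrow> real) \<Rightarrow> (nat \<Rightarrow> real) \<Rightarrow> (nat \<Rightarrow> 'a \<Rightarrow> nat \<Rightarrow> real) \<Rightarrow> bool" where
  "guided_estimator M X Y Q ginv K e \<gamma> p h x0 bhat \<longleftrightarrow>
     (\<forall>n. (\<forall>j\<le>p. (\<lambda>\<omega>. bhat n \<omega> j) \<in> borel_measurable M) \<and>
        (\<forall>\<omega>\<in>space M.
           let L = guided_quasi_lik Q ginv K e \<gamma> p n (h n) (x0 n) (\<lambda>i. X i \<omega>) (\<lambda>i. Y i \<omega>) in
           (\<exists>\<beta>. \<forall>\<beta>'. L \<beta>' \<le> L \<beta>) \<longrightarrow> (\<forall>\<beta>'. L \<beta>' \<le> L (bhat n \<omega>))))"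


section \<open>Kernel constants, asymptotic variance and bias\<close>

definition kernel_moment :: "(real \<Rightarrow> real) \<Rightarrow> nat \<Rightarrow> real set \<Rightarrow> real" where
  "kernel_moment K l A = (LINT z:A|lborel. z ^ l * K z)"

definition moment_mat :: "(real \<Rightarrow> real) \<Rightarrow> nat \<Rightarrow> real set \<Rightarrow> real mat" where
  "moment_mat K p A = Matrix.mat (p + 1) (p + 1) (\<lambda>(i, j). kernel_moment K (i + j) A)"

definition equiv_kernel :: "(real \<Rightarrow> real) \<Rightarrow> nat \<Rightarrow> nat \<Rightarrow> real set \<Rightarrow> real \<Rightarrow> real" where
  "equiv_kernel K r p A z =
     fact r * (Determinant.det (replace_col (moment_mat K p A) (Matrix.vec (p + 1) (\<lambda>i. z ^ i)) r)
               / Determinant.det (moment_mat K p A)) * K z"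

definition asym_var ::
  "(real \<Rightarrow> real) \<Rightarrow> nat \<Rightarrow> nat \<Rightarrow> nat \<Rightarrow> (real \<Rightarrow> real) \<Rightarrow> (real \<Rightarrow> real) \<Rightarrow> (real \<Rightarrow> real)
    \<Rightarrow> (real \<Rightarrow> real) \<Rightarrow> real \<Rightarrow> real set \<Rightarrow> real" where
  "asym_var K r s p v g \<mu> f x0 A =
     v x0 * (deriv g (\<mu> x0))\<^sup>2 * inverse (f x0)
       * (LINT z:A|lborel. equiv_kernel K r p A z * equiv_kernel K s p A z)"

definition local_dom :: "(real \<Rightarrow> real) \<Rightarrow> real \<Rightarrow> real \<Rightarrow> real set" where
  "local_dom f x0 h = {z. x0 - h * z \<in> supp f} \<inter> {-1..1}"

definition rho :: "(real \<Rightarrow> real) \<Rightarrow> (real \<Rightarrow> real) \<Rightarrow> (real \<Rightarrow> real) \<Rightarrow> real \<Rightarrow> real" where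
  "rho g V \<mu> x = inverse ((deriv g (\<mu> x))\<^sup>2 * V (\<mu> x))"

definition phi :: "real \<Rightarrow> (real \<Rightarrow> real) \<Rightarrow> (real \<Rightarrow> real) \<Rightarrow> real \<Rightarrow> real" where
  "phi \<gamma> eta0 e x = (eta0 x - e x) / guide_power \<gamma> (e x)"

text \<open>Bias terms without the factor \<open>1 + O(h)\<close>.\<close>

definition bias_odd ::
  "(real \<Rightarrow> real) \<Rightarrow> nat \<Rightarrow> real \<Rightarrow> (real \<Rightarrow> real) \<Rightarrow> (real \<Rightarrow> real) \<Rightarrow> real \<Rightarrow> real \<Rightarrow> real set
    \<Rightarrow> real" where
  "bias_odd K p \<gamma> eta0 e x0 h A =
     guide_power \<gamma> (e x0) / fact (p + 1) * (deriv ^^ (p + 1)) (phi \<gamma> eta0 e) x0 * h ^ (p + 1)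
       * (LINT z:A|lborel. z ^ (p + 1) * equiv_kernel K 0 p A z)"

text \<open>The first-order derivative is relative to the support of \<open>f\<close>, see above; \<open>\<eta>\<^sup>2\<^sup>\<gamma>\<close> is
  the square of \<open>\<eta>\<^sup>\<gamma>\<close>.\<close>

definition bias_even ::
  "(real \<Rightarrow> real) \<Rightarrow> nat \<Rightarrow> real \<Rightarrow> (real \<Rightarrow> real) \<Rightarrow> (real \<Rightarrow> real) \<Rightarrow> (real \<Rightarrow> real) \<Rightarrow> (real \<Rightarrow> real)
    \<Rightarrow> real \<Rightarrow> real \<Rightarrow> real set \<Rightarrow> real" where
  "bias_even K p \<gamma> eta0 e r f x0 h A =
     ((LINT z:A|lborel. z ^ (p + 2) * equiv_kernel K 0 p A z)
        * (1 / fact (p + 2)) * (deriv ^^ (p + 2)) (phi \<gamma> eta0 e) x0 * guide_power \<gamma> (e x0)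
      + 1 / fact (p + 1) * (deriv ^^ (p + 1)) (phi \<gamma> eta0 e) x0
        * (vector_derivative (\<lambda>x. r x * (guide_power \<gamma> (e x))\<^sup>2 * f x) (at x0 within supp f)
           / (r x0 * guide_power \<gamma> (e x0) * f x0))
        * (LINT z:A|lborel. z ^ (p + 2) * equiv_kernel K 0 p A z)) * h ^ (p + 2)"

text \<open>The estimator is centred at \<open>eta0 (x0 n)\<close> plus bias; \<open>s n\<close> is the asymptotic variance and
  \<open>b n\<close> the bias without its factor \<open>1 + O(h)\<close>, which is some sequence \<open>1 + r n\<close>.\<close>

definition asymp_normal ::
  "'a measure \<Rightarrow> (nat \<Rightarrow> real) \<Rightarrow> (nat \<Rightarrow> real) \<Rightarrow> (nat \<Rightarrow> 'a \<Rightarrow> nat \<Rightarrow> real) \<Rightarrow> (real \<Rightarrow> real)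
    \<Rightarrow> (nat \<Rightarrow> real) \<Rightarrow> (nat \<Rightarrow> real) \<Rightarrow> bool" where
  "asymp_normal M h x0 bhat eta0 s b \<longleftrightarrow>
     (\<exists>r. r \<in> O(h) \<and>
        weak_conv_m
          (\<lambda>n. distr M borel (\<lambda>\<omega>. sqrt (real n * h n) / sqrt (s n)
                                  * (bhat n \<omega> 0 - eta0 (x0 n) - b n * (1 + r n))))
          std_normal_distribution)"

end

theory Submission
  imports Defs
begin

text \<open>In the linear predictor the quasi-likelihood is concave (A1), so the estimator can be located by a
  quadratic expansion on a bounded set of coefficients. The expansion is taken at the coefficients
  \<open>bs\<close> whose predictor is the guide plus the power of the guide times the Taylor polynomial of \<open>phi\<close>. In
  \<open>u j = sqrt (n h) h ^ j (beta j - bs j)\<close> the criterion is, up to a small error and with high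
  probability, the score times \<open>u\<close> minus half the quadratic form of a multiple of the matrix of kernel
  moments over the part of the window inside the support. By concavity every maximizer is then close
  to the maximizer \<open>uhat\<close> of that quadratic, whose zeroth coordinate is a sum weighted by the equivalent
  kernel. Its centred part is row-wise i.i.d. and obeys the Lindeberg central limit theorem; the
  rest concentrates at the bias of order \<open>h ^ (p + 1)\<close>. Everything of order \<open>h ^ (p + 2)\<close> disappears because
  \<open>n h ^ (2 p + 3)\<close> is bounded, so the factor \<open>1 + O(h)\<close> may be taken to be 1.

  At the boundary the window inside the support varies with \<open>n\<close>; all bounds are therefore uniform
  over windows containing \<open>[0, 1]\<close> or \<open>[-1, 0]\<close>. In the coordinate \<open>(x - x0) / h\<close> the window is the mirror
  image of \<open>local_dom\<close>, which is harmless because the kernel is symmetric.\<close>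

subsection \<open>Convergence and boundedness in probability\<close>

text \<open>A maximizer need not exist for every sample, and the estimator is constrained only when
  one does. Existence therefore has to come out of the argument, on events of high probability;
  global concavity yields it together with the location, and takes the place of a separate
  consistency proof.

  The expansion is made at the approximating predictor, not the true one, because the criterion is
  then exactly a function of a polynomial perturbation. The price is a score with nonzero mean: the
  approximation error of order h^(p+1), averaged against the equivalent kernel, is the bias. Since
  \<open>sqrt (n h) h^(p+1)\<close> stays bounded, only the limit of this mean matters, so
  continuity of the derivative of order p+1 stands in for a further Taylor term. For even p its
  coefficient vanishes in the interior by symmetry of the kernel.

  Along a boundary sequence neither the window nor the variance need converge. Limits are therefore
  stated as differences from a moving target, and the limit law is obtained after dividing by a
  standard deviation that moves as well.\<close>

lemma eventually_bounded_of_tendsto: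
  fixes a :: "nat \<Rightarrow> real"
  assumes "a \<longlonglongrightarrow> c" shows "\<forall>\<^sub>F n in sequentially. \<bar>a n\<bar> \<le> \<bar>c\<bar> + 1"
proof -
  have "\<forall>\<^sub>F n in sequentially. \<bar>a n - c\<bar> < 1" using tendstoD[OF assms, of 1] by (simp add: dist_real_def)
  then show ?thesis by eventually_elim linarith
qed

text \<open>Lets second moments control first absolute moments where no normalization is
  available.\<close>

lemma abs_le_one_plus_square: "\<bar>u\<bar> \<le> 1 + u\<^sup>2" for u :: real
proof -
  have "0 \<le> (\<bar>u\<bar> - 1/2)\<^sup>2" by simp
  then have "\<bar>u\<bar> \<le> \<bar>u\<bar> * \<bar>u\<bar> + 1/4" by (simp only: power2_eq_square) (simp add: algebra_simps)
  then show ?thesis by (simp only: abs_mult_self_eq power2_eq_square)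
qed

text \<open>An enclosing event is used instead of the probability of the set itself: exceptional
  sets can then be united and enlarged without proving the predicate measurable.\<close>

abbreviation (in prob_space) unlikely :: "real \<Rightarrow> ('a \<Rightarrow> bool) \<Rightarrow> bool" where
  "unlikely \<eta> P \<equiv> \<exists>B\<in>events. prob B \<le> \<eta> \<and> {\<omega>\<in>space M. P \<omega>} \<subseteq> B"

definition (in prob_space) to_zero_in_prob :: "(nat \<Rightarrow> 'a \<Rightarrow> real) \<Rightarrow> bool" where
  "to_zero_in_prob U \<longleftrightarrow>
     (\<forall>\<epsilon>>0. \<forall>\<eta>>0. \<forall>\<^sub>F n in sequentially. unlikely \<eta> (\<lambda>\<omega>. \<epsilon> < \<bar>U n \<omega>\<bar>))"

definition (in prob_space) bounded_in_prob :: "(nat \<Rightarrow> 'a \<Rightarrow> real) \<Rightarrow> bool" where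
  "bounded_in_prob U \<longleftrightarrow>
     (\<forall>\<eta>>0. \<exists>R. \<forall>\<^sub>F n in sequentially. unlikely \<eta> (\<lambda>\<omega>. R < \<bar>U n \<omega>\<bar>))"

context prob_space begin

text \<open>Off \<open>B\<close> the map x -> exp(i t x) is Lipschitz with constant |t|; on
  \<open>B\<close> two points of the unit circle differ by at most 2. Integrating the two bounds
  gives the two terms.\<close>

lemma char_perturbation_le:
  assumes [measurable]: "random_variable borel U" "random_variable borel W" and B: "B \<in> events"
    and sub: "{\<omega>\<in>space M. \<epsilon> < \<bar>W \<omega> - U \<omega>\<bar>} \<subseteq> B" and "0 \<le> \<epsilon>"
  shows "cmod (char (distr M borel W) t - char (distr M borel U) t) \<le> \<bar>t\<bar> * \<epsilon> + 2 * prob B"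
proof -
  note B[measurable]
  have i: "integrable M (\<lambda>x. iexp (t * W x))" "integrable M (\<lambda>x. iexp (t * U x))"
    by (auto intro!: integrable_iexp)
  have "char (distr M borel W) t - char (distr M borel U) t = (CLINT x|M. iexp (t * W x) - iexp (t * U x))"
    using i by (simp add: char_def integral_distr)
  also have "cmod \<dots> \<le> (LINT x|M. cmod (iexp (t * W x) - iexp (t * U x)))"
    by (rule integral_norm_bound)
  also have "\<dots> \<le> (LINT x|M. \<bar>t\<bar> * \<epsilon> + 2 * indicator B x)"
  proof (rule integral_mono)
    show "integrable M (\<lambda>x. cmod (iexp (t * W x) - iexp (t * U x)))"
      using i by auto
    show "integrable M (\<lambda>x. \<bar>t\<bar> * \<epsilon> + 2 * indicator B x :: real)"
      by (intro Bochner_Integration.integrable_add integrable_mult_right) (auto simp: emeasure_eq_measure)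
    fix x assume x: "x \<in> space M"
    have 2: "cmod (iexp (t * W x) - iexp (t * U x)) \<le> 2"
      using norm_triangle_ineq4[of "iexp (t * W x)" "iexp (t * U x)"] by simp
    have "iexp (t * W x) - iexp (t * U x) = iexp (t * U x) * (iexp (t * (W x - U x)) - 1)"
      by (simp add: field_simps exp_add[symmetric])
    then have "cmod (iexp (t * W x) - iexp (t * U x)) = cmod (iexp (t * (W x - U x)) - 1)"
      by (simp add: norm_mult)
    also have "\<dots> \<le> \<bar>t * (W x - U x)\<bar>"
      using iexp_approx1[of "t * (W x - U x)" 0] by simp
    finally have 1: "cmod (iexp (t * W x) - iexp (t * U x)) \<le> \<bar>t\<bar> * \<bar>W x - U x\<bar>"
      by (simp add: abs_mult)
    show "cmod (iexp (t * W x) - iexp (t * U x)) \<le> \<bar>t\<bar> * \<epsilon> + 2 * indicator B x"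
    proof (cases "x \<in> B")
      case True
      have "0 \<le> \<bar>t\<bar> * \<epsilon>" using \<open>0 \<le> \<epsilon>\<close> by simp
      then show ?thesis using 2 True by (auto simp: indicator_def)
    next
      case False
      then have "\<bar>W x - U x\<bar> \<le> \<epsilon>" using sub x by auto
      from mult_left_mono[OF this, of "\<bar>t\<bar>"] show ?thesis using 1 False by simp
    qed
  qed
  also have "\<dots> = \<bar>t\<bar> * \<epsilon> + 2 * prob B"
    by (subst Bochner_Integration.integral_add) (auto simp: emeasure_eq_measure prob_space)
  finally show ?thesis .
qed

text \<open>Slutsky's theorem at one fixed \<open>t\<close>. No distribution with characteristic
  function value \<open>L\<close> is involved; pointwise limits are all that Levy's continuity
  theorem consumes later.\<close>

lemma char_slutsky:
  assumes U: "\<And>n. random_variable borel (U n)" and W: "\<And>n. random_variable borel (W n)"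
    and d: "to_zero_in_prob (\<lambda>n \<omega>. W n \<omega> - U n \<omega>)"
    and lim: "(\<lambda>n. char (distr M borel (U n)) t) \<longlonglongrightarrow> L"
  shows "(\<lambda>n. char (distr M borel (W n)) t) \<longlonglongrightarrow> L"
proof -
  have "(\<lambda>n. char (distr M borel (W n)) t - char (distr M borel (U n)) t) \<longlonglongrightarrow> 0"
  proof (rule tendstoI)
    fix \<epsilon> :: real assume "0 < \<epsilon>"
    \<comment> \<open>The added 1 covers t = 0. With this choice the Lipschitz part is below half of
      \<epsilon>, and an event of probability at most \<epsilon>/4 costs at most the other
      half.\<close>
    define \<delta> where "\<delta> = \<epsilon> / (2 * (\<bar>t\<bar> + 1))"
    have "0 < \<delta>" using \<open>0 < \<epsilon>\<close> by (simp add: \<delta>_def add_nonneg_pos)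
    have "\<bar>t\<bar> * \<delta> < \<epsilon> / 2"
    proof -
      have "\<bar>t\<bar> * \<epsilon> < (\<bar>t\<bar> + 1) * \<epsilon>" using \<open>0 < \<epsilon>\<close> by simp
      then show ?thesis unfolding \<delta>_def by (simp add: field_simps)
    qed
    have "\<forall>\<^sub>F n in sequentially. unlikely (\<epsilon> / 4) (\<lambda>\<omega>. \<delta> < \<bar>W n \<omega> - U n \<omega>\<bar>)"
      using d[unfolded to_zero_in_prob_def, rule_format, OF \<open>0 < \<delta>\<close>, of "\<epsilon> / 4"] \<open>0 < \<epsilon>\<close> by simp
    then show "\<forall>\<^sub>F n in sequentially. dist (char (distr M borel (W n)) t - char (distr M borel (U n)) t) 0 < \<epsilon>"
    proof eventually_elim
      case (elim n)
      then obtain B where B: "B \<in> events" "prob B \<le> \<epsilon> / 4" "{\<omega>\<in>space M. \<delta> < \<bar>W n \<omega> - U n \<omega>\<bar>} \<subseteq> B" by auto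
      have "cmod (char (distr M borel (W n)) t - char (distr M borel (U n)) t) \<le> \<bar>t\<bar> * \<delta> + 2 * prob B"
        by (rule char_perturbation_le[OF U W B(1) B(3)]) (use \<open>0 < \<delta>\<close> in simp)
      then show ?case using B(2) \<open>\<bar>t\<bar> * \<delta> < \<epsilon> / 2\<close> by (simp add: dist_norm)
    qed
  qed
  from tendsto_add[OF this lim] show ?thesis by simp
qed

lemma to_zero_in_prob_add:
  assumes "to_zero_in_prob U" "to_zero_in_prob W"
  shows "to_zero_in_prob (\<lambda>n \<omega>. U n \<omega> + W n \<omega>)"
  unfolding to_zero_in_prob_def
proof (intro allI impI)
  fix \<epsilon> \<eta> :: real assume p: "0 < \<epsilon>" "0 < \<eta>"
  then have "0 < \<epsilon> / 2" "0 < \<eta> / 2" by auto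
  from assms[unfolded to_zero_in_prob_def, rule_format, OF this]
  show "\<forall>\<^sub>F n in sequentially. unlikely \<eta> (\<lambda>\<omega>. \<epsilon> < \<bar>U n \<omega> + W n \<omega>\<bar>)"
  proof eventually_elim
    case (elim n)
    then obtain B C where B: "B \<in> events" "prob B \<le> \<eta>/2" "{\<omega>\<in>space M. \<epsilon>/2 < \<bar>U n \<omega>\<bar>} \<subseteq> B"
      and C: "C \<in> events" "prob C \<le> \<eta>/2" "{\<omega>\<in>space M. \<epsilon>/2 < \<bar>W n \<omega>\<bar>} \<subseteq> C" by blast
    have "prob (B \<union> C) \<le> \<eta>" using measure_Un_le[of B M C] B C by simp
    moreover have "{\<omega>\<in>space M. \<epsilon> < \<bar>U n \<omega> + W n \<omega>\<bar>} \<subseteq> B \<union> C"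
    proof safe
      fix \<omega> assume w: "\<omega> \<in> space M" "\<epsilon> < \<bar>U n \<omega> + W n \<omega>\<bar>" "\<omega> \<notin> C"
      then have "\<bar>W n \<omega>\<bar> \<le> \<epsilon>/2" using C(3) by fastforce
      with w have "\<epsilon>/2 < \<bar>U n \<omega>\<bar>" by linarith
      then show "\<omega> \<in> B" using B(3) w by auto
    qed
    ultimately show ?case using B(1) C(1) by (intro bexI[of _ "B \<union> C"]) auto
  qed
qed

lemma to_zero_in_prob_scale:
  assumes U: "to_zero_in_prob U" and c: "\<forall>\<^sub>F n in sequentially. \<bar>c n\<bar> \<le> C"
  shows "to_zero_in_prob (\<lambda>n \<omega>. c n * U n \<omega>)"
  unfolding to_zero_in_prob_def
proof (intro allI impI)
  fix \<epsilon> \<eta> :: real assume p: "0 < \<epsilon>" "0 < \<eta>"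
  have C: "0 < \<bar>C\<bar> + 1" by simp
  then have "0 < \<epsilon> / (\<bar>C\<bar> + 1)" using p by simp
  from U[unfolded to_zero_in_prob_def, rule_format, OF this p(2)] c
  show "\<forall>\<^sub>F n in sequentially. unlikely \<eta> (\<lambda>\<omega>. \<epsilon> < \<bar>c n * U n \<omega>\<bar>)"
  proof eventually_elim
    case (elim n)
    then obtain B where B: "B \<in> events" "prob B \<le> \<eta>" "{\<omega>\<in>space M. \<epsilon> / (\<bar>C\<bar>+1) < \<bar>U n \<omega>\<bar>} \<subseteq> B" by blast
    have "{\<omega>\<in>space M. \<epsilon> < \<bar>c n * U n \<omega>\<bar>} \<subseteq> {\<omega>\<in>space M. \<epsilon> / (\<bar>C\<bar>+1) < \<bar>U n \<omega>\<bar>}"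
    proof safe
      fix \<omega> assume "\<epsilon> < \<bar>c n * U n \<omega>\<bar>"
      also have "\<dots> \<le> (\<bar>C\<bar>+1) * \<bar>U n \<omega>\<bar>"
        unfolding abs_mult by (rule mult_right_mono) (use elim in auto)
      finally show "\<epsilon> / (\<bar>C\<bar>+1) < \<bar>U n \<omega>\<bar>" using C by (simp add: pos_divide_less_eq mult.commute)
    qed
    then show ?case using B by blast
  qed
qed

lemma to_zero_in_prob_zero: "to_zero_in_prob (\<lambda>n \<omega>. 0)"
  unfolding to_zero_in_prob_def
proof (intro allI impI)
  fix \<epsilon> \<eta> :: real assume p: "0 < \<epsilon>" "0 < \<eta>"
  then have "unlikely \<eta> (\<lambda>\<omega>. \<epsilon> < \<bar>0::real\<bar>)"
    by (intro bexI[of _ "{}"]) simp_all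
  then show "\<forall>\<^sub>F n in sequentially. unlikely \<eta> (\<lambda>\<omega>. \<epsilon> < \<bar>0::real\<bar>)"
    by simp
qed

lemma to_zero_in_prob_sum:
  assumes "\<And>i. i \<in> I \<Longrightarrow> to_zero_in_prob (U i)"
  shows "to_zero_in_prob (\<lambda>n \<omega>. \<Sum>i\<in>I. U i n \<omega>)"
  using assms
proof (induction I rule: infinite_finite_induct)
  case (insert x F)
  then show ?case by (simp add: to_zero_in_prob_add)
qed (simp_all add: to_zero_in_prob_zero)

lemma to_zero_in_prob_mono:
  assumes "to_zero_in_prob U" "\<forall>\<^sub>F n in sequentially. \<forall>\<omega>\<in>space M. \<bar>W n \<omega>\<bar> \<le> \<bar>U n \<omega>\<bar>"
  shows "to_zero_in_prob W"
  unfolding to_zero_in_prob_def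
proof (intro allI impI)
  fix \<epsilon> \<eta> :: real assume p: "0 < \<epsilon>" "0 < \<eta>"
  from assms(1)[unfolded to_zero_in_prob_def, rule_format, OF this] assms(2)
  show "\<forall>\<^sub>F n in sequentially. unlikely \<eta> (\<lambda>\<omega>. \<epsilon> < \<bar>W n \<omega>\<bar>)"
  proof eventually_elim
    case (elim n)
    then obtain B where B: "B \<in> events" "prob B \<le> \<eta>" "{\<omega>\<in>space M. \<epsilon> < \<bar>U n \<omega>\<bar>} \<subseteq> B" by blast
    have "{\<omega>\<in>space M. \<epsilon> < \<bar>W n \<omega>\<bar>} \<subseteq> {\<omega>\<in>space M. \<epsilon> < \<bar>U n \<omega>\<bar>}"
      using elim(2) by force
    with B show ?case by (intro bexI[of _ B] conjI) (auto dest: subset_trans)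
  qed
qed

lemma to_zero_in_prob_abs: "to_zero_in_prob U \<Longrightarrow> to_zero_in_prob (\<lambda>n \<omega>. \<bar>U n \<omega>\<bar>)"
  by (erule to_zero_in_prob_mono) simp

lemma to_zero_in_prob_const:
  assumes "c \<longlonglongrightarrow> 0" shows "to_zero_in_prob (\<lambda>n \<omega>. c n)"
  unfolding to_zero_in_prob_def
proof (intro allI impI)
  fix \<epsilon> \<eta> :: real assume p: "0 < \<epsilon>" "0 < \<eta>"
  from order_tendstoD(2)[OF tendsto_rabs_zero[OF assms] p(1)]
  show "\<forall>\<^sub>F n in sequentially. unlikely \<eta> (\<lambda>\<omega>. \<epsilon> < \<bar>c n\<bar>)"
  proof eventually_elim
    case (elim n)
    then show ?case using p by (intro bexI[of _ "{}"]) auto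
  qed
qed

text \<open>Chebyshev's inequality: Markov applied to the square.\<close>

lemma to_zero_in_prob_L2:
  assumes m: "\<And>n. random_variable borel (U n)"
    and i: "\<forall>\<^sub>F n in sequentially. integrable M (\<lambda>\<omega>. (U n \<omega>)\<^sup>2) \<and> expectation (\<lambda>\<omega>. (U n \<omega>)\<^sup>2) \<le> r n"
    and r: "r \<longlonglongrightarrow> 0"
  shows "to_zero_in_prob U"
  unfolding to_zero_in_prob_def
proof (intro allI impI)
  fix \<epsilon> \<eta> :: real assume p: "0 < \<epsilon>" "0 < \<eta>"
  have [measurable]: "random_variable borel (U n)" for n by (rule m)
  have "0 < \<eta> * \<epsilon>\<^sup>2" using p by simp
  from order_tendstoD(2)[OF r this] i
  show "\<forall>\<^sub>F n in sequentially. unlikely \<eta> (\<lambda>\<omega>. \<epsilon> < \<bar>U n \<omega>\<bar>)"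
  proof eventually_elim
    case (elim n)
    let ?B = "{\<omega>\<in>space M. \<epsilon>\<^sup>2 \<le> (U n \<omega>)\<^sup>2}"
    have "prob ?B \<le> expectation (\<lambda>\<omega>. (U n \<omega>)\<^sup>2) / \<epsilon>\<^sup>2"
      using elim p by (intro integral_Markov_inequality_measure[where A="space M" and u="\<lambda>\<omega>. (U n \<omega>)\<^sup>2", simplified]) auto
    also have "\<dots> \<le> \<eta>" using elim p by (simp add: pos_divide_le_eq)
    finally show ?case
      using p by (intro bexI[of _ ?B]) (auto intro!: abs_le_square_iff[THEN iffD1])
  qed
qed

lemma bounded_in_prob_add:
  assumes "bounded_in_prob U" "bounded_in_prob W"
  shows "bounded_in_prob (\<lambda>n \<omega>. U n \<omega> + W n \<omega>)"
  unfolding bounded_in_prob_def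
proof (intro allI impI)
  fix \<eta> :: real assume p: "0 < \<eta>"
  then have p2: "0 < \<eta> / 2" by simp
  obtain R1 where R1: "\<forall>\<^sub>F n in sequentially. unlikely (\<eta>/2) (\<lambda>\<omega>. R1 < \<bar>U n \<omega>\<bar>)"
    using assms(1) p2 unfolding bounded_in_prob_def by blast
  obtain R2 where R2: "\<forall>\<^sub>F n in sequentially. unlikely (\<eta>/2) (\<lambda>\<omega>. R2 < \<bar>W n \<omega>\<bar>)"
    using assms(2) p2 unfolding bounded_in_prob_def by blast
  have "\<forall>\<^sub>F n in sequentially. unlikely \<eta> (\<lambda>\<omega>. R1 + R2 < \<bar>U n \<omega> + W n \<omega>\<bar>)"
    using R1 R2
  proof eventually_elim
    case (elim n)
    then obtain B C where B: "B \<in> events" "prob B \<le> \<eta>/2" "{\<omega>\<in>space M. R1 < \<bar>U n \<omega>\<bar>} \<subseteq> B"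
      and C: "C \<in> events" "prob C \<le> \<eta>/2" "{\<omega>\<in>space M. R2 < \<bar>W n \<omega>\<bar>} \<subseteq> C" by blast
    have "prob (B \<union> C) \<le> \<eta>" using measure_Un_le[of B M C] B C by simp
    moreover have "{\<omega>\<in>space M. R1 + R2 < \<bar>U n \<omega> + W n \<omega>\<bar>} \<subseteq> B \<union> C"
    proof safe
      fix \<omega> assume w: "\<omega> \<in> space M" "R1 + R2 < \<bar>U n \<omega> + W n \<omega>\<bar>" "\<omega> \<notin> C"
      then have "\<bar>W n \<omega>\<bar> \<le> R2" using C(3) by fastforce
      with w have "R1 < \<bar>U n \<omega>\<bar>" by linarith
      then show "\<omega> \<in> B" using B(3) w by auto
    qed
    ultimately show ?case using B(1) C(1) by (intro bexI[of _ "B \<union> C"]) auto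
  qed
  then show "\<exists>R. \<forall>\<^sub>F n in sequentially. unlikely \<eta> (\<lambda>\<omega>. R < \<bar>U n \<omega> + W n \<omega>\<bar>)"
    by blast
qed

text \<open>The constant \<open>C\<close> is the same for all n, which is why the moment inverses
  are bounded uniformly over windows before this is applied.\<close>

lemma bounded_in_prob_mono:
  assumes "bounded_in_prob U" and c: "\<forall>\<^sub>F n in sequentially. \<forall>\<omega>\<in>space M. \<bar>W n \<omega>\<bar> \<le> C * \<bar>U n \<omega>\<bar>"
  shows "bounded_in_prob W"
  unfolding bounded_in_prob_def
proof (intro allI impI)
  fix \<eta> :: real assume p: "0 < \<eta>"
  obtain R where R: "\<forall>\<^sub>F n in sequentially. unlikely \<eta> (\<lambda>\<omega>. R < \<bar>U n \<omega>\<bar>)"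
    using assms(1) p unfolding bounded_in_prob_def by blast
  have "\<forall>\<^sub>F n in sequentially. unlikely \<eta> (\<lambda>\<omega>. \<bar>C\<bar> * R < \<bar>W n \<omega>\<bar>)"
    using R c
  proof eventually_elim
    case (elim n)
    then obtain B where B: "B \<in> events" "prob B \<le> \<eta>" "{\<omega>\<in>space M. R < \<bar>U n \<omega>\<bar>} \<subseteq> B" by blast
    have "{\<omega>\<in>space M. \<bar>C\<bar> * R < \<bar>W n \<omega>\<bar>} \<subseteq> {\<omega>\<in>space M. R < \<bar>U n \<omega>\<bar>}"
    proof safe
      fix \<omega> assume w: "\<omega> \<in> space M" "\<bar>C\<bar> * R < \<bar>W n \<omega>\<bar>"
      note w(2)
      also have "\<bar>W n \<omega>\<bar> \<le> C * \<bar>U n \<omega>\<bar>" using elim w by simp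
      also have "\<dots> \<le> \<bar>C\<bar> * \<bar>U n \<omega>\<bar>" by (intro mult_right_mono) auto
      finally show "R < \<bar>U n \<omega>\<bar>" by (rule mult_less_cancel_left_pos[THEN iffD1, rotated]) (use w elim in \<open>auto intro: ccontr\<close>)
    qed
    with B show ?case by (intro bexI[of _ B] conjI) (auto dest: subset_trans)
  qed
  then show "\<exists>R. \<forall>\<^sub>F n in sequentially. unlikely \<eta> (\<lambda>\<omega>. R < \<bar>W n \<omega>\<bar>)" by blast
qed

lemma bounded_in_prob_sum:
  assumes "\<And>i. i \<in> J \<Longrightarrow> bounded_in_prob (U i)"
  shows "bounded_in_prob (\<lambda>n \<omega>. \<Sum>i\<in>J. U i n \<omega>)"
proof -
  have z: "bounded_in_prob (\<lambda>n \<omega>. 0)"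
    unfolding bounded_in_prob_def
  proof (intro allI impI exI[of _ "0::real"])
    fix \<eta> :: real assume p: "0 < \<eta>"
    then have "unlikely \<eta> (\<lambda>\<omega>. 0 < \<bar>0::real\<bar>)"
      by (intro bexI[of _ "{}"]) simp_all
    then show "\<forall>\<^sub>F n in sequentially. unlikely \<eta> (\<lambda>\<omega>. 0 < \<bar>0::real\<bar>)" by simp
  qed
  show ?thesis using assms
  proof (induction J rule: infinite_finite_induct)
    case (insert x F)
    then show ?case by (simp add: bounded_in_prob_add)
  qed (simp_all add: z)
qed

lemma bounded_in_prob_L1:
  assumes i: "\<forall>\<^sub>F n in sequentially. integrable M (U n) \<and> expectation (U n) \<le> C" and nn: "\<And>n \<omega>. \<omega> \<in> space M \<Longrightarrow> 0 \<le> U n \<omega>"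
  shows "bounded_in_prob U"
  unfolding bounded_in_prob_def
proof (intro allI impI exI)
  fix \<eta> :: real assume p: "0 < \<eta>"
  \<comment> \<open>Markov's inequality at this level gives exactly \<eta>; the added 1 keeps the
    level positive whatever the sign of \<open>C\<close>.\<close>
  let ?R = "(\<bar>C\<bar> + 1) / \<eta>"
  have R: "0 < ?R" using p by (simp add: add_nonneg_pos)
  from i show "\<forall>\<^sub>F n in sequentially. unlikely \<eta> (\<lambda>\<omega>. ?R < \<bar>U n \<omega>\<bar>)"
  proof eventually_elim
    case (elim n)
    then have [measurable]: "U n \<in> borel_measurable M" by auto
    let ?B = "{\<omega>\<in>space M. ?R \<le> U n \<omega>}"
    have "prob ?B \<le> expectation (U n) / ?R"
      using elim nn R by (intro integral_Markov_inequality_measure[where A="space M" and u="U n", simplified]) auto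
    also have "\<dots> \<le> (\<bar>C\<bar> + 1) / ?R" using elim R by (intro divide_right_mono) auto
    also have "\<dots> = \<eta>" using p by (simp add: add_nonneg_pos[THEN less_imp_neq, symmetric])
    finally show ?case using nn by (intro bexI[of _ ?B]) auto
  qed
qed

lemma bounded_in_prob_L2:
  assumes i: "\<forall>\<^sub>F n in sequentially. integrable M (\<lambda>\<omega>. (U n \<omega>)\<^sup>2) \<and> expectation (\<lambda>\<omega>. (U n \<omega>)\<^sup>2) \<le> C"
  shows "bounded_in_prob U"
proof -
  have 1: "bounded_in_prob (\<lambda>n \<omega>. 1)"
    by (rule bounded_in_prob_L1[of _ 1]) (simp_all add: prob_space)
  have "bounded_in_prob (\<lambda>n \<omega>. (U n \<omega>)\<^sup>2)"
    by (rule bounded_in_prob_L1[OF i]) simp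
  from bounded_in_prob_add[OF 1 this] show ?thesis
  proof (rule bounded_in_prob_mono[where C = 1])
    have "\<bar>u\<bar> \<le> 1 * \<bar>1 + u\<^sup>2\<bar>" for u :: real
      using abs_le_one_plus_square[of u] by simp
    then show "\<forall>\<^sub>F n in sequentially. \<forall>\<omega>\<in>space M. \<bar>U n \<omega>\<bar> \<le> 1 * \<bar>1 + (U n \<omega>)\<^sup>2\<bar>" by simp
  qed
qed

lemma bounded_in_prob_if_to_zero:
  assumes "to_zero_in_prob (\<lambda>n \<omega>. U n \<omega> - c n)" and c: "\<forall>\<^sub>F n in sequentially. \<bar>c n\<bar> \<le> C"
  shows "bounded_in_prob U"
  unfolding bounded_in_prob_def
proof (intro allI impI exI)
  fix \<eta> :: real assume p: "0 < \<eta>"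
  have "0 < (1::real)" by simp
  from assms(1)[unfolded to_zero_in_prob_def, rule_format, OF this p] c
  show "\<forall>\<^sub>F n in sequentially. unlikely \<eta> (\<lambda>\<omega>. C + 1 < \<bar>U n \<omega>\<bar>)"
  proof eventually_elim
    case (elim n)
    then obtain B where B: "B \<in> events" "prob B \<le> \<eta>" "{\<omega>\<in>space M. 1 < \<bar>U n \<omega> - c n\<bar>} \<subseteq> B" by blast
    have "{\<omega>\<in>space M. C + 1 < \<bar>U n \<omega>\<bar>} \<subseteq> {\<omega>\<in>space M. 1 < \<bar>U n \<omega> - c n\<bar>}"
      using elim(2) by auto
    with B show ?case by (intro bexI[of _ B] conjI) (auto dest: subset_trans)
  qed
qed

text \<open>Serves to exchange one standardization of the noise for another: the two factors differ
  by a null sequence while the noise stays bounded in probability.\<close>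

lemma to_zero_in_prob_null_mult:
  assumes U: "bounded_in_prob U" and c: "c \<longlonglongrightarrow> 0"
  shows "to_zero_in_prob (\<lambda>n \<omega>. c n * U n \<omega>)"
  unfolding to_zero_in_prob_def
proof (intro allI impI)
  fix \<epsilon> \<eta> :: real assume p: "0 < \<epsilon>" "0 < \<eta>"
  obtain R where R: "\<forall>\<^sub>F n in sequentially. unlikely \<eta> (\<lambda>\<omega>. R < \<bar>U n \<omega>\<bar>)"
    using U p unfolding bounded_in_prob_def by blast
  have R1: "0 < \<bar>R\<bar> + 1" by simp
  have "0 < \<epsilon> / (\<bar>R\<bar> + 1)" using p by simp
  from R order_tendstoD(2)[OF tendsto_rabs_zero[OF c] this]
  show "\<forall>\<^sub>F n in sequentially. unlikely \<eta> (\<lambda>\<omega>. \<epsilon> < \<bar>c n * U n \<omega>\<bar>)"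
  proof eventually_elim
    case (elim n)
    then obtain B where B: "B \<in> events" "prob B \<le> \<eta>" "{\<omega>\<in>space M. R < \<bar>U n \<omega>\<bar>} \<subseteq> B" by blast
    have "{\<omega>\<in>space M. \<epsilon> < \<bar>c n * U n \<omega>\<bar>} \<subseteq> {\<omega>\<in>space M. R < \<bar>U n \<omega>\<bar>}"
    proof safe
      fix \<omega> assume w: "\<epsilon> < \<bar>c n * U n \<omega>\<bar>"
      show "R < \<bar>U n \<omega>\<bar>"
      proof (rule ccontr)
        assume "\<not> ?thesis"
        then have "\<bar>U n \<omega>\<bar> \<le> \<bar>R\<bar> + 1" by linarith
        then have "\<bar>c n * U n \<omega>\<bar> \<le> \<epsilon> / (\<bar>R\<bar> + 1) * (\<bar>R\<bar> + 1)"
          unfolding abs_mult using elim(2) by (intro mult_mono) auto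
        then show False using w R1 by simp
      qed
    qed
    with B show ?case by (intro bexI[of _ B] conjI) (auto dest: subset_trans)
  qed
qed

subsection \<open>Row-wise independent sums\<close>

text \<open>Centred summands are pairwise uncorrelated, so the second moment of the centred sum is
  the sum of the variances, and each variance is at most the raw second moment. The raw moment is
  the quantity that kernel expectations bound directly.\<close>

lemma iid_sum_second_moment:
  fixes F :: "nat \<Rightarrow> 'a \<Rightarrow> real"
  assumes ind: "indep_vars (\<lambda>_. borel) F {..<n}"
    and d: "\<And>i. i < n \<Longrightarrow> distr M borel (F i) = distr M borel (F 0)"
    and sq: "integrable M (\<lambda>\<omega>. (F 0 \<omega>)\<^sup>2)"
  shows "integrable M (\<lambda>\<omega>. ((\<Sum>i<n. F i \<omega>) - n * expectation (F 0))\<^sup>2) \<and>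
    expectation (\<lambda>\<omega>. ((\<Sum>i<n. F i \<omega>) - n * expectation (F 0))\<^sup>2) \<le> n * expectation (\<lambda>\<omega>. (F 0 \<omega>)\<^sup>2)"
proof (cases "n = 0")
  case True then show ?thesis by simp
next
  case False
  define m where "m = expectation (F 0)"
  define G where "G i \<omega> = F i \<omega> - m" for i \<omega>
  have rv: "random_variable borel (F i)" if "i < n" for i
    using ind that by (auto simp: indep_vars_def2)
  have sqi: "integrable M (\<lambda>\<omega>. (F i \<omega>)\<^sup>2)" if i: "i < n" for i
  proof -
    have "integrable (distr M borel (F i)) (\<lambda>x. x\<^sup>2)"
      unfolding d[OF i] using sq rv[of 0] False by (subst integrable_distr_eq) auto
    then show ?thesis using rv[OF i] by (subst (asm) integrable_distr_eq) auto
  qed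
  have fi: "integrable M (F i)" if "i < n" for i
    using sqi[OF that] rv[OF that] by (rule square_integrable_imp_integrable[rotated])
  have ei: "expectation (F i) = m" if i: "i < n" for i
  proof -
    have "expectation (F i) = (LINT x|distr M borel (F i). x)" using rv[OF i] by (subst integral_distr) auto
    also have "\<dots> = m" unfolding m_def d[OF i] using rv[of 0] False by (subst integral_distr) auto
    finally show ?thesis .
  qed
  have Gi: "integrable M (G i)" if "i < n" for i
    unfolding G_def using fi[OF that] by auto
  have eG: "expectation (G i) = 0" if "i < n" for i
    unfolding G_def using fi[OF that] ei[OF that] by (simp add: prob_space)
  have esq: "expectation (\<lambda>\<omega>. (F i \<omega>)\<^sup>2) = expectation (\<lambda>\<omega>. (F 0 \<omega>)\<^sup>2)" if i: "i < n" for i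
  proof -
    have "expectation (\<lambda>\<omega>. (F i \<omega>)\<^sup>2) = (LINT x|distr M borel (F i). x\<^sup>2)"
      using rv[OF i] by (subst integral_distr) auto
    also have "\<dots> = expectation (\<lambda>\<omega>. (F 0 \<omega>)\<^sup>2)"
      unfolding d[OF i] using rv[of 0] False by (subst integral_distr) auto
    finally show ?thesis .
  qed
  have Gsq: "integrable M (\<lambda>\<omega>. G i \<omega> * G i \<omega>)" and eGsq: "expectation (\<lambda>\<omega>. G i \<omega> * G i \<omega>) \<le> expectation (\<lambda>\<omega>. (F 0 \<omega>)\<^sup>2)" if i: "i < n" for i
  proof -
    have eq: "(\<lambda>\<omega>. G i \<omega> * G i \<omega>) = (\<lambda>\<omega>. (F i \<omega>)\<^sup>2 - 2 * m * F i \<omega> + m\<^sup>2)"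
      unfolding G_def by (auto simp: power2_eq_square algebra_simps)
    show "integrable M (\<lambda>\<omega>. G i \<omega> * G i \<omega>)"
      unfolding eq using sqi[OF i] fi[OF i] by auto
    have "expectation (\<lambda>\<omega>. G i \<omega> * G i \<omega>) = expectation (\<lambda>\<omega>. (F i \<omega>)\<^sup>2) - 2 * m * expectation (F i) + m\<^sup>2"
      unfolding eq using sqi[OF i] fi[OF i] by (simp add: prob_space)
    also have "\<dots> \<le> expectation (\<lambda>\<omega>. (F 0 \<omega>)\<^sup>2)" using ei[OF i] esq[OF i]
      by (simp add: power2_eq_square)
    finally show "expectation (\<lambda>\<omega>. G i \<omega> * G i \<omega>) \<le> expectation (\<lambda>\<omega>. (F 0 \<omega>)\<^sup>2)" .
  qed
  have pair: "integrable M (\<lambda>\<omega>. G i \<omega> * G j \<omega>) \<and> expectation (\<lambda>\<omega>. G i \<omega> * G j \<omega>) = 0"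
    if ij: "i < n" "j < n" "i \<noteq> j" for i j
  proof -
    have "indep_vars (\<lambda>_. borel) G {..<n}"
      unfolding G_def using ind by (rule indep_vars_compose2) auto
    then have "indep_vars (\<lambda>_. borel) G (insert i {j})"
      by (rule indep_vars_subset) (use ij in auto)
    \<comment> \<open>Independence of a pair is read off from independence of one variable and a sum
      of others, here a sum with one term.\<close>
    then have "indep_var borel (G i) borel (\<lambda>\<omega>. \<Sum>k\<in>{j}. G k \<omega>)"
      using ij by (intro indep_vars_sum) auto
    then have "indep_var borel (G i) borel (G j)" by simp
    then show ?thesis using indep_var_integrable[OF _ Gi Gi] indep_var_lebesgue_integral[OF _ Gi Gi] ij eG by auto
  qed
  have sum: "((\<Sum>i<n. F i \<omega>) - n * m)\<^sup>2 = (\<Sum>i<n. \<Sum>j<n. G i \<omega> * G j \<omega>)" for \<omega>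
    by (simp add: G_def power2_eq_square sum_product[symmetric] sum_subtractf)
  have Gij: "integrable M (\<lambda>\<omega>. G i \<omega> * G j \<omega>)" if "i < n" "j < n" for i j
    using pair[OF that] Gsq[OF that(1)] by (cases "i = j") auto
  have "expectation (\<lambda>\<omega>. \<Sum>i<n. \<Sum>j<n. G i \<omega> * G j \<omega>) = (\<Sum>i<n. \<Sum>j<n. expectation (\<lambda>\<omega>. G i \<omega> * G j \<omega>))"
    using Gij by (subst Bochner_Integration.integral_sum) (auto intro!: Bochner_Integration.integrable_sum sum.cong)
  also have "\<dots> = (\<Sum>i<n. \<Sum>j<n. if i = j then expectation (\<lambda>\<omega>. G i \<omega> * G i \<omega>) else 0)"
    using pair by (intro sum.cong) auto
  also have "\<dots> = (\<Sum>i<n. expectation (\<lambda>\<omega>. G i \<omega> * G i \<omega>))"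
    by (intro sum.cong) (auto simp: sum.delta)
  also have "\<dots> \<le> (\<Sum>i<n. expectation (\<lambda>\<omega>. (F 0 \<omega>)\<^sup>2))"
    using eGsq by (intro sum_mono) auto
  finally show ?thesis
    using Gij unfolding m_def[symmetric] sum by (auto intro!: Bochner_Integration.integrable_sum)
qed

text \<open>The characteristic function of a row sum is an n-th power, and |a^n - b^n| <= n |a - b|
  in the unit disc reduces the claim to a second-order expansion of one summand, compared with 1 -
  t^2/(2n). Integrability and centring are asked only eventually, because they are known only once
  the window lies where the local bounds hold.\<close>

lemma triangular_iid_clt:
  fixes F :: "nat \<Rightarrow> nat \<Rightarrow> 'a \<Rightarrow> real"
  assumes ind: "\<And>n. indep_vars (\<lambda>_. borel) (F n) {..<n}"
    and rv: "\<And>n. random_variable borel (F n 0)"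
    and d: "\<And>n i. i < n \<Longrightarrow> distr M borel (F n i) = distr M borel (F n 0)"
    and sq: "\<forall>\<^sub>F n in sequentially. integrable M (\<lambda>\<omega>. (F n 0 \<omega>)\<^sup>2) \<and> expectation (F n 0) = 0"
    and var: "(\<lambda>n. n * expectation (\<lambda>\<omega>. (F n 0 \<omega>)\<^sup>2)) \<longlonglongrightarrow> 1"
    and lind: "\<And>\<epsilon>. 0 < \<epsilon> \<Longrightarrow>
      (\<lambda>n. n * expectation (\<lambda>\<omega>. if \<epsilon> < \<bar>F n 0 \<omega>\<bar> then (F n 0 \<omega>)\<^sup>2 else 0)) \<longlonglongrightarrow> 0"
  shows "(\<lambda>n. char (distr M borel (\<lambda>\<omega>. \<Sum>i<n. F n i \<omega>)) t) \<longlonglongrightarrow> char std_normal_distribution t"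
proof -
  note rv[measurable]
  define \<sigma> where "\<sigma> n = expectation (\<lambda>\<omega>. (F n 0 \<omega>)\<^sup>2)" for n
  define \<phi> where "\<phi> n = char (distr M borel (F n 0)) t" for n
  define l where "l \<epsilon> n = expectation (\<lambda>\<omega>. if \<epsilon> < \<bar>F n 0 \<omega>\<bar> then (F n 0 \<omega>)\<^sup>2 else 0)" for \<epsilon> n
  have char_eq: "char (distr M borel (\<lambda>\<omega>. \<Sum>i<n. F n i \<omega>)) t = \<phi> n ^ n" for n
  proof -
    have "(\<Prod>i<n. char (distr M borel (F n i)) t) = (\<Prod>i<n. \<phi> n)"
    proof (rule prod.cong)
      fix i assume "i \<in> {..<n}"
      then have i: "i < n" by simp
      show "char (distr M borel (F n i)) t = \<phi> n" unfolding \<phi>_def d[OF i] ..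
    qed simp
    then show ?thesis unfolding char_distr_sum[OF ind] by simp
  qed
  \<comment> \<open>The remainder of the expansion is bounded by the smaller of a quadratic and a
    cubic term. The quadratic one is used on the Lindeberg tail, the cubic one where the summand is
    at most \<epsilon>.\<close>
  have approx: "cmod (\<phi> n - (1 - t\<^sup>2 * \<sigma> n / 2)) \<le> t\<^sup>2 / 6 * (6 * l \<epsilon> n + \<bar>t\<bar> * \<epsilon> * \<sigma> n)"
    if n: "integrable M (\<lambda>\<omega>. (F n 0 \<omega>)\<^sup>2)" "expectation (F n 0) = 0" and "0 < \<epsilon>" for n \<epsilon>
  proof -
    have i1: "integrable M (F n 0)" by (rule square_integrable_imp_integrable[OF rv n(1)])
    have il: "integrable M (\<lambda>\<omega>. if \<epsilon> < \<bar>F n 0 \<omega>\<bar> then (F n 0 \<omega>)\<^sup>2 else 0)"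
      by (rule Bochner_Integration.integrable_bound[OF n(1)]) auto
    have "cmod (\<phi> n - (1 - t\<^sup>2 * \<sigma> n / 2)) \<le> t\<^sup>2 / 6 * expectation (\<lambda>x. min (6 * (F n 0 x)\<^sup>2) (\<bar>t\<bar> * \<bar>F n 0 x\<bar>^3))"
      unfolding \<phi>_def by (rule char_approx3'[OF rv i1 n _ refl]) (simp add: n \<sigma>_def)
    also have "\<dots> \<le> t\<^sup>2 / 6 * expectation (\<lambda>x. 6 * (if \<epsilon> < \<bar>F n 0 x\<bar> then (F n 0 x)\<^sup>2 else 0) + \<bar>t\<bar> * \<epsilon> * (F n 0 x)\<^sup>2)"
    proof (intro mult_left_mono integral_mono')
      show "integrable M (\<lambda>x. 6 * (if \<epsilon> < \<bar>F n 0 x\<bar> then (F n 0 x)\<^sup>2 else 0) + \<bar>t\<bar> * \<epsilon> * (F n 0 x)\<^sup>2)"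
        using n il by (intro Bochner_Integration.integrable_add integrable_mult_right)
      fix x
      show "0 \<le> 6 * (if \<epsilon> < \<bar>F n 0 x\<bar> then (F n 0 x)\<^sup>2 else 0) + \<bar>t\<bar> * \<epsilon> * (F n 0 x)\<^sup>2"
        using \<open>0 < \<epsilon>\<close> by simp
      show "min (6 * (F n 0 x)\<^sup>2) (\<bar>t\<bar> * \<bar>F n 0 x\<bar>^3) \<le> 6 * (if \<epsilon> < \<bar>F n 0 x\<bar> then (F n 0 x)\<^sup>2 else 0) + \<bar>t\<bar> * \<epsilon> * (F n 0 x)\<^sup>2"
      proof (cases "\<epsilon> < \<bar>F n 0 x\<bar>")
        case True
        have "0 \<le> \<bar>t\<bar> * \<epsilon> * (F n 0 x)\<^sup>2" using \<open>0 < \<epsilon>\<close> by simp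
        then show ?thesis using True by simp
      next
        case False
        have "\<bar>F n 0 x\<bar>^3 = \<bar>F n 0 x\<bar> * (F n 0 x)\<^sup>2" by (simp add: power3_eq_cube power2_eq_square)
        also have "\<dots> \<le> \<epsilon> * (F n 0 x)\<^sup>2" by (rule mult_right_mono) (use False in auto)
        finally have "\<bar>t\<bar> * \<bar>F n 0 x\<bar>^3 \<le> \<bar>t\<bar> * (\<epsilon> * (F n 0 x)\<^sup>2)" by (rule mult_left_mono) simp
        then show ?thesis using False by (simp add: mult.assoc)
      qed
    qed auto
    also have "\<dots> = t\<^sup>2 / 6 * (6 * l \<epsilon> n + \<bar>t\<bar> * \<epsilon> * \<sigma> n)"
      unfolding l_def \<sigma>_def
      by (subst Bochner_Integration.integral_add) (use n il in auto)
    finally show ?thesis .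
  qed
  have "(\<lambda>n. \<phi> n ^ n - of_real ((1 + (- (t\<^sup>2) / 2) / n) ^ n)) \<longlonglongrightarrow> 0"
  proof (rule tendstoI)
    fix e :: real assume e: "0 < e"
    \<comment> \<open>Only t^2 |t| \<epsilon> / 6 survives in the limit of the bound; this choice
      puts it below e / 12, also for t = 0.\<close>
    define \<epsilon> where "\<epsilon> = e / (2 * (t\<^sup>2 * \<bar>t\<bar> + 1))"
    have den: "0 < 2 * (t\<^sup>2 * \<bar>t\<bar> + 1)" by (simp add: add_nonneg_pos)
    have \<epsilon>: "0 < \<epsilon>" using e den by (simp add: \<epsilon>_def)
    have lim: "(\<lambda>n. t\<^sup>2 / 6 * (6 * (n * l \<epsilon> n) + \<bar>t\<bar> * \<epsilon> * (n * \<sigma> n)) + t\<^sup>2 / 2 * \<bar>n * \<sigma> n - 1\<bar>)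
       \<longlonglongrightarrow> t\<^sup>2 / 6 * (6 * 0 + \<bar>t\<bar> * \<epsilon> * 1) + t\<^sup>2 / 2 * \<bar>1 - 1\<bar>"
      unfolding l_def \<sigma>_def by (intro tendsto_intros lind[OF \<epsilon>] var)
    have "0 \<le> t\<^sup>2 * \<bar>t\<bar> * e" using e by simp
    moreover have "(t\<^sup>2 / 6 * (6 * 0 + \<bar>t\<bar> * \<epsilon> * 1)) * (12 * (t\<^sup>2 * \<bar>t\<bar> + 1)) = t\<^sup>2 * \<bar>t\<bar> * e"
      using den unfolding \<epsilon>_def by (simp add: divide_simps)
    ultimately have "(t\<^sup>2 / 6 * (6 * 0 + \<bar>t\<bar> * \<epsilon> * 1)) * (12 * (t\<^sup>2 * \<bar>t\<bar> + 1)) < e * (12 * (t\<^sup>2 * \<bar>t\<bar> + 1))"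
    proof -
      assume 1: "0 \<le> t\<^sup>2 * \<bar>t\<bar> * e"
        and 2: "(t\<^sup>2 / 6 * (6 * 0 + \<bar>t\<bar> * \<epsilon> * 1)) * (12 * (t\<^sup>2 * \<bar>t\<bar> + 1)) = t\<^sup>2 * \<bar>t\<bar> * e"
      have "e * (12 * (t\<^sup>2 * \<bar>t\<bar> + 1)) = 12 * (t\<^sup>2 * \<bar>t\<bar> * e) + 12 * e"
        by (simp add: algebra_simps)
      then show ?thesis unfolding 2 using 1 e by linarith
    qed
    then have "t\<^sup>2 / 6 * (6 * 0 + \<bar>t\<bar> * \<epsilon> * 1) + t\<^sup>2 / 2 * \<bar>1 - 1\<bar> < e"
      using den by simp
    \<comment> \<open>From t^2 / 4 <= n on, the number 1 - t^2/(2n) lies in [-1, 1], as the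
      comparison of n-th powers requires.\<close>
    from order_tendstoD(2)[OF lim this] sq eventually_ge_at_top[of "nat \<lceil>t\<^sup>2 / 4\<rceil> + 1"]
    show "\<forall>\<^sub>F n in sequentially. dist (\<phi> n ^ n - of_real ((1 + (- (t\<^sup>2) / 2) / n) ^ n)) 0 < e"
    proof eventually_elim
      case (elim n)
      have n: "0 < n" "t\<^sup>2 / 4 \<le> n" using elim(3) by linarith+
      interpret D: real_distribution "distr M borel (F n 0)" by simp
      have "cmod (\<phi> n ^ n - of_real (1 + (- (t\<^sup>2) / 2) / n) ^ n) \<le> n * cmod (\<phi> n - of_real (1 + (- (t\<^sup>2) / 2) / n))"
        using n by (intro norm_power_diff)
          (auto intro!: D.cmod_char_le_1 abs_leI simp del: of_real_diff simp: of_real_diff[symmetric] divide_le_eq \<phi>_def)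
      also have "\<dots> \<le> n * (t\<^sup>2 / 6 * (6 * l \<epsilon> n + \<bar>t\<bar> * \<epsilon> * \<sigma> n) + t\<^sup>2 / 2 * \<bar>\<sigma> n - 1 / n\<bar>)"
      proof (rule mult_left_mono)
        have "\<phi> n - of_real (1 + (- (t\<^sup>2) / 2) / n) = (\<phi> n - (1 - t\<^sup>2 * \<sigma> n / 2)) + of_real (- (t\<^sup>2 / 2) * (\<sigma> n - 1 / n))"
          using n by (simp add: field_simps)
        then have "cmod (\<phi> n - of_real (1 + (- (t\<^sup>2) / 2) / n)) \<le> cmod (\<phi> n - (1 - t\<^sup>2 * \<sigma> n / 2)) + cmod (of_real (- (t\<^sup>2 / 2) * (\<sigma> n - 1 / n)))"
          by (metis norm_triangle_ineq)
        also have "cmod (of_real (- (t\<^sup>2 / 2) * (\<sigma> n - 1 / n))) = t\<^sup>2 / 2 * \<bar>\<sigma> n - 1 / n\<bar>"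
          unfolding norm_of_real abs_mult by simp
        finally show "cmod (\<phi> n - of_real (1 + (- (t\<^sup>2) / 2) / n)) \<le> t\<^sup>2 / 6 * (6 * l \<epsilon> n + \<bar>t\<bar> * \<epsilon> * \<sigma> n) + t\<^sup>2 / 2 * \<bar>\<sigma> n - 1 / n\<bar>"
          using approx[of n \<epsilon>] elim(2) \<epsilon> by simp
      qed simp
      also have "\<dots> = t\<^sup>2 / 6 * (6 * (n * l \<epsilon> n) + \<bar>t\<bar> * \<epsilon> * (n * \<sigma> n)) + t\<^sup>2 / 2 * (n * \<bar>\<sigma> n - 1 / n\<bar>)"
        by (simp add: algebra_simps)
      also have "n * \<bar>\<sigma> n - 1 / n\<bar> = \<bar>n * (\<sigma> n - 1 / n)\<bar>" by (simp add: abs_mult)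
      also have "n * (\<sigma> n - 1 / n) = n * \<sigma> n - 1" using n by (simp add: field_simps)
      finally show ?case using elim(1) by (simp add: dist_norm)
    qed
  qed
  moreover have "(\<lambda>n. complex_of_real ((1 + (- (t\<^sup>2) / 2) / n) ^ n)) \<longlonglongrightarrow> complex_of_real (exp (- (t\<^sup>2) / 2))"
    by (rule isCont_tendsto_compose [OF _ tendsto_exp_limit_sequentially]) auto
  ultimately have "(\<lambda>n. (\<phi> n ^ n - of_real ((1 + (- (t\<^sup>2) / 2) / n) ^ n)) + of_real ((1 + (- (t\<^sup>2) / 2) / n) ^ n)) \<longlonglongrightarrow> 0 + of_real (exp (- (t\<^sup>2) / 2))"
    by (rule tendsto_add)
  then show ?thesis unfolding char_eq by (simp add: char_std_normal_distribution)
qed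

end

subsection \<open>Maximizers of concave functions\<close>

text \<open>Coefficient vectors live in the product space of all functions on the natural numbers,
  so compactness is Tychonoff's theorem. Coordinates that do not matter are pinned by intervals
  consisting of one point.\<close>

lemma compact_box:
  fixes a b :: "nat \<Rightarrow> real"
  shows "compact {u. \<forall>j. a j \<le> u j \<and> u j \<le> b j}"
proof -
  have "compactin (product_topology (\<lambda>_. euclidean) UNIV) (PiE UNIV (\<lambda>j. {a j..b j}))"
    by (subst compactin_PiE) (simp add: compactin_euclidean_iff)
  then have "compact (PiE UNIV (\<lambda>j. {a j..b j}))"
    by (simp only: euclidean_product_topology compactin_euclidean_iff)
  also have "PiE UNIV (\<lambda>j. {a j..b j}) = {u. \<forall>j. a j \<le> u j \<and> u j \<le> b j}"
    by (auto simp: PiE_def Pi_def)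
  finally show ?thesis .
qed

text \<open>Completing the square at the stationary point \<open>v\<close> of the quadratic.\<close>

lemma quadratic_completion:
  fixes H :: "'i \<Rightarrow> 'i \<Rightarrow> real"
  assumes sym: "\<And>j k. j \<in> J \<Longrightarrow> k \<in> J \<Longrightarrow> H j k = H k j"
    and hat: "\<And>j. j \<in> J \<Longrightarrow> (\<Sum>k\<in>J. H j k * v k) = S j"
  shows "(\<Sum>j\<in>J. S j * u j) - (\<Sum>j\<in>J. \<Sum>k\<in>J. H j k * u j * u k) / 2
    = (\<Sum>j\<in>J. S j * v j) - (\<Sum>j\<in>J. \<Sum>k\<in>J. H j k * v j * v k) / 2
      - (\<Sum>j\<in>J. \<Sum>k\<in>J. H j k * (u j - v j) * (u k - v k)) / 2"
proof -
  have S: "(\<Sum>j\<in>J. S j * w j) = (\<Sum>j\<in>J. \<Sum>k\<in>J. H j k * w j * v k)" for w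
    by (rule sum.cong) (simp_all add: hat[symmetric] sum_distrib_left sum_distrib_right mult_ac)
  have swap: "(\<Sum>j\<in>J. \<Sum>k\<in>J. H j k * v j * u k) = (\<Sum>j\<in>J. \<Sum>k\<in>J. H j k * u j * v k)"
    by (subst sum.swap) (intro sum.cong refl, simp add: sym)
  have "(\<Sum>j\<in>J. \<Sum>k\<in>J. H j k * (u j - v j) * (u k - v k))
    = (\<Sum>j\<in>J. \<Sum>k\<in>J. H j k * u j * u k - H j k * u j * v k - H j k * v j * u k + H j k * v j * v k)"
    by (intro sum.cong refl) (simp add: algebra_simps)
  also have "\<dots> = (\<Sum>j\<in>J. \<Sum>k\<in>J. H j k * u j * u k) - 2 * (\<Sum>j\<in>J. \<Sum>k\<in>J. H j k * u j * v k)
      + (\<Sum>j\<in>J. \<Sum>k\<in>J. H j k * v j * v k)"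
    by (simp add: sum.distrib sum_subtractf swap)
  finally show ?thesis unfolding S by linarith
qed

text \<open>On the boundary of the box of radius \<delta> around \<open>v\<close> the quadratic lies
  at least l \<delta>^2 / 2 below its value at \<open>v\<close>. This exceeds the two approximation
  errors, at most \<tau> R^2 each, which is what \<open>small\<close> says. So \<open>A\<close> is
  smaller on the boundary than at \<open>v\<close>, and concavity carries the inequality along rays
  to everything outside. The slack (p + 1) \<delta> in \<open>R\<close> keeps the whole box inside
  the region where the approximation holds. Existence of a maximizer is part of the conclusion
  because the estimator is specified only under it.\<close>

lemma concave_argmax_near_quadratic:
  fixes A :: "(nat \<Rightarrow> real) \<Rightarrow> real" and H :: "nat \<Rightarrow> nat \<Rightarrow> real"
  assumes conc: "\<And>u w s. 0 \<le> s \<Longrightarrow> s \<le> 1 \<Longrightarrow> (1 - s) * A u + s * A w \<le> A (\<lambda>j. (1 - s) * u j + s * w j)"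
    and dep: "\<And>u w. (\<And>j. j \<le> p \<Longrightarrow> u j = w j) \<Longrightarrow> A u = A w"
    and cont: "continuous_on UNIV A"
    and approx: "\<And>u. (\<Sum>j\<le>p. \<bar>u j\<bar>) \<le> R \<Longrightarrow>
      \<bar>A u - ((\<Sum>j\<le>p. S j * u j) - (\<Sum>j\<le>p. \<Sum>k\<le>p. H j k * u j * u k) / 2)\<bar> \<le> \<tau> * (\<Sum>j\<le>p. \<bar>u j\<bar>)\<^sup>2"
    and sym: "\<And>j k. j \<le> p \<Longrightarrow> k \<le> p \<Longrightarrow> H j k = H k j"
    and pd: "\<And>u. l * (\<Sum>j\<le>p. (u j)\<^sup>2) \<le> (\<Sum>j\<le>p. \<Sum>k\<le>p. H j k * u j * u k)"
    and hat: "\<And>j. j \<le> p \<Longrightarrow> (\<Sum>k\<le>p. H j k * v k) = S j"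
    and R: "(\<Sum>j\<le>p. \<bar>v j\<bar>) + (real p + 1) * \<delta> \<le> R"
    and pos: "0 < l" "0 < \<delta>" "0 \<le> \<tau>" and small: "4 * \<tau> * R\<^sup>2 < l * \<delta>\<^sup>2"
  shows "(\<exists>u. \<forall>w. A w \<le> A u) \<and> (\<forall>u. (\<forall>w. A w \<le> A u) \<longrightarrow> (\<forall>j\<le>p. \<bar>u j - v j\<bar> \<le> \<delta>))"
proof -
  have approxR: "\<bar>A u - ((\<Sum>j\<le>p. S j * u j) - (\<Sum>j\<le>p. \<Sum>k\<le>p. H j k * u j * u k) / 2)\<bar> \<le> \<tau> * R\<^sup>2"
    if u: "(\<Sum>j\<le>p. \<bar>u j\<bar>) \<le> R" for u
  proof -
    have "(\<Sum>j\<le>p. \<bar>u j\<bar>)\<^sup>2 \<le> R\<^sup>2" by (rule power_mono[OF u]) (simp add: sum_nonneg)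
    from mult_left_mono[OF this pos(3)] approx[OF u] show ?thesis by linarith
  qed
  have boundary: "A w < A v"
    if w: "\<And>j. j \<le> p \<Longrightarrow> \<bar>w j - v j\<bar> \<le> \<delta>" and i: "i \<le> p" "\<bar>w i - v i\<bar> = \<delta>" for w i
  proof -
    have "(\<Sum>j\<le>p. \<bar>w j\<bar>) \<le> (\<Sum>j\<le>p. \<bar>v j\<bar> + \<delta>)"
    proof (rule sum_mono)
      fix j assume "j \<in> {..p}"
      then show "\<bar>w j\<bar> \<le> \<bar>v j\<bar> + \<delta>" using w[of j] by simp
    qed
    also have "\<dots> = (\<Sum>j\<le>p. \<bar>v j\<bar>) + (real p + 1) * \<delta>" by (simp add: sum.distrib)
    finally have wR: "(\<Sum>j\<le>p. \<bar>w j\<bar>) \<le> R" using R by simp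
    have vR: "(\<Sum>j\<le>p. \<bar>v j\<bar>) \<le> R" using R pos by (smt (verit) mult_nonneg_nonneg of_nat_0_le_iff)
    have "\<delta>\<^sup>2 = (w i - v i)\<^sup>2" using i(2) by (metis power2_abs)
    also have "\<dots> \<le> (\<Sum>j\<le>p. (w j - v j)\<^sup>2)" using i by (intro member_le_sum) auto
    finally have "l * \<delta>\<^sup>2 \<le> l * (\<Sum>j\<le>p. (w j - v j)\<^sup>2)" using pos by (intro mult_left_mono) auto
    also have "\<dots> \<le> (\<Sum>j\<le>p. \<Sum>k\<le>p. H j k * (w j - v j) * (w k - v k))" by (rule pd)
    finally have q: "l * \<delta>\<^sup>2 \<le> (\<Sum>j\<le>p. \<Sum>k\<le>p. H j k * (w j - v j) * (w k - v k))" .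
    have "(\<Sum>j\<le>p. S j * w j) - (\<Sum>j\<le>p. \<Sum>k\<le>p. H j k * w j * w k) / 2
      = (\<Sum>j\<le>p. S j * v j) - (\<Sum>j\<le>p. \<Sum>k\<le>p. H j k * v j * v k) / 2
       - (\<Sum>j\<le>p. \<Sum>k\<le>p. H j k * (w j - v j) * (w k - v k)) / 2"
      by (rule quadratic_completion) (use sym hat in auto)
    then show ?thesis using q approxR[OF wR] approxR[OF vR] small by linarith
  qed
  have outside: "A u < A v" if i: "i \<le> p" "\<delta> < \<bar>u i - v i\<bar>" for u i
  proof -
    \<comment> \<open>Pulling \<open>u\<close> towards \<open>v\<close> by the factor \<delta> / m
      makes the largest deviation equal to \<delta>, so the shrunken point is on the boundary of the
      box and no coordinate leaves it.\<close>
    define m where "m = Max ((\<lambda>j. \<bar>u j - v j\<bar>) ` {..p})"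
    have "m \<in> (\<lambda>j. \<bar>u j - v j\<bar>) ` {..p}" unfolding m_def by (rule Max_in) auto
    then obtain k where k: "k \<le> p" "m = \<bar>u k - v k\<bar>" by auto
    have le: "\<bar>u j - v j\<bar> \<le> m" if "j \<le> p" for j unfolding m_def using that by (intro Max_ge) auto
    have m: "\<delta> < m" using le[OF i(1)] i(2) by simp
    define s where "s = \<delta> / m"
    have s: "0 < s" "s \<le> 1" using m pos by (auto simp: s_def)
    define w where "w j = (1 - s) * v j + s * u j" for j
    have wv: "\<bar>w j - v j\<bar> = s * \<bar>u j - v j\<bar>" for j
    proof -
      have "w j - v j = s * (u j - v j)" by (simp add: w_def algebra_simps)
      then show ?thesis using s by (simp add: abs_mult)
    qed
    have sm: "s * m = \<delta>" using m pos by (simp add: s_def)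
    have "A w < A v"
    proof (rule boundary)
      show "\<bar>w j - v j\<bar> \<le> \<delta>" if "j \<le> p" for j
        unfolding wv sm[symmetric] using le[OF that] s by (intro mult_left_mono) auto
      show "k \<le> p" "\<bar>w k - v k\<bar> = \<delta>" unfolding wv using k sm by auto
    qed
    moreover have "(1 - s) * A v + s * A u \<le> A w" unfolding w_def by (rule conc) (use s in auto)
    ultimately have "s * A u < s * A v" by (simp add: algebra_simps)
    then show ?thesis using s by simp
  qed
  \<comment> \<open>Coordinates beyond \<open>p\<close> are frozen at those of \<open>v\<close> to
    make the box compact; \<open>dep\<close> later moves an arbitrary competitor into it without
    changing the value of \<open>A\<close>.\<close>
  define B where "B = {u. \<forall>j. (if j \<le> p then v j - \<delta> else v j) \<le> u j \<and> u j \<le> (if j \<le> p then v j + \<delta> else v j)}"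
  have "compact B" unfolding B_def by (rule compact_box)
  moreover have vB: "v \<in> B" using pos by (auto simp: B_def)
  ultimately obtain u where u: "u \<in> B" "\<And>w. w \<in> B \<Longrightarrow> A w \<le> A u"
    using continuous_attains_sup[of B A] continuous_on_subset[OF cont, of B] by auto
  have "A w \<le> A u" for w
  proof (cases "\<exists>j\<le>p. \<delta> < \<bar>w j - v j\<bar>")
    case True
    then show ?thesis using outside u(2)[OF vB] by force
  next
    case False
    define w' where "w' j = (if j \<le> p then w j else v j)" for j
    have "w' \<in> B" unfolding B_def w'_def using False by (auto simp: abs_le_iff not_less)
    moreover have "A w = A w'" by (rule dep) (simp add: w'_def)
    ultimately show ?thesis using u(2) by simp
  qed
  moreover have "\<bar>u j - v j\<bar> \<le> \<delta>" if "\<And>w. A w \<le> A u" "j \<le> p" for u j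
    using outside[of j u] that(1)[of v] that(2) by force
  ultimately show ?thesis by blast
qed

subsection \<open>Moment matrices\<close>

text \<open>The bound 1 / l on the entries depends on the matrix only through \<open>l\<close>, so
  it is uniform over a family of matrices with a common lower bound. The last clause is Cramer's
  rule; it links the determinants that define the equivalent kernel to a row of the inverse.\<close>

lemma posdef_matrix_inverse:
  fixes N :: "nat \<Rightarrow> nat \<Rightarrow> real"
  assumes l: "0 < l" and pd: "\<And>u. l * (\<Sum>j\<le>p. (u j)\<^sup>2) \<le> (\<Sum>j\<le>p. \<Sum>k\<le>p. N j k * u j * u k)"
  defines "A \<equiv> Matrix.mat (p + 1) (p + 1) (\<lambda>(i, j). N i j)"
  shows "\<exists>Ni. (\<forall>i\<le>p. \<forall>j\<le>p. (\<Sum>k\<le>p. N i k * Ni k j) = (if i = j then 1 else 0)) \<and>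
     (\<forall>i\<le>p. \<forall>j\<le>p. (\<Sum>k\<le>p. Ni i k * N k j) = (if i = j then 1 else 0)) \<and>
     (\<forall>i\<le>p. \<forall>j\<le>p. \<bar>Ni i j\<bar> \<le> 1 / l) \<and>
     (\<forall>b. \<forall>i\<le>p. Determinant.det (replace_col A (Matrix.vec (p + 1) b) i) / Determinant.det A = (\<Sum>k\<le>p. Ni i k * b k))"
proof -
  have A: "A \<in> carrier_mat (p + 1) (p + 1)" by (simp add: A_def)
  have set: "{0..<p + 1} = {..p}" by auto
  have det: "Determinant.det A \<noteq> 0"
  proof
    assume "Determinant.det A = 0"
    then obtain w where w: "w \<in> carrier_vec (p + 1)" "w \<noteq> 0\<^sub>v (p + 1)" "A *\<^sub>v w = 0\<^sub>v (p + 1)"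
      using det_0_iff_vec_prod_zero[OF A] by auto
    have "(\<Sum>k\<le>p. N j k * (w $ k)) = 0" if "j \<le> p" for j
    proof -
      have "(A *\<^sub>v w) $ j = (\<Sum>k\<le>p. N j k * (w $ k))"
        using that w(1) unfolding A_def by (simp add: scalar_prod_def set[symmetric])
      then show ?thesis using w(3) that by simp
    qed
    then have "(\<Sum>j\<le>p. \<Sum>k\<le>p. N j k * (w $ j) * (w $ k)) = 0"
      by (intro sum.neutral) (auto simp: mult.assoc mult.left_commute[of _ "w $ _"] sum_distrib_left[symmetric])
    then have "l * (\<Sum>j\<le>p. (w $ j)\<^sup>2) \<le> 0" using pd[of "\<lambda>j. w $ j"] by simp
    then have "(\<Sum>j\<le>p. (w $ j)\<^sup>2) = 0" using l by (simp add: mult_le_0_iff sum_nonneg order.antisym)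
    then have "\<forall>j\<in>{..p}. (w $ j)\<^sup>2 = 0" by (subst (asm) sum_nonneg_eq_0_iff) auto
    then have "w = 0\<^sub>v (p + 1)" using w(1) by (intro eq_vecI) auto
    then show False using w(2) by simp
  qed
  obtain B where B: "B \<in> carrier_mat (p + 1) (p + 1)" "A * B = 1\<^sub>m (p + 1)" "B * A = 1\<^sub>m (p + 1)"
    using det_non_zero_imp_unit[OF A det, of "()"]
    unfolding Units_def ring_mat_def by auto
  define Ni where "Ni i j = B $$ (i, j)" for i j
  have inv: "(\<Sum>k\<le>p. N i k * Ni k j) = (if i = j then 1 else 0)" if "i \<le> p" "j \<le> p" for i j
  proof -
    have "(A * B) $$ (i, j) = (\<Sum>k\<le>p. N i k * Ni k j)"
      using that B(1) unfolding A_def Ni_def by (simp add: scalar_prod_def set[symmetric])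
    then show ?thesis using that unfolding B(2) by simp
  qed
  have linv: "(\<Sum>k\<le>p. Ni i k * N k j) = (if i = j then 1 else 0)" if "i \<le> p" "j \<le> p" for i j
  proof -
    have "(B * A) $$ (i, j) = (\<Sum>k\<le>p. Ni i k * N k j)"
      using that B(1) unfolding A_def Ni_def by (simp add: scalar_prod_def set[symmetric])
    then show ?thesis using that unfolding B(3) by simp
  qed
  \<comment> \<open>Evaluated at column j of the inverse, the quadratic form equals the diagonal
    entry \<open>Ni j j\<close>. Hence l times the squared norm of that column is at most
    \<open>Ni j j\<close>; the diagonal entry itself gives \<open>Ni j j\<close> <= 1 / l, and then
    every entry of the column obeys the same bound.\<close>
  have bound: "\<bar>Ni i j\<bar> \<le> 1 / l" if ij: "i \<le> p" "j \<le> p" for i j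
  proof -
    have "(\<Sum>a\<le>p. \<Sum>k\<le>p. N a k * Ni a j * Ni k j) = (\<Sum>a\<le>p. Ni a j * (if a = j then 1 else 0))"
      by (intro sum.cong refl) (auto simp: inv[symmetric] ij sum_distrib_left mult_ac)
    also have "\<dots> = Ni j j" using ij by (simp add: sum.delta if_distrib[of "\<lambda>x. _ * x"] cong: if_cong)
    finally have "l * (\<Sum>a\<le>p. (Ni a j)\<^sup>2) \<le> Ni j j" using pd[of "\<lambda>a. Ni a j"] by simp
    moreover have le: "(Ni a j)\<^sup>2 \<le> (\<Sum>a\<le>p. (Ni a j)\<^sup>2)" if "a \<le> p" for a
      using that by (intro member_le_sum) auto
    ultimately have 1: "l * (Ni a j)\<^sup>2 \<le> Ni j j" if "a \<le> p" for a
      using that l by (meson mult_left_mono order.trans less_imp_le)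
    have "Ni j j \<le> 1 / l"
    proof (cases "Ni j j \<le> 0")
      case True
      then show ?thesis using l by (meson divide_nonneg_pos order.trans zero_le_one)
    next
      case False
      have "(l * Ni j j) * Ni j j \<le> 1 * Ni j j" using 1[OF ij(2)] by (simp add: power2_eq_square mult.assoc)
      then have "l * Ni j j \<le> 1" using False by simp
      then show ?thesis using l by (simp add: field_simps)
    qed
    then have "l * (Ni i j)\<^sup>2 \<le> 1 / l" using 1[OF ij(1)] by simp
    then have "(Ni i j)\<^sup>2 \<le> (1 / l)\<^sup>2" using l by (simp add: field_simps power2_eq_square)
    then show ?thesis using l by (metis abs_le_square_iff abs_of_pos zero_less_divide_1_iff)
  qed
  have cramer: "Determinant.det (replace_col A (Matrix.vec (p + 1) b) i) / Determinant.det A = (\<Sum>k\<le>p. Ni i k * b k)"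
    if "i \<le> p" for b i
  proof -
    let ?b = "Matrix.vec (p + 1) b"
    let ?x = "B *\<^sub>v ?b"
    have "A *\<^sub>v ?x = (A * B) *\<^sub>v ?b" by (rule assoc_mult_mat_vec[symmetric, OF A B(1)]) simp
    also have "\<dots> = ?b" unfolding B(2) by (rule one_mult_mat_vec) simp
    finally have "Determinant.det (replace_col A ?b i) = ?x $ i * Determinant.det A"
      using cramer_lemma_mat[OF A, of ?x i] B(1) that by simp
    moreover have "?x $ i = (\<Sum>k\<le>p. Ni i k * b k)"
      using that B(1) unfolding Ni_def by (simp add: scalar_prod_def set[symmetric])
    ultimately show ?thesis using det by simp
  qed
  show ?thesis using inv linv bound cramer by blast
qed

section \<open>Kernel moments as integrals of polynomials over the window\<close>

lemma windowed_integrable: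
  fixes J m :: "real \<Rightarrow> real"
  assumes J: "integrable lborel J" "\<And>z. z \<notin> {-1..1} \<Longrightarrow> J z = 0"
    and [measurable]: "m \<in> borel_measurable borel" and m: "\<And>z. z \<in> {-1..1} \<Longrightarrow> \<bar>m z\<bar> \<le> C"
  shows "integrable lborel (\<lambda>z. m z * J z)" "\<bar>LINT z|lborel. m z * J z\<bar> \<le> C * (LINT z|lborel. \<bar>J z\<bar>)"
proof -
  have C: "0 \<le> C" using m[of 0] by simp
  have le: "\<bar>m z * J z\<bar> \<le> C * \<bar>J z\<bar>" for z
    using m[of z] J(2)[of z] by (cases "z \<in> {-1..1}") (auto simp: abs_mult intro: mult_right_mono)
  have [measurable]: "J \<in> borel_measurable borel" using J(1) by auto
  show i: "integrable lborel (\<lambda>z. m z * J z)"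
    by (rule Bochner_Integration.integrable_bound[of _ "\<lambda>z. C * \<bar>J z\<bar>"])
      (use J(1) le C in \<open>auto simp: abs_mult\<close>)
  have "\<bar>LINT z|lborel. m z * J z\<bar> \<le> (LINT z|lborel. \<bar>m z * J z\<bar>)"
    by (rule integral_abs_bound)
  also have "\<dots> \<le> (LINT z|lborel. C * \<bar>J z\<bar>)"
    by (rule integral_mono) (use i J(1) le in auto)
  finally show "\<bar>LINT z|lborel. m z * J z\<bar> \<le> C * (LINT z|lborel. \<bar>J z\<bar>)" by simp
qed

lemma lborel_integral_reflect:
  fixes f :: "real \<Rightarrow> real"
  shows "(LINT z|lborel. f (- z)) = (LINT z|lborel. f z)"
  using lborel_integral_real_affine[of "-1" f 0] by simp

lemma lborel_integrable_reflect:
  fixes f :: "real \<Rightarrow> real"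
  shows "integrable lborel f \<Longrightarrow> integrable lborel (\<lambda>z. f (- z))"
  using lborel_integrable_real_affine[of f "-1" 0] by simp

definition polyval :: "nat \<Rightarrow> (nat \<Rightarrow> real) \<Rightarrow> real \<Rightarrow> real" where
  "polyval p u z = (\<Sum>j\<le>p. u j * z ^ j)"

lemma polyval_measurable [measurable]: "polyval p u \<in> borel_measurable borel"
  unfolding polyval_def by measurable

lemma polyval_bound:
  assumes "z \<in> {-1..1}" shows "\<bar>polyval p u z\<bar> \<le> (\<Sum>j\<le>p. \<bar>u j\<bar>)"
proof -
  have "\<bar>polyval p u z\<bar> \<le> (\<Sum>j\<le>p. \<bar>u j * z ^ j\<bar>)" unfolding polyval_def by (rule sum_abs)
  also have "\<dots> \<le> (\<Sum>j\<le>p. \<bar>u j\<bar>)"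
  proof (rule sum_mono)
    fix j
    have "\<bar>z\<bar> ^ j \<le> 1" using assms by (intro power_le_one) auto
    then show "\<bar>u j * z ^ j\<bar> \<le> \<bar>u j\<bar>" by (simp add: abs_mult power_abs mult_left_le)
  qed
  finally show ?thesis .
qed

lemma polyval_affine: "polyval p (\<lambda>j. a * u j + b * w j) z = a * polyval p u z + b * polyval p w z"
  by (simp add: polyval_def sum.distrib sum_distrib_left algebra_simps)

locale kernel =
  fixes K :: "real \<Rightarrow> real"
  assumes K_nonneg: "\<And>z. 0 \<le> K z" and K_sym: "\<And>z. K (- z) = K z"
    and K_integrable: "integrable lborel K" and K_integral: "(LINT z|lborel. K z) = 1"
    and K_supp: "supp K = {-1..1}" and K_square: "integrable lborel (\<lambda>z. (K z)\<^sup>2)"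
begin

lemma K_outside: "z \<notin> {-1..1} \<Longrightarrow> K z = 0"
  using closure_subset[of "{x. K x \<noteq> 0}"] K_supp unfolding supp_def by auto

lemma K_measurable [measurable]: "K \<in> borel_measurable borel"
  using K_integrable by auto

lemma K_abs_integral: "(LINT z|lborel. \<bar>K z\<bar>) = 1"
  using K_nonneg K_integral by simp

lemma kernel_moment_eq: "kernel_moment K l A = (LINT z|lborel. (indicator A z * z ^ l) * K z)"
  unfolding kernel_moment_def set_lebesgue_integral_def by (simp add: mult.assoc)

text \<open>Recognizes the moment matrix as the Gram matrix of the monomials for the weight K on
  \<open>A\<close>. Positivity, monotonicity in \<open>A\<close> and behaviour under reflection are
  all read off from the integral.\<close>

lemma bilinear_moment:
  assumes [measurable]: "A \<in> sets borel"
  shows "(\<Sum>j\<le>p. \<Sum>k\<le>p. kernel_moment K (j + k) A * u j * w k)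
    = (LINT z|lborel. (indicator A z * (polyval p u z * polyval p w z)) * K z)"
proof -
  have i: "integrable lborel (\<lambda>z. (indicator A z * z ^ (j + k)) * K z)" for j k
    by (rule windowed_integrable[OF K_integrable K_outside, of _ 1])
      (auto simp: indicator_def power_abs intro!: power_le_one)
  have "(LINT z|lborel. (indicator A z * (polyval p u z * polyval p w z)) * K z)
    = (LINT z|lborel. (\<Sum>j\<le>p. \<Sum>k\<le>p. ((indicator A z * z ^ (j + k)) * K z) * (u j * w k)))"
    unfolding polyval_def sum_product unfolding sum_distrib_left sum_distrib_right
    by (intro Bochner_Integration.integral_cong sum.cong refl) (simp add: power_add)
  also have "\<dots> = (\<Sum>j\<le>p. \<Sum>k\<le>p. (LINT z|lborel. (indicator A z * z ^ (j + k)) * K z) * (u j * w k))"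
    using i by (subst Bochner_Integration.integral_sum, force)+ auto
  finally show ?thesis by (simp add: kernel_moment_eq mult.assoc)
qed

text \<open>A nonzero polynomial has finitely many roots, so a vanishing integral would force K to
  vanish almost everywhere on [0, 1], and by symmetry on [-1, 1], against total mass 1.\<close>

lemma half_moment_pos:
  assumes "i \<le> p" "u i \<noteq> 0"
  shows "0 < (\<Sum>j\<le>p. \<Sum>k\<le>p. kernel_moment K (j + k) {0..1} * u j * u k)"
proof -
  let ?F = "\<lambda>z. (indicator {0..1} z * (polyval p u z * polyval p u z)) * K z"
  have nn: "0 \<le> ?F z" for z using K_nonneg by (simp add: indicator_def)
  have i: "integrable lborel ?F"
  proof (rule windowed_integrable[OF K_integrable K_outside])
    fix z :: real assume z: "z \<in> {-1..1}"
    have "\<bar>polyval p u z * polyval p u z\<bar> \<le> (\<Sum>j\<le>p. \<bar>u j\<bar>) * (\<Sum>j\<le>p. \<bar>u j\<bar>)"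
      unfolding abs_mult using polyval_bound[OF z] by (intro mult_mono) (auto simp: sum_nonneg)
    then show "\<bar>indicator {0..1} z * (polyval p u z * polyval p u z)\<bar> \<le> (\<Sum>j\<le>p. \<bar>u j\<bar>) * (\<Sum>j\<le>p. \<bar>u j\<bar>)"
      by (auto simp: indicator_def sum_nonneg)
  qed auto
  have "(LINT z|lborel. ?F z) \<noteq> 0"
  proof
    assume "(LINT z|lborel. ?F z) = 0"
    then have ae: "AE z in lborel. ?F z = 0"
      using integral_nonneg_eq_0_iff_AE[OF i] nn by simp
    have fin: "finite {z. polyval p u z = 0}"
      unfolding polyval_def using polyfun_finite_roots[of u p] assms by auto
    have "AE z in lborel. z \<notin> {z. polyval p u z = 0}"
      using finite_imp_null_set_lborel[OF fin] by (rule AE_not_in)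
    with ae have K0: "AE z in lborel. indicator {0..1} z * K z = 0"
      by eventually_elim auto
    have iK: "integrable lborel (\<lambda>z. indicator {0..1} z * K z)"
      by (rule windowed_integrable[OF K_integrable K_outside, of _ 1]) (auto simp: indicator_def)
    have i0: "(LINT z|lborel. indicator {0..1} z * K z) = 0"
      using integral_cong_AE[OF _ _ K0] by simp
    \<comment> \<open>An inequality and not an equality pointwise, because the point 0 is counted in
      both halves.\<close>
    have "(LINT z|lborel. K z) \<le> (LINT z|lborel. indicator {0..1} z * K z + indicator {0..1} (- z) * K (- z))"
      using K_nonneg K_outside K_integrable iK lborel_integrable_reflect[OF iK]
      by (intro integral_mono) (auto simp: indicator_def K_sym not_le)
    also have "\<dots> = 0"
      using iK lborel_integrable_reflect[OF iK] i0 lborel_integral_reflect[of "\<lambda>z. indicator {0..1} z * K z"]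
      by (subst Bochner_Integration.integral_add) auto
    finally show False using K_integral by simp
  qed
  moreover have "0 \<le> (LINT z|lborel. ?F z)" using nn by simp
  ultimately show ?thesis by (subst bilinear_moment) auto
qed

text \<open>The least value of a positive continuous form on the compact unit sphere is positive,
  and homogeneity extends the bound to all vectors.\<close>

lemma half_moment_posdef:
  "\<exists>l>0. \<forall>u. l * (\<Sum>j\<le>p. (u j)\<^sup>2) \<le> (\<Sum>j\<le>p. \<Sum>k\<le>p. kernel_moment K (j + k) {0..1} * u j * u k)"
proof -
  define Q where "Q u = (\<Sum>j\<le>p. \<Sum>k\<le>p. kernel_moment K (j + k) {0..1} * u j * u k)" for u
  define B where "B = {u. \<forall>j::nat. (if j \<le> p then - 1 else 0) \<le> u j \<and> u j \<le> (if j \<le> p then 1 else 0 :: real)} \<inter> {u. (\<Sum>j\<le>p. (u j)\<^sup>2) = 1}"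
  have cQ: "continuous_on S Q" for S unfolding Q_def
    by (intro continuous_intros continuous_on_subset[OF continuous_on_product_coordinates]) auto
  have "compact B" unfolding B_def
    by (intro compact_Int_closed compact_box closed_Collect_eq continuous_intros continuous_on_product_coordinates)
  moreover have "(\<lambda>j. if j = 0 then 1 else 0) \<in> B"
    by (auto simp: B_def if_distrib[of "\<lambda>x. x\<^sup>2"] sum.delta cong: if_cong)
  ultimately obtain w where w: "w \<in> B" "\<And>u. u \<in> B \<Longrightarrow> Q w \<le> Q u"
    using continuous_attains_inf[of B Q] cQ by auto
  have "\<exists>i\<le>p. w i \<noteq> 0"
  proof (rule ccontr)
    assume "\<not> ?thesis"
    then have "(\<Sum>j\<le>p. (w j)\<^sup>2) = 0" by auto
    then show False using w(1) by (simp add: B_def)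
  qed
  then have pos: "0 < Q w" unfolding Q_def using half_moment_pos by blast
  have "Q w * (\<Sum>j\<le>p. (u j)\<^sup>2) \<le> Q u" for u
  proof (cases "(\<Sum>j\<le>p. (u j)\<^sup>2) = 0")
    case True
    then have "\<forall>j\<in>{..p}. (u j)\<^sup>2 = 0" by (subst (asm) sum_nonneg_eq_0_iff) auto
    then have "Q u = 0" by (auto simp: Q_def intro!: sum.neutral)
    then show ?thesis using True by simp
  next
    case False
    define r where "r = sqrt (\<Sum>j\<le>p. (u j)\<^sup>2)"
    have r2: "r\<^sup>2 = (\<Sum>j\<le>p. (u j)\<^sup>2)" unfolding r_def by (simp add: sum_nonneg)
    have r: "0 < r" unfolding r_def using False by (simp add: sum_nonneg less_le)
    \<comment> \<open>The normalized vector is set to 0 beyond \<open>p\<close> so that it lies in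
      the compact set \<open>B\<close>, where these coordinates are pinned.\<close>
    define t where "t j = (if j \<le> p then u j / r else 0)" for j
    have "(\<Sum>j\<le>p. (t j)\<^sup>2) = (\<Sum>j\<le>p. (u j)\<^sup>2 / r\<^sup>2)"
      by (intro sum.cong) (auto simp: t_def power_divide)
    also have "\<dots> = 1" using r by (simp add: sum_divide_distrib[symmetric] r2[symmetric])
    finally have t1: "(\<Sum>j\<le>p. (t j)\<^sup>2) = 1" .
    have "\<bar>t j\<bar> \<le> 1" if "j \<le> p" for j
    proof -
      have "(t j)\<^sup>2 \<le> (\<Sum>j\<le>p. (t j)\<^sup>2)" using that by (intro member_le_sum) auto
      then show ?thesis using t1 by (simp add: abs_square_le_1)
    qed
    then have "- 1 \<le> t j \<and> t j \<le> 1" if "j \<le> p" for j using that by (simp add: abs_le_iff minus_le_iff)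
    moreover have "t j = 0" if "\<not> j \<le> p" for j using that by (simp add: t_def)
    ultimately have "t \<in> B" using t1 by (simp add: B_def)
    then have "Q w \<le> Q t" by (rule w(2))
    also have "Q t = Q u / r\<^sup>2"
      unfolding Q_def sum_divide_distrib by (intro sum.cong refl) (auto simp: t_def power2_eq_square)
    finally show ?thesis using r by (simp add: r2[symmetric] field_simps)
  qed
  then show ?thesis using pos unfolding Q_def by blast
qed

text \<open>Enlarging \<open>A\<close> can only increase the form, so a half interval is the worst
  case. The left half reduces to the right one by reflection, which alternates the signs of the
  coefficients and leaves their squares alone; hence the same \<open>l\<close> serves both.\<close>

lemma moment_posdef:
  "\<exists>l>0. \<forall>A\<in>sets borel. ({0..1} \<subseteq> A \<or> {-1..0} \<subseteq> A) \<longrightarrow>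
     (\<forall>u. l * (\<Sum>j\<le>p. (u j)\<^sup>2) \<le> (\<Sum>j\<le>p. \<Sum>k\<le>p. kernel_moment K (j + k) A * u j * u k))"
proof -
  obtain l where l: "0 < l"
    and pd: "\<And>u. l * (\<Sum>j\<le>p. (u j)\<^sup>2) \<le> (\<Sum>j\<le>p. \<Sum>k\<le>p. kernel_moment K (j + k) {0..1} * u j * u k)"
    using half_moment_posdef[of p] by blast
  have I: "integrable lborel (\<lambda>z. (indicator A z * (polyval p u z * polyval p u z)) * K z)" if [measurable]: "A \<in> sets borel" for A u
  proof (rule windowed_integrable[OF K_integrable K_outside])
    fix z :: real assume z: "z \<in> {-1..1}"
    have "\<bar>polyval p u z * polyval p u z\<bar> \<le> (\<Sum>j\<le>p. \<bar>u j\<bar>) * (\<Sum>j\<le>p. \<bar>u j\<bar>)"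
      unfolding abs_mult using polyval_bound[OF z] by (intro mult_mono) (auto simp: sum_nonneg)
    then show "\<bar>indicator A z * (polyval p u z * polyval p u z)\<bar> \<le> (\<Sum>j\<le>p. \<bar>u j\<bar>) * (\<Sum>j\<le>p. \<bar>u j\<bar>)"
      by (auto simp: indicator_def sum_nonneg)
  qed auto
  have mono: "(\<Sum>j\<le>p. \<Sum>k\<le>p. kernel_moment K (j + k) B * u j * u k) \<le> (\<Sum>j\<le>p. \<Sum>k\<le>p. kernel_moment K (j + k) A * u j * u k)"
    if "A \<in> sets borel" "B \<in> sets borel" "B \<subseteq> A" for A B u
    unfolding bilinear_moment[OF that(1)] bilinear_moment[OF that(2)] using that K_nonneg
    by (intro integral_mono I mult_right_mono) (auto simp: indicator_def)
  have neg: "l * (\<Sum>j\<le>p. (u j)\<^sup>2) \<le> (\<Sum>j\<le>p. \<Sum>k\<le>p. kernel_moment K (j + k) {-1..0} * u j * u k)" for u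
  proof -
    define w where "w j = (-1) ^ j * u j" for j
    have pw: "polyval p u (- z) = polyval p w z" for z
      unfolding polyval_def w_def by (intro sum.cong) (auto simp: power_minus[of z])
    have "(\<Sum>j\<le>p. \<Sum>k\<le>p. kernel_moment K (j + k) {-1..0} * u j * u k)
      = (LINT z|lborel. (indicator {-1..0} (- z) * (polyval p u (- z) * polyval p u (- z))) * K (- z))"
      by (subst lborel_integral_reflect[where f = "\<lambda>z. (indicator {-1..0} z * (polyval p u z * polyval p u z)) * K z"])
        (rule bilinear_moment, simp)
    also have "\<dots> = (LINT z|lborel. (indicator {0..1} z * (polyval p w z * polyval p w z)) * K z)"
      unfolding pw K_sym by (intro Bochner_Integration.integral_cong refl) (auto simp: indicator_def)
    also have "\<dots> = (\<Sum>j\<le>p. \<Sum>k\<le>p. kernel_moment K (j + k) {0..1} * w j * w k)"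
      by (rule bilinear_moment[symmetric]) simp
    finally show ?thesis using pd[of w] by (simp add: w_def power_mult_distrib flip: power_mult)
  qed
  have "l * (\<Sum>j\<le>p. (u j)\<^sup>2) \<le> (\<Sum>j\<le>p. \<Sum>k\<le>p. kernel_moment K (j + k) A * u j * u k)"
    if "A \<in> sets borel" "{0..1} \<subseteq> A \<or> {-1..0} \<subseteq> A" for A u
    using that(2) order.trans[OF pd mono[OF that(1)]] order.trans[OF neg mono[OF that(1)]] by auto
  then show ?thesis using l by blast
qed

text \<open>At a boundary point at least one full half of the smoothing window lies in the support;
  a fixed half interval is what makes the constants independent of n.\<close>

definition window :: "real set \<Rightarrow> bool" where
  "window A \<longleftrightarrow> A \<in> sets borel \<and> ({0..1} \<subseteq> A \<or> {-1..0} \<subseteq> A)"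

lemma kernel_moment_cong:
  assumes "A \<inter> {-1..1} = B \<inter> {-1..1}" shows "kernel_moment K l A = kernel_moment K l B"
  unfolding kernel_moment_eq
proof (intro Bochner_Integration.integral_cong refl)
  fix z show "indicator A z * z ^ l * K z = indicator B z * z ^ l * K z"
  proof (cases "z \<in> {-1..1}")
    case True
    then have "z \<in> A \<longleftrightarrow> z \<in> B" using assms by blast
    then show ?thesis by (simp add: indicator_def)
  qed (simp add: K_outside)
qed

lemma equiv_kernel_cong:
  assumes "A \<inter> {-1..1} = B \<inter> {-1..1}" shows "equiv_kernel K r p A z = equiv_kernel K r p B z"
  unfolding equiv_kernel_def moment_mat_def kernel_moment_cong[OF assms] ..

lemma equiv_kernel_outside: "z \<notin> {-1..1} \<Longrightarrow> equiv_kernel K r p A z = 0"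
  unfolding equiv_kernel_def by (simp add: K_outside)

lemma window_integral_cong:
  assumes "A \<inter> {-1..1} = B \<inter> {-1..1}" and "\<And>z. z \<notin> {-1..1} \<Longrightarrow> m z = 0"
  shows "(LINT z:A|lborel. m z) = (LINT z:B|lborel. m z :: real)"
  unfolding set_lebesgue_integral_def
proof (intro Bochner_Integration.integral_cong refl)
  fix z show "indicator A z *\<^sub>R m z = indicator B z *\<^sub>R m z"
  proof (cases "z \<in> {-1..1}")
    case True
    then have "z \<in> A \<longleftrightarrow> z \<in> B" using assms(1) by blast
    then show ?thesis by (simp add: indicator_def)
  qed (simp add: assms(2))
qed

text \<open>The third and fourth clauses replace the determinants by a linear system: the equivalent
  kernel is K times the polynomial whose coefficients solve the moment system with right-hand side
  (1, 0, ..., 0), and row 0 of the inverse is such a solution. Statements about the equivalent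
  kernel then become statements about solutions.\<close>

definition inverse_moments :: "real \<Rightarrow> nat \<Rightarrow> real set \<Rightarrow> (nat \<Rightarrow> nat \<Rightarrow> real) \<Rightarrow> bool" where
  "inverse_moments l p A Ni \<longleftrightarrow>
     (\<forall>i\<le>p. \<forall>j\<le>p. (\<Sum>k\<le>p. kernel_moment K (i + k) A * Ni k j) = (if i = j then 1 else 0)) \<and>
     (\<forall>i\<le>p. \<forall>j\<le>p. \<bar>Ni i j\<bar> \<le> 1 / l) \<and>
     (\<forall>c. (\<forall>i\<le>p. (\<Sum>k\<le>p. kernel_moment K (i + k) A * c k) = (if i = 0 then 1 else 0)) \<longrightarrow>
        (\<forall>z. equiv_kernel K 0 p A z = polyval p c z * K z)) \<and>
     (\<forall>i\<le>p. (\<Sum>k\<le>p. kernel_moment K (i + k) A * Ni 0 k) = (if i = 0 then 1 else 0))"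

lemma moment_inverse:
  "\<exists>l>0. \<forall>A. window A \<longrightarrow>
     (\<forall>u. l * (\<Sum>j\<le>p. (u j)\<^sup>2) \<le> (\<Sum>j\<le>p. \<Sum>k\<le>p. kernel_moment K (j + k) A * u j * u k)) \<and>
     (\<exists>Ni. inverse_moments l p A Ni)"
proof -
  obtain l where l: "0 < l"
    and pd: "\<And>A u. window A \<Longrightarrow> l * (\<Sum>j\<le>p. (u j)\<^sup>2) \<le> (\<Sum>j\<le>p. \<Sum>k\<le>p. kernel_moment K (j + k) A * u j * u k)"
    using moment_posdef[of p] unfolding window_def by blast
  have "\<exists>Ni. inverse_moments l p A Ni"
    if A: "window A" for A
  proof -
    let ?N = "\<lambda>i j. kernel_moment K (i + j) A"
    obtain Ni where Ni: "(\<forall>i\<le>p. \<forall>j\<le>p. (\<Sum>k\<le>p. ?N i k * Ni k j) = (if i = j then 1 else 0)) \<and>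
       (\<forall>i\<le>p. \<forall>j\<le>p. (\<Sum>k\<le>p. Ni i k * ?N k j) = (if i = j then 1 else 0)) \<and>
       (\<forall>i\<le>p. \<forall>j\<le>p. \<bar>Ni i j\<bar> \<le> 1 / l) \<and>
       (\<forall>b. \<forall>i\<le>p. Determinant.det (replace_col (moment_mat K p A) (Matrix.vec (p + 1) b) i)
          / Determinant.det (moment_mat K p A) = (\<Sum>k\<le>p. Ni i k * b k))"
      unfolding moment_mat_def by (rule exE[OF posdef_matrix_inverse[OF l pd[OF A]]])
    note rinv = Ni[THEN conjunct1]
      and linv = Ni[THEN conjunct2, THEN conjunct1, rule_format]
      and bound = Ni[THEN conjunct2, THEN conjunct2, THEN conjunct1]
      and cramer = Ni[THEN conjunct2, THEN conjunct2, THEN conjunct2, rule_format]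
    have uniq: "x i = (\<Sum>k\<le>p. Ni i k * b k)"
      if x: "\<And>k. k \<le> p \<Longrightarrow> (\<Sum>j\<le>p. ?N k j * x j) = b k" and i: "i \<le> p" for x b i
    proof -
      have "(\<Sum>k\<le>p. Ni i k * b k) = (\<Sum>k\<le>p. \<Sum>j\<le>p. Ni i k * ?N k j * x j)"
        by (intro sum.cong refl) (simp add: x[symmetric] sum_distrib_left mult.assoc)
      also have "\<dots> = (\<Sum>j\<le>p. (\<Sum>k\<le>p. Ni i k * ?N k j) * x j)"
        by (subst sum.swap) (simp add: sum_distrib_right)
      also have "\<dots> = (\<Sum>j\<le>p. if j = i then x j else 0)"
        using i by (intro sum.cong refl) (auto simp: linv)
      also have "\<dots> = x i" using i by simp
      finally show ?thesis by simp
    qed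
    \<comment> \<open>Row 0 of the inverse solves the same system as column 0, because the moment
      matrix depends on i + j only and is therefore symmetric.\<close>
    have row: "(\<Sum>k\<le>p. ?N i k * Ni 0 k) = (if i = 0 then 1 else 0)" if "i \<le> p" for i
    proof -
      have "(\<Sum>k\<le>p. ?N i k * Ni 0 k) = (\<Sum>k\<le>p. Ni 0 k * ?N k i)"
        by (intro sum.cong refl) (simp only: mult.commute add.commute[of i])
      also have "\<dots> = (if i = 0 then 1 else 0)" using linv[of 0 i] that by (cases "i = 0") auto
      finally show ?thesis .
    qed
    have c: "\<forall>z. equiv_kernel K 0 p A z = polyval p c z * K z"
      if c: "\<forall>i\<le>p. (\<Sum>k\<le>p. ?N i k * c k) = (if i = 0 then 1 else 0)" for c
    proof -
      have eq: "c i = Ni 0 i" if "i \<le> p" for i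
      proof -
        have "c i = (\<Sum>k\<le>p. Ni i k * (if k = 0 then 1 else 0))"
          by (rule uniq[OF _ that]) (use c in blast)
        moreover have "Ni 0 i = (\<Sum>k\<le>p. Ni i k * (if k = 0 then 1 else 0))"
          by (rule uniq[OF row that])
        ultimately show ?thesis by simp
      qed
      then have "equiv_kernel K 0 p A z = polyval p c z * K z" for z
        unfolding equiv_kernel_def using cramer[of 0 "\<lambda>i. z ^ i"] by (simp add: polyval_def)
      then show ?thesis by blast
    qed
    show ?thesis unfolding inverse_moments_def
      by (rule exI[of _ Ni], intro conjI rinv bound) (use c row in simp_all)
  qed
  with l pd show ?thesis by (intro exI[of _ l]) simp
qed

text \<open>The premise says that the polynomial times K has moments 1, 0, ..., 0 of orders 0 to
  \<open>p\<close> over \<open>A\<close>; being the only such product, it is the equivalent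
  kernel.\<close>

lemma equiv_kernel_eqI:
  assumes A: "window A" and "\<And>i. i \<le> p \<Longrightarrow> (\<Sum>k\<le>p. kernel_moment K (i + k) A * c k) = (if i = 0 then 1 else 0)"
  shows "equiv_kernel K 0 p A z = polyval p c z * K z"
proof -
  obtain l Ni where "inverse_moments l p A Ni" using moment_inverse[of p] A by blast
  then show ?thesis using assms(2) by (simp add: inverse_moments_def)
qed

lemma equiv_kernel_obtain:
  assumes A: "window A"
  obtains c where "\<And>i. i \<le> p \<Longrightarrow> (\<Sum>k\<le>p. kernel_moment K (i + k) A * c k) = (if i = 0 then 1 else 0)"
    "\<And>z. equiv_kernel K 0 p A z = polyval p c z * K z"
proof -
  obtain l Ni where "inverse_moments l p A Ni" using moment_inverse[of p] A by blast
  then have "(\<Sum>k\<le>p. kernel_moment K (i + k) A * Ni 0 k) = (if i = 0 then 1 else 0)" if "i \<le> p" for i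
    using that by (simp add: inverse_moments_def)
  with equiv_kernel_eqI[OF A this] show ?thesis using that by blast
qed

lemma window_uminus: "window A \<Longrightarrow> window (uminus ` A)"
proof -
  assume A: "window A"
  have "uminus ` A = uminus -` A"
  proof (rule subset_antisym; rule subsetI)
    fix x assume "x \<in> uminus -` A"
    then show "x \<in> uminus ` A" by (intro image_eqI[of _ _ "- x"]) auto
  qed auto
  moreover have "(uminus -` A \<inter> space borel :: real set) \<in> sets borel"
    by (rule measurable_sets[of _ borel borel]) (use A in \<open>auto simp: window_def\<close>)
  ultimately have "uminus ` A \<in> sets borel" by simp
  moreover have "{0..1} \<subseteq> uminus ` A \<or> {-1..0} \<subseteq> uminus ` A"
    using A image_mono[of "{0..1::real}" A uminus] image_mono[of "{-1..0::real}" A uminus]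
    unfolding window_def by (auto simp only: image_uminus_atLeastAtMost minus_zero minus_minus)
  ultimately show ?thesis unfolding window_def by blast
qed

lemma set_integral_uminus:
  fixes m :: "real \<Rightarrow> real"
  shows "(LINT z:uminus ` A|lborel. m z) = (LINT z:A|lborel. m (- z))"
proof -
  have "indicator (uminus ` A) (- z) = (indicator A z :: real)" for z :: real
    by (auto simp: indicator_def image_iff)
  then show ?thesis unfolding set_lebesgue_integral_def
    by (subst lborel_integral_reflect[symmetric]) simp
qed

lemma kernel_moment_uminus: "kernel_moment K l (uminus ` A) = (-1) ^ l * kernel_moment K l A"
proof -
  have "(- z) ^ l * K (- z) = (-1) ^ l * (z ^ l * K z)" for z
    unfolding power_minus[of z] K_sym by simp
  then show ?thesis unfolding kernel_moment_def set_integral_uminus by simp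
qed

text \<open>Reflecting the domain multiplies the moment of order l by (-1)^l, so alternating the
  signs of a solution of the moment system gives a solution for the reflected domain.\<close>

lemma equiv_kernel_uminus:
  assumes A: "window A" shows "equiv_kernel K 0 p (uminus ` A) z = equiv_kernel K 0 p A (- z)"
proof -
  obtain c where c: "\<And>i. i \<le> p \<Longrightarrow> (\<Sum>k\<le>p. kernel_moment K (i + k) A * c k) = (if i = 0 then 1 else 0)"
    and e: "\<And>z. equiv_kernel K 0 p A z = polyval p c z * K z"
    using equiv_kernel_obtain[OF A] by blast
  have "equiv_kernel K 0 p (uminus ` A) z = polyval p (\<lambda>k. (-1) ^ k * c k) z * K z"
  proof (rule equiv_kernel_eqI[OF window_uminus[OF A]])
    fix i assume i: "i \<le> p"
    have "(\<Sum>k\<le>p. kernel_moment K (i + k) (uminus ` A) * ((- 1) ^ k * c k))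
      = (\<Sum>k\<le>p. (-1) ^ i * (((-1) ^ k * (-1) ^ k) * (kernel_moment K (i + k) A * c k)))"
      unfolding kernel_moment_uminus by (intro sum.cong refl) (simp only: power_add mult_ac)
    also have "\<dots> = (-1) ^ i * (\<Sum>k\<le>p. kernel_moment K (i + k) A * c k)"
      by (simp add: sum_distrib_left flip: power_mult_distrib)
    also have "\<dots> = (if i = 0 then 1 else 0)" using c[OF i] by simp
    finally show "(\<Sum>k\<le>p. kernel_moment K (i + k) (uminus ` A) * ((- 1) ^ k * c k)) = (if i = 0 then 1 else 0)" .
  qed
  also have "polyval p (\<lambda>k. (-1) ^ k * c k) z = polyval p c (- z)"
    unfolding polyval_def by (intro sum.cong refl) (simp add: power_minus[of z])
  finally show ?thesis by (simp add: e K_sym)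
qed

text \<open>Over the whole line the equivalent kernel is even. For even \<open>p\<close> this
  removes the bias term of order h^(p+1) at interior points.\<close>

lemma equiv_kernel_odd_moment:
  assumes "odd q" shows "(LINT z:UNIV|lborel. z ^ q * equiv_kernel K 0 p UNIV z) = 0"
proof -
  have w: "window UNIV" by (simp add: window_def)
  have u: "uminus ` UNIV = (UNIV :: real set)" by (simp add: surj_uminus)
  have "(LINT z:UNIV|lborel. z ^ q * equiv_kernel K 0 p UNIV z)
      = (LINT z:UNIV|lborel. (- z) ^ q * equiv_kernel K 0 p UNIV (- z))"
    using set_integral_uminus[of UNIV] unfolding u .
  also have "\<dots> = (LINT z:UNIV|lborel. - (z ^ q * equiv_kernel K 0 p UNIV z))"
    using equiv_kernel_uminus[OF w, of p] unfolding u by (simp add: assms power_minus_odd)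
  also have "\<dots> = - (LINT z:UNIV|lborel. z ^ q * equiv_kernel K 0 p UNIV z)"
    unfolding set_lebesgue_integral_def by simp
  finally show ?thesis by simp
qed

lemma polyval_kernel_square_integrable:
  assumes [measurable]: "A \<in> sets borel"
  shows "integrable lborel (\<lambda>z. indicator A z * (polyval p c z)\<^sup>2 * (K z)\<^sup>2)"
proof (rule windowed_integrable[OF K_square])
  fix z :: real assume z: "z \<in> {-1..1}"
  have "(polyval p c z)\<^sup>2 \<le> (\<Sum>j\<le>p. \<bar>c j\<bar>)\<^sup>2"
    using polyval_bound[OF z, of p c] power_mono[OF _ abs_ge_zero, of "polyval p c z" _ 2] by simp
  then show "\<bar>indicator A z * (polyval p c z)\<^sup>2\<bar> \<le> (\<Sum>j\<le>p. \<bar>c j\<bar>)\<^sup>2"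
    by (auto simp: indicator_def)
qed (auto simp: K_outside)

text \<open>The equivalent kernel has integral 1 over \<open>A\<close>, and \<open>x \<le> x\<^sup>2 + 1/4\<close>.\<close>

lemma equiv_kernel_square_ge:
  assumes A: "window A" "A \<subseteq> {-1..1}"
  shows "1 / 2 \<le> (LINT z:A|lborel. equiv_kernel K 0 p A z * equiv_kernel K 0 p A z)"
proof -
  have [measurable]: "A \<in> sets borel" using A by (simp add: window_def)
  obtain c where c: "\<And>i. i \<le> p \<Longrightarrow> (\<Sum>k\<le>p. kernel_moment K (i + k) A * c k) = (if i = 0 then 1 else 0)"
    and e: "\<And>z. equiv_kernel K 0 p A z = polyval p c z * K z"
    using equiv_kernel_obtain[OF A(1)] by blast
  have sq: "integrable lborel (\<lambda>z. indicator A z * (polyval p c z)\<^sup>2 * (K z)\<^sup>2)"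
    by (rule polyval_kernel_square_integrable) simp
  have mi: "integrable lborel (\<lambda>z. (indicator A z * polyval p c z) * K z)"
    by (rule windowed_integrable[OF K_integrable K_outside, of _ "\<Sum>j\<le>p. \<bar>c j\<bar>"])
      (auto simp: indicator_def sum_nonneg intro!: polyval_bound)
  have i4: "integrable lborel (\<lambda>z. indicator {-1..1::real} z * (1/4) :: real)"
    by (intro integrable_mult_left) simp
  \<comment> \<open>Row 0 of the moment system, padded with the unit vector to a bilinear form so
    that it turns into the integral of the equivalent kernel. Integrating the constant 1/4 over an
    interval of length 2 then costs one half of this 1.\<close>
  have "1 = (\<Sum>j\<le>p. \<Sum>k\<le>p. kernel_moment K (j + k) A * (if j = 0 then 1 else 0) * c k)"
  proof -
    have "(\<Sum>k\<le>p. kernel_moment K (j + k) A * (if j = 0 then 1 else 0) * c k)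
      = (if j = 0 then (\<Sum>k\<le>p. kernel_moment K (0 + k) A * c k) else 0)" for j :: nat
      by simp
    then show ?thesis using c[of 0] by simp
  qed
  also have "\<dots> = (LINT z|lborel. (indicator A z * (polyval p (\<lambda>j. if j = 0 then 1 else 0) z * polyval p c z)) * K z)"
    by (rule bilinear_moment) simp
  also have "\<dots> = (LINT z|lborel. (indicator A z * polyval p c z) * K z)"
    by (simp add: polyval_def if_distrib[of "\<lambda>x. x * _"] cong: if_cong)
  also have "\<dots> \<le> (LINT z|lborel. indicator A z * (polyval p c z)\<^sup>2 * (K z)\<^sup>2 + indicator {-1..1} z * (1/4))"
  proof (rule integral_mono[OF mi])
    show "integrable lborel (\<lambda>z. indicator A z * (polyval p c z)\<^sup>2 * (K z)\<^sup>2 + indicator {-1..1} z * (1/4))"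
      by (intro Bochner_Integration.integrable_add sq i4)
    fix z
    have "0 \<le> (polyval p c z * K z - 1/2)\<^sup>2" by simp
    then have "polyval p c z * K z \<le> (polyval p c z)\<^sup>2 * (K z)\<^sup>2 + 1/4"
      by (simp add: power2_eq_square algebra_simps)
    then show "(indicator A z * polyval p c z) * K z \<le> indicator A z * (polyval p c z)\<^sup>2 * (K z)\<^sup>2 + indicator {-1..1} z * (1/4)"
      using A(2) by (auto simp: indicator_def)
  qed
  also have "\<dots> = (LINT z|lborel. indicator A z * (polyval p c z)\<^sup>2 * (K z)\<^sup>2) + 1 / 2"
    by (subst Bochner_Integration.integral_add[OF sq i4]) simp
  finally show ?thesis
    unfolding e set_lebesgue_integral_def by (simp add: power2_eq_square mult_ac)
qed

end

subsection \<open>Iterated differentiability\<close>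

text \<open>The derivative is peeled off next to the function and not at the top, which lets the
  closure properties be proved by induction with the function generalized.\<close>

lemma times_cont_diff_on_Suc:
  "times_cont_diff_on (Suc k) f S \<longleftrightarrow> (\<forall>x\<in>S. f differentiable (at x)) \<and> times_cont_diff_on k (deriv f) S"
proof -
  have "(\<forall>j<Suc k. P j) \<longleftrightarrow> P 0 \<and> (\<forall>j<k. P (Suc j))" for P
    using less_Suc_eq_0_disj by auto
  then show ?thesis
    unfolding times_cont_diff_on_def by (simp add: funpow_swap1)
qed

lemma times_cont_diff_on_0: "times_cont_diff_on 0 f S \<longleftrightarrow> continuous_on S f"
  by (simp add: times_cont_diff_on_def)

lemma differentiable_deriv: "(f has_real_derivative deriv f x) (at x)" if "f differentiable (at x)" for f :: "real \<Rightarrow> real"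
  using that by (meson DERIV_deriv_iff_real_differentiable)

lemma times_cont_diff_on_continuous: "times_cont_diff_on k f S \<Longrightarrow> continuous_on S f"
proof (cases k)
  case (Suc j)
  assume "times_cont_diff_on k f S"
  then have "f differentiable (at x)" if "x \<in> S" for x using that unfolding Suc times_cont_diff_on_Suc by blast
  then show ?thesis
    by (meson continuous_at_imp_continuous_on differentiable_imp_continuous_within)
qed (simp add: times_cont_diff_on_0)

lemma times_cont_diff_on_SucD: "times_cont_diff_on (Suc k) f S \<Longrightarrow> times_cont_diff_on k f S"
proof (induction k arbitrary: f)
  case 0
  then show ?case using times_cont_diff_on_continuous by (auto simp: times_cont_diff_on_0)
next
  case (Suc k)
  then show ?case by (subst (asm) times_cont_diff_on_Suc, subst times_cont_diff_on_Suc) blast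
qed

lemma times_cont_diff_on_mono: "times_cont_diff_on k f S \<Longrightarrow> j \<le> k \<Longrightarrow> T \<subseteq> S \<Longrightarrow> times_cont_diff_on j f T"
proof -
  assume f: "times_cont_diff_on k f S" and "j \<le> k" and T: "T \<subseteq> S"
  from \<open>j \<le> k\<close> have "times_cont_diff_on j f S"
    by (induction j rule: inc_induct) (auto simp: f times_cont_diff_on_SucD)
  then show ?thesis using T unfolding times_cont_diff_on_def by (meson continuous_on_subset subset_iff)
qed

text \<open>On an open set, agreement on the set is agreement near each of its points, so it passes
  to all derivatives.\<close>

lemma times_cont_diff_on_cong:
  assumes "open S" "times_cont_diff_on k f S" "\<And>x. x \<in> S \<Longrightarrow> f x = g x"
  shows "times_cont_diff_on k g S"
  using assms(2,3)
proof (induction k arbitrary: f g)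
  case 0
  then show ?case unfolding times_cont_diff_on_0 by (simp cong: continuous_on_cong)
next
  case (Suc k)
  have ev: "\<forall>\<^sub>F y in nhds x. f y = g y" if "x \<in> S" for x
    using that assms(1) Suc.prems(2) eventually_nhds by blast
  have d: "g differentiable (at x)" if x: "x \<in> S" for x
  proof -
    have "(f has_real_derivative deriv f x) (at x)"
      using Suc.prems(1) x by (auto simp: times_cont_diff_on_Suc intro: differentiable_deriv)
    then have "(g has_real_derivative deriv f x) (at x)"
      using DERIV_cong_ev[OF refl ev[OF x] refl] by blast
    then show ?thesis by (auto simp: real_differentiable_def)
  qed
  have "times_cont_diff_on k (deriv g) S"
  proof (rule Suc.IH)
    show "times_cont_diff_on k (deriv f) S" using Suc.prems(1) by (simp add: times_cont_diff_on_Suc)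
    show "deriv f x = deriv g x" if "x \<in> S" for x by (rule deriv_cong_ev[OF ev[OF that] refl])
  qed
  then show ?case using d by (simp add: times_cont_diff_on_Suc)
qed

lemma times_cont_diff_on_SucI:
  assumes "open S" "\<And>x. x \<in> S \<Longrightarrow> (f has_real_derivative f' x) (at x)" "times_cont_diff_on k f' S"
  shows "times_cont_diff_on (Suc k) f S"
  unfolding times_cont_diff_on_Suc
proof
  show "\<forall>x\<in>S. f differentiable (at x)" using assms(2) by (auto simp: real_differentiable_def)
  show "times_cont_diff_on k (deriv f) S"
    by (rule times_cont_diff_on_cong[OF assms(1,3)]) (metis DERIV_imp_deriv assms(2))
qed

lemma times_cont_diff_on_SucE:
  assumes "times_cont_diff_on (Suc k) f S"
  shows "\<And>x. x \<in> S \<Longrightarrow> (f has_real_derivative deriv f x) (at x)" "times_cont_diff_on k (deriv f) S"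
    "times_cont_diff_on k f S"
  using assms times_cont_diff_on_SucD[OF assms] by (auto simp: times_cont_diff_on_Suc intro: differentiable_deriv)

lemma times_cont_diff_on_add:
  assumes "open S" "times_cont_diff_on k f S" "times_cont_diff_on k g S"
  shows "times_cont_diff_on k (\<lambda>x. f x + g x) S"
  using assms(2,3)
proof (induction k arbitrary: f g)
  case 0
  then show ?case by (simp add: times_cont_diff_on_0 continuous_on_add)
next
  case (Suc k)
  show ?case
    by (rule times_cont_diff_on_SucI[OF assms(1) DERIV_add Suc.IH])
      (use Suc.prems in \<open>auto intro: times_cont_diff_on_SucE\<close>)
qed

lemma times_cont_diff_on_const: "times_cont_diff_on k (\<lambda>x. c) S"
proof (induction k arbitrary: c)
  case 0 then show ?case by (simp add: times_cont_diff_on_0)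
next
  case (Suc k)
  have "deriv (\<lambda>x. c) = (\<lambda>x. 0)" by (auto intro: ext DERIV_imp_deriv)
  then show ?case using Suc by (simp add: times_cont_diff_on_Suc)
qed

lemma times_cont_diff_on_mult:
  assumes "open S" "times_cont_diff_on k f S" "times_cont_diff_on k g S"
  shows "times_cont_diff_on k (\<lambda>x. f x * g x) S"
  using assms(2,3)
proof (induction k arbitrary: f g)
  case 0
  then show ?case by (simp add: times_cont_diff_on_0 continuous_on_mult)
next
  case (Suc k)
  show ?case
    by (rule times_cont_diff_on_SucI[OF assms(1) DERIV_mult times_cont_diff_on_add[OF assms(1) Suc.IH Suc.IH]])
      (use Suc.prems in \<open>auto intro: times_cont_diff_on_SucE\<close>)
qed

text \<open>The exponent is generalized in the induction because each differentiation lowers it by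
  one; a positive base keeps every exponent admissible.\<close>

lemma times_cont_diff_on_powr:
  assumes "open S" "times_cont_diff_on k e S" "\<And>x. x \<in> S \<Longrightarrow> 0 < e x"
  shows "times_cont_diff_on k (\<lambda>x. e x powr a) S"
  using assms(2)
proof (induction k arbitrary: a)
  case 0
  then show ?case using assms(3) by (fastforce simp: times_cont_diff_on_0 intro!: continuous_on_powr)
next
  case (Suc k)
  show ?case
  proof (rule times_cont_diff_on_SucI[OF assms(1)])
    show "((\<lambda>x. e x powr a) has_real_derivative (a * e x powr (a - 1)) * deriv e x) (at x)" if "x \<in> S" for x
      using times_cont_diff_on_SucE(1)[OF Suc.prems that] assms(3)[OF that]
      by (auto intro!: derivative_eq_intros simp: powr_diff)
    show "times_cont_diff_on k (\<lambda>x. (a * e x powr (a - 1)) * deriv e x) S"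
      by (intro times_cont_diff_on_mult assms times_cont_diff_on_const Suc.IH times_cont_diff_on_SucE[OF Suc.prems])
  qed
qed

text \<open>Lagrange's remainder on either side of \<open>x0\<close>. The intermediate point is
  controlled by a weak inequality on distances, so that x = x0 is included.\<close>

lemma times_cont_diff_on_taylor:
  assumes f: "times_cont_diff_on (Suc k) f (ball c r)" and x: "x0 \<in> ball c r" "x \<in> ball c r"
  shows "\<exists>t\<in>ball c r. \<bar>t - x0\<bar> \<le> \<bar>x - x0\<bar> \<and>
    f x = (\<Sum>j\<le>k. (deriv ^^ j) f x0 / fact j * (x - x0) ^ j) + (deriv ^^ Suc k) f t / fact (Suc k) * (x - x0) ^ Suc k"
proof (cases "x = x0")
  case True
  have "(\<Sum>j\<le>k. (deriv ^^ j) f x0 / fact j * (x - x0) ^ j) = (\<Sum>j\<le>k. if j = 0 then f x0 else 0)"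
    using True by (intro sum.cong) auto
  then show ?thesis using True x by (intro bexI[of _ x0]) auto
next
  case False
  let ?a = "min x0 x" and ?b = "max x0 x"
  have sub: "{?a..?b} \<subseteq> ball c r" using x by (auto simp: dist_real_def)
  have "\<exists>t. (if x < x0 then x < t \<and> t < x0 else x0 < t \<and> t < x) \<and>
     f x = (\<Sum>m<Suc k. (deriv ^^ m) f x0 / fact m * (x - x0) ^ m) + (deriv ^^ Suc k) f t / fact (Suc k) * (x - x0) ^ Suc k"
  proof (rule Taylor[where a = ?a and b = ?b])
    show "\<forall>m t. m < Suc k \<and> ?a \<le> t \<and> t \<le> ?b \<longrightarrow> DERIV ((deriv ^^ m) f) t :> (deriv ^^ Suc m) f t"
    proof (intro allI impI, elim conjE)
      fix m t assume "m < Suc k" "?a \<le> t" "t \<le> ?b"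
      then have "(deriv ^^ m) f differentiable (at t)"
        using f sub unfolding times_cont_diff_on_def by auto
      then show "DERIV ((deriv ^^ m) f) t :> (deriv ^^ Suc m) f t"
        by (simp add: differentiable_deriv)
    qed
  qed (use False in auto)
  then obtain t where t: "if x < x0 then x < t \<and> t < x0 else x0 < t \<and> t < x"
    and eq: "f x = (\<Sum>m<Suc k. (deriv ^^ m) f x0 / fact m * (x - x0) ^ m) + (deriv ^^ Suc k) f t / fact (Suc k) * (x - x0) ^ Suc k"
    by blast
  have "t \<in> ball c r" using t sub by (intro subsetD[OF sub]) (auto split: if_splits)
  moreover have "\<bar>t - x0\<bar> \<le> \<bar>x - x0\<bar>" using t by (auto split: if_splits)
  ultimately show ?thesis using eq unfolding lessThan_Suc_atMost by blast
qed

subsection \<open>The guide\<close>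

lemma guide_power_measurable [measurable]: "guide_power \<gamma> \<in> borel_measurable borel"
  unfolding guide_power_def by measurable

lemma guide_power_zero: "guide_power 0 t = 1"
  by (simp add: guide_power_def)

text \<open>Near \<open>xd\<close> the guide keeps its sign \<open>s\<close>, so its power is a
  constant sign times a real power of the positive function \<open>s * e x\<close>, which is as
  smooth as \<open>e\<close>. For \<gamma> = 0 the power is constantly 1 and the guide may
  vanish.\<close>

lemma phi_smooth_near:
  assumes eta0: "times_cont_diff_on k eta0 UNIV" and e: "times_cont_diff_on k e UNIV"
    and nz: "\<gamma> \<noteq> 0 \<longrightarrow> e xd \<noteq> 0"
  shows "\<exists>r>0. times_cont_diff_on k (phi \<gamma> eta0 e) (ball xd r) \<and>
     times_cont_diff_on k (\<lambda>x. guide_power \<gamma> (e x)) (ball xd r) \<and> (\<forall>x\<in>ball xd r. guide_power \<gamma> (e x) \<noteq> 0)"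
proof (cases "\<gamma> = 0")
  case True
  have "times_cont_diff_on k (\<lambda>x. eta0 x + (- 1) * e x) (ball xd 1)"
    by (intro times_cont_diff_on_add times_cont_diff_on_mult times_cont_diff_on_const
        times_cont_diff_on_mono[OF eta0] times_cont_diff_on_mono[OF e]) auto
  moreover have "phi \<gamma> eta0 e = (\<lambda>x. eta0 x + (- 1) * e x)"
    by (auto simp: phi_def True guide_power_zero)
  ultimately show ?thesis
    by (intro exI[of _ 1]) (auto simp: True guide_power_zero times_cont_diff_on_const)
next
  case False
  then have nz: "e xd \<noteq> 0" using nz by simp
  define s where "s = sgn (e xd)"
  have s: "s * s = 1" "\<bar>s\<bar> = 1" "0 < s * e xd" using nz by (auto simp: s_def sgn_if)
  have ce: "continuous_on UNIV e" by (rule times_cont_diff_on_continuous[OF e])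
  have "open {x. 0 < s * e x}"
    by (intro open_Collect_less continuous_intros ce)
  then obtain r where r: "0 < r" "ball xd r \<subseteq> {x. 0 < s * e x}"
    using s(3) open_contains_ball[of "{x. 0 < s * e x}"] by auto
  \<comment> \<open>The sign left over when the positive power is factored out: integer powers
    remember the sign of the guide, other powers use the absolute value. Being its own inverse, it
    also serves in the quotient \<open>phi\<close>.\<close>
  define \<sigma> where "\<sigma> = (if \<gamma> \<in> \<nat> then s ^ nat \<lfloor>\<gamma>\<rfloor> else 1)"
  have \<sigma>: "\<sigma> * \<sigma> = 1" unfolding \<sigma>_def using s(1) by (simp flip: power_mult_distrib)
  have gp: "guide_power \<gamma> (e x) = \<sigma> * (s * e x) powr \<gamma>" if "x \<in> ball xd r" for x
  proof -
    have pos: "0 < s * e x" using r(2) that by auto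
    have ex: "e x = s * (s * e x)" using s(1) by (simp flip: mult.assoc)
    show ?thesis
    proof (cases "\<gamma> \<in> \<nat>")
      case True
      then obtain m where m: "\<gamma> = of_nat m" by (auto elim: Nats_cases)
      have "e x ^ m = s ^ m * (s * e x) ^ m" by (subst ex) (rule power_mult_distrib)
      then show ?thesis using True pos by (simp add: guide_power_def \<sigma>_def m powr_realpow)
    next
      case False
      have "\<bar>e x\<bar> = \<bar>s * e x\<bar>" by (simp add: abs_mult s(2))
      then show ?thesis using False pos by (simp add: guide_power_def \<sigma>_def)
    qed
  qed
  have se: "times_cont_diff_on k (\<lambda>x. s * e x) (ball xd r)"
    by (intro times_cont_diff_on_mult times_cont_diff_on_const times_cont_diff_on_mono[OF e]) auto
  have "times_cont_diff_on k (\<lambda>x. (eta0 x + (- 1) * e x) * (\<sigma> * (s * e x) powr (- \<gamma>))) (ball xd r)"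
    using r(2)
    by (intro times_cont_diff_on_add times_cont_diff_on_mult times_cont_diff_on_const times_cont_diff_on_powr se
        times_cont_diff_on_mono[OF eta0] times_cont_diff_on_mono[OF e]) auto
  moreover have "(eta0 x + (- 1) * e x) * (\<sigma> * (s * e x) powr (- \<gamma>)) = phi \<gamma> eta0 e x" if x: "x \<in> ball xd r" for x
  proof -
    have nz: "\<sigma> \<noteq> 0" using \<sigma> by auto
    have "1 / (\<sigma> * (s * e x) powr \<gamma>) = (\<sigma> * \<sigma>) / (\<sigma> * (s * e x) powr \<gamma>)" by (simp only: \<sigma>)
    also have "\<dots> = \<sigma> * (s * e x) powr (- \<gamma>)" using nz by (simp add: powr_minus divide_inverse)
    finally have "\<sigma> * (s * e x) powr (- \<gamma>) = 1 / (\<sigma> * (s * e x) powr \<gamma>)" ..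
    then show ?thesis by (simp add: phi_def gp[OF x])
  qed
  ultimately have "times_cont_diff_on k (phi \<gamma> eta0 e) (ball xd r)"
    by (rule times_cont_diff_on_cong[OF open_ball])
  moreover have "times_cont_diff_on k (\<lambda>x. guide_power \<gamma> (e x)) (ball xd r)"
  proof (rule times_cont_diff_on_cong[OF open_ball])
    show "times_cont_diff_on k (\<lambda>x. \<sigma> * (s * e x) powr \<gamma>) (ball xd r)"
      by (intro times_cont_diff_on_mult times_cont_diff_on_const times_cont_diff_on_powr se) (use r(2) in auto)
  qed (simp add: gp)
  moreover have "guide_power \<gamma> (e x) \<noteq> 0" if x: "x \<in> ball xd r" for x
  proof -
    have "0 < s * e x" using r(2) x by auto
    then show ?thesis using \<sigma> unfolding gp[OF x] by auto
  qed
  ultimately show ?thesis using r(1) by blast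
qed

subsection \<open>The quasi-likelihood as a function of the linear predictor\<close>

lemma isCont_realD:
  fixes f :: "real \<Rightarrow> real"
  assumes "isCont f x" "0 < \<epsilon>"
  obtains d where "0 < d" "\<And>t. \<bar>t - x\<bar> < d \<Longrightarrow> \<bar>f t - f x\<bar> < \<epsilon>"
proof -
  have "\<forall>\<^sub>F t in nhds x. \<bar>f t - f x\<bar> < \<epsilon>"
    using assms tendstoD[of f "f x" "nhds x" \<epsilon>] by (simp add: continuous_at dist_real_def tendsto_nhds_iff isCont_def)
  then show ?thesis using that unfolding eventually_nhds_metric dist_real_def by blast
qed

text \<open>The set \<open>I\<close> of possible means may be a proper subset of the line, such as
  the positive numbers or (0, 1), and smoothness is asked only there; \<open>g\<close> maps it onto
  the whole line, so the linear predictor is unrestricted.\<close>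

locale quasi_link =
  fixes I YY :: "real set" and g ginv V :: "real \<Rightarrow> real" and Q :: "real \<Rightarrow> real \<Rightarrow> real"
  assumes I_open: "open I" and g_mono: "mono_on I g \<or> antimono_on I g" and g_bij: "bij_betw g I UNIV"
    and V_pos: "\<And>w. w \<in> I \<Longrightarrow> 0 < V w"
    and Q_deriv: "\<And>w y. w \<in> I \<Longrightarrow> y \<in> YY \<Longrightarrow> ((\<lambda>w. Q w y) has_real_derivative (y - w) / V w) (at w)"
    and ginv_def: "ginv = the_inv_into I g"
    and A1: "\<And>y x. y \<in> YY \<Longrightarrow> (\<forall>i<2. (\<lambda>x. quasi_deriv Q ginv i x y) differentiable (at x)) \<and>
                    quasi_deriv Q ginv 2 x y < 0"
    and V_smooth: "times_cont_diff_on 2 V I" and g_smooth: "times_cont_diff_on 3 g I"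
begin

lemma ginv_in: "ginv t \<in> I" and g_ginv [simp]: "g (ginv t) = t"
  using g_bij unfolding ginv_def bij_betw_def
  by (auto intro!: the_inv_into_into f_the_inv_into_f)

lemma ginv_g [simp]: "w \<in> I \<Longrightarrow> ginv (g w) = w"
  using g_bij unfolding ginv_def bij_betw_def by (simp add: the_inv_into_f_f)

lemma range_ginv: "range ginv = I"
proof (rule subset_antisym)
  show "I \<subseteq> range ginv" using ginv_g by (metis rangeI subsetI)
qed (use ginv_in in blast)

text \<open>A monotone function with open range has no jumps. A decreasing link is reduced to an
  increasing one by negation.\<close>

lemma ginv_continuous: "continuous_on UNIV ginv"
  using g_mono
proof
  assume m: "mono_on I g"
  show ?thesis
  proof (rule continuous_onI_mono)
    show "open (range ginv)" unfolding range_ginv by (rule I_open)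
    fix x y :: real assume "x \<le> y"
    show "ginv x \<le> ginv y"
    proof (rule ccontr)
      assume n: "\<not> ?thesis"
      then have "g (ginv y) \<le> g (ginv x)" using m ginv_in by (intro mono_onD[OF m]) auto
      then show False using \<open>x \<le> y\<close> n by simp
    qed
  qed
next
  assume m: "antimono_on I g"
  have "continuous_on UNIV (\<lambda>x. - ginv x)"
  proof (rule continuous_onI_mono)
    have "range (\<lambda>x. - ginv x) = uminus ` I" unfolding range_ginv[symmetric] by auto
    then show "open (range (\<lambda>x. - ginv x))" using open_negations[OF I_open] by simp
    fix x y :: real assume "x \<le> y"
    show "- ginv x \<le> - ginv y"
    proof (rule ccontr)
      assume n: "\<not> ?thesis"
      then have "g (ginv y) \<le> g (ginv x)" using monotone_onD[OF m, of "ginv x" "ginv y"] ginv_in by auto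
      then show False using \<open>x \<le> y\<close> n by simp
    qed
  qed
  from continuous_on_minus[OF this] show ?thesis by simp
qed

lemma g_deriv: "w \<in> I \<Longrightarrow> (g has_real_derivative deriv g w) (at w)"
  and g_deriv2: "w \<in> I \<Longrightarrow> (deriv g has_real_derivative deriv (deriv g) w) (at w)"
  and deriv_g_continuous: "continuous_on I (deriv g)"
  and deriv2_g_continuous: "continuous_on I (deriv (deriv g))"
  and V_deriv: "w \<in> I \<Longrightarrow> (V has_real_derivative deriv V w) (at w)"
  and V_continuous: "continuous_on I V"
  and deriv_V_continuous: "continuous_on I (deriv V)"
proof -
  have g3: "times_cont_diff_on (Suc 2) g I" using g_smooth by (simp add: numeral_eq_Suc)
  have g2: "times_cont_diff_on (Suc 1) (deriv g) I" using times_cont_diff_on_SucE(2)[OF g3] by (simp add: numeral_eq_Suc)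
  have g1: "times_cont_diff_on 1 (deriv (deriv g)) I" by (rule times_cont_diff_on_SucE(2)[OF g2])
  have V2: "times_cont_diff_on (Suc 1) V I" using V_smooth by (simp add: numeral_eq_Suc)
  show "w \<in> I \<Longrightarrow> (g has_real_derivative deriv g w) (at w)" by (rule times_cont_diff_on_SucE(1)[OF g3])
  show "w \<in> I \<Longrightarrow> (deriv g has_real_derivative deriv (deriv g) w) (at w)" by (rule times_cont_diff_on_SucE(1)[OF g2])
  show "continuous_on I (deriv g)" by (rule times_cont_diff_on_continuous[OF g2])
  show "continuous_on I (deriv (deriv g))" by (rule times_cont_diff_on_continuous[OF g1])
  show "w \<in> I \<Longrightarrow> (V has_real_derivative deriv V w) (at w)" by (rule times_cont_diff_on_SucE(1)[OF V2])
  show "continuous_on I V" by (rule times_cont_diff_on_continuous[OF V2])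
  show "continuous_on I (deriv V)" by (rule times_cont_diff_on_continuous[OF times_cont_diff_on_SucE(2)[OF V2]])
qed

lemma continuous_ginv_comp: "continuous_on I F \<Longrightarrow> continuous_on UNIV (\<lambda>t. F (ginv t))"
  using continuous_on_compose2[OF _ ginv_continuous, of I F] ginv_in by blast

text \<open>The factor of y - ginv t in the derivative of \<open>Q (ginv t) y\<close> with respect
  to t.\<close>

definition score_weight :: "real \<Rightarrow> real" where
  "score_weight t = 1 / (V (ginv t) * deriv g (ginv t))"

lemma ginv_measurable [measurable]: "ginv \<in> borel_measurable borel"
  by (rule borel_measurable_continuous_onI[OF ginv_continuous])

lemma score_weight_measurable [measurable]: "score_weight \<in> borel_measurable borel"
proof -
  have [measurable]: "(\<lambda>t. V (ginv t)) \<in> borel_measurable borel" "(\<lambda>t. deriv g (ginv t)) \<in> borel_measurable borel"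
    by (intro borel_measurable_continuous_onI continuous_ginv_comp V_continuous deriv_g_continuous)+
  show ?thesis unfolding score_weight_def by measurable
qed

text \<open>Condition A1 makes the second derivative negative on the whole line, so concavity is
  global; this is what allows an expansion valid only near the truth to control all
  maximizers.\<close>

lemma quasi_concave:
  assumes y: "y \<in> YY" and s: "0 \<le> s" "s \<le> 1"
  shows "(1 - s) * Q (ginv a) y + s * Q (ginv b) y \<le> Q (ginv ((1 - s) * a + s * b)) y"
proof -
  define q where "q t = Q (ginv t) y" for t
  have d0: "(q has_real_derivative deriv q t) (at t)" for t
    using A1[OF y, of t] by (intro differentiable_deriv) (auto simp: quasi_deriv_def q_def[abs_def] dest: spec[of _ 0])
  have d1: "(deriv q has_real_derivative deriv (deriv q) t) (at t)" for t
    using A1[OF y, of t] by (intro differentiable_deriv) (auto simp: quasi_deriv_def q_def[abs_def] dest: spec[of _ 1])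
  have d2: "deriv (deriv q) t < 0" for t
    using A1[OF y, of t] by (simp add: quasi_deriv_def q_def[abs_def] numeral_eq_Suc)
  have "convex_on UNIV (\<lambda>t. - q t)"
  proof (rule f''_ge0_imp_convex)
    show "((\<lambda>t. - q t) has_real_derivative - deriv q t) (at t)" for t by (rule DERIV_minus[OF d0])
    show "((\<lambda>t. - deriv q t) has_real_derivative - deriv (deriv q) t) (at t)" for t by (rule DERIV_minus[OF d1])
    show "0 \<le> - deriv (deriv q) t" for t using d2[of t] by simp
  qed simp
  from convex_onD[OF this s, of a b] show ?thesis by (simp add: q_def)
qed

lemma quasi_continuous:
  assumes y: "y \<in> YY" shows "continuous_on UNIV (\<lambda>t. Q (ginv t) y)"
proof -
  have "(\<lambda>t. Q (ginv t) y) differentiable (at t)" for t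
    using A1[OF y, of t] by (auto simp: quasi_deriv_def dest: spec[of _ 0])
  then show ?thesis
    by (meson continuous_at_imp_continuous_on differentiable_imp_continuous_within)
qed

end

section \<open>Expansions of the quasi-likelihood near the limiting predictor\<close>

locale quasi_link_at = quasi_link +
  fixes w0 :: real
  assumes w0: "w0 \<in> I" and g'w0: "deriv g w0 \<noteq> 0"
begin

text \<open>The derivative of the link is known to be nonzero at \<open>w0\<close>; continuity
  supplies a neighbourhood in which the inverse link can be differentiated.\<close>

lemma near: "\<exists>r>0. \<forall>t\<in>ball (g w0) r. deriv g (ginv t) \<noteq> 0"
proof -
  have "open {t. deriv g (ginv t) \<noteq> 0}"
    by (intro open_Collect_neq continuous_ginv_comp deriv_g_continuous continuous_on_const)
  moreover have "g w0 \<in> {t. deriv g (ginv t) \<noteq> 0}" using w0 g'w0 by simp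
  ultimately show ?thesis by (fastforce simp: open_contains_ball)
qed

lemma ginv_deriv:
  assumes "deriv g (ginv t) \<noteq> 0"
  shows "(ginv has_real_derivative 1 / deriv g (ginv t)) (at t)"
  using DERIV_inverse_function[where f = g and g = ginv and x = t and a = "t - 1" and b = "t + 1", OF g_deriv[OF ginv_in[of t]] assms]
    ginv_continuous by (simp add: inverse_eq_divide continuous_on_eq_continuous_at)

text \<open>The derivative of \<open>score_weight\<close> by the quotient rule, with 1 / g' for the
  derivative of the inverse link. It is written out so that its continuity is visible.\<close>

definition score_weight' :: "real \<Rightarrow> real" where
  "score_weight' t = - ((deriv V (ginv t) * (1 / deriv g (ginv t))) * deriv g (ginv t)
       + V (ginv t) * (deriv (deriv g) (ginv t) * (1 / deriv g (ginv t)))) / (V (ginv t) * deriv g (ginv t))\<^sup>2"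

lemma score_weight_deriv:
  assumes nz: "deriv g (ginv t) \<noteq> 0"
  shows "(score_weight has_real_derivative score_weight' t) (at t)"
proof -
  note gi = ginv_deriv[OF nz]
  have 1: "((\<lambda>t. V (ginv t)) has_real_derivative deriv V (ginv t) * (1 / deriv g (ginv t))) (at t)"
    by (rule DERIV_chain2[OF V_deriv[OF ginv_in] gi])
  have 2: "((\<lambda>t. deriv g (ginv t)) has_real_derivative deriv (deriv g) (ginv t) * (1 / deriv g (ginv t))) (at t)"
    by (rule DERIV_chain2[OF g_deriv2[OF ginv_in] gi])
  have "V (ginv t) * deriv g (ginv t) \<noteq> 0" using nz V_pos[OF ginv_in[of t]] by simp
  from DERIV_divide[OF DERIV_const DERIV_mult[OF 1 2] this, of 1]
  show ?thesis unfolding score_weight_def[abs_def] score_weight'_def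
    by (simp add: power2_eq_square mult_ac)
qed

lemma score_weight'_isCont:
  assumes nz: "deriv g (ginv t) \<noteq> 0" shows "isCont score_weight' t"
proof -
  have c: "isCont (\<lambda>t. F (ginv t)) t" if "continuous_on I F" for F
    using continuous_ginv_comp[OF that] by (simp add: continuous_on_eq_continuous_at)
  have "V (ginv t) \<noteq> 0" using V_pos[OF ginv_in[of t]] by simp
  then show ?thesis unfolding score_weight'_def[abs_def] using nz
    by (intro continuous_intros c V_continuous deriv_V_continuous deriv_g_continuous deriv2_g_continuous) auto
qed

lemma quasi_deriv1:
  assumes y: "y \<in> YY" and nz: "deriv g (ginv t) \<noteq> 0"
  shows "((\<lambda>t. Q (ginv t) y) has_real_derivative (y - ginv t) * score_weight t) (at t)"
  using DERIV_chain2[OF Q_deriv[OF ginv_in y] ginv_deriv[OF nz]] by (simp add: score_weight_def)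

lemma quasi_deriv2:
  assumes nz: "deriv g (ginv t) \<noteq> 0"
  shows "((\<lambda>t. (y - ginv t) * score_weight t) has_real_derivative
     (y - ginv t) * score_weight' t - (1 / deriv g (ginv t)) * score_weight t) (at t)"
  by (rule DERIV_cong[OF DERIV_mult[OF DERIV_diff[OF DERIV_const ginv_deriv[OF nz]] score_weight_deriv[OF nz]]])
     (simp add: mult_ac)

text \<open>Minus the expected second derivative of the quasi-likelihood in the linear predictor,
  for a response with mean \<open>w0\<close>; it is the value of \<open>rho\<close> at a point where
  the mean is \<open>w0\<close>.\<close>

definition info0 :: real where "info0 = 1 / (V w0 * (deriv g w0)\<^sup>2)"

lemma info0_pos: "0 < info0"
  using V_pos[OF w0] g'w0 by (simp add: info0_def)

text \<open>The second derivative is affine in y with coefficients continuous in t, so freezing it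
  at \<open>g w0\<close> costs at most \<epsilon> (1 + |y|), uniformly in y. The first-order term
  stays at the moving base point \<open>t\<close>, where the approximating predictor will
  be.\<close>

lemma quasi_second_order_expansion:
  assumes \<epsilon>: "0 < \<epsilon>"
  shows "\<exists>\<delta>>0. \<forall>y\<in>YY. \<forall>t d. \<bar>t - g w0\<bar> < \<delta> \<and> \<bar>t + d - g w0\<bar> < \<delta> \<longrightarrow>
    \<bar>Q (ginv (t + d)) y - Q (ginv t) y - (y - ginv t) * score_weight t * d
      - ((y - w0) * score_weight' (g w0) - info0) * d\<^sup>2 / 2\<bar> \<le> \<epsilon> * (1 + \<bar>y\<bar>) * d\<^sup>2"
proof -
  \<comment> \<open>With these names the second derivative in t is y * \<alpha> t - \<beta>
    t.\<close>
  define \<alpha> where "\<alpha> = score_weight'"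
  define \<beta> where "\<beta> t = ginv t * score_weight' t + (1 / deriv g (ginv t)) * score_weight t" for t
  obtain r where r: "0 < r" "\<And>t. t \<in> ball (g w0) r \<Longrightarrow> deriv g (ginv t) \<noteq> 0"
    using near by blast
  have nz0: "deriv g (ginv (g w0)) \<noteq> 0" using w0 g'w0 by simp
  have ca: "isCont \<alpha> (g w0)" unfolding \<alpha>_def by (rule score_weight'_isCont[OF nz0])
  have cg: "isCont ginv (g w0)" "isCont (\<lambda>t. deriv g (ginv t)) (g w0)"
    using ginv_continuous continuous_ginv_comp[OF deriv_g_continuous] by (auto simp: continuous_on_eq_continuous_at)
  have cb: "isCont \<beta> (g w0)" unfolding \<beta>_def[abs_def]
    using cg nz0 by (intro continuous_intros score_weight'_isCont DERIV_isCont[OF score_weight_deriv]) auto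
  obtain d1 where d1: "0 < d1" "\<And>t. \<bar>t - g w0\<bar> < d1 \<Longrightarrow> \<bar>\<alpha> t - \<alpha> (g w0)\<bar> < \<epsilon>"
    by (rule isCont_realD[OF ca \<epsilon>]) blast
  obtain d2 where d2: "0 < d2" "\<And>t. \<bar>t - g w0\<bar> < d2 \<Longrightarrow> \<bar>\<beta> t - \<beta> (g w0)\<bar> < \<epsilon>"
    by (rule isCont_realD[OF cb \<epsilon>]) blast
  define \<delta> where "\<delta> = min r (min d1 d2)"
  have \<delta>: "0 < \<delta>" using r d1 d2 by (simp add: \<delta>_def)
  have \<delta>r: "\<delta> \<le> r" "\<delta> \<le> d1" "\<delta> \<le> d2" by (simp_all add: \<delta>_def)
  have "\<bar>Q (ginv (t + d)) y - Q (ginv t) y - (y - ginv t) * score_weight t * d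
      - ((y - w0) * score_weight' (g w0) - info0) * d\<^sup>2 / 2\<bar> \<le> \<epsilon> * (1 + \<bar>y\<bar>) * d\<^sup>2"
    if y: "y \<in> YY" and t: "\<bar>t - g w0\<bar> < \<delta>" "\<bar>t + d - g w0\<bar> < \<delta>" for y t d
  proof (cases "d = 0")
    case True then show ?thesis by simp
  next
    case False
    define diff where "diff m = (if m = 0 then (\<lambda>t. Q (ginv t) y) else if m = 1 then (\<lambda>t. (y - ginv t) * score_weight t)
      else (\<lambda>t. (y - ginv t) * score_weight' t - (1 / deriv g (ginv t)) * score_weight t))" for m :: nat
    have nz: "deriv g (ginv s) \<noteq> 0" if "min t (t + d) \<le> s" "s \<le> max t (t + d)" for s
    proof -
      have "\<bar>s - g w0\<bar> < r" using that t \<delta>r by linarith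
      then show ?thesis by (intro r(2)) (simp add: dist_real_def abs_minus_commute)
    qed
    have "\<exists>s. (if t + d < t then t + d < s \<and> s < t else t < s \<and> s < t + d) \<and>
      Q (ginv (t + d)) y = (\<Sum>m<2. diff m t / fact m * (t + d - t) ^ m) + diff 2 s / fact 2 * (t + d - t)\<^sup>2"
    proof (rule Taylor[where a = "min t (t + d)" and b = "max t (t + d)"])
      show "\<forall>m s. m < 2 \<and> min t (t + d) \<le> s \<and> s \<le> max t (t + d) \<longrightarrow> DERIV (diff m) s :> diff (Suc m) s"
      proof (intro allI impI, elim conjE)
        fix m :: nat and s assume m: "m < 2" and s: "min t (t + d) \<le> s" "s \<le> max t (t + d)"
        show "DERIV (diff m) s :> diff (Suc m) s"
          using m quasi_deriv1[OF y nz[OF s]] quasi_deriv2[OF nz[OF s], of y] by (cases m) (auto simp: diff_def)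
      qed
    qed (use False in \<open>auto simp: diff_def\<close>)
    then obtain s where s: "if t + d < t then t + d < s \<and> s < t else t < s \<and> s < t + d"
      and eq: "Q (ginv (t + d)) y = (\<Sum>m<2. diff m t / fact m * (t + d - t) ^ m) + diff 2 s / fact 2 * (t + d - t)\<^sup>2"
      by blast
    have "min t (t + d) \<le> s" "s \<le> max t (t + d)" using s by (simp_all split: if_splits)
    then have sd: "\<bar>s - g w0\<bar> < d1" "\<bar>s - g w0\<bar> < d2" using t \<delta>r by linarith+
    have exp: "Q (ginv (t + d)) y - Q (ginv t) y - (y - ginv t) * score_weight t * d = diff 2 s * d\<^sup>2 / 2"
      unfolding eq by (simp add: diff_def numeral_eq_Suc)
    have i0: "info0 = (1 / deriv g w0) * score_weight (g w0)"
      using w0 by (simp add: info0_def score_weight_def power2_eq_square)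
    have "diff 2 s - ((y - w0) * score_weight' (g w0) - info0) = y * (\<alpha> s - \<alpha> (g w0)) - (\<beta> s - \<beta> (g w0))"
      unfolding diff_def \<alpha>_def \<beta>_def i0 using w0 by (simp add: algebra_simps)
    also have "\<bar>\<dots>\<bar> \<le> \<bar>y\<bar> * \<bar>\<alpha> s - \<alpha> (g w0)\<bar> + \<bar>\<beta> s - \<beta> (g w0)\<bar>"
      by (metis abs_mult abs_triangle_ineq4)
    also have "\<dots> \<le> \<bar>y\<bar> * \<epsilon> + \<epsilon>"
      using d1(2)[OF sd(1)] d2(2)[OF sd(2)] by (intro add_mono mult_left_mono) auto
    finally have "\<bar>diff 2 s - ((y - w0) * score_weight' (g w0) - info0)\<bar> \<le> \<epsilon> * (1 + \<bar>y\<bar>)"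
      by (simp add: algebra_simps)
    then have "\<bar>diff 2 s - ((y - w0) * score_weight' (g w0) - info0)\<bar> * (d\<^sup>2 / 2) \<le> \<epsilon> * (1 + \<bar>y\<bar>) * (d\<^sup>2 / 2)"
      by (rule mult_right_mono) simp
    also have "\<dots> \<le> \<epsilon> * (1 + \<bar>y\<bar>) * d\<^sup>2"
      using \<epsilon> by (intro mult_left_mono) auto
    finally have "\<bar>(diff 2 s - ((y - w0) * score_weight' (g w0) - info0)) * (d\<^sup>2 / 2)\<bar> \<le> \<epsilon> * (1 + \<bar>y\<bar>) * d\<^sup>2"
      by (simp add: abs_mult)
    then show ?thesis unfolding exp by (simp add: algebra_simps diff_divide_distrib add_divide_distrib)
  qed
  then show ?thesis using \<delta> by blast
qed

text \<open>Strict differentiability of the inverse link: both points may move, as the true and the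
  approximating predictor do.\<close>

lemma ginv_increment:
  assumes \<epsilon>: "0 < \<epsilon>"
  shows "\<exists>\<delta>>0. \<forall>s t. \<bar>s - g w0\<bar> < \<delta> \<and> \<bar>t - g w0\<bar> < \<delta> \<longrightarrow>
    \<bar>ginv s - ginv t - (s - t) / deriv g w0\<bar> \<le> \<epsilon> * \<bar>s - t\<bar>"
proof -
  obtain r where r: "0 < r" "\<And>t. t \<in> ball (g w0) r \<Longrightarrow> deriv g (ginv t) \<noteq> 0"
    using near by blast
  have "isCont (\<lambda>t. 1 / deriv g (ginv t)) (g w0)"
    using continuous_ginv_comp[OF deriv_g_continuous] w0 g'w0
    by (intro continuous_intros) (auto simp: continuous_on_eq_continuous_at)
  then obtain d1 where d1: "0 < d1" "\<And>t. \<bar>t - g w0\<bar> < d1 \<Longrightarrow> \<bar>1 / deriv g (ginv t) - 1 / deriv g (ginv (g w0))\<bar> < \<epsilon>"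
    by (rule isCont_realD[OF _ \<epsilon>]) blast
  define \<delta> where "\<delta> = min r d1"
  have \<delta>r: "\<delta> \<le> r" "\<delta> \<le> d1" by (simp_all add: \<delta>_def)
  have main: "\<bar>ginv s - ginv t - (s - t) / deriv g w0\<bar> \<le> \<epsilon> * \<bar>s - t\<bar>"
    if st: "s < t" "\<bar>s - g w0\<bar> < \<delta>" "\<bar>t - g w0\<bar> < \<delta>" for s t
  proof -
    have "\<exists>z. s < z \<and> z < t \<and> ginv t - ginv s = (t - s) * (1 / deriv g (ginv z))"
    proof (rule MVT2[OF st(1)], rule ginv_deriv, rule r(2))
      fix x assume "s \<le> x" "x \<le> t"
      then have "\<bar>x - g w0\<bar> < r" using st \<delta>r by linarith
      then show "x \<in> ball (g w0) r" by (simp add: dist_real_def abs_minus_commute)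
    qed
    then obtain z where z: "s < z" "z < t" "ginv t - ginv s = (t - s) * (1 / deriv g (ginv z))" by blast
    have "\<bar>1 / deriv g (ginv z) - 1 / deriv g w0\<bar> \<le> \<epsilon>"
    proof -
      have "\<bar>z - g w0\<bar> < d1" using z st \<delta>r by linarith
      from d1(2)[OF this] show ?thesis using w0 by simp
    qed
    then have "\<bar>s - t\<bar> * \<bar>1 / deriv g (ginv z) - 1 / deriv g w0\<bar> \<le> \<bar>s - t\<bar> * \<epsilon>" by (rule mult_left_mono) simp
    moreover have "ginv s - ginv t - (s - t) / deriv g w0 = (s - t) * (1 / deriv g (ginv z) - 1 / deriv g w0)"
    proof -
      define c where "c = 1 / deriv g (ginv z)"
      have "ginv t - ginv s = (t - s) * c" using z(3) by (simp add: c_def)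
      then show ?thesis unfolding c_def[symmetric] by (simp add: algebra_simps)
    qed
    ultimately show ?thesis by (simp add: abs_mult mult.commute)
  qed
  have "\<bar>ginv s - ginv t - (s - t) / deriv g w0\<bar> \<le> \<epsilon> * \<bar>s - t\<bar>"
    if st: "\<bar>s - g w0\<bar> < \<delta>" "\<bar>t - g w0\<bar> < \<delta>" for s t
  proof (cases s t rule: linorder_cases)
    case greater
    have "ginv s - ginv t - (s - t) / deriv g w0 = - (ginv t - ginv s - (t - s) / deriv g w0)"
      by (simp add: diff_divide_distrib)
    then show ?thesis using main[OF greater st(2) st(1)] by (simp only: abs_minus_cancel abs_minus_commute[of s])
  qed (use main st in auto)
  then show ?thesis using r(1) d1(1) by (intro exI[of _ \<delta>]) (auto simp: \<delta>_def)
qed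

lemma score_weight_isCont: "isCont score_weight (g w0)"
  using w0 g'w0 by (intro DERIV_isCont[OF score_weight_deriv]) simp

text \<open>The function \<open>rho\<close> in terms of the linear predictor instead of x. Its
  smoothness in x then follows from that of the true predictor, which is smooth on the whole
  line.\<close>

definition info :: "real \<Rightarrow> real" where "info t = score_weight t * (1 / deriv g (ginv t))"

definition info' :: "real \<Rightarrow> real" where
  "info' t = score_weight' t * (1 / deriv g (ginv t))
     + (- (deriv (deriv g) (ginv t) * (1 / deriv g (ginv t))) / (deriv g (ginv t))\<^sup>2) * score_weight t"

lemma info_deriv:
  assumes nz: "deriv g (ginv t) \<noteq> 0"
  shows "(info has_real_derivative info' t) (at t)"
proof -
  have "((\<lambda>t. deriv g (ginv t)) has_real_derivative deriv (deriv g) (ginv t) * (1 / deriv g (ginv t))) (at t)"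
    by (rule DERIV_chain2[OF g_deriv2[OF ginv_in] ginv_deriv[OF nz]])
  from DERIV_divide[OF DERIV_const this nz, of 1]
  have "((\<lambda>t. 1 / deriv g (ginv t)) has_real_derivative - (deriv (deriv g) (ginv t) * (1 / deriv g (ginv t))) / (deriv g (ginv t))\<^sup>2) (at t)"
    by (simp add: power2_eq_square)
  from DERIV_mult[OF score_weight_deriv[OF nz] this]
  show ?thesis unfolding info_def[abs_def] info'_def .
qed

lemma info'_isCont: "isCont info' (g w0)"
proof -
  have c: "isCont (\<lambda>t. F (ginv t)) (g w0)" if "continuous_on I F" for F
    using continuous_ginv_comp[OF that] by (simp add: continuous_on_eq_continuous_at)
  show ?thesis unfolding info'_def[abs_def] using w0 g'w0
    by (intro continuous_intros c deriv_g_continuous deriv2_g_continuous score_weight'_isCont score_weight_isCont) auto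
qed

lemma info_w0: "info (g w0) = info0"
  using w0 by (simp add: info_def info0_def score_weight_def power2_eq_square)

lemma rho_eq_info: "\<mu> x \<in> I \<Longrightarrow> rho g V \<mu> x = info (g (\<mu> x))"
  by (simp add: rho_def info_def score_weight_def power2_eq_square inverse_eq_divide)

end

subsection \<open>Kernel-weighted functionals of the sample\<close>

text \<open>\<open>S\<close> stands for the support and \<open>xd\<close> for the limit of the
  design points. The bounds are local, since density, variance and mean may be unbounded
  elsewhere.\<close>

locale regression_design = prob_space M + kernel K
  for M :: "'a measure" and K :: "real \<Rightarrow> real" +
  fixes X Y :: "nat \<Rightarrow> 'a \<Rightarrow> real" and f \<mu> v :: "real \<Rightarrow> real" and S :: "real set" and xd r Cb :: real
  assumes iid: "iid_pairs M X Y"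
    and f_nonneg: "\<And>x. 0 \<le> f x" and X_density: "distributed M lborel (X 0) (\<lambda>x. ennreal (f x))"
    and regression: "regression_function M (X 0) (Y 0) \<mu>"
    and cond_var: "conditional_variance M (X 0) (Y 0) \<mu> v"
    and lindeberg: "lindeberg_at M (X 0) (Y 0) \<mu> xd"
    and S_closed: "closed S" and f_outside: "\<And>x. x \<notin> S \<Longrightarrow> f x = 0"
    and r_pos: "0 < r"
    and local_bounds: "\<And>x. x \<in> S \<Longrightarrow> \<bar>x - xd\<bar> \<le> r \<Longrightarrow> f x \<le> Cb \<and> v x \<le> Cb \<and> \<bar>\<mu> x\<bar> \<le> Cb"
    and Cb_nonneg: "0 \<le> Cb"
begin

lemma pair_measurable [measurable]: "(\<lambda>\<omega>. (X i \<omega>, Y i \<omega>)) \<in> M \<rightarrow>\<^sub>M (borel :: (real \<times> real) measure)"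
  using iid by (auto simp: iid_pairs_def indep_vars_def2)

lemma X_measurable [measurable]: "X i \<in> borel_measurable M"
  and Y_measurable [measurable]: "Y i \<in> borel_measurable M"
proof -
  have "(\<lambda>\<omega>. fst (X i \<omega>, Y i \<omega>)) \<in> borel_measurable M" "(\<lambda>\<omega>. snd (X i \<omega>, Y i \<omega>)) \<in> borel_measurable M"
    by (rule measurable_compose[OF pair_measurable], simp add: borel_prod[symmetric])+
  then show "X i \<in> borel_measurable M" "Y i \<in> borel_measurable M" by simp_all
qed

lemma \<mu>_measurable [measurable]: "\<mu> \<in> borel_measurable borel"
  using regression by (simp add: regression_function_def)

lemma v_measurable [measurable]: "v \<in> borel_measurable borel" and v_nonneg: "0 \<le> v x"
  using cond_var by (simp_all add: conditional_variance_def)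

lemma f_measurable [measurable]: "f \<in> borel_measurable borel"
proof -
  have "(\<lambda>x. enn2real (ennreal (f x))) \<in> borel_measurable lborel"
    using distributed_borel_measurable[OF X_density] by measurable
  then show ?thesis using f_nonneg by simp
qed

section \<open>Conditional moments given the covariate\<close>

abbreviation "\<F> \<equiv> sigma_gen M (X 0)"

lemma subalgebra_\<F>: "subalgebra M \<F>"
proof -
  have "sets \<F> \<subseteq> sets M"
    unfolding sigma_gen_def by (subst sets_vimage_algebra2) (auto intro: measurable_sets)
  then show ?thesis by (simp add: subalgebra_def sigma_gen_def)
qed

sublocale cond: finite_measure_subalgebra M \<F>
  by unfold_locales (rule subalgebra_\<F>)

lemma comp_X_\<F>: "\<psi> \<in> measurable borel N \<Longrightarrow> (\<lambda>\<omega>. \<psi> (X 0 \<omega>)) \<in> measurable \<F> N"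
  unfolding sigma_gen_def by (rule measurable_compose[OF measurable_vimage_algebra1]) auto

lemma nn_expectation_X: "\<psi> \<in> borel_measurable borel \<Longrightarrow> (\<integral>\<^sup>+\<omega>. \<psi> (X 0 \<omega>) \<partial>M) = (\<integral>\<^sup>+x. ennreal (f x) * \<psi> x \<partial>lborel)"
  using distributed_nn_integral[OF X_density, of \<psi>] by simp

text \<open>Stated for nonnegative integrals, because integrability of the weighted squared residual
  is not known in advance; it is deduced from this identity.\<close>

lemma nn_expectation_square:
  assumes [measurable]: "\<psi> \<in> borel_measurable borel"
  shows "(\<integral>\<^sup>+\<omega>. \<psi> (X 0 \<omega>) * ennreal ((Y 0 \<omega> - \<mu> (X 0 \<omega>))\<^sup>2) \<partial>M) = (\<integral>\<^sup>+\<omega>. \<psi> (X 0 \<omega>) * ennreal (v (X 0 \<omega>)) \<partial>M)"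
proof -
  have "(\<integral>\<^sup>+\<omega>. \<psi> (X 0 \<omega>) * ennreal ((Y 0 \<omega> - \<mu> (X 0 \<omega>))\<^sup>2) \<partial>M)
    = (\<integral>\<^sup>+\<omega>. \<psi> (X 0 \<omega>) * nn_cond_exp M \<F> (\<lambda>\<omega>. ennreal ((Y 0 \<omega> - \<mu> (X 0 \<omega>))\<^sup>2)) \<omega> \<partial>M)"
    by (rule cond.nn_cond_exp_intg[symmetric]) (auto intro: comp_X_\<F>)
  also have "\<dots> = (\<integral>\<^sup>+\<omega>. \<psi> (X 0 \<omega>) * ennreal (v (X 0 \<omega>)) \<partial>M)"
  proof (rule nn_integral_cong_AE)
    have "AE \<omega> in M. nn_cond_exp M \<F> (\<lambda>\<omega>. ennreal ((Y 0 \<omega> - \<mu> (X 0 \<omega>))\<^sup>2)) \<omega> = ennreal (v (X 0 \<omega>))"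
      using cond_var by (simp add: conditional_variance_def)
    then show "AE \<omega> in M. \<psi> (X 0 \<omega>) * nn_cond_exp M \<F> (\<lambda>\<omega>. ennreal ((Y 0 \<omega> - \<mu> (X 0 \<omega>))\<^sup>2)) \<omega>
        = \<psi> (X 0 \<omega>) * ennreal (v (X 0 \<omega>))"
      by eventually_elim simp
  qed
  finally show ?thesis .
qed

text \<open>What matters is the order of the quantifiers: \<delta> and \<open>B\<close> are fixed
  before \<psi>, which will be a kernel weight that changes with n.\<close>

lemma nn_expectation_tail:
  assumes \<epsilon>: "0 < \<epsilon>"
  shows "\<exists>\<delta>>0. \<exists>B. \<forall>\<psi>\<in>borel_measurable borel. (\<forall>x. \<delta> \<le> \<bar>x - xd\<bar> \<longrightarrow> \<psi> x = 0) \<longrightarrow>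
    (\<integral>\<^sup>+\<omega>. \<psi> (X 0 \<omega>) * (if B < \<bar>Y 0 \<omega> - \<mu> (X 0 \<omega>)\<bar> then ennreal ((Y 0 \<omega> - \<mu> (X 0 \<omega>))\<^sup>2) else 0) \<partial>M)
      \<le> (\<integral>\<^sup>+\<omega>. \<psi> (X 0 \<omega>) * ennreal \<epsilon> \<partial>M)"
proof -
  obtain \<delta> B where \<delta>: "0 < \<delta>" and ae: "AE \<omega> in M. \<bar>X 0 \<omega> - xd\<bar> < \<delta> \<longrightarrow>
        nn_cond_exp M \<F> (\<lambda>\<omega>. if \<bar>Y 0 \<omega> - \<mu> (X 0 \<omega>)\<bar> > B then ennreal ((Y 0 \<omega> - \<mu> (X 0 \<omega>))\<^sup>2) else 0) \<omega>
        \<le> ennreal \<epsilon>"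
    using lindeberg \<epsilon> unfolding lindeberg_at_def by blast
  have "(\<integral>\<^sup>+\<omega>. \<psi> (X 0 \<omega>) * (if B < \<bar>Y 0 \<omega> - \<mu> (X 0 \<omega>)\<bar> then ennreal ((Y 0 \<omega> - \<mu> (X 0 \<omega>))\<^sup>2) else 0) \<partial>M)
      \<le> (\<integral>\<^sup>+\<omega>. \<psi> (X 0 \<omega>) * ennreal \<epsilon> \<partial>M)"
    if [measurable]: "\<psi> \<in> borel_measurable borel" and out: "\<forall>x. \<delta> \<le> \<bar>x - xd\<bar> \<longrightarrow> \<psi> x = 0" for \<psi>
  proof -
    have "(\<integral>\<^sup>+\<omega>. \<psi> (X 0 \<omega>) * (if B < \<bar>Y 0 \<omega> - \<mu> (X 0 \<omega>)\<bar> then ennreal ((Y 0 \<omega> - \<mu> (X 0 \<omega>))\<^sup>2) else 0) \<partial>M)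
      = (\<integral>\<^sup>+\<omega>. \<psi> (X 0 \<omega>) * nn_cond_exp M \<F> (\<lambda>\<omega>. if \<bar>Y 0 \<omega> - \<mu> (X 0 \<omega>)\<bar> > B then ennreal ((Y 0 \<omega> - \<mu> (X 0 \<omega>))\<^sup>2) else 0) \<omega> \<partial>M)"
      by (rule cond.nn_cond_exp_intg[symmetric]) (auto intro: comp_X_\<F>)
    also have "\<dots> \<le> (\<integral>\<^sup>+\<omega>. \<psi> (X 0 \<omega>) * ennreal \<epsilon> \<partial>M)"
    proof (rule nn_integral_mono_AE)
      from ae show "AE \<omega> in M. \<psi> (X 0 \<omega>) * nn_cond_exp M \<F> (\<lambda>\<omega>. if \<bar>Y 0 \<omega> - \<mu> (X 0 \<omega>)\<bar> > B then ennreal ((Y 0 \<omega> - \<mu> (X 0 \<omega>))\<^sup>2) else 0) \<omega>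
          \<le> \<psi> (X 0 \<omega>) * ennreal \<epsilon>"
      proof eventually_elim
        case (elim \<omega>)
        then show ?case using out by (cases "\<bar>X 0 \<omega> - xd\<bar> < \<delta>") (auto intro: mult_left_mono)
      qed
    qed
    finally show ?thesis .
  qed
  then show ?thesis using \<delta> by blast
qed

lemma expectation_residual:
  assumes [measurable]: "\<beta> \<in> borel_measurable borel"
    and i: "integrable M (\<lambda>\<omega>. \<beta> (X 0 \<omega>) * Y 0 \<omega>)" "integrable M (\<lambda>\<omega>. \<beta> (X 0 \<omega>) * \<mu> (X 0 \<omega>))"
  shows "expectation (\<lambda>\<omega>. \<beta> (X 0 \<omega>) * (Y 0 \<omega> - \<mu> (X 0 \<omega>))) = 0"
proof -
  have "expectation (\<lambda>\<omega>. \<beta> (X 0 \<omega>) * Y 0 \<omega>) = expectation (\<lambda>\<omega>. \<beta> (X 0 \<omega>) * real_cond_exp M \<F> (Y 0) \<omega>)"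
    by (rule cond.real_cond_exp_intg(2)[symmetric, OF i(1)]) (auto intro: comp_X_\<F>)
  also have "\<dots> = expectation (\<lambda>\<omega>. \<beta> (X 0 \<omega>) * \<mu> (X 0 \<omega>))"
  proof (rule integral_cong_AE)
    show "AE \<omega> in M. \<beta> (X 0 \<omega>) * real_cond_exp M \<F> (Y 0) \<omega> = \<beta> (X 0 \<omega>) * \<mu> (X 0 \<omega>)"
      using regression unfolding regression_function_def by auto
  qed measurable
  finally show ?thesis using i by (simp add: right_diff_distrib)
qed

section \<open>Expectations of kernel weights\<close>

definition near :: "real \<Rightarrow> real \<Rightarrow> bool" where
  "near x0 h \<longleftrightarrow> 0 < h \<and> \<bar>x0 - xd\<bar> + h \<le> r"

text \<open>Three weights are meant: K for means, its square for variances, and the part of the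
  square where K is large for the Lindeberg tail.\<close>

definition kernel_fun :: "(real \<Rightarrow> real) \<Rightarrow> bool" where
  "kernel_fun J \<longleftrightarrow> integrable lborel J \<and> (\<forall>z. z \<notin> {-1..1} \<longrightarrow> J z = 0) \<and> (\<forall>z. 0 \<le> J z)"

lemma kernel_funD:
  assumes "kernel_fun J"
  shows "integrable lborel J" "z \<notin> {-1..1} \<Longrightarrow> J z = 0" "0 \<le> J z" "J \<in> borel_measurable borel"
    "(LINT z|lborel. \<bar>J z\<bar>) = (LINT z|lborel. J z)" "0 \<le> (LINT z|lborel. J z)"
  using assms unfolding kernel_fun_def by auto

lemma kernel_fun_K: "kernel_fun K" and kernel_fun_K2: "kernel_fun (\<lambda>z. (K z)\<^sup>2)"
  unfolding kernel_fun_def using K_integrable K_square K_outside K_nonneg by auto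

lemma scaled_in_window:
  fixes x x0 h :: real
  assumes "0 < h" shows "(x - x0) / h \<in> {-1..1} \<longleftrightarrow> \<bar>x - x0\<bar> \<le> h"
proof -
  have "z \<in> {-1..1} \<longleftrightarrow> \<bar>z\<bar> \<le> 1" for z :: real by auto
  then have "(x - x0) / h \<in> {-1..1} \<longleftrightarrow> \<bar>(x - x0) / h\<bar> \<le> 1" .
  then show ?thesis using assms by (simp add: abs_divide pos_divide_le_eq)
qed

lemma AE_X_in_S: "AE \<omega> in M. X 0 \<omega> \<in> S"
proof -
  have [measurable]: "S \<in> sets borel" using S_closed by simp
  have "(\<integral>\<^sup>+\<omega>. indicator (- S) (X 0 \<omega>) \<partial>M) = (\<integral>\<^sup>+x. ennreal (f x) * indicator (- S) x \<partial>lborel)"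
    by (rule nn_expectation_X) simp
  also have "(\<lambda>x. ennreal (f x) * indicator (- S) x) = (\<lambda>x. 0)"
    by (rule ext) (auto simp: indicator_def f_outside)
  finally have "(\<integral>\<^sup>+\<omega>. indicator (- S) (X 0 \<omega>) \<partial>M) = 0" by simp
  then have "AE \<omega> in M. indicator (- S) (X 0 \<omega>) = (0 :: ennreal)"
    by (subst (asm) nn_integral_0_iff_AE) auto
  then show ?thesis by eventually_elim (auto simp: indicator_def split: if_splits)
qed

context
  fixes J \<alpha> :: "real \<Rightarrow> real" and x0 h C :: real
  assumes n: "near x0 h" and J: "kernel_fun J" and \<alpha>m [measurable]: "\<alpha> \<in> borel_measurable borel"
    and \<alpha>: "\<And>x. x \<in> S \<Longrightarrow> \<bar>x - x0\<bar> \<le> h \<Longrightarrow> \<bar>\<alpha> x\<bar> \<le> C" and C: "0 \<le> C"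
begin

lemma h_pos: "0 < h" using n by (simp add: near_def)

lemma local_bounds': "x \<in> S \<Longrightarrow> \<bar>x - x0\<bar> \<le> h \<Longrightarrow> f x \<le> Cb \<and> v x \<le> Cb \<and> \<bar>\<mu> x\<bar> \<le> Cb"
  using n by (intro local_bounds) (auto simp: near_def)

lemma J_measurable [measurable]: "J \<in> borel_measurable borel" by (rule kernel_funD[OF J])

text \<open>The substitution x = x0 + h z. Where x leaves \<open>S\<close> the density vanishes, so
  bounds on \<alpha> are called for only inside the support.\<close>

lemma kernel_expectation:
  shows "integrable M (\<lambda>\<omega>. J ((X 0 \<omega> - x0) / h) * \<alpha> (X 0 \<omega>))"
    and "expectation (\<lambda>\<omega>. J ((X 0 \<omega> - x0) / h) * \<alpha> (X 0 \<omega>)) = h * (LINT z|lborel. (\<alpha> (x0 + h * z) * f (x0 + h * z)) * J z)"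
    and "\<bar>expectation (\<lambda>\<omega>. J ((X 0 \<omega> - x0) / h) * \<alpha> (X 0 \<omega>))\<bar> \<le> h * (C * Cb * (LINT z|lborel. J z))"
proof -
  let ?F = "\<lambda>x. f x * (J ((x - x0) / h) * \<alpha> x)"
  have Fz: "?F (x0 + h * z) = (\<alpha> (x0 + h * z) * f (x0 + h * z)) * J z" for z
    using h_pos by simp
  have b: "\<bar>\<alpha> (x0 + h * z) * f (x0 + h * z)\<bar> \<le> C * Cb" if "z \<in> {-1..1}" for z
  proof (cases "x0 + h * z \<in> S")
    case True
    have z: "\<bar>x0 + h * z - x0\<bar> \<le> h" using that h_pos by (simp add: abs_mult mult_left_le abs_le_iff)
    show ?thesis unfolding abs_mult
      using \<alpha>[OF True z] local_bounds'[OF True z] f_nonneg[of "x0 + h * z"] C by (intro mult_mono) auto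
  next
    case False
    then show ?thesis using C Cb_nonneg by (simp add: f_outside)
  qed
  note w = windowed_integrable[OF kernel_funD(1,2)[OF J], where m = "\<lambda>z. \<alpha> (x0 + h * z) * f (x0 + h * z)", OF _ _ b]
  have "integrable lborel (\<lambda>z. ?F (x0 + h * z))"
    unfolding Fz by (rule w(1)) auto
  then have "integrable lborel ?F"
    using lborel_integrable_real_affine_iff[of h ?F x0] h_pos by simp
  then show "integrable M (\<lambda>\<omega>. J ((X 0 \<omega> - x0) / h) * \<alpha> (X 0 \<omega>))"
    using distributed_integrable[OF X_density, of "\<lambda>x. J ((x - x0) / h) * \<alpha> x"] f_nonneg by simp
  have "expectation (\<lambda>\<omega>. J ((X 0 \<omega> - x0) / h) * \<alpha> (X 0 \<omega>)) = (LINT x|lborel. ?F x)"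
    using distributed_integral[OF X_density, of "\<lambda>x. J ((x - x0) / h) * \<alpha> x"] f_nonneg by simp
  also have "\<dots> = h * (LINT z|lborel. ?F (x0 + h * z))"
    using lborel_integral_real_affine[of h ?F x0] h_pos by simp
  finally show e: "expectation (\<lambda>\<omega>. J ((X 0 \<omega> - x0) / h) * \<alpha> (X 0 \<omega>)) = h * (LINT z|lborel. (\<alpha> (x0 + h * z) * f (x0 + h * z)) * J z)"
    unfolding Fz .
  have "\<bar>LINT z|lborel. (\<alpha> (x0 + h * z) * f (x0 + h * z)) * J z\<bar> \<le> C * Cb * (LINT z|lborel. \<bar>J z\<bar>)"
    by (rule w(2)) auto
  then show "\<bar>expectation (\<lambda>\<omega>. J ((X 0 \<omega> - x0) / h) * \<alpha> (X 0 \<omega>))\<bar> \<le> h * (C * Cb * (LINT z|lborel. J z))"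
    unfolding e abs_mult kernel_funD(5)[OF J] using h_pos by simp
qed

end

context
  fixes J \<alpha> :: "real \<Rightarrow> real" and x0 h C :: real
  assumes n: "near x0 h" and J: "kernel_fun J" and \<alpha>m [measurable]: "\<alpha> \<in> borel_measurable borel"
    and \<alpha>: "\<And>x. x \<in> S \<Longrightarrow> \<bar>x - x0\<bar> \<le> h \<Longrightarrow> \<bar>\<alpha> x\<bar> \<le> C" and C: "0 \<le> C"
begin

text \<open>Conditioning on the covariate replaces the squared residual by \<open>v\<close>. The
  identity of nonnegative integrals has a finite right-hand side, and this yields integrability of
  the left-hand side.\<close>

lemma kernel_expectation_square:
  assumes nn: "\<And>x. 0 \<le> \<alpha> x"
  shows "integrable M (\<lambda>\<omega>. J ((X 0 \<omega> - x0) / h) * \<alpha> (X 0 \<omega>) * (Y 0 \<omega> - \<mu> (X 0 \<omega>))\<^sup>2)"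
    and "expectation (\<lambda>\<omega>. J ((X 0 \<omega> - x0) / h) * \<alpha> (X 0 \<omega>) * (Y 0 \<omega> - \<mu> (X 0 \<omega>))\<^sup>2)
      = expectation (\<lambda>\<omega>. J ((X 0 \<omega> - x0) / h) * (\<alpha> (X 0 \<omega>) * v (X 0 \<omega>)))"
    and "expectation (\<lambda>\<omega>. J ((X 0 \<omega> - x0) / h) * \<alpha> (X 0 \<omega>) * (Y 0 \<omega> - \<mu> (X 0 \<omega>))\<^sup>2)
      \<le> h * (C * Cb * Cb * (LINT z|lborel. J z))"
proof -
  note [measurable] = kernel_funD(4)[OF J]
  have \<alpha>v: "\<bar>\<alpha> x * v x\<bar> \<le> C * Cb" if "x \<in> S" "\<bar>x - x0\<bar> \<le> h" for x
    unfolding abs_mult using \<alpha>[OF that] local_bounds'[OF n J \<alpha>m \<alpha> C that] v_nonneg[of x] C by (intro mult_mono) auto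
  note k = kernel_expectation[where \<alpha> = "\<lambda>x. \<alpha> x * v x", OF n J _ \<alpha>v]
  have CC: "0 \<le> C * Cb" using C Cb_nonneg by simp
  have ki: "integrable M (\<lambda>\<omega>. J ((X 0 \<omega> - x0) / h) * (\<alpha> (X 0 \<omega>) * v (X 0 \<omega>)))"
    by (rule k(1)[OF _ _ _ CC]) auto
  have nneq: "(\<integral>\<^sup>+\<omega>. ennreal (J ((X 0 \<omega> - x0) / h) * \<alpha> (X 0 \<omega>) * (Y 0 \<omega> - \<mu> (X 0 \<omega>))\<^sup>2) \<partial>M)
    = (\<integral>\<^sup>+\<omega>. ennreal (J ((X 0 \<omega> - x0) / h) * (\<alpha> (X 0 \<omega>) * v (X 0 \<omega>))) \<partial>M)"
    using nn_expectation_square[of "\<lambda>x. ennreal (J ((x - x0) / h) * \<alpha> x)"] kernel_funD(3)[OF J] nn v_nonneg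
    by (simp add: ennreal_mult[symmetric] mult.assoc)
  also have "\<dots> = ennreal (expectation (\<lambda>\<omega>. J ((X 0 \<omega> - x0) / h) * (\<alpha> (X 0 \<omega>) * v (X 0 \<omega>))))"
    using kernel_funD(3)[OF J] nn v_nonneg by (intro nn_integral_eq_integral ki) auto
  finally have e: "(\<integral>\<^sup>+\<omega>. ennreal (J ((X 0 \<omega> - x0) / h) * \<alpha> (X 0 \<omega>) * (Y 0 \<omega> - \<mu> (X 0 \<omega>))\<^sup>2) \<partial>M)
    = ennreal (expectation (\<lambda>\<omega>. J ((X 0 \<omega> - x0) / h) * (\<alpha> (X 0 \<omega>) * v (X 0 \<omega>))))" .
  show i: "integrable M (\<lambda>\<omega>. J ((X 0 \<omega> - x0) / h) * \<alpha> (X 0 \<omega>) * (Y 0 \<omega> - \<mu> (X 0 \<omega>))\<^sup>2)"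
    using e kernel_funD(3)[OF J] nn by (intro integrableI_nonneg) auto
  show e2: "expectation (\<lambda>\<omega>. J ((X 0 \<omega> - x0) / h) * \<alpha> (X 0 \<omega>) * (Y 0 \<omega> - \<mu> (X 0 \<omega>))\<^sup>2)
      = expectation (\<lambda>\<omega>. J ((X 0 \<omega> - x0) / h) * (\<alpha> (X 0 \<omega>) * v (X 0 \<omega>)))"
    using e kernel_funD(3)[OF J] nn v_nonneg
    by (subst integral_eq_nn_integral) (auto intro!: integral_nonneg_AE)
  have "\<bar>expectation (\<lambda>\<omega>. J ((X 0 \<omega> - x0) / h) * (\<alpha> (X 0 \<omega>) * v (X 0 \<omega>)))\<bar> \<le> h * (C * Cb * Cb * (LINT z|lborel. J z))"
    by (rule k(3)[OF _ _ _ CC]) auto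
  then show "expectation (\<lambda>\<omega>. J ((X 0 \<omega> - x0) / h) * \<alpha> (X 0 \<omega>) * (Y 0 \<omega> - \<mu> (X 0 \<omega>))\<^sup>2)
      \<le> h * (C * Cb * Cb * (LINT z|lborel. J z))" unfolding e2 by simp
qed

end

text \<open>Integrability comes from |u| <= 1 + u^2 for the residual u and the second moment already
  known; the mean is then 0 by the tower property.\<close>

lemma kernel_expectation_residual:
  assumes n: "near x0 h" and J: "kernel_fun J" and \<alpha>m [measurable]: "\<alpha> \<in> borel_measurable borel"
    and \<alpha>: "\<And>x. x \<in> S \<Longrightarrow> \<bar>x - x0\<bar> \<le> h \<Longrightarrow> \<bar>\<alpha> x\<bar> \<le> C" and C: "0 \<le> C"
  shows "integrable M (\<lambda>\<omega>. J ((X 0 \<omega> - x0) / h) * \<alpha> (X 0 \<omega>) * (Y 0 \<omega> - \<mu> (X 0 \<omega>)))"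
    and "expectation (\<lambda>\<omega>. J ((X 0 \<omega> - x0) / h) * \<alpha> (X 0 \<omega>) * (Y 0 \<omega> - \<mu> (X 0 \<omega>))) = 0"
proof -
  note [measurable] = kernel_funD(4)[OF J]
  have 1: "\<bar>\<bar>\<alpha> x\<bar>\<bar> \<le> C" if "x \<in> S" "\<bar>x - x0\<bar> \<le> h" for x using \<alpha>[OF that] by simp
  have 2: "\<bar>\<alpha> x * \<mu> x\<bar> \<le> C * Cb" if "x \<in> S" "\<bar>x - x0\<bar> \<le> h" for x
    unfolding abs_mult using \<alpha>[OF that] local_bounds'[OF n J \<alpha>m \<alpha> C that] C by (intro mult_mono) auto
  have CC: "0 \<le> C * Cb" using C Cb_nonneg by simp
  have i1: "integrable M (\<lambda>\<omega>. J ((X 0 \<omega> - x0) / h) * \<bar>\<alpha> (X 0 \<omega>)\<bar>)"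
    by (rule kernel_expectation[OF n J _ 1 C]) auto
  have i2: "integrable M (\<lambda>\<omega>. J ((X 0 \<omega> - x0) / h) * \<bar>\<alpha> (X 0 \<omega>)\<bar> * (Y 0 \<omega> - \<mu> (X 0 \<omega>))\<^sup>2)"
    by (rule kernel_expectation_square[OF n J _ 1 C]) auto
  have i3: "integrable M (\<lambda>\<omega>. J ((X 0 \<omega> - x0) / h) * (\<alpha> (X 0 \<omega>) * \<mu> (X 0 \<omega>)))"
    by (rule kernel_expectation[OF n J _ 2 CC]) auto
  show i: "integrable M (\<lambda>\<omega>. J ((X 0 \<omega> - x0) / h) * \<alpha> (X 0 \<omega>) * (Y 0 \<omega> - \<mu> (X 0 \<omega>)))"
  proof (rule Bochner_Integration.integrable_bound[OF Bochner_Integration.integrable_add[OF i1 i2]])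
    show "AE \<omega> in M. norm (J ((X 0 \<omega> - x0) / h) * \<alpha> (X 0 \<omega>) * (Y 0 \<omega> - \<mu> (X 0 \<omega>)))
      \<le> norm (J ((X 0 \<omega> - x0) / h) * \<bar>\<alpha> (X 0 \<omega>)\<bar> + J ((X 0 \<omega> - x0) / h) * \<bar>\<alpha> (X 0 \<omega>)\<bar> * (Y 0 \<omega> - \<mu> (X 0 \<omega>))\<^sup>2)"
    proof (rule AE_I2)
      fix \<omega>
      let ?j = "J ((X 0 \<omega> - x0) / h) * \<bar>\<alpha> (X 0 \<omega>)\<bar>" and ?u = "Y 0 \<omega> - \<mu> (X 0 \<omega>)"
      have j: "0 \<le> ?j" using kernel_funD(3)[OF J] by simp
      have "\<bar>?u\<bar> \<le> 1 + ?u\<^sup>2" by (rule abs_le_one_plus_square)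
      from mult_left_mono[OF this j] show "norm (J ((X 0 \<omega> - x0) / h) * \<alpha> (X 0 \<omega>) * ?u) \<le> norm (?j + ?j * ?u\<^sup>2)"
        using j kernel_funD(3)[OF J] by (simp add: abs_mult distrib_left)
    qed
  qed measurable
  have "expectation (\<lambda>\<omega>. (J ((X 0 \<omega> - x0) / h) * \<alpha> (X 0 \<omega>)) * (Y 0 \<omega> - \<mu> (X 0 \<omega>))) = 0"
  proof (rule expectation_residual[where \<beta> = "\<lambda>x. J ((x - x0) / h) * \<alpha> x"])
    show "integrable M (\<lambda>\<omega>. J ((X 0 \<omega> - x0) / h) * \<alpha> (X 0 \<omega>) * \<mu> (X 0 \<omega>))"
      using i3 by (simp add: mult.assoc)
    from Bochner_Integration.integrable_add[OF i this]
    show "integrable M (\<lambda>\<omega>. J ((X 0 \<omega> - x0) / h) * \<alpha> (X 0 \<omega>) * Y 0 \<omega>)"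
      by (simp add: algebra_simps)
  qed measurable
  then show "expectation (\<lambda>\<omega>. J ((X 0 \<omega> - x0) / h) * \<alpha> (X 0 \<omega>) * (Y 0 \<omega> - \<mu> (X 0 \<omega>))) = 0" .
qed

lemma iid_functional:
  assumes [measurable]: "\<Phi> \<in> borel_measurable (borel :: (real \<times> real) measure)"
  shows "indep_vars (\<lambda>_. borel) (\<lambda>i \<omega>. \<Phi> (X i \<omega>, Y i \<omega>) :: real) {..<n}"
    "distr M borel (\<lambda>\<omega>. \<Phi> (X i \<omega>, Y i \<omega>)) = distr M borel (\<lambda>\<omega>. \<Phi> (X 0 \<omega>, Y 0 \<omega>))"
proof -
  have ind: "indep_vars (\<lambda>_. borel :: (real \<times> real) measure) (\<lambda>i \<omega>. (X i \<omega>, Y i \<omega>)) UNIV"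
    and d: "distr M (borel :: (real \<times> real) measure) (\<lambda>\<omega>. (X i \<omega>, Y i \<omega>)) = distr M borel (\<lambda>\<omega>. (X 0 \<omega>, Y 0 \<omega>))"
    using iid unfolding iid_pairs_def by auto
  show "indep_vars (\<lambda>_. borel) (\<lambda>i \<omega>. \<Phi> (X i \<omega>, Y i \<omega>)) {..<n}"
    by (rule indep_vars_subset[OF indep_vars_compose2[OF ind]]) auto
  have "distr M borel (\<lambda>\<omega>. \<Phi> (X i \<omega>, Y i \<omega>)) = distr (distr M borel (\<lambda>\<omega>. (X i \<omega>, Y i \<omega>))) borel \<Phi>"
    by (subst distr_distr) (auto simp: comp_def)
  also have "\<dots> = distr M borel (\<lambda>\<omega>. \<Phi> (X 0 \<omega>, Y 0 \<omega>))"
    unfolding d by (subst distr_distr) (auto simp: comp_def)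
  finally show "distr M borel (\<lambda>\<omega>. \<Phi> (X i \<omega>, Y i \<omega>)) = distr M borel (\<lambda>\<omega>. \<Phi> (X 0 \<omega>, Y 0 \<omega>))" .
qed

end

section \<open>Limits along shrinking windows\<close>

locale regression_asymp = regression_design +
  fixes x0 h :: "nat \<Rightarrow> real"
  assumes h_gt_0: "\<And>n. 0 < h n" and h_lim: "h \<longlonglongrightarrow> 0" and x0_lim: "x0 \<longlonglongrightarrow> xd" and xd_in: "xd \<in> S"
    and f_cont: "continuous_on S f" and v_cont: "continuous_on S v" and \<mu>_cont: "continuous_on S \<mu>"
    and f_pos: "0 < f xd" and v_pos: "0 < v xd"
    and nh_lim: "filterlim (\<lambda>n. real n * h n) at_top sequentially"
    and windows: "\<forall>\<^sub>F n in sequentially. window ({z. x0 n + h n * z \<in> S} \<inter> {-1..1})"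
begin

definition Dom :: "nat \<Rightarrow> real set" where
  "Dom n = {z. x0 n + h n * z \<in> S} \<inter> {-1..1}"

lemma window_Dom: "\<forall>\<^sub>F n in sequentially. window (Dom n)"
  using windows by (simp add: Dom_def)

lemma Dom_measurable [measurable]: "Dom n \<in> sets borel"
proof -
  have "{z. x0 n + h n * z \<in> S} = (\<lambda>z. x0 n + h n * z) -` S \<inter> space borel" by auto
  also have "\<dots> \<in> sets borel"
    by (rule measurable_sets[of _ borel borel]) (use S_closed in auto)
  finally show ?thesis by (auto simp: Dom_def)
qed

text \<open>Limits along this filter are limits that are uniform over the part of the support in the
  smoothing window.\<close>

definition Win :: "(nat \<times> real) filter" where
  "Win = filtercomap fst sequentially \<sqinter> principal {(n, x). x \<in> S \<and> \<bar>x - x0 n\<bar> \<le> h n}"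

lemma eventually_Win:
  "eventually P Win \<longleftrightarrow> (\<forall>\<^sub>F n in sequentially. \<forall>x\<in>S. \<bar>x - x0 n\<bar> \<le> h n \<longrightarrow> P (n, x))"
proof
  assume "eventually P Win"
  then obtain Q where Q: "eventually Q sequentially" and "\<And>n x. Q n \<Longrightarrow> x \<in> S \<and> \<bar>x - x0 n\<bar> \<le> h n \<Longrightarrow> P (n, x)"
    unfolding Win_def eventually_inf_principal eventually_filtercomap by fastforce
  from Q show "\<forall>\<^sub>F n in sequentially. \<forall>x\<in>S. \<bar>x - x0 n\<bar> \<le> h n \<longrightarrow> P (n, x)"
    by eventually_elim (use \<open>\<And>n x. Q n \<Longrightarrow> x \<in> S \<and> \<bar>x - x0 n\<bar> \<le> h n \<Longrightarrow> P (n, x)\<close> in blast)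
next
  assume "\<forall>\<^sub>F n in sequentially. \<forall>x\<in>S. \<bar>x - x0 n\<bar> \<le> h n \<longrightarrow> P (n, x)"
  then show "eventually P Win"
    unfolding Win_def eventually_inf_principal eventually_filtercomap by (intro exI conjI) auto
qed

lemma tendsto_Win_fst: "a \<longlonglongrightarrow> c \<Longrightarrow> ((\<lambda>p. a (fst p)) \<longlongrightarrow> c) Win"
  by (rule filterlim_compose[of a]) (auto simp: Win_def filterlim_filtercomap intro: filterlim_mono[OF filterlim_filtercomap[of fst sequentially]])

lemma tendsto_Win_snd: "(snd \<longlongrightarrow> xd) Win"
proof (rule tendsto_sandwich[of "\<lambda>p. x0 (fst p) - h (fst p)" _ _ "\<lambda>p. x0 (fst p) + h (fst p)"])
  show "\<forall>\<^sub>F p in Win. x0 (fst p) - h (fst p) \<le> snd p" "\<forall>\<^sub>F p in Win. snd p \<le> x0 (fst p) + h (fst p)"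
    unfolding eventually_Win by (intro always_eventually; force)+
  show "((\<lambda>p. x0 (fst p) - h (fst p)) \<longlongrightarrow> xd) Win"
    using tendsto_Win_fst[OF tendsto_diff[OF x0_lim h_lim]] by simp
  show "((\<lambda>p. x0 (fst p) + h (fst p)) \<longlongrightarrow> xd) Win"
    using tendsto_Win_fst[OF tendsto_add[OF x0_lim h_lim]] by simp
qed

text \<open>Continuity relative to the support is enough because the filter sees points of
  \<open>S\<close> only. This covers density, variance and mean at a boundary point.\<close>

lemma tendsto_Win_continuous_on:
  "continuous_on S F \<Longrightarrow> ((\<lambda>p. F (snd p)) \<longlongrightarrow> F xd) Win"
  by (rule continuous_on_tendsto_compose[OF _ tendsto_Win_snd xd_in]) (auto simp: eventually_Win)

lemma tendsto_Win_isCont: "isCont F xd \<Longrightarrow> ((\<lambda>p. F (snd p)) \<longlongrightarrow> F xd) Win"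
  by (rule isCont_tendsto_compose[OF _ tendsto_Win_snd])

lemma tendsto_Win_bounded:
  fixes \<alpha> :: "nat \<Rightarrow> real \<Rightarrow> real"
  assumes "((\<lambda>p. \<alpha> (fst p) (snd p)) \<longlongrightarrow> c) Win"
  shows "\<forall>\<^sub>F n in sequentially. \<forall>x\<in>S. \<bar>x - x0 n\<bar> \<le> h n \<longrightarrow> \<bar>\<alpha> n x\<bar> \<le> \<bar>c\<bar> + 1"
proof -
  have "\<forall>\<^sub>F p in Win. \<bar>\<alpha> (fst p) (snd p) - c\<bar> < 1"
    using tendstoD[OF assms, of 1] by (simp add: dist_real_def)
  then show ?thesis unfolding eventually_Win
    by eventually_elim force
qed

lemma eventually_window_small:
  assumes "0 < d" shows "\<forall>\<^sub>F n in sequentially. \<bar>x0 n - xd\<bar> + h n < d"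
proof -
  have "(\<lambda>n. \<bar>x0 n - xd\<bar> + h n) \<longlonglongrightarrow> \<bar>xd - xd\<bar> + 0" by (intro tendsto_intros x0_lim h_lim)
  then show ?thesis using assms by (intro order_tendstoD) auto
qed

lemma eventually_near: "\<forall>\<^sub>F n in sequentially. near (x0 n) (h n)"
  using eventually_window_small[OF r_pos] by eventually_elim (simp add: near_def h_gt_0)

abbreviation "Z n x \<equiv> (x - x0 n) / h n"

lemma Z_in: "\<bar>x - x0 n\<bar> \<le> h n \<Longrightarrow> Z n x \<in> {-1..1}"
  using scaled_in_window[OF h_gt_0] by blast

text \<open>Neither the weights \<open>m n\<close> nor the window \<open>Dom n\<close> need
  converge, so the comparison is with the integral over the current window. Only \<alpha> times the
  density is replaced by its limit, uniformly over the window.\<close>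

lemma kernel_expectation_limit:
  assumes J: "kernel_fun J" and \<alpha>m: "\<And>n. \<alpha> n \<in> borel_measurable borel" and mm: "\<And>n. m n \<in> borel_measurable borel"
    and \<alpha>: "((\<lambda>p. \<alpha> (fst p) (snd p)) \<longlongrightarrow> c) Win"
    and m: "\<forall>\<^sub>F n in sequentially. \<forall>z\<in>{-1..1}. \<bar>m n z\<bar> \<le> Cm"
  shows "(\<lambda>n. expectation (\<lambda>\<omega>. J (Z n (X 0 \<omega>)) * (m n (Z n (X 0 \<omega>)) * \<alpha> n (X 0 \<omega>))) / h n
     - c * f xd * (LINT z:Dom n|lborel. m n z * J z)) \<longlonglongrightarrow> 0"
proof (rule tendstoI)
  note [measurable] = \<alpha>m mm kernel_funD(4)[OF J]
  fix \<epsilon> :: real assume \<epsilon>: "0 < \<epsilon>"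
  define IJ where "IJ = (LINT z|lborel. J z)"
  have IJ: "0 \<le> IJ" unfolding IJ_def by (rule kernel_funD[OF J])
  \<comment> \<open>Chosen so that the final error bound, sup of the weight times \<delta> times the
    integral of \<open>J\<close>, is at most half of \<epsilon>.\<close>
  define \<delta> where "\<delta> = \<epsilon> / (2 * ((\<bar>Cm\<bar> + 1) * (IJ + 1)))"
  have \<delta>: "0 < \<delta>" unfolding \<delta>_def using \<epsilon> IJ by (simp add: add_nonneg_pos)
  have "((\<lambda>p. \<alpha> (fst p) (snd p) * f (snd p)) \<longlongrightarrow> c * f xd) Win"
    by (intro tendsto_mult \<alpha> tendsto_Win_continuous_on f_cont)
  from tendstoD[OF this \<delta>] have close: "\<forall>\<^sub>F n in sequentially. \<forall>x\<in>S. \<bar>x - x0 n\<bar> \<le> h n \<longrightarrow> \<bar>\<alpha> n x * f x - c * f xd\<bar> < \<delta>"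
    unfolding eventually_Win by (simp add: dist_real_def)
  from close m tendsto_Win_bounded[OF \<alpha>] eventually_near
  show "\<forall>\<^sub>F n in sequentially. dist (expectation (\<lambda>\<omega>. J (Z n (X 0 \<omega>)) * (m n (Z n (X 0 \<omega>)) * \<alpha> n (X 0 \<omega>))) / h n
     - c * f xd * (LINT z:Dom n|lborel. m n z * J z)) 0 < \<epsilon>"
  proof eventually_elim
    case (elim n)
    have "\<bar>m n 0\<bar> \<le> Cm" using elim(2) by simp
    then have Cm: "0 \<le> Cm" by linarith
    let ?a = "\<lambda>x. m n (Z n x) * \<alpha> n x"
    have b: "\<bar>?a x\<bar> \<le> Cm * (\<bar>c\<bar> + 1)" if "x \<in> S" "\<bar>x - x0 n\<bar> \<le> h n" for x
      unfolding abs_mult using elim Z_in[OF that(2)] that Cm by (intro mult_mono) auto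
    have CC: "0 \<le> Cm * (\<bar>c\<bar> + 1)" using Cm by simp
    have hz: "Z n (x0 n + h n * z) = z" for z using h_gt_0[of n] by simp
    have "expectation (\<lambda>\<omega>. J (Z n (X 0 \<omega>)) * ?a (X 0 \<omega>)) = h n * (LINT z|lborel. (?a (x0 n + h n * z) * f (x0 n + h n * z)) * J z)"
      by (rule kernel_expectation(2)[where \<alpha> = ?a, OF elim(4) J _ b CC]) auto
    then have e1: "expectation (\<lambda>\<omega>. J (Z n (X 0 \<omega>)) * ?a (X 0 \<omega>)) / h n = (LINT z|lborel. (?a (x0 n + h n * z) * f (x0 n + h n * z)) * J z)"
      using h_gt_0[of n] by simp
    have e2: "c * f xd * (LINT z:Dom n|lborel. m n z * J z) = (LINT z|lborel. (c * f xd * indicator (Dom n) z * m n z) * J z)"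
      unfolding set_lebesgue_integral_def by (simp add: mult.assoc flip: integral_mult_right_zero)
    have w1: "\<bar>?a (x0 n + h n * z) * f (x0 n + h n * z)\<bar> \<le> Cm * (\<bar>c\<bar> + 1) * Cb" if z: "z \<in> {-1..1}" for z
    proof (cases "x0 n + h n * z \<in> S")
      case True
      have zz: "\<bar>x0 n + h n * z - x0 n\<bar> \<le> h n" using z h_gt_0[of n] by (simp add: abs_mult mult_left_le abs_le_iff)
      have "f (x0 n + h n * z) \<le> Cb" using elim(4) zz True by (intro conjunct1[OF local_bounds]) (auto simp: near_def)
      then show ?thesis unfolding abs_mult[of _ "f _"]
        using b[OF True zz] f_nonneg[of "x0 n + h n * z"] CC by (intro mult_mono) auto
    next
      case False
      then show ?thesis using CC Cb_nonneg by (simp add: f_outside)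
    qed
    have w2: "\<bar>c * f xd * indicator (Dom n) z * m n z\<bar> \<le> \<bar>c * f xd\<bar> * Cm" if z: "z \<in> {-1..1}" for z
    proof -
      have "\<bar>indicator (Dom n) z * m n z\<bar> \<le> Cm" using elim(2) z Cm by (auto simp: indicator_def)
      from mult_left_mono[OF this, of "\<bar>c * f xd\<bar>"] show ?thesis by (simp add: abs_mult mult.assoc)
    qed
    \<comment> \<open>Outside the support both terms vanish, one through the density and the other
      through the indicator of \<open>Dom n\<close>, so the difference is small there too.\<close>
    have w3: "\<bar>?a (x0 n + h n * z) * f (x0 n + h n * z) - c * f xd * indicator (Dom n) z * m n z\<bar> \<le> Cm * \<delta>" if z: "z \<in> {-1..1}" for z
    proof (cases "x0 n + h n * z \<in> S")
      case True
      have zz: "\<bar>x0 n + h n * z - x0 n\<bar> \<le> h n" using z h_gt_0[of n] by (simp add: abs_mult mult_left_le abs_le_iff)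
      have "?a (x0 n + h n * z) * f (x0 n + h n * z) - c * f xd * indicator (Dom n) z * m n z
        = m n z * (\<alpha> n (x0 n + h n * z) * f (x0 n + h n * z) - c * f xd)"
        using True z hz by (simp add: Dom_def algebra_simps)
      also have "\<bar>\<dots>\<bar> \<le> Cm * \<delta>" unfolding abs_mult
        using elim(2) z elim(1) True zz Cm by (intro mult_mono) (auto intro: less_imp_le)
      finally show ?thesis .
    next
      case False
      then show ?thesis using Cm \<delta> by (simp add: Dom_def f_outside)
    qed
    note wi = windowed_integrable[OF kernel_funD(1,2)[OF J]]
    have d: "(LINT z|lborel. (?a (x0 n + h n * z) * f (x0 n + h n * z)) * J z) - (LINT z|lborel. (c * f xd * indicator (Dom n) z * m n z) * J z)
      = (LINT z|lborel. (?a (x0 n + h n * z) * f (x0 n + h n * z) - c * f xd * indicator (Dom n) z * m n z) * J z)"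
      unfolding left_diff_distrib[of _ _ "J _"]
      by (rule Bochner_Integration.integral_diff[symmetric]; rule wi(1)[OF _ _ w1] wi(1)[OF _ _ w2]; simp)
    have w: "\<bar>LINT z|lborel. (?a (x0 n + h n * z) * f (x0 n + h n * z) - c * f xd * indicator (Dom n) z * m n z) * J z\<bar> \<le> Cm * \<delta> * IJ"
      unfolding IJ_def kernel_funD(5)[OF J, symmetric] by (rule wi(2)[OF _ _ w3]) auto
    have "Cm * \<delta> * IJ \<le> (\<bar>Cm\<bar> + 1) * \<delta> * (IJ + 1)" using \<delta> IJ by (intro mult_mono) auto
    moreover have "(\<bar>Cm\<bar> + 1) * \<delta> * (IJ + 1) = \<epsilon> / 2" unfolding \<delta>_def using IJ by (simp add: add_nonneg_pos divide_simps)
    ultimately have "Cm * \<delta> * IJ < \<epsilon>" using \<epsilon> by linarith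
    with w have "\<bar>LINT z|lborel. (?a (x0 n + h n * z) * f (x0 n + h n * z) - c * f xd * indicator (Dom n) z * m n z) * J z\<bar> < \<epsilon>"
      by (rule order.strict_trans1)
    then show ?case unfolding e1 e2 dist_real_def d[symmetric] by simp
  qed
qed

text \<open>One family for all sums over the sample: \<alpha> is the part determined by the
  covariate, \<beta> multiplies the residual, and \<open>m\<close> is a weight in the scaled
  coordinate. The noise has \<alpha> = 0, the bias \<beta> = 0, the second derivative both
  parts.\<close>

definition summand :: "(nat \<Rightarrow> real \<Rightarrow> real) \<Rightarrow> (nat \<Rightarrow> real \<Rightarrow> real) \<Rightarrow> (nat \<Rightarrow> real \<Rightarrow> real) \<Rightarrow> nat \<Rightarrow> real \<times> real \<Rightarrow> real" where
  "summand m \<alpha> \<beta> n p = K (Z n (fst p)) * (m n (Z n (fst p)) * (\<alpha> n (fst p) + \<beta> n (fst p) * (snd p - \<mu> (fst p))))"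

context
  fixes m \<alpha> \<beta> :: "nat \<Rightarrow> real \<Rightarrow> real" and Cm c c' :: real
  assumes mm [measurable]: "\<And>n. m n \<in> borel_measurable borel" and \<alpha>m [measurable]: "\<And>n. \<alpha> n \<in> borel_measurable borel"
    and \<beta>m [measurable]: "\<And>n. \<beta> n \<in> borel_measurable borel"
    and m: "\<forall>\<^sub>F n in sequentially. \<forall>z\<in>{-1..1}. \<bar>m n z\<bar> \<le> Cm"
    and \<alpha>: "((\<lambda>p. \<alpha> (fst p) (snd p)) \<longlongrightarrow> c) Win" and \<beta>: "((\<lambda>p. \<beta> (fst p) (snd p)) \<longlongrightarrow> c') Win"
begin

lemma summand_measurable [measurable]: "summand m \<alpha> \<beta> n \<in> borel_measurable borel"
  unfolding summand_def borel_prod[symmetric] by measurable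

text \<open>Both parts have second moment of order h, the width of the window. The residual has
  conditional mean 0, so the mean sees \<alpha> alone.\<close>

lemma summand_moments:
  "\<exists>C. \<forall>\<^sub>F n in sequentially. integrable M (\<lambda>\<omega>. (summand m \<alpha> \<beta> n (X 0 \<omega>, Y 0 \<omega>))\<^sup>2) \<and>
     expectation (\<lambda>\<omega>. (summand m \<alpha> \<beta> n (X 0 \<omega>, Y 0 \<omega>))\<^sup>2) \<le> h n * C \<and>
     expectation (\<lambda>\<omega>. summand m \<alpha> \<beta> n (X 0 \<omega>, Y 0 \<omega>)) = expectation (\<lambda>\<omega>. K (Z n (X 0 \<omega>)) * (m n (Z n (X 0 \<omega>)) * \<alpha> n (X 0 \<omega>)))"
proof -
  define Ca where "Ca = \<bar>Cm\<bar> * (\<bar>c\<bar> + 1)" define Cc where "Cc = \<bar>Cm\<bar> * (\<bar>c'\<bar> + 1)"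
  have C0: "0 \<le> Ca" "0 \<le> Cc" "0 \<le> Ca\<^sup>2" "0 \<le> Cc\<^sup>2" by (simp_all add: Ca_def Cc_def)
  define I2 where "I2 = (LINT z|lborel. (K z)\<^sup>2)"
  have "\<forall>\<^sub>F n in sequentially. integrable M (\<lambda>\<omega>. (summand m \<alpha> \<beta> n (X 0 \<omega>, Y 0 \<omega>))\<^sup>2) \<and>
     expectation (\<lambda>\<omega>. (summand m \<alpha> \<beta> n (X 0 \<omega>, Y 0 \<omega>))\<^sup>2) \<le> h n * (2 * (Ca\<^sup>2 * Cb * I2) + 2 * (Cc\<^sup>2 * Cb * Cb * I2)) \<and>
     expectation (\<lambda>\<omega>. summand m \<alpha> \<beta> n (X 0 \<omega>, Y 0 \<omega>)) = expectation (\<lambda>\<omega>. K (Z n (X 0 \<omega>)) * (m n (Z n (X 0 \<omega>)) * \<alpha> n (X 0 \<omega>)))"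
    using m tendsto_Win_bounded[OF \<alpha>] tendsto_Win_bounded[OF \<beta>] eventually_near
  proof eventually_elim
    case (elim n)
    note near = elim(4)
    let ?a = "\<lambda>x. m n (Z n x) * \<alpha> n x" and ?b = "\<lambda>x. m n (Z n x) * \<beta> n x"
    have mz: "\<bar>m n (Z n x)\<bar> \<le> \<bar>Cm\<bar>" if "\<bar>x - x0 n\<bar> \<le> h n" for x
      using bspec[OF elim(1) Z_in[OF that]] by linarith
    have a: "\<bar>?a x\<bar> \<le> Ca" if "x \<in> S" "\<bar>x - x0 n\<bar> \<le> h n" for x
      unfolding abs_mult Ca_def using elim(2) that mz by (intro mult_mono) auto
    have b: "\<bar>?b x\<bar> \<le> Cc" if "x \<in> S" "\<bar>x - x0 n\<bar> \<le> h n" for x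
      unfolding abs_mult Cc_def using elim(3) that mz by (intro mult_mono) auto
    have a2: "\<bar>(?a x)\<^sup>2\<bar> \<le> Ca\<^sup>2" if "x \<in> S" "\<bar>x - x0 n\<bar> \<le> h n" for x
      using power_mono[OF a[OF that] abs_ge_zero, of 2] by simp
    have b2: "\<bar>(?b x)\<^sup>2\<bar> \<le> Cc\<^sup>2" if "x \<in> S" "\<bar>x - x0 n\<bar> \<le> h n" for x
      using power_mono[OF b[OF that] abs_ge_zero, of 2] by simp
    have iK: "integrable M (\<lambda>\<omega>. K (Z n (X 0 \<omega>)) * ?a (X 0 \<omega>))"
      by (rule kernel_expectation(1)[where \<alpha> = ?a, OF near kernel_fun_K _ a C0(1)]) auto
    have iR: "integrable M (\<lambda>\<omega>. K (Z n (X 0 \<omega>)) * ?b (X 0 \<omega>) * (Y 0 \<omega> - \<mu> (X 0 \<omega>)))"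
      and eR: "expectation (\<lambda>\<omega>. K (Z n (X 0 \<omega>)) * ?b (X 0 \<omega>) * (Y 0 \<omega> - \<mu> (X 0 \<omega>))) = 0"
      by (rule kernel_expectation_residual[where \<alpha> = ?b, OF near kernel_fun_K _ b C0(2)]; simp)+
    have iA: "integrable M (\<lambda>\<omega>. (K (Z n (X 0 \<omega>)))\<^sup>2 * (?a (X 0 \<omega>))\<^sup>2)"
      and eA: "\<bar>expectation (\<lambda>\<omega>. (K (Z n (X 0 \<omega>)))\<^sup>2 * (?a (X 0 \<omega>))\<^sup>2)\<bar> \<le> h n * (Ca\<^sup>2 * Cb * I2)"
      unfolding I2_def
      by (rule kernel_expectation(1,3)[where \<alpha> = "\<lambda>x. (?a x)\<^sup>2", OF near kernel_fun_K2 _ a2 C0(3)]; simp)+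
    have iB: "integrable M (\<lambda>\<omega>. (K (Z n (X 0 \<omega>)))\<^sup>2 * (?b (X 0 \<omega>))\<^sup>2 * (Y 0 \<omega> - \<mu> (X 0 \<omega>))\<^sup>2)"
      and eB: "expectation (\<lambda>\<omega>. (K (Z n (X 0 \<omega>)))\<^sup>2 * (?b (X 0 \<omega>))\<^sup>2 * (Y 0 \<omega> - \<mu> (X 0 \<omega>))\<^sup>2) \<le> h n * (Cc\<^sup>2 * Cb * Cb * I2)"
      unfolding I2_def
      by (rule kernel_expectation_square(1,3)[where \<alpha> = "\<lambda>x. (?b x)\<^sup>2", OF near kernel_fun_K2 _ b2 C0(4)]; simp)+
    have split: "summand m \<alpha> \<beta> n (X 0 \<omega>, Y 0 \<omega>) = K (Z n (X 0 \<omega>)) * ?a (X 0 \<omega>) + K (Z n (X 0 \<omega>)) * ?b (X 0 \<omega>) * (Y 0 \<omega> - \<mu> (X 0 \<omega>))" for \<omega>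
      by (simp add: summand_def algebra_simps)
    have le: "(summand m \<alpha> \<beta> n (X 0 \<omega>, Y 0 \<omega>))\<^sup>2 \<le> 2 * ((K (Z n (X 0 \<omega>)))\<^sup>2 * (?a (X 0 \<omega>))\<^sup>2)
       + 2 * ((K (Z n (X 0 \<omega>)))\<^sup>2 * (?b (X 0 \<omega>))\<^sup>2 * (Y 0 \<omega> - \<mu> (X 0 \<omega>))\<^sup>2)" for \<omega>
    proof -
      have "(s + t)\<^sup>2 \<le> 2 * s\<^sup>2 + 2 * t\<^sup>2" for s t :: real
        using sum_squares_bound[of s t] by (simp add: power2_sum)
      from this[of "K (Z n (X 0 \<omega>)) * ?a (X 0 \<omega>)" "K (Z n (X 0 \<omega>)) * ?b (X 0 \<omega>) * (Y 0 \<omega> - \<mu> (X 0 \<omega>))"]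
      show ?thesis unfolding split power_mult_distrib .
    qed
    have ii: "integrable M (\<lambda>\<omega>. 2 * ((K (Z n (X 0 \<omega>)))\<^sup>2 * (?a (X 0 \<omega>))\<^sup>2)
       + 2 * ((K (Z n (X 0 \<omega>)))\<^sup>2 * (?b (X 0 \<omega>))\<^sup>2 * (Y 0 \<omega> - \<mu> (X 0 \<omega>))\<^sup>2))"
      by (intro Bochner_Integration.integrable_add integrable_mult_right iA iB)
    have i: "integrable M (\<lambda>\<omega>. (summand m \<alpha> \<beta> n (X 0 \<omega>, Y 0 \<omega>))\<^sup>2)"
    proof (rule Bochner_Integration.integrable_bound[OF ii])
      show "AE \<omega> in M. norm ((summand m \<alpha> \<beta> n (X 0 \<omega>, Y 0 \<omega>))\<^sup>2) \<le> norm (2 * ((K (Z n (X 0 \<omega>)))\<^sup>2 * (?a (X 0 \<omega>))\<^sup>2)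
       + 2 * ((K (Z n (X 0 \<omega>)))\<^sup>2 * (?b (X 0 \<omega>))\<^sup>2 * (Y 0 \<omega> - \<mu> (X 0 \<omega>))\<^sup>2))"
        by (rule AE_I2) (use order.trans[OF le abs_ge_self] in simp)
    qed measurable
    have "expectation (\<lambda>\<omega>. (summand m \<alpha> \<beta> n (X 0 \<omega>, Y 0 \<omega>))\<^sup>2) \<le> expectation (\<lambda>\<omega>. 2 * ((K (Z n (X 0 \<omega>)))\<^sup>2 * (?a (X 0 \<omega>))\<^sup>2)
       + 2 * ((K (Z n (X 0 \<omega>)))\<^sup>2 * (?b (X 0 \<omega>))\<^sup>2 * (Y 0 \<omega> - \<mu> (X 0 \<omega>))\<^sup>2))"
      by (rule integral_mono[OF i ii le])
    also have "\<dots> = 2 * expectation (\<lambda>\<omega>. (K (Z n (X 0 \<omega>)))\<^sup>2 * (?a (X 0 \<omega>))\<^sup>2)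
       + 2 * expectation (\<lambda>\<omega>. (K (Z n (X 0 \<omega>)))\<^sup>2 * (?b (X 0 \<omega>))\<^sup>2 * (Y 0 \<omega> - \<mu> (X 0 \<omega>))\<^sup>2)"
      using iA iB by (subst Bochner_Integration.integral_add) auto
    also have "\<dots> \<le> 2 * (h n * (Ca\<^sup>2 * Cb * I2)) + 2 * (h n * (Cc\<^sup>2 * Cb * Cb * I2))"
      using eA eB by linarith
    finally have e: "expectation (\<lambda>\<omega>. (summand m \<alpha> \<beta> n (X 0 \<omega>, Y 0 \<omega>))\<^sup>2) \<le> h n * (2 * (Ca\<^sup>2 * Cb * I2) + 2 * (Cc\<^sup>2 * Cb * Cb * I2))"
      by (simp add: distrib_left mult.left_commute)
    have "expectation (\<lambda>\<omega>. summand m \<alpha> \<beta> n (X 0 \<omega>, Y 0 \<omega>)) = expectation (\<lambda>\<omega>. K (Z n (X 0 \<omega>)) * ?a (X 0 \<omega>))"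
      unfolding split Bochner_Integration.integral_add[OF iK iR] eR by simp
    then show ?case by (intro conjI i e)
  qed
  then show ?thesis by (rule exI[of _ "2 * (Ca\<^sup>2 * Cb * I2) + 2 * (Cc\<^sup>2 * Cb * Cb * I2)"])
qed

lemma summand_sum_moments:
  "\<exists>C. \<forall>\<^sub>F n in sequentially.
     integrable M (\<lambda>\<omega>. ((\<Sum>i<n. summand m \<alpha> \<beta> n (X i \<omega>, Y i \<omega>)) - n * expectation (\<lambda>\<omega>. K (Z n (X 0 \<omega>)) * (m n (Z n (X 0 \<omega>)) * \<alpha> n (X 0 \<omega>))))\<^sup>2) \<and>
     expectation (\<lambda>\<omega>. ((\<Sum>i<n. summand m \<alpha> \<beta> n (X i \<omega>, Y i \<omega>)) - n * expectation (\<lambda>\<omega>. K (Z n (X 0 \<omega>)) * (m n (Z n (X 0 \<omega>)) * \<alpha> n (X 0 \<omega>))))\<^sup>2)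
       \<le> real n * h n * C"
proof -
  obtain C where C: "\<forall>\<^sub>F n in sequentially. integrable M (\<lambda>\<omega>. (summand m \<alpha> \<beta> n (X 0 \<omega>, Y 0 \<omega>))\<^sup>2) \<and>
     expectation (\<lambda>\<omega>. (summand m \<alpha> \<beta> n (X 0 \<omega>, Y 0 \<omega>))\<^sup>2) \<le> h n * C \<and>
     expectation (\<lambda>\<omega>. summand m \<alpha> \<beta> n (X 0 \<omega>, Y 0 \<omega>)) = expectation (\<lambda>\<omega>. K (Z n (X 0 \<omega>)) * (m n (Z n (X 0 \<omega>)) * \<alpha> n (X 0 \<omega>)))"
    using summand_moments by blast
  show ?thesis
  proof (rule exI[of _ C], use C in eventually_elim)
    case (elim n)
    have "expectation (\<lambda>\<omega>. (summand m \<alpha> \<beta> n (X 0 \<omega>, Y 0 \<omega>))\<^sup>2) \<le> h n * C" using elim by blast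
    then have "real n * expectation (\<lambda>\<omega>. (summand m \<alpha> \<beta> n (X 0 \<omega>, Y 0 \<omega>))\<^sup>2) \<le> real n * h n * C"
      using mult_left_mono[of _ _ "real n"] by (simp add: mult.assoc)
    moreover note I = iid_sum_second_moment[where F = "\<lambda>i \<omega>. summand m \<alpha> \<beta> n (X i \<omega>, Y i \<omega>)" and n = n,
        OF iid_functional(1)[OF summand_measurable] iid_functional(2)[OF summand_measurable] elim[THEN conjunct1],
        unfolded elim[THEN conjunct2, THEN conjunct2]]
    ultimately show ?case by (intro conjI I[THEN conjunct1] order.trans[OF I[THEN conjunct2]])
  qed
qed

text \<open>Chebyshev: after division by n h the variance is of order 1 / (n h), and the mean is
  handled by \<open>kernel_expectation_limit\<close>.\<close>

lemma kernel_lln: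
  "to_zero_in_prob (\<lambda>n \<omega>. (\<Sum>i<n. summand m \<alpha> \<beta> n (X i \<omega>, Y i \<omega>)) / (real n * h n)
     - c * f xd * (LINT z:Dom n|lborel. m n z * K z))"
proof -
  define E where "E n = expectation (\<lambda>\<omega>. K (Z n (X 0 \<omega>)) * (m n (Z n (X 0 \<omega>)) * \<alpha> n (X 0 \<omega>)))" for n
  define T where "T n \<omega> = (\<Sum>i<n. summand m \<alpha> \<beta> n (X i \<omega>, Y i \<omega>))" for n \<omega>
  have [measurable]: "(\<lambda>\<omega>. summand m \<alpha> \<beta> n (X i \<omega>, Y i \<omega>)) \<in> borel_measurable M" for n i
    by (rule measurable_compose[OF pair_measurable summand_measurable])
  obtain C where C: "\<forall>\<^sub>F n in sequentially. integrable M (\<lambda>\<omega>. (T n \<omega> - n * E n)\<^sup>2) \<and>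
     expectation (\<lambda>\<omega>. (T n \<omega> - n * E n)\<^sup>2) \<le> real n * h n * C"
    using summand_sum_moments unfolding T_def E_def by blast
  have nh0: "\<forall>\<^sub>F n in sequentially. 0 < real n * h n"
    using nh_lim by (simp add: filterlim_at_top_dense)
  have 1: "to_zero_in_prob (\<lambda>n \<omega>. (T n \<omega> - n * E n) / (real n * h n))"
  proof (rule to_zero_in_prob_L2[where r = "\<lambda>n. C / (real n * h n)"])
    show "(\<lambda>\<omega>. (T n \<omega> - n * E n) / (real n * h n)) \<in> borel_measurable M" for n unfolding T_def by measurable
    show "(\<lambda>n. C / (real n * h n)) \<longlonglongrightarrow> 0"
      by (rule tendsto_divide_0[OF tendsto_const filterlim_at_top_imp_at_infinity[OF nh_lim]])
    show "\<forall>\<^sub>F n in sequentially. integrable M (\<lambda>\<omega>. ((T n \<omega> - n * E n) / (real n * h n))\<^sup>2) \<and>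
       expectation (\<lambda>\<omega>. ((T n \<omega> - n * E n) / (real n * h n))\<^sup>2) \<le> C / (real n * h n)"
      using C nh0
    proof eventually_elim
      case (elim n)
      have "expectation (\<lambda>\<omega>. ((T n \<omega> - n * E n) / (real n * h n))\<^sup>2) = expectation (\<lambda>\<omega>. (T n \<omega> - n * E n)\<^sup>2) / (real n * h n)\<^sup>2"
        by (simp add: power_divide)
      also have "\<dots> \<le> (real n * h n * C) / (real n * h n)\<^sup>2" using elim by (intro divide_right_mono) auto
      also have "\<dots> = C / (real n * h n)" using elim(2) by (simp add: power2_eq_square)
      finally show ?case using elim by (simp add: power_divide)
    qed
  qed
  have 2: "to_zero_in_prob (\<lambda>n \<omega>. E n / h n - c * f xd * (LINT z:Dom n|lborel. m n z * K z))"
    unfolding E_def by (rule to_zero_in_prob_const) (rule kernel_expectation_limit[OF kernel_fun_K \<alpha>m mm \<alpha> m])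
  from to_zero_in_prob_add[OF 1 2] show ?thesis
  proof (rule to_zero_in_prob_mono, use nh0 in eventually_elim)
    case (elim n)
    then have "0 < n" using h_gt_0[of n] by (simp add: zero_less_mult_iff)
    then have "(T n \<omega> - real n * E n) / (real n * h n) = T n \<omega> / (real n * h n) - E n / h n" for \<omega>
      by (simp add: diff_divide_distrib)
    then show ?case unfolding T_def[symmetric] by simp
  qed
qed

end

section \<open>Size and limit law of the noise\<close>

lemma noise_bounded:
  assumes mm: "\<And>n. m n \<in> borel_measurable borel" and \<beta>m: "\<And>n. \<beta> n \<in> borel_measurable borel"
    and m: "\<forall>\<^sub>F n in sequentially. \<forall>z\<in>{-1..1}. \<bar>m n z\<bar> \<le> Cm"
    and \<beta>: "((\<lambda>p. \<beta> (fst p) (snd p)) \<longlongrightarrow> c') Win"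
  shows "bounded_in_prob (\<lambda>n \<omega>. (\<Sum>i<n. summand m (\<lambda>n x. 0) \<beta> n (X i \<omega>, Y i \<omega>)) / sqrt (real n * h n))"
proof -
  define T where "T n \<omega> = (\<Sum>i<n. summand m (\<lambda>n x. 0) \<beta> n (X i \<omega>, Y i \<omega>))" for n \<omega>
  obtain C where C: "\<forall>\<^sub>F n in sequentially. integrable M (\<lambda>\<omega>. (T n \<omega>)\<^sup>2) \<and> expectation (\<lambda>\<omega>. (T n \<omega>)\<^sup>2) \<le> real n * h n * C"
    using summand_sum_moments[where \<alpha> = "\<lambda>n x. 0" and c = 0, OF mm _ \<beta>m m _ \<beta>] unfolding T_def by auto
  have nh0: "\<forall>\<^sub>F n in sequentially. 0 < real n * h n"
    using nh_lim by (simp add: filterlim_at_top_dense)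
  show ?thesis unfolding T_def[symmetric]
  proof (rule bounded_in_prob_L2[where C = C], use C nh0 in eventually_elim)
    case (elim n)
    then have "expectation (\<lambda>\<omega>. (T n \<omega>)\<^sup>2) / (real n * h n) \<le> C"
      by (simp add: pos_divide_le_eq mult.commute)
    then show ?case using elim by (simp add: power_divide)
  qed
qed

text \<open>A large summand has either a residual above \<open>B\<close> or a large kernel value.
  The first part is small by the local Lindeberg condition. In the second, the kernel exceeds a
  threshold tending to infinity; since K may be unbounded, this part is removed by dominated
  convergence with the square of K as majorant.\<close>

lemma noise_tail:
  assumes mm [measurable]: "\<And>n. m n \<in> borel_measurable borel" and \<beta>m [measurable]: "\<And>n. \<beta> n \<in> borel_measurable borel"
    and m: "\<forall>\<^sub>F n in sequentially. \<forall>z\<in>{-1..1}. \<bar>m n z\<bar> \<le> Cm"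
    and \<beta>: "((\<lambda>p. \<beta> (fst p) (snd p)) \<longlongrightarrow> c') Win"
    and s: "filterlim s at_top sequentially"
  shows "(\<lambda>n. expectation (\<lambda>\<omega>. if s n < \<bar>summand m (\<lambda>n x. 0) \<beta> n (X 0 \<omega>, Y 0 \<omega>)\<bar>
      then (summand m (\<lambda>n x. 0) \<beta> n (X 0 \<omega>, Y 0 \<omega>))\<^sup>2 else 0) / h n) \<longlonglongrightarrow> 0"
proof (rule tendstoI)
  fix \<epsilon> :: real assume \<epsilon>: "0 < \<epsilon>"
  define C where "C = (\<bar>Cm\<bar> + 1) * (\<bar>c'\<bar> + 1)"
  have C: "0 < C" by (simp add: C_def add_nonneg_pos)
  define I2 where "I2 = (LINT z|lborel. (K z)\<^sup>2)"
  have I2: "0 \<le> I2" by (simp add: I2_def)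
  \<comment> \<open>Collects the constant in front of the Lindeberg part; the added 1 makes it
    positive, so that dividing \<epsilon> by 2 D is legitimate.\<close>
  define D where "D = C\<^sup>2 * Cb * I2 + 1"
  have D: "0 < D" using Cb_nonneg I2 by (simp add: D_def add_nonneg_pos)
  define \<epsilon>' where "\<epsilon>' = \<epsilon> / (2 * D)"
  have \<epsilon>': "0 < \<epsilon>'" using \<epsilon> D by (simp add: \<epsilon>'_def)
  obtain \<delta> B where \<delta>: "0 < \<delta>" and tail: "\<And>\<psi>. \<psi> \<in> borel_measurable borel \<Longrightarrow> (\<And>x. \<delta> \<le> \<bar>x - xd\<bar> \<Longrightarrow> \<psi> x = 0) \<Longrightarrow>
    (\<integral>\<^sup>+\<omega>. \<psi> (X 0 \<omega>) * (if B < \<bar>Y 0 \<omega> - \<mu> (X 0 \<omega>)\<bar> then ennreal ((Y 0 \<omega> - \<mu> (X 0 \<omega>))\<^sup>2) else 0) \<partial>M)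
      \<le> (\<integral>\<^sup>+\<omega>. \<psi> (X 0 \<omega>) * ennreal \<epsilon>' \<partial>M)"
    using nn_expectation_tail[OF \<epsilon>'] by blast
  \<comment> \<open>If the other factors are at most C (|B| + 1), a summand above \<open>s n\<close>
    forces the kernel above this level.\<close>
  define \<theta> where "\<theta> n = s n / (C * (\<bar>B\<bar> + 1))" for n
  have CB: "0 < C * (\<bar>B\<bar> + 1)" using C by (simp add: add_nonneg_pos)
  have \<theta>: "filterlim \<theta> at_top sequentially"
    unfolding \<theta>_def using filterlim_tendsto_pos_mult_at_top[OF tendsto_const[of "1 / (C * (\<bar>B\<bar> + 1))"] _ s] CB by simp
  define J where "J n z = (if \<theta> n < K z then (K z)\<^sup>2 else 0)" for n z
  have [measurable]: "J n \<in> borel_measurable borel" for n unfolding J_def by measurable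
  have Ji: "integrable lborel (J n)" for n
    by (rule Bochner_Integration.integrable_bound[OF K_square]) (auto simp: J_def)
  have J: "kernel_fun (J n)" for n
    using Ji by (auto simp: kernel_fun_def J_def K_outside)
  have "(\<lambda>n. LINT z|lborel. J n z) \<longlonglongrightarrow> (LINT z::real|lborel. (0::real))"
  proof (rule Bochner_Integration.integral_dominated_convergence[where w = "\<lambda>z. (K z)\<^sup>2"])
    show "AE z in lborel. (\<lambda>n. J n z) \<longlonglongrightarrow> 0"
    proof (rule AE_I2)
      fix z
      have "\<forall>\<^sub>F n in sequentially. K z < \<theta> n" using \<theta> by (simp add: filterlim_at_top_dense)
      then have "\<forall>\<^sub>F n in sequentially. J n z = 0" by eventually_elim (simp add: J_def)
      then show "(\<lambda>n. J n z) \<longlonglongrightarrow> 0" by (rule tendsto_eventually)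
    qed
    show "AE z in lborel. norm (J n z) \<le> (K z)\<^sup>2" for n by (rule AE_I2) (simp add: J_def)
  qed (use K_square in auto)
  then have JL: "(\<lambda>n. C\<^sup>2 * Cb * Cb * (LINT z|lborel. J n z)) \<longlonglongrightarrow> 0"
    by (auto intro: tendsto_mult_right_zero)
  note ed = eventually_window_small[OF \<delta>]
  have "0 < \<epsilon> / 2" using \<epsilon> by simp
  from order_tendstoD(2)[OF JL this] m tendsto_Win_bounded[OF \<beta>] eventually_near ed
  show "\<forall>\<^sub>F n in sequentially. dist (expectation (\<lambda>\<omega>. if s n < \<bar>summand m (\<lambda>n x. 0) \<beta> n (X 0 \<omega>, Y 0 \<omega>)\<bar>
      then (summand m (\<lambda>n x. 0) \<beta> n (X 0 \<omega>, Y 0 \<omega>))\<^sup>2 else 0) / h n) 0 < \<epsilon>"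
  proof eventually_elim
    case (elim n)
    note near = elim(4)
    let ?b = "\<lambda>x. m n (Z n x) * \<beta> n x"
    let ?G = "\<lambda>\<omega>. summand m (\<lambda>n x. 0) \<beta> n (X 0 \<omega>, Y 0 \<omega>)"
    let ?u = "\<lambda>\<omega>. Y 0 \<omega> - \<mu> (X 0 \<omega>)"
    have G: "?G \<omega> = K (Z n (X 0 \<omega>)) * ?b (X 0 \<omega>) * ?u \<omega>" for \<omega> by (simp add: summand_def)
    have [measurable]: "?G \<in> borel_measurable M" unfolding G by measurable
    have b: "\<bar>?b x\<bar> \<le> C" if "x \<in> S" "\<bar>x - x0 n\<bar> \<le> h n" for x
    proof -
      have "\<bar>m n (Z n x)\<bar> \<le> \<bar>Cm\<bar> + 1" using bspec[OF elim(2) Z_in[OF that(2)]] by linarith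
      then show ?thesis unfolding abs_mult C_def using elim(3) that by (intro mult_mono) auto
    qed
    have b2: "\<bar>(?b x)\<^sup>2\<bar> \<le> C\<^sup>2" if "x \<in> S" "\<bar>x - x0 n\<bar> \<le> h n" for x
      using power_mono[OF b[OF that] abs_ge_zero, of 2] by simp
    have C2: "0 \<le> C\<^sup>2" by simp
    define \<psi> where "\<psi> x = (K (Z n x))\<^sup>2 * (?b x)\<^sup>2" for x
    have [measurable]: "\<psi> \<in> borel_measurable borel" unfolding \<psi>_def by measurable
    have \<psi>0: "\<psi> x = 0" if "\<delta> \<le> \<bar>x - xd\<bar>" for x
    proof -
      have "\<not> \<bar>x - x0 n\<bar> \<le> h n" using that elim(5) by linarith
      then have "Z n x \<notin> {-1..1}" using scaled_in_window[OF h_gt_0[of n], of x "x0 n"] by blast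
      then show ?thesis by (simp add: \<psi>_def K_outside)
    qed
    have i\<psi>: "integrable M (\<lambda>\<omega>. \<psi> (X 0 \<omega>))"
      and e\<psi>: "\<bar>expectation (\<lambda>\<omega>. \<psi> (X 0 \<omega>))\<bar> \<le> h n * (C\<^sup>2 * Cb * I2)"
      unfolding I2_def \<psi>_def
      by (rule kernel_expectation(1,3)[where \<alpha> = "\<lambda>x. (?b x)\<^sup>2", OF near kernel_fun_K2 _ b2 C2]; simp)+
    have iJ: "integrable M (\<lambda>\<omega>. J n (Z n (X 0 \<omega>)) * (?b (X 0 \<omega>))\<^sup>2 * (?u \<omega>)\<^sup>2)"
      and eJ: "expectation (\<lambda>\<omega>. J n (Z n (X 0 \<omega>)) * (?b (X 0 \<omega>))\<^sup>2 * (?u \<omega>)\<^sup>2) \<le> h n * (C\<^sup>2 * Cb * Cb * (LINT z|lborel. J n z))"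
      by (rule kernel_expectation_square(1,3)[where \<alpha> = "\<lambda>x. (?b x)\<^sup>2", OF near J _ b2 C2]; simp)+
    have "AE \<omega> in M. ennreal (if s n < \<bar>?G \<omega>\<bar> then (?G \<omega>)\<^sup>2 else 0)
      \<le> ennreal (\<psi> (X 0 \<omega>)) * (if B < \<bar>?u \<omega>\<bar> then ennreal ((?u \<omega>)\<^sup>2) else 0)
        + ennreal (J n (Z n (X 0 \<omega>)) * (?b (X 0 \<omega>))\<^sup>2 * (?u \<omega>)\<^sup>2)"
      using AE_X_in_S
    proof eventually_elim
      case (elim \<omega>)
      have Gs: "(?G \<omega>)\<^sup>2 = \<psi> (X 0 \<omega>) * (?u \<omega>)\<^sup>2" unfolding G \<psi>_def by (simp add: power_mult_distrib)
      show ?case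
      proof (cases "s n < \<bar>?G \<omega>\<bar>")
        case sG: True
        show ?thesis
        proof (cases "B < \<bar>?u \<omega>\<bar>")
          case True
          then show ?thesis using sG Gs by (simp add: \<psi>_def ennreal_mult[symmetric])
        next
          case False
          \<comment> \<open>In either case \<psi> may be replaced by its truncated version: above
            the threshold the two coincide, and where K vanishes both are 0. The second alternative
            includes observations outside the window, for which no bound on the weight is
            available.\<close>
          have "K (Z n (X 0 \<omega>)) * (C * (\<bar>B\<bar> + 1)) > s n \<or> K (Z n (X 0 \<omega>)) = 0"
          proof (cases "\<bar>X 0 \<omega> - x0 n\<bar> \<le> h n")
            case True
            have "\<bar>?b (X 0 \<omega>) * ?u \<omega>\<bar> \<le> C * (\<bar>B\<bar> + 1)"
              unfolding abs_mult[of _ "?u \<omega>"] using b[OF elim True] False C by (intro mult_mono) auto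
            then have "K (Z n (X 0 \<omega>)) * \<bar>?b (X 0 \<omega>) * ?u \<omega>\<bar> \<le> K (Z n (X 0 \<omega>)) * (C * (\<bar>B\<bar> + 1))"
              by (rule mult_left_mono) (rule K_nonneg)
            moreover have "\<bar>?G \<omega>\<bar> = K (Z n (X 0 \<omega>)) * \<bar>?b (X 0 \<omega>) * ?u \<omega>\<bar>"
              unfolding G using K_nonneg[of "Z n (X 0 \<omega>)"] by (simp add: abs_mult mult.assoc)
            ultimately show ?thesis using sG by simp
          next
            case False
            then have "Z n (X 0 \<omega>) \<notin> {-1..1}" using scaled_in_window[OF h_gt_0[of n], of "X 0 \<omega>" "x0 n"] by blast
            then show ?thesis by (simp add: K_outside)
          qed
          then have "\<psi> (X 0 \<omega>) = J n (Z n (X 0 \<omega>)) * (?b (X 0 \<omega>))\<^sup>2"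
            unfolding \<psi>_def J_def \<theta>_def using CB by (auto simp: pos_divide_less_eq)
          then show ?thesis using sG Gs by simp
        qed
      qed simp
    qed
    then have "(\<integral>\<^sup>+\<omega>. ennreal (if s n < \<bar>?G \<omega>\<bar> then (?G \<omega>)\<^sup>2 else 0) \<partial>M)
      \<le> (\<integral>\<^sup>+\<omega>. ennreal (\<psi> (X 0 \<omega>)) * (if B < \<bar>?u \<omega>\<bar> then ennreal ((?u \<omega>)\<^sup>2) else 0)
        + ennreal (J n (Z n (X 0 \<omega>)) * (?b (X 0 \<omega>))\<^sup>2 * (?u \<omega>)\<^sup>2) \<partial>M)"
      by (rule nn_integral_mono_AE)
    also have "\<dots> = (\<integral>\<^sup>+\<omega>. ennreal (\<psi> (X 0 \<omega>)) * (if B < \<bar>?u \<omega>\<bar> then ennreal ((?u \<omega>)\<^sup>2) else 0) \<partial>M)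
        + (\<integral>\<^sup>+\<omega>. ennreal (J n (Z n (X 0 \<omega>)) * (?b (X 0 \<omega>))\<^sup>2 * (?u \<omega>)\<^sup>2) \<partial>M)"
      by (rule nn_integral_add) measurable
    also have "\<dots> \<le> ennreal (h n * (C\<^sup>2 * Cb * I2) * \<epsilon>') + ennreal (h n * (C\<^sup>2 * Cb * Cb * (LINT z|lborel. J n z)))"
    proof (rule add_mono)
      have "(\<integral>\<^sup>+\<omega>. ennreal (\<psi> (X 0 \<omega>)) * (if B < \<bar>?u \<omega>\<bar> then ennreal ((?u \<omega>)\<^sup>2) else 0) \<partial>M)
        \<le> (\<integral>\<^sup>+\<omega>. ennreal (\<psi> (X 0 \<omega>)) * ennreal \<epsilon>' \<partial>M)"
        by (rule tail) (simp_all add: \<psi>0)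
      also have "\<dots> = (\<integral>\<^sup>+\<omega>. ennreal (\<psi> (X 0 \<omega>) * \<epsilon>') \<partial>M)"
        using \<epsilon>' by (simp add: ennreal_mult \<psi>_def)
      also have "\<dots> = ennreal (expectation (\<lambda>\<omega>. \<psi> (X 0 \<omega>) * \<epsilon>'))"
        using \<epsilon>' i\<psi> by (intro nn_integral_eq_integral) (auto simp: \<psi>_def)
      also have "\<dots> \<le> ennreal (h n * (C\<^sup>2 * Cb * I2) * \<epsilon>')"
        using e\<psi> \<epsilon>' by (intro ennreal_leI) (auto intro: mult_right_mono)
      finally show "(\<integral>\<^sup>+\<omega>. ennreal (\<psi> (X 0 \<omega>)) * (if B < \<bar>?u \<omega>\<bar> then ennreal ((?u \<omega>)\<^sup>2) else 0) \<partial>M)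
        \<le> ennreal (h n * (C\<^sup>2 * Cb * I2) * \<epsilon>')" .
      have "(\<integral>\<^sup>+\<omega>. ennreal (J n (Z n (X 0 \<omega>)) * (?b (X 0 \<omega>))\<^sup>2 * (?u \<omega>)\<^sup>2) \<partial>M)
        = ennreal (expectation (\<lambda>\<omega>. J n (Z n (X 0 \<omega>)) * (?b (X 0 \<omega>))\<^sup>2 * (?u \<omega>)\<^sup>2))"
        using kernel_funD(3)[OF J] by (intro nn_integral_eq_integral iJ) auto
      also have "\<dots> \<le> ennreal (h n * (C\<^sup>2 * Cb * Cb * (LINT z|lborel. J n z)))"
        by (rule ennreal_leI[OF eJ])
      finally show "(\<integral>\<^sup>+\<omega>. ennreal (J n (Z n (X 0 \<omega>)) * (?b (X 0 \<omega>))\<^sup>2 * (?u \<omega>)\<^sup>2) \<partial>M)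
        \<le> ennreal (h n * (C\<^sup>2 * Cb * Cb * (LINT z|lborel. J n z)))" .
    qed
    also have "\<dots> = ennreal (h n * (C\<^sup>2 * Cb * I2 * \<epsilon>' + C\<^sup>2 * Cb * Cb * (LINT z|lborel. J n z)))"
      using h_gt_0[of n] Cb_nonneg I2 \<epsilon>' kernel_funD(6)[OF J, of n]
      by (subst ennreal_plus[symmetric]) (auto simp: distrib_left mult.assoc)
    finally have "(\<integral>\<^sup>+\<omega>. ennreal (if s n < \<bar>?G \<omega>\<bar> then (?G \<omega>)\<^sup>2 else 0) \<partial>M) \<le> \<dots>" .
    then have "expectation (\<lambda>\<omega>. if s n < \<bar>?G \<omega>\<bar> then (?G \<omega>)\<^sup>2 else 0) \<le> h n * (C\<^sup>2 * Cb * I2 * \<epsilon>' + C\<^sup>2 * Cb * Cb * (LINT z|lborel. J n z))"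
      using h_gt_0[of n] Cb_nonneg I2 \<epsilon>' kernel_funD(6)[OF J, of n]
      by (subst integral_eq_nn_integral) (auto intro!: enn2real_leI)
    then have "expectation (\<lambda>\<omega>. if s n < \<bar>?G \<omega>\<bar> then (?G \<omega>)\<^sup>2 else 0) / h n \<le> C\<^sup>2 * Cb * I2 * \<epsilon>' + C\<^sup>2 * Cb * Cb * (LINT z|lborel. J n z)"
      using h_gt_0[of n] by (simp add: pos_divide_le_eq mult.commute)
    moreover have "C\<^sup>2 * Cb * I2 * \<epsilon>' \<le> D * \<epsilon>'" using \<epsilon>' by (intro mult_right_mono) (auto simp: D_def)
    moreover have "D * \<epsilon>' = \<epsilon> / 2" using D by (simp add: \<epsilon>'_def)
    moreover have "0 \<le> expectation (\<lambda>\<omega>. if s n < \<bar>?G \<omega>\<bar> then (?G \<omega>)\<^sup>2 else 0) / h n"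
      using h_gt_0[of n] by (intro divide_nonneg_pos integral_nonneg_AE) auto
    ultimately show ?case using elim(1) unfolding dist_real_def by linarith
  qed
qed

text \<open>The variance \<open>T n\<close> follows the window and need not converge, so each row is
  standardized by its own value; the lower bound \<delta> keeps the standardized Lindeberg sums
  under control.\<close>

lemma noise_clt:
  assumes mm [measurable]: "\<And>n. m n \<in> borel_measurable borel" and \<beta>m [measurable]: "\<And>n. \<beta> n \<in> borel_measurable borel"
    and m: "\<forall>\<^sub>F n in sequentially. \<forall>z\<in>{-1..1}. \<bar>m n z\<bar> \<le> Cm"
    and \<beta>: "((\<lambda>p. \<beta> (fst p) (snd p)) \<longlongrightarrow> c') Win"
    and T: "\<And>n. T n = c'\<^sup>2 * v xd * f xd * (LINT z:Dom n|lborel. (m n z)\<^sup>2 * (K z)\<^sup>2)"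
    and \<delta>: "0 < \<delta>" "\<forall>\<^sub>F n in sequentially. \<delta> \<le> T n"
  shows "(\<lambda>n. char (distr M borel (\<lambda>\<omega>. (\<Sum>i<n. summand m (\<lambda>n x. 0) \<beta> n (X i \<omega>, Y i \<omega>)) / (sqrt (real n * h n) * sqrt (T n)))) t)
    \<longlonglongrightarrow> char std_normal_distribution t"
proof -
  define G where "G n = summand m (\<lambda>n x. 0) \<beta> n" for n
  define q where "q n = sqrt (real n * h n) * sqrt (T n)" for n
  define F where "F n i \<omega> = G n (X i \<omega>, Y i \<omega>) / q n" for n i \<omega>
  have Gm [measurable]: "G n \<in> borel_measurable borel" for n
    unfolding G_def by (rule summand_measurable[where \<alpha> = "\<lambda>n x. 0" and c = 0, OF mm _ \<beta>m m _ \<beta>]) auto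
  have Gq [measurable]: "(\<lambda>p. G n p / q n) \<in> borel_measurable borel" for n by measurable
  have nh0: "\<forall>\<^sub>F n in sequentially. 0 < real n * h n"
    using nh_lim by (simp add: filterlim_at_top_dense)
  have q2: "\<forall>\<^sub>F n in sequentially. (q n)\<^sup>2 = real n * h n * T n \<and> 0 < q n \<and> 0 < T n \<and> 0 < real n * h n"
    using nh0 \<delta>(2) by eventually_elim (use \<delta>(1) in \<open>simp add: q_def power_mult_distrib\<close>)
  have near: "\<forall>\<^sub>F n in sequentially. \<forall>x\<in>S. \<bar>x - x0 n\<bar> \<le> h n \<longrightarrow> \<bar>m n (Z n x) * \<beta> n x\<bar> \<le> (\<bar>Cm\<bar> + 1) * (\<bar>c'\<bar> + 1)"
    using m tendsto_Win_bounded[OF \<beta>]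
  proof eventually_elim
    case (elim n)
    have "\<bar>m n (Z n x)\<bar> \<le> \<bar>Cm\<bar> + 1" if "\<bar>x - x0 n\<bar> \<le> h n" for x
      using bspec[OF elim(1) Z_in[OF that]] by linarith
    then show ?case unfolding abs_mult using elim(2) by (auto intro!: mult_mono)
  qed
  have mom: "\<forall>\<^sub>F n in sequentially. integrable M (\<lambda>\<omega>. (G n (X 0 \<omega>, Y 0 \<omega>))\<^sup>2) \<and> expectation (\<lambda>\<omega>. G n (X 0 \<omega>, Y 0 \<omega>)) = 0"
    using summand_moments[where \<alpha> = "\<lambda>n x. 0" and c = 0, OF mm _ \<beta>m m _ \<beta>] unfolding G_def
    by (auto elim: eventually_mono)
  have var_lim: "(\<lambda>n. expectation (\<lambda>\<omega>. (G n (X 0 \<omega>, Y 0 \<omega>))\<^sup>2) / h n - T n) \<longlonglongrightarrow> 0"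
  proof (rule Lim_transform_eventually)
    have "((\<lambda>p. (\<beta> (fst p) (snd p))\<^sup>2 * v (snd p)) \<longlongrightarrow> c'\<^sup>2 * v xd) Win"
      by (intro tendsto_intros \<beta> tendsto_Win_continuous_on v_cont)
    moreover have "\<forall>\<^sub>F n in sequentially. \<forall>z\<in>{-1..1}. \<bar>(m n z)\<^sup>2\<bar> \<le> Cm\<^sup>2"
      using m
    proof eventually_elim
      case (elim n)
      show ?case
      proof
        fix z :: real assume "z \<in> {-1..1}"
        then have "\<bar>m n z\<bar> \<le> Cm" using elim by blast
        from power_mono[OF this abs_ge_zero, of 2] show "\<bar>(m n z)\<^sup>2\<bar> \<le> Cm\<^sup>2" by simp
      qed
    qed
    ultimately show "(\<lambda>n. expectation (\<lambda>\<omega>. (K (Z n (X 0 \<omega>)))\<^sup>2 * ((m n (Z n (X 0 \<omega>)))\<^sup>2 * ((\<beta> n (X 0 \<omega>))\<^sup>2 * v (X 0 \<omega>)))) / h n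
       - c'\<^sup>2 * v xd * f xd * (LINT z:Dom n|lborel. (m n z)\<^sup>2 * (K z)\<^sup>2)) \<longlonglongrightarrow> 0"
      by (intro kernel_expectation_limit[OF kernel_fun_K2, where \<alpha> = "\<lambda>n x. (\<beta> n x)\<^sup>2 * v x" and m = "\<lambda>n z. (m n z)\<^sup>2"]) auto
    show "\<forall>\<^sub>F n in sequentially. expectation (\<lambda>\<omega>. (K (Z n (X 0 \<omega>)))\<^sup>2 * ((m n (Z n (X 0 \<omega>)))\<^sup>2 * ((\<beta> n (X 0 \<omega>))\<^sup>2 * v (X 0 \<omega>)))) / h n
       - c'\<^sup>2 * v xd * f xd * (LINT z:Dom n|lborel. (m n z)\<^sup>2 * (K z)\<^sup>2) = expectation (\<lambda>\<omega>. (G n (X 0 \<omega>, Y 0 \<omega>))\<^sup>2) / h n - T n"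
      using near eventually_near
    proof eventually_elim
      case (elim n)
      let ?b = "\<lambda>x. m n (Z n x) * \<beta> n x"
      have b2: "\<bar>(?b x)\<^sup>2\<bar> \<le> ((\<bar>Cm\<bar> + 1) * (\<bar>c'\<bar> + 1))\<^sup>2" if "x \<in> S" "\<bar>x - x0 n\<bar> \<le> h n" for x
        using power_mono[OF elim(1)[rule_format, OF that] abs_ge_zero, of 2] by simp
      have "expectation (\<lambda>\<omega>. (G n (X 0 \<omega>, Y 0 \<omega>))\<^sup>2) = expectation (\<lambda>\<omega>. (K (Z n (X 0 \<omega>)))\<^sup>2 * (?b (X 0 \<omega>))\<^sup>2 * (Y 0 \<omega> - \<mu> (X 0 \<omega>))\<^sup>2)"
        by (simp add: G_def summand_def power_mult_distrib mult.assoc)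
      also have "\<dots> = expectation (\<lambda>\<omega>. (K (Z n (X 0 \<omega>)))\<^sup>2 * ((?b (X 0 \<omega>))\<^sup>2 * v (X 0 \<omega>)))"
        by (rule kernel_expectation_square(2)[where \<alpha> = "\<lambda>x. (?b x)\<^sup>2", OF elim(2) kernel_fun_K2 _ b2]) auto
      finally show ?case unfolding T by (simp add: power_mult_distrib mult.assoc)
    qed
  qed
  have "(\<lambda>n. char (distr M borel (\<lambda>\<omega>. \<Sum>i<n. F n i \<omega>)) t) \<longlonglongrightarrow> char std_normal_distribution t"
  proof (rule triangular_iid_clt)
    show "indep_vars (\<lambda>_. borel) (F n) {..<n}" for n
      unfolding F_def by (rule iid_functional(1)[OF Gq])
    show "F n 0 \<in> borel_measurable M" for n
      unfolding F_def by (rule measurable_compose[OF pair_measurable Gq])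
    show "distr M borel (F n i) = distr M borel (F n 0)" for n i
      unfolding F_def by (rule iid_functional(2)[OF Gq])
    show "\<forall>\<^sub>F n in sequentially. integrable M (\<lambda>\<omega>. (F n 0 \<omega>)\<^sup>2) \<and> expectation (F n 0) = 0"
      using mom unfolding F_def by eventually_elim (simp add: power_divide)
    show "(\<lambda>n. real n * expectation (\<lambda>\<omega>. (F n 0 \<omega>)\<^sup>2)) \<longlonglongrightarrow> 1"
    proof (rule Lim_transform_eventually)
      have "(\<lambda>n. (expectation (\<lambda>\<omega>. (G n (X 0 \<omega>, Y 0 \<omega>))\<^sup>2) / h n - T n) * (1 / T n)) \<longlonglongrightarrow> 0"
      proof (rule Lim_null_comparison)
        show "\<forall>\<^sub>F n in sequentially. norm ((expectation (\<lambda>\<omega>. (G n (X 0 \<omega>, Y 0 \<omega>))\<^sup>2) / h n - T n) * (1 / T n))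
           \<le> \<bar>expectation (\<lambda>\<omega>. (G n (X 0 \<omega>, Y 0 \<omega>))\<^sup>2) / h n - T n\<bar> * (1 / \<delta>)"
          using \<delta>(2)
        proof eventually_elim
          case (elim n)
          have "\<bar>1 / T n\<bar> \<le> 1 / \<delta>" using elim \<delta>(1) by (simp add: frac_le)
          then show ?case unfolding real_norm_def abs_mult by (rule mult_left_mono) simp
        qed
        show "(\<lambda>n. \<bar>expectation (\<lambda>\<omega>. (G n (X 0 \<omega>, Y 0 \<omega>))\<^sup>2) / h n - T n\<bar> * (1 / \<delta>)) \<longlonglongrightarrow> 0"
          by (intro tendsto_mult_left_zero tendsto_rabs_zero var_lim)
      qed
      from tendsto_add[OF this tendsto_const[of 1]]
      show "(\<lambda>n. (expectation (\<lambda>\<omega>. (G n (X 0 \<omega>, Y 0 \<omega>))\<^sup>2) / h n - T n) * (1 / T n) + 1) \<longlonglongrightarrow> 1" by simp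
      show "\<forall>\<^sub>F n in sequentially. (expectation (\<lambda>\<omega>. (G n (X 0 \<omega>, Y 0 \<omega>))\<^sup>2) / h n - T n) * (1 / T n) + 1 = real n * expectation (\<lambda>\<omega>. (F n 0 \<omega>)\<^sup>2)"
        using q2
      proof eventually_elim
        case (elim n)
        then have "0 < n" using h_gt_0[of n] by (simp add: zero_less_mult_iff)
        have "expectation (\<lambda>\<omega>. (F n 0 \<omega>)\<^sup>2) = expectation (\<lambda>\<omega>. (G n (X 0 \<omega>, Y 0 \<omega>))\<^sup>2) / (real n * h n * T n)"
          using elim unfolding F_def by (simp add: power_divide)
        then show ?case using elim \<open>0 < n\<close> h_gt_0[of n] by (simp add: field_simps)
      qed
    qed
    fix \<epsilon> :: real assume \<epsilon>: "0 < \<epsilon>"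
    \<comment> \<open>A threshold for the unstandardized summand that does not involve
      \<open>T n\<close>: since \<delta> <= \<open>T n\<close>, exceeding \<epsilon> after
      standardization implies exceeding \<open>s n\<close> before.\<close>
    define s where "s n = \<epsilon> * sqrt \<delta> * sqrt (real n * h n)" for n
    have s: "filterlim s at_top sequentially"
      unfolding s_def using \<epsilon> \<delta>(1)
      by (intro filterlim_tendsto_pos_mult_at_top[OF tendsto_const] filterlim_compose[OF sqrt_at_top nh_lim]) auto
    let ?L = "\<lambda>n. expectation (\<lambda>\<omega>. if s n < \<bar>G n (X 0 \<omega>, Y 0 \<omega>)\<bar> then (G n (X 0 \<omega>, Y 0 \<omega>))\<^sup>2 else 0) / h n"
    have L: "?L \<longlonglongrightarrow> 0"
      using noise_tail[OF mm \<beta>m m \<beta> s] unfolding G_def by simp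
    show "(\<lambda>n. real n * expectation (\<lambda>\<omega>. if \<epsilon> < \<bar>F n 0 \<omega>\<bar> then (F n 0 \<omega>)\<^sup>2 else 0)) \<longlonglongrightarrow> 0"
    proof (rule Lim_null_comparison)
      show "(\<lambda>n. ?L n * (1 / \<delta>)) \<longlonglongrightarrow> 0" by (rule tendsto_mult_left_zero[OF L])
      show "\<forall>\<^sub>F n in sequentially. norm (real n * expectation (\<lambda>\<omega>. if \<epsilon> < \<bar>F n 0 \<omega>\<bar> then (F n 0 \<omega>)\<^sup>2 else 0)) \<le> ?L n * (1 / \<delta>)"
        using q2 \<delta>(2) mom
      proof eventually_elim
        case (elim n)
        then have n: "0 < n" using h_gt_0[of n] by (simp add: zero_less_mult_iff)
        have [measurable]: "(\<lambda>\<omega>. G n (X 0 \<omega>, Y 0 \<omega>)) \<in> borel_measurable M"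
          by (rule measurable_compose[OF pair_measurable Gm])
        have sq: "s n \<le> \<epsilon> * q n"
          unfolding s_def q_def using \<epsilon> elim by (simp add: mult.assoc mult.commute[of "sqrt \<delta>"] mult_left_mono)
        have "expectation (\<lambda>\<omega>. if \<epsilon> < \<bar>F n 0 \<omega>\<bar> then (F n 0 \<omega>)\<^sup>2 else 0)
          \<le> expectation (\<lambda>\<omega>. (if s n < \<bar>G n (X 0 \<omega>, Y 0 \<omega>)\<bar> then (G n (X 0 \<omega>, Y 0 \<omega>))\<^sup>2 else 0) / (q n)\<^sup>2)"
        proof (rule integral_mono')
          show "integrable M (\<lambda>\<omega>. (if s n < \<bar>G n (X 0 \<omega>, Y 0 \<omega>)\<bar> then (G n (X 0 \<omega>, Y 0 \<omega>))\<^sup>2 else 0) / (q n)\<^sup>2)"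
            by (intro integrable_divide Bochner_Integration.integrable_bound[OF elim(3)[THEN conjunct1]]) auto
          fix \<omega>
          show "(if \<epsilon> < \<bar>F n 0 \<omega>\<bar> then (F n 0 \<omega>)\<^sup>2 else 0) \<le> (if s n < \<bar>G n (X 0 \<omega>, Y 0 \<omega>)\<bar> then (G n (X 0 \<omega>, Y 0 \<omega>))\<^sup>2 else 0) / (q n)\<^sup>2"
          proof (cases "\<epsilon> < \<bar>F n 0 \<omega>\<bar>")
            case True
            then have "\<epsilon> * q n < \<bar>G n (X 0 \<omega>, Y 0 \<omega>)\<bar>"
              using elim(1) by (simp add: F_def abs_divide pos_less_divide_eq)
            then have "s n < \<bar>G n (X 0 \<omega>, Y 0 \<omega>)\<bar>" using sq by linarith
            then show ?thesis using True by (simp add: F_def power_divide)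
          qed simp
        qed auto
        then have "real n * expectation (\<lambda>\<omega>. if \<epsilon> < \<bar>F n 0 \<omega>\<bar> then (F n 0 \<omega>)\<^sup>2 else 0)
          \<le> real n * (expectation (\<lambda>\<omega>. if s n < \<bar>G n (X 0 \<omega>, Y 0 \<omega>)\<bar> then (G n (X 0 \<omega>, Y 0 \<omega>))\<^sup>2 else 0) / (q n)\<^sup>2)"
          by (intro mult_left_mono) auto
        also have "\<dots> = ?L n * (1 / T n)"
          using elim(1) n h_gt_0[of n] by (simp add: field_simps)
        also have "\<dots> \<le> ?L n * (1 / \<delta>)"
          using elim \<delta>(1) h_gt_0[of n] by (intro mult_left_mono frac_le divide_nonneg_pos integral_nonneg_AE) auto
        finally show ?case by (simp add: integral_nonneg_AE)
      qed
    qed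
  qed
  then show ?thesis unfolding F_def q_def G_def by (simp add: sum_divide_distrib)
qed

end

subsection \<open>The guided local quasi-likelihood fit\<close>

locale guided_fit =
  regression_asymp M K X Y f \<mu> v S xd r Cb x0 h + quasi_link_at I YY g ginv V Q "\<mu> xd"
  for M :: "'a measure" and K :: "real \<Rightarrow> real" and X Y :: "nat \<Rightarrow> 'a \<Rightarrow> real" and f \<mu> v :: "real \<Rightarrow> real"
    and S :: "real set" and xd r Cb :: real and x0 h :: "nat \<Rightarrow> real"
    and I YY :: "real set" and g ginv V :: "real \<Rightarrow> real" and Q :: "real \<Rightarrow> real \<Rightarrow> real" +
  fixes e :: "real \<Rightarrow> real" and \<gamma> :: real and p :: nat and bhat :: "nat \<Rightarrow> 'a \<Rightarrow> nat \<Rightarrow> real"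
  assumes Y_in: "\<And>i \<omega>. \<omega> \<in> space M \<Longrightarrow> Y i \<omega> \<in> YY"
    and \<mu>_in: "\<And>x. x \<in> S \<Longrightarrow> \<mu> x \<in> I"
    and eta0_smooth: "times_cont_diff_on (p + 2) (\<lambda>x. g (\<mu> x)) UNIV" and e_smooth: "times_cont_diff_on (p + 2) e UNIV"
    and e_nz: "\<gamma> \<noteq> 0 \<longrightarrow> e xd \<noteq> 0"
    and nh3: "Bseq (\<lambda>n. real n * h n ^ (2 * p + 3))"
    and estimator: "guided_estimator M X Y Q ginv K e \<gamma> p h x0 bhat"
begin

abbreviation "eta0 \<equiv> \<lambda>x. g (\<mu> x)"

definition gp :: "real \<Rightarrow> real" where "gp x = guide_power \<gamma> (e x)"

definition Dphi :: "nat \<Rightarrow> real \<Rightarrow> real" where "Dphi j = (deriv ^^ j) (phi \<gamma> eta0 e)"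

definition taylor :: "nat \<Rightarrow> real \<Rightarrow> real" where
  "taylor n x = (\<Sum>j\<le>p. Dphi j (x0 n) / fact j * (x - x0 n) ^ j)"

text \<open>The linear predictor \<open>ts\<close> of the best local approximation and its coefficients \<open>bs\<close>: in the
  guided family the polynomial part approximates \<open>phi\<close>.\<close>

definition ts :: "nat \<Rightarrow> real \<Rightarrow> real" where "ts n x = e x + gp x * taylor n x"

definition wt :: "nat \<Rightarrow> real \<Rightarrow> real" where "wt n x = gp x / gp (x0 n)"

definition bs :: "nat \<Rightarrow> nat \<Rightarrow> real" where
  "bs n j = gp (x0 n) * (Dphi j (x0 n) / fact j) + (if j = 0 then e (x0 n) else 0)"

abbreviation "t0 \<equiv> g (\<mu> xd)"

section \<open>The approximating predictor and its error\<close>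

lemma eta0_continuous: "continuous_on UNIV eta0" and e_continuous: "continuous_on UNIV e"
  by (rule times_cont_diff_on_continuous[OF eta0_smooth], rule times_cont_diff_on_continuous[OF e_smooth])

lemma e_measurable [measurable]: "e \<in> borel_measurable borel"
  by (rule borel_measurable_continuous_onI[OF e_continuous])

lemma gp_measurable [measurable]: "gp \<in> borel_measurable borel"
  unfolding gp_def[abs_def] by measurable

lemma ts_measurable [measurable]: "ts n \<in> borel_measurable borel" and wt_measurable [measurable]: "wt n \<in> borel_measurable borel"
  unfolding ts_def[abs_def] wt_def[abs_def] taylor_def by measurable

lemma local_smoothness:
  obtains r' where "0 < r'" "times_cont_diff_on (p + 2) (phi \<gamma> eta0 e) (ball xd r')"
    "times_cont_diff_on (p + 2) gp (ball xd r')" "\<And>x. x \<in> ball xd r' \<Longrightarrow> gp x \<noteq> 0"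
proof -
  obtain r' where r': "0 < r'" "times_cont_diff_on (p + 2) (phi \<gamma> eta0 e) (ball xd r')"
    "times_cont_diff_on (p + 2) (\<lambda>x. guide_power \<gamma> (e x)) (ball xd r')"
    "\<forall>x\<in>ball xd r'. guide_power \<gamma> (e x) \<noteq> 0"
    using phi_smooth_near[OF eta0_smooth e_smooth e_nz] by (elim exE conjE) (rule that)
  have gp: "gp = (\<lambda>x. guide_power \<gamma> (e x))" by (rule ext) (rule gp_def)
  show ?thesis
    by (rule that[OF r'(1,2)]) (use r'(3,4) in \<open>simp_all add: gp\<close>)
qed

lemma gp_isCont: "isCont gp xd" and gp_nz: "gp xd \<noteq> 0" and Dphi_isCont: "j \<le> p + 2 \<Longrightarrow> isCont (Dphi j) xd"
proof -
  obtain r' where r': "0 < r'" "times_cont_diff_on (p + 2) (phi \<gamma> eta0 e) (ball xd r')"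
    "times_cont_diff_on (p + 2) gp (ball xd r')" "\<And>x. x \<in> ball xd r' \<Longrightarrow> gp x \<noteq> 0"
    by (rule local_smoothness) blast
  show "isCont gp xd" using r'(1) times_cont_diff_on_continuous[OF r'(3)] by (simp add: continuous_on_eq_continuous_at)
  show "gp xd \<noteq> 0" using r'(1,4) by simp
  assume "j \<le> p + 2"
  then consider "j < p + 2" | "j = p + 2" by linarith
  then show "isCont (Dphi j) xd"
  proof cases
    case 1
    then have "Dphi j differentiable (at xd)"
      using r'(1,2) unfolding times_cont_diff_on_def Dphi_def by auto
    then show ?thesis by (rule differentiable_imp_continuous_within)
  next
    case 2
    then have "continuous_on (ball xd r') (Dphi j)"
      using r'(2) unfolding times_cont_diff_on_def Dphi_def by blast
    then show ?thesis using r'(1) by (simp add: continuous_on_eq_continuous_at)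
  qed
qed

lemma x0_isCont_lim: "isCont F xd \<Longrightarrow> (\<lambda>n. F (x0 n)) \<longlonglongrightarrow> F xd"
  by (rule isCont_tendsto_compose[OF _ x0_lim])

lemma gp_x0_nz: "\<forall>\<^sub>F n in sequentially. gp (x0 n) \<noteq> 0"
  using tendsto_imp_eventually_ne[OF x0_isCont_lim[OF gp_isCont] gp_nz] .

text \<open>By definition of \<open>phi\<close> the true predictor is the guide plus
  \<open>gp\<close> times \<open>phi\<close>, so the error of \<open>ts\<close> is \<open>gp\<close>
  times a Lagrange remainder. The intermediate point is kept as a function of n and x, to be sent to
  \<open>xd\<close> along the filter; the derivative of order p + 1 then needs only
  continuity.\<close>

lemma taylor_remainder:
  "\<exists>\<xi>. ((\<lambda>q. \<xi> (fst q) (snd q)) \<longlongrightarrow> xd) Win \<and>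
    (\<forall>\<^sub>F q in Win. eta0 (snd q) - ts (fst q) (snd q)
       = gp (snd q) * (Dphi (p + 1) (\<xi> (fst q) (snd q)) / fact (p + 1)) * (snd q - x0 (fst q)) ^ (p + 1))"
proof -
  obtain r' where r': "0 < r'" "times_cont_diff_on (p + 2) (phi \<gamma> eta0 e) (ball xd r')"
    "times_cont_diff_on (p + 2) gp (ball xd r')" "\<And>x. x \<in> ball xd r' \<Longrightarrow> gp x \<noteq> 0"
    by (rule local_smoothness) blast
  have sm: "times_cont_diff_on (Suc p) (phi \<gamma> eta0 e) (ball xd r')"
    by (rule times_cont_diff_on_mono[OF r'(2)]) auto
  define P where "P n x t \<longleftrightarrow> \<bar>t - x0 n\<bar> \<le> \<bar>x - x0 n\<bar> \<and>
     eta0 x - ts n x = gp x * (Dphi (p + 1) t / fact (p + 1)) * (x - x0 n) ^ (p + 1)" for n x t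
  \<comment> \<open>A simultaneous choice of intermediate points; outside the window, or for small
    n, the value is arbitrary and the filter does not see it.\<close>
  define \<xi> where "\<xi> n x = (SOME t. P n x t)" for n x
  from eventually_window_small[OF r'(1)]
  have ev: "\<forall>\<^sub>F q in Win. P (fst q) (snd q) (\<xi> (fst q) (snd q))"
    unfolding eventually_Win
  proof eventually_elim
    case (elim n)
    show ?case
    proof (intro ballI impI)
      fix x assume x: "x \<in> S" "\<bar>x - x0 n\<bar> \<le> h n"
      have b: "x0 n \<in> ball xd r'" "x \<in> ball xd r'"
        using elim x h_gt_0[of n] by (auto simp: dist_real_def)
      obtain t where t: "\<bar>t - x0 n\<bar> \<le> \<bar>x - x0 n\<bar>"
        "phi \<gamma> eta0 e x = (\<Sum>j\<le>p. (deriv ^^ j) (phi \<gamma> eta0 e) (x0 n) / fact j * (x - x0 n) ^ j)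
           + (deriv ^^ Suc p) (phi \<gamma> eta0 e) t / fact (Suc p) * (x - x0 n) ^ Suc p"
        using times_cont_diff_on_taylor[OF sm b] by blast
      have ph: "phi \<gamma> eta0 e x = taylor n x + Dphi (p + 1) t / fact (p + 1) * (x - x0 n) ^ (p + 1)"
        using t(2) unfolding taylor_def Dphi_def by simp
      have "eta0 x - e x = gp x * phi \<gamma> eta0 e x"
        using r'(4)[OF b(2)] by (simp add: phi_def gp_def)
      then have "eta0 x - ts n x = gp x * (phi \<gamma> eta0 e x - taylor n x)"
        by (simp add: ts_def algebra_simps)
      then have "P n x t" unfolding P_def using t(1) by (simp add: ph)
      then have "P n x (\<xi> n x)" unfolding \<xi>_def by (rule someI)
      then show "P (fst (n, x)) (snd (n, x)) (\<xi> (fst (n, x)) (snd (n, x)))" by simp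
    qed
  qed
  have "((\<lambda>q. \<xi> (fst q) (snd q) - x0 (fst q)) \<longlongrightarrow> 0) Win"
  proof (rule Lim_null_comparison)
    have "\<forall>\<^sub>F q in Win. \<bar>snd q - x0 (fst q)\<bar> \<le> h (fst q)"
      unfolding eventually_Win by simp
    with ev show "\<forall>\<^sub>F q in Win. norm (\<xi> (fst q) (snd q) - x0 (fst q)) \<le> h (fst q)"
      by eventually_elim (auto simp: P_def)
    show "((\<lambda>q. h (fst q)) \<longlongrightarrow> 0) Win" by (rule tendsto_Win_fst[OF h_lim])
  qed
  from tendsto_add[OF this tendsto_Win_fst[OF x0_lim]]
  have "((\<lambda>q. \<xi> (fst q) (snd q)) \<longlongrightarrow> xd) Win" by simp
  moreover have "\<forall>\<^sub>F q in Win. eta0 (snd q) - ts (fst q) (snd q)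
       = gp (snd q) * (Dphi (p + 1) (\<xi> (fst q) (snd q)) / fact (p + 1)) * (snd q - x0 (fst q)) ^ (p + 1)"
    using ev by eventually_elim (simp add: P_def)
  ultimately show ?thesis by blast
qed

lemma tendsto_Win_diff: "((\<lambda>q. snd q - x0 (fst q)) \<longlongrightarrow> 0) Win"
  using tendsto_diff[OF tendsto_Win_snd tendsto_Win_fst[OF x0_lim]] by simp

lemma eta0_lim: "((\<lambda>q. eta0 (snd q)) \<longlongrightarrow> t0) Win"
  using eta0_continuous by (intro tendsto_Win_isCont) (simp add: continuous_on_eq_continuous_at)

lemma ts_lim: "((\<lambda>q. ts (fst q) (snd q)) \<longlongrightarrow> t0) Win"
proof -
  obtain \<xi> where \<xi>: "((\<lambda>q. \<xi> (fst q) (snd q)) \<longlongrightarrow> xd) Win"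
    and eq: "\<forall>\<^sub>F q in Win. eta0 (snd q) - ts (fst q) (snd q)
       = gp (snd q) * (Dphi (p + 1) (\<xi> (fst q) (snd q)) / fact (p + 1)) * (snd q - x0 (fst q)) ^ (p + 1)"
    using taylor_remainder by blast
  have "((\<lambda>q. gp (snd q) * (Dphi (p + 1) (\<xi> (fst q) (snd q)) / fact (p + 1)) * (snd q - x0 (fst q)) ^ (p + 1))
     \<longlongrightarrow> gp xd * (Dphi (p + 1) xd / fact (p + 1)) * 0 ^ (p + 1)) Win"
    by (intro tendsto_intros tendsto_Win_isCont[OF gp_isCont] isCont_tendsto_compose[OF Dphi_isCont \<xi>] tendsto_Win_diff) auto
  then have "((\<lambda>q. eta0 (snd q) - ts (fst q) (snd q)) \<longlongrightarrow> 0) Win"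
    using tendsto_cong[OF eq] by simp
  from tendsto_diff[OF eta0_lim this] show ?thesis by simp
qed

lemma wt_lim: "((\<lambda>q. wt (fst q) (snd q)) \<longlongrightarrow> 1) Win"
proof -
  have "((\<lambda>q. gp (snd q) / gp (x0 (fst q))) \<longlongrightarrow> gp xd / gp xd) Win"
    by (intro tendsto_divide tendsto_Win_isCont[OF gp_isCont] tendsto_Win_fst[OF x0_isCont_lim[OF gp_isCont]] gp_nz)
  then show ?thesis using gp_nz by (simp add: wt_def)
qed

text \<open>Weight of the residual in the score: the derivative of the quasi-likelihood at the
  approximating predictor, times the guide ratio that multiplies the polynomial part.\<close>

definition noise_wt :: "nat \<Rightarrow> real \<Rightarrow> real" where "noise_wt n x = score_weight (ts n x) * wt n x"

lemma noise_wt_measurable [measurable]: "noise_wt n \<in> borel_measurable borel"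
  unfolding noise_wt_def[abs_def] by measurable

lemma noise_wt_lim: "((\<lambda>q. noise_wt (fst q) (snd q)) \<longlongrightarrow> score_weight t0) Win"
  using tendsto_mult[OF isCont_tendsto_compose[OF score_weight_isCont ts_lim] wt_lim] by (simp add: noise_wt_def)

definition cB :: real where "cB = gp xd * (Dphi (p + 1) xd / fact (p + 1)) * info0"

text \<open>The systematic part of the score with the factor (x - x0)^(p+1) divided out, so that it
  has a limit. At the centre it is given this limit \<open>cB\<close> as its value, which spares the
  limit statements an exceptional point.\<close>

definition bias_wt :: "nat \<Rightarrow> real \<Rightarrow> real" where
  "bias_wt n x = (if x = x0 n then cB else (\<mu> x - ginv (ts n x)) * noise_wt n x / (x - x0 n) ^ (p + 1))"

lemma bias_wt_measurable [measurable]: "bias_wt n \<in> borel_measurable borel"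
  unfolding bias_wt_def[abs_def] by measurable

lemma info0_eq: "info0 = 1 / deriv g (\<mu> xd) * score_weight t0"
  using w0 by (simp add: info0_def score_weight_def power2_eq_square)

text \<open>The two predictors may coincide, so the difference quotient is completed by the
  derivative; the product of slope and difference is then correct in every case.\<close>

lemma ginv_slope_lim:
  assumes s: "(s \<longlongrightarrow> t0) F" and t: "(t \<longlongrightarrow> t0) F"
  shows "((\<lambda>q. if s q = t q then 1 / deriv g (\<mu> xd) else (ginv (s q) - ginv (t q)) / (s q - t q)) \<longlongrightarrow> 1 / deriv g (\<mu> xd)) F"
proof (rule tendstoI)
  fix \<epsilon> :: real assume \<epsilon>: "0 < \<epsilon>"
  then have "0 < \<epsilon> / 2" by simp
  from ginv_increment[OF this] obtain \<delta> where \<delta>: "0 < \<delta>"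
    "\<And>s t. \<bar>s - t0\<bar> < \<delta> \<Longrightarrow> \<bar>t - t0\<bar> < \<delta> \<Longrightarrow> \<bar>ginv s - ginv t - (s - t) / deriv g (\<mu> xd)\<bar> \<le> \<epsilon> / 2 * \<bar>s - t\<bar>"
    by blast
  from tendstoD[OF s \<delta>(1)] tendstoD[OF t \<delta>(1)]
  show "\<forall>\<^sub>F q in F. dist (if s q = t q then 1 / deriv g (\<mu> xd) else (ginv (s q) - ginv (t q)) / (s q - t q)) (1 / deriv g (\<mu> xd)) < \<epsilon>"
  proof eventually_elim
    case (elim q)
    show ?case
    proof (cases "s q = t q")
      case True then show ?thesis using \<epsilon> by simp
    next
      case False
      have "(ginv (s q) - ginv (t q)) / (s q - t q) - 1 / deriv g (\<mu> xd) = (ginv (s q) - ginv (t q) - (s q - t q) / deriv g (\<mu> xd)) / (s q - t q)"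
        unfolding diff_divide_distrib[of "ginv (s q) - ginv (t q)"] using False by simp
      also have "\<bar>\<dots>\<bar> \<le> \<epsilon> / 2"
        using \<delta>(2)[of "s q" "t q"] elim False by (simp add: abs_divide pos_divide_le_eq dist_real_def)
      finally show ?thesis using False \<epsilon> by (simp add: dist_real_def)
    qed
  qed
qed

text \<open>On the support, the error of the mean is a slope of the inverse link times the error of
  the predictor, and the Taylor remainder supplies precisely the power of x - x0 that is divided
  out.\<close>

lemma bias_wt_lim: "((\<lambda>q. bias_wt (fst q) (snd q)) \<longlongrightarrow> cB) Win"
proof -
  obtain \<xi> where \<xi>: "((\<lambda>q. \<xi> (fst q) (snd q)) \<longlongrightarrow> xd) Win"
    and eq: "\<forall>\<^sub>F q in Win. eta0 (snd q) - ts (fst q) (snd q)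
       = gp (snd q) * (Dphi (p + 1) (\<xi> (fst q) (snd q)) / fact (p + 1)) * (snd q - x0 (fst q)) ^ (p + 1)"
    using taylor_remainder by blast
  define sl where "sl q = (if eta0 (snd q) = ts (fst q) (snd q) then 1 / deriv g (\<mu> xd)
      else (ginv (eta0 (snd q)) - ginv (ts (fst q) (snd q))) / (eta0 (snd q) - ts (fst q) (snd q)))" for q
  have sl: "(sl \<longlongrightarrow> 1 / deriv g (\<mu> xd)) Win"
    unfolding sl_def[abs_def] by (rule ginv_slope_lim[OF eta0_lim ts_lim])
  define R where "R q = (if snd q = x0 (fst q) then cB
     else sl q * (gp (snd q) * (Dphi (p + 1) (\<xi> (fst q) (snd q)) / fact (p + 1))) * noise_wt (fst q) (snd q))" for q
  have "((\<lambda>q. sl q * (gp (snd q) * (Dphi (p + 1) (\<xi> (fst q) (snd q)) / fact (p + 1))) * noise_wt (fst q) (snd q))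
      \<longlongrightarrow> 1 / deriv g (\<mu> xd) * (gp xd * (Dphi (p + 1) xd / fact (p + 1))) * score_weight t0) Win"
    by (intro tendsto_intros sl tendsto_Win_isCont[OF gp_isCont] isCont_tendsto_compose[OF Dphi_isCont \<xi>] noise_wt_lim) auto
  also have "1 / deriv g (\<mu> xd) * (gp xd * (Dphi (p + 1) xd / fact (p + 1))) * score_weight t0 = cB"
    unfolding cB_def info0_eq by (simp add: mult_ac)
  finally have lim: "((\<lambda>q. sl q * (gp (snd q) * (Dphi (p + 1) (\<xi> (fst q) (snd q)) / fact (p + 1))) * noise_wt (fst q) (snd q)) \<longlongrightarrow> cB) Win" .
  have "(R \<longlongrightarrow> cB) Win"
  proof (rule tendstoI)
    fix \<epsilon> :: real assume "0 < \<epsilon>"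
    from tendstoD[OF lim this] show "\<forall>\<^sub>F q in Win. dist (R q) cB < \<epsilon>"
      by eventually_elim (simp add: R_def \<open>0 < \<epsilon>\<close>)
  qed
  moreover have "\<forall>\<^sub>F q in Win. R q = bias_wt (fst q) (snd q)"
  proof -
    have "\<forall>\<^sub>F q in Win. snd q \<in> S" unfolding eventually_Win by simp
    with eq show ?thesis
    proof eventually_elim
      case (elim q)
      obtain n x where q: "q = (n, x)" by (cases q)
      have gm: "ginv (eta0 x) = \<mu> x" using elim(2) \<mu>_in by (simp add: q)
      have "\<mu> x - ginv (ts n x) = sl q * (eta0 x - ts n x)"
        using gm by (cases "eta0 x = ts n x") (auto simp: sl_def q)
      then show ?case using elim(1) by (simp add: R_def bias_wt_def q)
    qed
  qed
  ultimately show ?thesis by (rule Lim_transform_eventually)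
qed

section \<open>The score and the maximizer of the limiting quadratic\<close>

definition kap :: "nat \<Rightarrow> real" where "kap n = sqrt (real n * h n)"

text \<open>The second derivative of the rescaled criterion is close to minus \<open>lam0\<close>
  times the moment matrix of the window.\<close>

definition lam0 :: real where "lam0 = f xd * info0"

lemma lam0_pos: "0 < lam0"
  using f_pos info0_pos by (simp add: lam0_def)

lemma kap_pos: "\<forall>\<^sub>F n in sequentially. 0 < real n * h n \<and> 0 < kap n"
proof -
  have "\<forall>\<^sub>F n in sequentially. 0 < real n * h n" using nh_lim by (simp add: filterlim_at_top_dense)
  then show ?thesis by eventually_elim (simp add: kap_def)
qed

lemma kap_lim: "filterlim kap at_top sequentially"
  unfolding kap_def[abs_def] by (rule filterlim_compose[OF sqrt_at_top nh_lim])

text \<open>Chosen once for all windows, so that the bound on the entries of \<open>Ni n\<close>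
  does not depend on n.\<close>

definition l0 :: real where
  "l0 = (SOME l. 0 < l \<and> (\<forall>A. window A \<longrightarrow>
     (\<forall>u. l * (\<Sum>j\<le>p. (u j)\<^sup>2) \<le> (\<Sum>j\<le>p. \<Sum>k\<le>p. kernel_moment K (j + k) A * u j * u k)) \<and>
     (\<exists>Ni. inverse_moments l p A Ni)))"

definition Ni :: "nat \<Rightarrow> nat \<Rightarrow> nat \<Rightarrow> real" where "Ni n = (SOME N. inverse_moments l0 p (Dom n) N)"

lemma l0: "0 < l0 \<and> (\<forall>A. window A \<longrightarrow>
     (\<forall>u. l0 * (\<Sum>j\<le>p. (u j)\<^sup>2) \<le> (\<Sum>j\<le>p. \<Sum>k\<le>p. kernel_moment K (j + k) A * u j * u k)) \<and>
     (\<exists>Ni. inverse_moments l0 p A Ni))"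
  unfolding l0_def by (rule someI_ex) (use moment_inverse[of p] in blast)

lemma l0_pos: "0 < l0" using l0 by blast

lemma Ni:
  assumes "window (Dom n)"
  shows "l0 * (\<Sum>j\<le>p. (u j)\<^sup>2) \<le> (\<Sum>j\<le>p. \<Sum>k\<le>p. kernel_moment K (j + k) (Dom n) * u j * u k)"
    and "i \<le> p \<Longrightarrow> j \<le> p \<Longrightarrow> (\<Sum>k\<le>p. kernel_moment K (i + k) (Dom n) * Ni n k j) = (if i = j then 1 else 0)"
    and "i \<le> p \<Longrightarrow> j \<le> p \<Longrightarrow> \<bar>Ni n i j\<bar> \<le> 1 / l0"
    and "equiv_kernel K 0 p (Dom n) z = polyval p (Ni n 0) z * K z"
proof -
  show "l0 * (\<Sum>j\<le>p. (u j)\<^sup>2) \<le> (\<Sum>j\<le>p. \<Sum>k\<le>p. kernel_moment K (j + k) (Dom n) * u j * u k)"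
    using l0 assms by blast
  have "\<exists>N. inverse_moments l0 p (Dom n) N" using l0 assms by blast
  then have N: "inverse_moments l0 p (Dom n) (Ni n)" unfolding Ni_def by (rule someI_ex)
  show "i \<le> p \<Longrightarrow> j \<le> p \<Longrightarrow> (\<Sum>k\<le>p. kernel_moment K (i + k) (Dom n) * Ni n k j) = (if i = j then 1 else 0)"
    "i \<le> p \<Longrightarrow> j \<le> p \<Longrightarrow> \<bar>Ni n i j\<bar> \<le> 1 / l0"
    using N by (simp_all add: inverse_moments_def)
  show "equiv_kernel K 0 p (Dom n) z = polyval p (Ni n 0) z * K z"
    using N by (intro equiv_kernel_eqI[OF assms]) (simp add: inverse_moments_def)
qed

text \<open>The polynomial factor of the equivalent kernel over \<open>Dom n\<close>.\<close>

definition aker :: "nat \<Rightarrow> real \<Rightarrow> real" where "aker n = polyval p (Ni n 0)"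

lemma aker_measurable [measurable]: "aker n \<in> borel_measurable borel"
  unfolding aker_def by measurable

definition Ca :: real where "Ca = (real p + 1) / l0"

lemma aker_bound: "\<forall>\<^sub>F n in sequentially. \<forall>z\<in>{-1..1}. \<bar>aker n z\<bar> \<le> Ca"
  using window_Dom
proof eventually_elim
  case (elim n)
  have "(\<Sum>j\<le>p. \<bar>Ni n 0 j\<bar>) \<le> (\<Sum>j\<le>p. 1 / l0)"
    using Ni(3)[OF elim] by (intro sum_mono) auto
  also have "\<dots> = Ca" by (simp add: Ca_def)
  finally show ?case unfolding aker_def using polyval_bound order.trans by blast
qed

definition noise_sum :: "(nat \<Rightarrow> real \<Rightarrow> real) \<Rightarrow> nat \<Rightarrow> 'a \<Rightarrow> real" where
  "noise_sum m n \<omega> = (\<Sum>i<n. summand m (\<lambda>n x. 0) noise_wt n (X i \<omega>, Y i \<omega>)) / kap n"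

definition bias_sum :: "(nat \<Rightarrow> real \<Rightarrow> real) \<Rightarrow> nat \<Rightarrow> 'a \<Rightarrow> real" where
  "bias_sum m n \<omega> = (\<Sum>i<n. summand (\<lambda>n z. m n z * z ^ (p + 1)) bias_wt (\<lambda>n x. 0) n (X i \<omega>, Y i \<omega>)) / (real n * h n)"

text \<open>The gradient of the rescaled criterion at u = 0, already split into noise and bias;
  \<open>score_alt\<close> confirms this when all covariates lie in the support.\<close>

definition score :: "nat \<Rightarrow> nat \<Rightarrow> 'a \<Rightarrow> real" where
  "score j n \<omega> = noise_sum (\<lambda>n z. z ^ j) n \<omega> + kap n * h n ^ (p + 1) * bias_sum (\<lambda>n z. z ^ j) n \<omega>"

definition uhat :: "nat \<Rightarrow> nat \<Rightarrow> 'a \<Rightarrow> real" where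
  "uhat j n \<omega> = (\<Sum>k\<le>p. Ni n j k * score k n \<omega>) / lam0"

text \<open>The square of this quantity is n h^(2p+3): here the upper bandwidth condition
  enters.\<close>

lemma kap_h: "\<exists>C. \<forall>\<^sub>F n in sequentially. \<bar>kap n * h n ^ (p + 1)\<bar> \<le> C"
proof -
  obtain B where B: "0 < B" "\<And>n. norm (real n * h n ^ (2 * p + 3)) \<le> B" using nh3 unfolding Bseq_def by blast
  have "\<bar>kap n * h n ^ (p + 1)\<bar> \<le> sqrt B" for n
  proof (rule real_le_rsqrt)
    have "(kap n)\<^sup>2 = real n * h n" unfolding kap_def using h_gt_0[of n] by simp
    moreover have "h n * (h n ^ (p + 1))\<^sup>2 = h n ^ (2 * p + 3)"
    proof -
      have "Suc ((p + 1) * 2) = 2 * p + 3" by simp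
      then show ?thesis by (metis power_Suc power_mult)
    qed
    ultimately have "(kap n * h n ^ (p + 1))\<^sup>2 = real n * h n ^ (2 * p + 3)" by (simp add: power_mult_distrib mult.assoc)
    then show "\<bar>kap n * h n ^ (p + 1)\<bar>\<^sup>2 \<le> B" using B(2)[of n] by simp
  qed
  then show ?thesis by (intro exI[of _ "sqrt B"]) simp
qed

lemma noise_sum_bounded:
  assumes "\<And>n. m n \<in> borel_measurable borel" "\<forall>\<^sub>F n in sequentially. \<forall>z\<in>{-1..1}. \<bar>m n z\<bar> \<le> Cm"
  shows "bounded_in_prob (noise_sum m)"
  using noise_bounded[OF assms(1) noise_wt_measurable assms(2) noise_wt_lim]
  unfolding noise_sum_def[abs_def] kap_def .

lemma bias_sum_lln:
  assumes [measurable]: "\<And>n. m n \<in> borel_measurable borel" and m: "\<forall>\<^sub>F n in sequentially. \<forall>z\<in>{-1..1}. \<bar>m n z\<bar> \<le> Cm"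
  shows "to_zero_in_prob (\<lambda>n \<omega>. bias_sum m n \<omega> - cB * f xd * (LINT z:Dom n|lborel. m n z * z ^ (p + 1) * K z))"
  unfolding bias_sum_def
proof (rule kernel_lln[OF _ bias_wt_measurable _ _ bias_wt_lim, where Cm = Cm and c' = 0])
  show "\<forall>\<^sub>F n in sequentially. \<forall>z\<in>{-1..1}. \<bar>m n z * z ^ (p + 1)\<bar> \<le> Cm" using m
  proof eventually_elim
    case (elim n)
    show ?case
    proof
      fix z :: real assume z: "z \<in> {-1..1}"
      then have "\<bar>z\<bar> ^ (p + 1) \<le> 1" by (intro power_le_one) auto
      then have "\<bar>m n z\<bar> * \<bar>z\<bar> ^ (p + 1) \<le> \<bar>m n z\<bar>" by (intro mult_left_le) auto
      also have "\<dots> \<le> Cm" using elim z by blast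
      finally show "\<bar>m n z * z ^ (p + 1)\<bar> \<le> Cm" by (simp add: abs_mult power_abs)
    qed
  qed
qed auto

lemma window_integral_bound:
  assumes [measurable]: "m \<in> borel_measurable borel" and m: "\<And>z. z \<in> {-1..1} \<Longrightarrow> \<bar>m z\<bar> \<le> C"
  shows "\<bar>LINT z:Dom n|lborel. m z * K z\<bar> \<le> C"
proof -
  have "\<bar>indicator (Dom n) z * m z\<bar> \<le> C" if "z \<in> {-1..1}" for z
    using m[OF that] by (auto simp: indicator_def)
  from windowed_integrable(2)[OF K_integrable K_outside _ this]
  show ?thesis unfolding set_lebesgue_integral_def K_abs_integral by (simp add: mult.assoc)
qed

lemma score_bounded: "bounded_in_prob (score j)"
proof -
  have z: "\<forall>\<^sub>F n in sequentially. \<forall>z\<in>{-1..1}. \<bar>z ^ j\<bar> \<le> (1::real)"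
    by (intro always_eventually allI ballI) (auto simp: power_abs intro!: power_le_one)
  obtain C where C: "\<forall>\<^sub>F n in sequentially. \<bar>kap n * h n ^ (p + 1)\<bar> \<le> C" using kap_h by blast
  have 1: "bounded_in_prob (noise_sum (\<lambda>n z. z ^ j))" by (rule noise_sum_bounded[OF _ z]) auto
  have "bounded_in_prob (bias_sum (\<lambda>n z. z ^ j))"
  proof (rule bounded_in_prob_if_to_zero[OF bias_sum_lln[OF _ z]])
    have "\<bar>LINT z:Dom n|lborel. z ^ j * z ^ (p + 1) * K z\<bar> \<le> 1" for n
      by (rule window_integral_bound) (auto simp: power_add[symmetric] power_abs simp del: power_Suc intro!: power_le_one)
    from mult_left_mono[OF this, of "\<bar>cB * f xd\<bar>"]
    show "\<forall>\<^sub>F n in sequentially. \<bar>cB * f xd * (LINT z:Dom n|lborel. z ^ j * z ^ (p + 1) * K z)\<bar> \<le> \<bar>cB * f xd\<bar>"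
      by (simp add: abs_mult)
  qed auto
  then have "bounded_in_prob (\<lambda>n \<omega>. kap n * h n ^ (p + 1) * bias_sum (\<lambda>n z. z ^ j) n \<omega>)"
  proof (rule bounded_in_prob_mono[where C = C], use C in eventually_elim)
    case (elim n)
    then show ?case unfolding abs_mult[of "kap n * h n ^ (p + 1)"] by (auto intro: mult_right_mono)
  qed
  from bounded_in_prob_add[OF 1 this] show ?thesis unfolding score_def[abs_def] .
qed

lemma uhat_bounded: "bounded_in_prob (\<lambda>n \<omega>. \<Sum>j\<le>p. \<bar>uhat j n \<omega>\<bar>)"
proof -
  have "bounded_in_prob (\<lambda>n \<omega>. \<bar>score k n \<omega>\<bar>)" for k
    by (rule bounded_in_prob_mono[OF score_bounded[of k], where C = 1]) simp
  then have "bounded_in_prob (\<lambda>n \<omega>. \<Sum>k\<le>p. \<bar>score k n \<omega>\<bar>)" by (rule bounded_in_prob_sum)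
  then show ?thesis
  proof (rule bounded_in_prob_mono[where C = "(real p + 1) * (1 / l0 / lam0)"], use window_Dom in eventually_elim)
    case (elim n)
    show ?case
    proof
      fix \<omega>
      have "\<bar>uhat j n \<omega>\<bar> \<le> (1 / l0 * (\<Sum>k\<le>p. \<bar>score k n \<omega>\<bar>)) / lam0" if "j \<le> p" for j
      proof -
        have "\<bar>\<Sum>k\<le>p. Ni n j k * score k n \<omega>\<bar> \<le> (\<Sum>k\<le>p. \<bar>Ni n j k * score k n \<omega>\<bar>)" by (rule sum_abs)
        also have "\<dots> \<le> (\<Sum>k\<le>p. 1 / l0 * \<bar>score k n \<omega>\<bar>)"
          unfolding abs_mult using Ni(3)[OF elim that] by (intro sum_mono mult_right_mono) auto
        finally show ?thesis unfolding uhat_def using lam0_pos by (simp add: abs_divide sum_distrib_left divide_right_mono)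
      qed
      then have "(\<Sum>j\<le>p. \<bar>uhat j n \<omega>\<bar>) \<le> (\<Sum>j\<le>p. (1 / l0 * (\<Sum>k\<le>p. \<bar>score k n \<omega>\<bar>)) / lam0)"
        by (intro sum_mono) auto
      also have "\<dots> = (real p + 1) * (1 / l0 / lam0) * \<bar>\<Sum>k\<le>p. \<bar>score k n \<omega>\<bar>\<bar>"
        by (simp add: sum_nonneg)
      finally show "\<bar>\<Sum>j\<le>p. \<bar>uhat j n \<omega>\<bar>\<bar> \<le> (real p + 1) * (1 / l0 / lam0) * \<bar>\<Sum>k\<le>p. \<bar>score k n \<omega>\<bar>\<bar>"
        by (simp add: sum_nonneg)
    qed
  qed
qed

lemma uhat_solves:
  assumes "window (Dom n)" "j \<le> p"
  shows "(\<Sum>k\<le>p. lam0 * kernel_moment K (j + k) (Dom n) * uhat k n \<omega>) = score j n \<omega>"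
proof -
  have "(\<Sum>k\<le>p. lam0 * kernel_moment K (j + k) (Dom n) * uhat k n \<omega>)
     = (\<Sum>k\<le>p. \<Sum>i\<le>p. kernel_moment K (j + k) (Dom n) * Ni n k i * score i n \<omega>)"
  proof (intro sum.cong refl)
    fix k
    have "lam0 * kernel_moment K (j + k) (Dom n) * uhat k n \<omega> = kernel_moment K (j + k) (Dom n) * (\<Sum>i\<le>p. Ni n k i * score i n \<omega>)"
      using lam0_pos by (simp add: uhat_def)
    then show "lam0 * kernel_moment K (j + k) (Dom n) * uhat k n \<omega> = (\<Sum>i\<le>p. kernel_moment K (j + k) (Dom n) * Ni n k i * score i n \<omega>)"
      by (simp add: sum_distrib_left mult.assoc)
  qed
  also have "\<dots> = (\<Sum>i\<le>p. (\<Sum>k\<le>p. kernel_moment K (j + k) (Dom n) * Ni n k i) * score i n \<omega>)"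
    by (subst sum.swap) (simp add: sum_distrib_right)
  also have "\<dots> = (\<Sum>i\<le>p. if i = j then score i n \<omega> else 0)"
    using Ni(2)[OF assms] by (intro sum.cong refl) auto
  also have "\<dots> = score j n \<omega>" using assms by simp
  finally show ?thesis .
qed

text \<open>Row 0 of the inverse combines the monomial scores into a single sum weighted by the
  polynomial of the equivalent kernel, for the noise and the bias alike.\<close>

lemma uhat_0: "uhat 0 n \<omega> = (noise_sum aker n \<omega> + kap n * h n ^ (p + 1) * bias_sum aker n \<omega>) / lam0"
proof -
  have lin: "summand (\<lambda>n z. aker n z * q z) \<alpha> \<beta> n t = (\<Sum>k\<le>p. Ni n 0 k * summand (\<lambda>n z. z ^ k * q z) \<alpha> \<beta> n t)" for q \<alpha> \<beta> t
    by (simp add: summand_def aker_def polyval_def sum_distrib_left sum_distrib_right mult_ac)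
  have "(\<Sum>i<n. summand (\<lambda>n z. aker n z * q z) \<alpha> \<beta> n (X i \<omega>, Y i \<omega>))
    = (\<Sum>k\<le>p. Ni n 0 k * (\<Sum>i<n. summand (\<lambda>n z. z ^ k * q z) \<alpha> \<beta> n (X i \<omega>, Y i \<omega>)))" for q \<alpha> \<beta>
    unfolding lin by (subst sum.swap) (simp add: sum_distrib_left)
  note S = this
  have N: "noise_sum aker n \<omega> = (\<Sum>k\<le>p. Ni n 0 k * noise_sum (\<lambda>n z. z ^ k) n \<omega>)"
  proof -
    have "(\<Sum>i<n. summand aker (\<lambda>n x. 0) noise_wt n (X i \<omega>, Y i \<omega>))
      = (\<Sum>k\<le>p. Ni n 0 k * (\<Sum>i<n. summand (\<lambda>n z. z ^ k) (\<lambda>n x. 0) noise_wt n (X i \<omega>, Y i \<omega>)))"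
      using S[of "\<lambda>_. 1"] by simp
    then show ?thesis unfolding noise_sum_def by (simp, subst sum_divide_distrib) simp
  qed
  have B: "bias_sum aker n \<omega> = (\<Sum>k\<le>p. Ni n 0 k * bias_sum (\<lambda>n z. z ^ k) n \<omega>)"
    unfolding bias_sum_def S by (subst sum_divide_distrib) simp
  show ?thesis unfolding uhat_def score_def N B
    by (simp add: distrib_left sum.distrib sum_distrib_left mult_ac)
qed

section \<open>The second-order term and the total weight of the expansion error\<close>

definition hess :: "nat \<Rightarrow> nat \<Rightarrow> 'a \<Rightarrow> real" where
  "hess l n \<omega> = (\<Sum>i<n. summand (\<lambda>n z. z ^ l) (\<lambda>n x. (wt n x)\<^sup>2 * ((\<mu> x - \<mu> xd) * score_weight' t0 - info0))
      (\<lambda>n x. (wt n x)\<^sup>2 * score_weight' t0) n (X i \<omega>, Y i \<omega>)) / (real n * h n)"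

text \<open>The deviation of a response from \<open>\<mu> xd\<close> is its residual, which averages
  out, plus a change of the mean that vanishes along the window. What remains is minus
  \<open>info0\<close>.\<close>

lemma hess_lln: "to_zero_in_prob (\<lambda>n \<omega>. hess l n \<omega> + lam0 * kernel_moment K l (Dom n))"
proof -
  have z: "\<forall>\<^sub>F n in sequentially. \<forall>z\<in>{-1..1}. \<bar>z ^ l\<bar> \<le> (1::real)"
    by (intro always_eventually allI ballI) (auto simp: power_abs intro!: power_le_one)
  have 1: "((\<lambda>q. (wt (fst q) (snd q))\<^sup>2 * ((\<mu> (snd q) - \<mu> xd) * score_weight' t0 - info0)) \<longlongrightarrow> 1\<^sup>2 * ((\<mu> xd - \<mu> xd) * score_weight' t0 - info0)) Win"
    by (intro tendsto_intros wt_lim tendsto_Win_continuous_on[OF \<mu>_cont])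
  have 2: "((\<lambda>q. (wt (fst q) (snd q))\<^sup>2 * score_weight' t0) \<longlongrightarrow> 1\<^sup>2 * score_weight' t0) Win"
    by (intro tendsto_intros wt_lim)
  have "to_zero_in_prob (\<lambda>n \<omega>. hess l n \<omega> - (1\<^sup>2 * ((\<mu> xd - \<mu> xd) * score_weight' t0 - info0)) * f xd * (LINT z:Dom n|lborel. z ^ l * K z))"
    unfolding hess_def by (rule kernel_lln[OF _ _ _ z 1 2]) auto
  then show ?thesis by (simp add: lam0_def kernel_moment_def mult_ac)
qed

text \<open>The sum of the pointwise expansion errors \<epsilon> (1 + |y|) d^2, without \<epsilon>
  and without the polynomial.\<close>

definition wmass :: "nat \<Rightarrow> 'a \<Rightarrow> real" where
  "wmass n \<omega> = (\<Sum>i<n. K (Z n (X i \<omega>)) * ((1 + \<bar>Y i \<omega>\<bar>) * (wt n (X i \<omega>))\<^sup>2)) / (real n * h n)"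

lemma iid_expectation:
  assumes \<Phi>: "\<Phi> \<in> borel_measurable (borel :: (real \<times> real) measure)"
    and i0: "integrable M (\<lambda>\<omega>. \<Phi> (X 0 \<omega>, Y 0 \<omega>))"
  shows "integrable M (\<lambda>\<omega>. \<Phi> (X i \<omega>, Y i \<omega>))" "expectation (\<lambda>\<omega>. \<Phi> (X i \<omega>, Y i \<omega>)) = (expectation (\<lambda>\<omega>. \<Phi> (X 0 \<omega>, Y 0 \<omega>)) :: real)"
proof -
  note d = iid_functional(2)[OF \<Phi>, of i]
  have [measurable]: "(\<lambda>\<omega>. \<Phi> (X j \<omega>, Y j \<omega>)) \<in> borel_measurable M" for j
    by (rule measurable_compose[OF pair_measurable \<Phi>])
  have "integrable (distr M borel (\<lambda>\<omega>. \<Phi> (X i \<omega>, Y i \<omega>))) (\<lambda>x. x)"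
    unfolding d using i0 by (subst integrable_distr_eq) auto
  then show "integrable M (\<lambda>\<omega>. \<Phi> (X i \<omega>, Y i \<omega>))" by (subst (asm) integrable_distr_eq) auto
  have "expectation (\<lambda>\<omega>. \<Phi> (X i \<omega>, Y i \<omega>)) = (LINT x|distr M borel (\<lambda>\<omega>. \<Phi> (X i \<omega>, Y i \<omega>)). x)"
    by (subst integral_distr) auto
  also have "\<dots> = expectation (\<lambda>\<omega>. \<Phi> (X 0 \<omega>, Y 0 \<omega>))" unfolding d by (subst integral_distr) auto
  finally show "expectation (\<lambda>\<omega>. \<Phi> (X i \<omega>, Y i \<omega>)) = expectation (\<lambda>\<omega>. \<Phi> (X 0 \<omega>, Y 0 \<omega>))" .
qed

lemma wmass_bounded: "bounded_in_prob wmass"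
proof -
  \<comment> \<open>Eventually the guide ratio is at most 2, whence the factors 4; 1 + |y| is
    bounded by 2 + |\<mu>| plus the squared residual, which gives the two terms.\<close>
  define C where "C = 4 * (2 + Cb) * Cb + 4 * Cb * Cb"
  show ?thesis
  proof (rule bounded_in_prob_L1[where C = C])
    show "0 \<le> wmass n \<omega>" for n \<omega>
      unfolding wmass_def using K_nonneg h_gt_0[of n] by (intro divide_nonneg_nonneg sum_nonneg) auto
    show "\<forall>\<^sub>F n in sequentially. integrable M (wmass n) \<and> expectation (wmass n) \<le> C"
      using tendsto_Win_bounded[OF wt_lim] eventually_near kap_pos
    proof eventually_elim
      case (elim n)
      define \<Phi> where "\<Phi> q = K (Z n (fst q)) * ((1 + \<bar>snd q\<bar>) * (wt n (fst q))\<^sup>2)" for q :: "real \<times> real"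
      have \<Phi>m [measurable]: "\<Phi> \<in> borel_measurable borel" unfolding \<Phi>_def borel_prod[symmetric] by measurable
      have w2: "(wt n x)\<^sup>2 \<le> 4" if "x \<in> S" "\<bar>x - x0 n\<bar> \<le> h n" for x
        using power_mono[of "\<bar>wt n x\<bar>" 2 2] elim(1) that by auto
      have b1: "\<bar>(wt n x)\<^sup>2 * (2 + \<bar>\<mu> x\<bar>)\<bar> \<le> 4 * (2 + Cb)" if "x \<in> S" "\<bar>x - x0 n\<bar> \<le> h n" for x
        unfolding abs_mult using w2[OF that] local_bounds'[OF elim(2) kernel_fun_K borel_measurable_const[of 0] _ order.refl that]
        by (intro mult_mono) auto
      have b2: "\<bar>(wt n x)\<^sup>2\<bar> \<le> 4" if "x \<in> S" "\<bar>x - x0 n\<bar> \<le> h n" for x using w2[OF that] by simp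
      have i1: "integrable M (\<lambda>\<omega>. K (Z n (X 0 \<omega>)) * ((wt n (X 0 \<omega>))\<^sup>2 * (2 + \<bar>\<mu> (X 0 \<omega>)\<bar>)))"
        and e1: "\<bar>expectation (\<lambda>\<omega>. K (Z n (X 0 \<omega>)) * ((wt n (X 0 \<omega>))\<^sup>2 * (2 + \<bar>\<mu> (X 0 \<omega>)\<bar>)))\<bar> \<le> h n * (4 * (2 + Cb) * Cb * (LINT z|lborel. K z))"
        by (rule kernel_expectation(1,3)[where \<alpha> = "\<lambda>x. (wt n x)\<^sup>2 * (2 + \<bar>\<mu> x\<bar>)", OF elim(2) kernel_fun_K _ b1]; use Cb_nonneg in simp)+
      have i2: "integrable M (\<lambda>\<omega>. K (Z n (X 0 \<omega>)) * (wt n (X 0 \<omega>))\<^sup>2 * (Y 0 \<omega> - \<mu> (X 0 \<omega>))\<^sup>2)"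
        and e2: "expectation (\<lambda>\<omega>. K (Z n (X 0 \<omega>)) * (wt n (X 0 \<omega>))\<^sup>2 * (Y 0 \<omega> - \<mu> (X 0 \<omega>))\<^sup>2) \<le> h n * (4 * Cb * Cb * (LINT z|lborel. K z))"
        by (rule kernel_expectation_square(1,3)[where \<alpha> = "\<lambda>x. (wt n x)\<^sup>2", OF elim(2) kernel_fun_K _ b2]; simp)+
      have le: "\<Phi> (X 0 \<omega>, Y 0 \<omega>) \<le> K (Z n (X 0 \<omega>)) * ((wt n (X 0 \<omega>))\<^sup>2 * (2 + \<bar>\<mu> (X 0 \<omega>)\<bar>)) + K (Z n (X 0 \<omega>)) * (wt n (X 0 \<omega>))\<^sup>2 * (Y 0 \<omega> - \<mu> (X 0 \<omega>))\<^sup>2" for \<omega>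
      proof -
        let ?u = "Y 0 \<omega> - \<mu> (X 0 \<omega>)"
        have "\<bar>?u\<bar> \<le> 1 + ?u\<^sup>2" by (rule abs_le_one_plus_square)
        then have "1 + \<bar>Y 0 \<omega>\<bar> \<le> (2 + \<bar>\<mu> (X 0 \<omega>)\<bar>) + ?u\<^sup>2" by linarith
        from mult_left_mono[OF this, of "K (Z n (X 0 \<omega>)) * (wt n (X 0 \<omega>))\<^sup>2"] show ?thesis
          unfolding \<Phi>_def using K_nonneg by (simp add: distrib_left mult_ac)
      qed
      have nn: "0 \<le> \<Phi> q" for q unfolding \<Phi>_def using K_nonneg by simp
      have i: "integrable M (\<lambda>\<omega>. \<Phi> (X 0 \<omega>, Y 0 \<omega>))"
      proof (rule Bochner_Integration.integrable_bound[OF Bochner_Integration.integrable_add[OF i1 i2]])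
        show "(\<lambda>\<omega>. \<Phi> (X 0 \<omega>, Y 0 \<omega>)) \<in> borel_measurable M" by (rule measurable_compose[OF pair_measurable \<Phi>m])
      qed (use le nn order.trans[OF le abs_ge_self] in auto)
      have "expectation (\<lambda>\<omega>. \<Phi> (X 0 \<omega>, Y 0 \<omega>)) \<le> expectation (\<lambda>\<omega>. K (Z n (X 0 \<omega>)) * ((wt n (X 0 \<omega>))\<^sup>2 * (2 + \<bar>\<mu> (X 0 \<omega>)\<bar>))
           + K (Z n (X 0 \<omega>)) * (wt n (X 0 \<omega>))\<^sup>2 * (Y 0 \<omega> - \<mu> (X 0 \<omega>))\<^sup>2)"
        by (rule integral_mono[OF i Bochner_Integration.integrable_add[OF i1 i2] le])
      also have "\<dots> \<le> h n * C"
        unfolding Bochner_Integration.integral_add[OF i1 i2] C_def using e1 e2 unfolding K_integral by (simp add: algebra_simps)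
      finally have e: "expectation (\<lambda>\<omega>. \<Phi> (X 0 \<omega>, Y 0 \<omega>)) \<le> h n * C" .
      have W: "wmass n = (\<lambda>\<omega>. (\<Sum>i<n. \<Phi> (X i \<omega>, Y i \<omega>)) / (real n * h n))"
        unfolding wmass_def[abs_def] \<Phi>_def by simp
      have "expectation (wmass n) = (\<Sum>i<n. expectation (\<lambda>\<omega>. \<Phi> (X i \<omega>, Y i \<omega>))) / (real n * h n)"
        unfolding W using iid_expectation(1)[OF \<Phi>m i] by simp
      also have "\<dots> = real n * expectation (\<lambda>\<omega>. \<Phi> (X 0 \<omega>, Y 0 \<omega>)) / (real n * h n)"
      proof -
        have "(\<Sum>i<n. expectation (\<lambda>\<omega>. \<Phi> (X i \<omega>, Y i \<omega>))) = (\<Sum>i<n. expectation (\<lambda>\<omega>. \<Phi> (X 0 \<omega>, Y 0 \<omega>)))"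
          by (intro sum.cong refl iid_expectation(2)[OF \<Phi>m i])
        then show ?thesis by simp
      qed
      also have "\<dots> \<le> (real n * (h n * C)) / (real n * h n)"
        using e elim by (intro divide_right_mono mult_left_mono) auto
      also have "\<dots> = C"
      proof -
        have "real n * h n \<noteq> 0" using conjunct1[OF elim(3)] by (rule less_imp_neq[THEN not_sym])
        then show ?thesis unfolding mult.assoc[symmetric] by (rule nonzero_mult_div_cancel_left)
      qed
      finally have "expectation (wmass n) \<le> C" .
      moreover have "integrable M (wmass n)" unfolding W using iid_expectation(1)[OF \<Phi>m i] by simp
      ultimately show ?case by blast
    qed
  qed
qed

section \<open>The rescaled criterion and its quadratic approximation\<close>

lemma kap_pos': "0 < real n * h n \<Longrightarrow> 0 < kap n" and kap_square: "(kap n)\<^sup>2 = real n * h n"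
  unfolding kap_def using h_gt_0[of n] by (simp_all only: real_sqrt_gt_zero) simp

text \<open>The value at u = 0 is subtracted: this leaves maximizers unchanged and removes the term
  of order zero from the expansion.\<close>

definition crit :: "nat \<Rightarrow> 'a \<Rightarrow> (nat \<Rightarrow> real) \<Rightarrow> real" where
  "crit n \<omega> u = (\<Sum>i<n. (Q (ginv (ts n (X i \<omega>) + wt n (X i \<omega>) * polyval p u (Z n (X i \<omega>)) / kap n)) (Y i \<omega>)
      - Q (ginv (ts n (X i \<omega>))) (Y i \<omega>)) * K (Z n (X i \<omega>)))"

lemma crit_concave:
  assumes \<omega>: "\<omega> \<in> space M" and s: "0 \<le> s" "s \<le> 1"
  shows "(1 - s) * crit n \<omega> u + s * crit n \<omega> w \<le> crit n \<omega> (\<lambda>j. (1 - s) * u j + s * w j)"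
  unfolding crit_def sum_distrib_left sum.distrib[symmetric]
proof (rule sum_mono)
  fix i
  let ?t = "ts n (X i \<omega>)" and ?c = "wt n (X i \<omega>)" and ?k = "K (Z n (X i \<omega>))" and ?y = "Y i \<omega>"
  let ?P = "\<lambda>u. polyval p u (Z n (X i \<omega>))"
  have arg: "?t + ?c * ?P (\<lambda>j. (1 - s) * u j + s * w j) / kap n
     = (1 - s) * (?t + ?c * ?P u / kap n) + s * (?t + ?c * ?P w / kap n)"
    unfolding polyval_affine by (simp add: algebra_simps add_divide_distrib diff_divide_distrib)
  have "(1 - s) * Q (ginv (?t + ?c * ?P u / kap n)) ?y + s * Q (ginv (?t + ?c * ?P w / kap n)) ?y
     \<le> Q (ginv (?t + ?c * ?P (\<lambda>j. (1 - s) * u j + s * w j) / kap n)) ?y"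
    unfolding arg by (rule quasi_concave[OF Y_in[OF \<omega>] s])
  then have "((1 - s) * Q (ginv (?t + ?c * ?P u / kap n)) ?y + s * Q (ginv (?t + ?c * ?P w / kap n)) ?y - Q (ginv ?t) ?y) * ?k
     \<le> (Q (ginv (?t + ?c * ?P (\<lambda>j. (1 - s) * u j + s * w j) / kap n)) ?y - Q (ginv ?t) ?y) * ?k"
    by (intro mult_right_mono K_nonneg) simp
  then show "(1 - s) * ((Q (ginv (?t + ?c * ?P u / kap n)) ?y - Q (ginv ?t) ?y) * ?k)
     + s * ((Q (ginv (?t + ?c * ?P w / kap n)) ?y - Q (ginv ?t) ?y) * ?k)
     \<le> (Q (ginv (?t + ?c * ?P (\<lambda>j. (1 - s) * u j + s * w j) / kap n)) ?y - Q (ginv ?t) ?y) * ?k"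
    by (simp add: algebra_simps)
qed

lemma crit_dep: "(\<And>j. j \<le> p \<Longrightarrow> u j = w j) \<Longrightarrow> crit n \<omega> u = crit n \<omega> w"
  unfolding crit_def polyval_def by simp

lemma crit_continuous:
  assumes \<omega>: "\<omega> \<in> space M" shows "continuous_on UNIV (crit n \<omega>)"
proof -
  have P: "continuous_on UNIV (\<lambda>u. polyval p u z)" for z
    unfolding polyval_def by (intro continuous_intros continuous_on_product_coordinates)
  have "continuous_on UNIV (\<lambda>u. Q (ginv (a + b * polyval p u z / c)) (Y i \<omega>))" for a b c z i
  proof (rule continuous_on_compose2[OF quasi_continuous[OF Y_in[OF \<omega>]]])
    show "continuous_on UNIV (\<lambda>u. a + b * polyval p u z / c)"
      unfolding divide_inverse by (intro continuous_intros P)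
  qed simp
  then show ?thesis unfolding crit_def[abs_def]
    by (intro continuous_on_sum continuous_on_mult continuous_on_diff continuous_on_const)
qed

text \<open>Splits the deviation from the approximating mean into approximation error and residual.
  At the centre the error is 0, since \<open>ts\<close> is exact there, and the value assigned to
  \<open>bias_wt\<close> is multiplied by 0.\<close>

lemma score_identity:
  assumes gp: "gp (x0 n) \<noteq> 0" and x: "x \<in> S"
  shows "(y - ginv (ts n x)) * score_weight (ts n x) * wt n x
     = (x - x0 n) ^ (p + 1) * bias_wt n x + noise_wt n x * (y - \<mu> x)"
proof -
  have "(x - x0 n) ^ (p + 1) * bias_wt n x = (\<mu> x - ginv (ts n x)) * noise_wt n x"
  proof (cases "x = x0 n")
    case True
    have "taylor n x = (\<Sum>j\<le>p. if j = 0 then phi \<gamma> eta0 e x else 0)"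
      unfolding taylor_def using True by (intro sum.cong) (auto simp: Dphi_def)
    then have "ts n x = eta0 x"
      using gp True by (simp add: ts_def phi_def gp_def)
    then have "ginv (ts n x) = \<mu> x" using \<mu>_in[OF x] by simp
    then show ?thesis using True by simp
  next
    case False
    then show ?thesis by (simp add: bias_wt_def)
  qed
  then show ?thesis by (simp add: noise_wt_def algebra_simps)
qed

lemma score_alt:
  assumes n: "0 < real n * h n" and gp: "gp (x0 n) \<noteq> 0" and inS: "\<And>i. X i \<omega> \<in> S"
  shows "score j n \<omega> = (\<Sum>i<n. K (Z n (X i \<omega>)) * ((Y i \<omega> - ginv (ts n (X i \<omega>))) * score_weight (ts n (X i \<omega>)) * wt n (X i \<omega>)) * Z n (X i \<omega>) ^ j) / kap n"
proof -
  have k: "kap n * kap n = real n * h n" "kap n \<noteq> 0"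
    using kap_square[of n, unfolded power2_eq_square] kap_pos'[OF n, THEN less_imp_neq, THEN not_sym] by blast+
  have "kap n * c / (real n * h n) = c / kap n" for c
    unfolding k(1)[symmetric] using k(2) by simp
  then have "kap n * h n ^ (p + 1) * bias_sum (\<lambda>n z. z ^ j) n \<omega>
    = (h n ^ (p + 1) * (\<Sum>i<n. summand (\<lambda>n z. z ^ j * z ^ (p + 1)) bias_wt (\<lambda>n x. 0) n (X i \<omega>, Y i \<omega>))) / kap n"
    unfolding bias_sum_def by (simp add: mult.assoc)
  then have "score j n \<omega> = ((\<Sum>i<n. summand (\<lambda>n z. z ^ j) (\<lambda>n x. 0) noise_wt n (X i \<omega>, Y i \<omega>))
     + (\<Sum>i<n. h n ^ (p + 1) * summand (\<lambda>n z. z ^ j * z ^ (p + 1)) bias_wt (\<lambda>n x. 0) n (X i \<omega>, Y i \<omega>))) / kap n"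
    unfolding score_def noise_sum_def by (simp add: add_divide_distrib sum_distrib_left)
  also have "\<dots> = (\<Sum>i<n. K (Z n (X i \<omega>)) * ((Y i \<omega> - ginv (ts n (X i \<omega>))) * score_weight (ts n (X i \<omega>)) * wt n (X i \<omega>)) * Z n (X i \<omega>) ^ j) / kap n"
    unfolding sum.distrib[symmetric]
  proof (intro arg_cong2[where f = "(/)"] sum.cong refl)
    fix i
    have "h n * Z n (X i \<omega>) = X i \<omega> - x0 n" using h_gt_0[of n] by simp
    then have hz: "h n ^ (p + 1) * Z n (X i \<omega>) ^ (p + 1) = (X i \<omega> - x0 n) ^ (p + 1)"
      unfolding power_mult_distrib[symmetric] by simp
    show "summand (\<lambda>n z. z ^ j) (\<lambda>n x. 0) noise_wt n (X i \<omega>, Y i \<omega>) + h n ^ (p + 1) * summand (\<lambda>n z. z ^ j * z ^ (p + 1)) bias_wt (\<lambda>n x. 0) n (X i \<omega>, Y i \<omega>)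
      = K (Z n (X i \<omega>)) * ((Y i \<omega> - ginv (ts n (X i \<omega>))) * score_weight (ts n (X i \<omega>)) * wt n (X i \<omega>)) * Z n (X i \<omega>) ^ j"
      unfolding score_identity[OF gp inS] hz[symmetric] summand_def fst_conv snd_conv
      by (simp only: mult_zero_left add_0_left add_0_right) (simp only: distrib_left distrib_right mult_ac add_ac)
  qed
  finally show ?thesis .
qed

lemma hess_alt:
  "hess l n \<omega> = (\<Sum>i<n. K (Z n (X i \<omega>)) * ((wt n (X i \<omega>))\<^sup>2 * ((Y i \<omega> - \<mu> xd) * score_weight' t0 - info0)) * Z n (X i \<omega>) ^ l) / (real n * h n)"
  unfolding hess_def summand_def by (simp add: algebra_simps)

lemma sum_poly_linear:
  "(\<Sum>i\<in>A. c i * polyval p u (z i)) = (\<Sum>j\<le>p. (\<Sum>i\<in>A. c i * z i ^ j) * u j)"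
  unfolding polyval_def sum_distrib_left sum_distrib_right
  by (subst sum.swap) (simp add: mult_ac)

lemma sum_poly_quadratic:
  "(\<Sum>i\<in>A. c i * (polyval p u (z i))\<^sup>2) = (\<Sum>j\<le>p. \<Sum>k\<le>p. (\<Sum>i\<in>A. c i * z i ^ (j + k)) * u j * u k)"
proof -
  have "(\<Sum>i\<in>A. c i * (polyval p u (z i))\<^sup>2) = (\<Sum>i\<in>A. \<Sum>j\<le>p. \<Sum>k\<le>p. c i * z i ^ (j + k) * u j * u k)"
    unfolding polyval_def power2_eq_square sum_product unfolding sum_distrib_left
    by (intro sum.cong refl) (simp add: power_add mult_ac)
  also have "\<dots> = (\<Sum>j\<le>p. \<Sum>i\<in>A. \<Sum>k\<le>p. c i * z i ^ (j + k) * u j * u k)" by (rule sum.swap)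
  also have "\<dots> = (\<Sum>j\<le>p. \<Sum>k\<le>p. \<Sum>i\<in>A. c i * z i ^ (j + k) * u j * u k)"
    by (intro sum.cong refl) (rule sum.swap)
  finally show ?thesis by (simp add: sum_distrib_right)
qed

text \<open>A statement about a single outcome, obtained by summing the pointwise expansion. The two
  error terms come from the expansion itself and from replacing the empirical second derivative by
  its limit; both are quadratic in the size of \<open>u\<close>.\<close>

lemma crit_approx:
  assumes \<omega>: "\<omega> \<in> space M" and inS: "\<And>i. X i \<omega> \<in> S" and n: "0 < real n * h n" and gp: "gp (x0 n) \<noteq> 0"
    and \<epsilon>: "0 < \<epsilon>"
    and exp: "\<And>y t d. y \<in> YY \<Longrightarrow> \<bar>t - t0\<bar> < \<delta> \<Longrightarrow> \<bar>t + d - t0\<bar> < \<delta> \<Longrightarrow>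
      \<bar>Q (ginv (t + d)) y - Q (ginv t) y - (y - ginv t) * score_weight t * d
        - ((y - \<mu> xd) * score_weight' t0 - info0) * d\<^sup>2 / 2\<bar> \<le> \<epsilon> * (1 + \<bar>y\<bar>) * d\<^sup>2"
    and tsn: "\<And>x. x \<in> S \<Longrightarrow> \<bar>x - x0 n\<bar> \<le> h n \<Longrightarrow> \<bar>ts n x - t0\<bar> < \<delta> / 2"
    and wtn: "\<And>x. x \<in> S \<Longrightarrow> \<bar>x - x0 n\<bar> \<le> h n \<Longrightarrow> \<bar>wt n x\<bar> \<le> 2"
    and R: "2 * R / kap n < \<delta> / 2" and u: "(\<Sum>j\<le>p. \<bar>u j\<bar>) \<le> R"
  shows "\<bar>crit n \<omega> u - ((\<Sum>j\<le>p. score j n \<omega> * u j) - (\<Sum>j\<le>p. \<Sum>k\<le>p. lam0 * kernel_moment K (j + k) (Dom n) * u j * u k) / 2)\<bar>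
    \<le> (\<epsilon> * wmass n \<omega> + (\<Sum>j\<le>p. \<Sum>k\<le>p. \<bar>hess (j + k) n \<omega> + lam0 * kernel_moment K (j + k) (Dom n)\<bar>)) * (\<Sum>j\<le>p. \<bar>u j\<bar>)\<^sup>2"
proof -
  define U where "U = (\<Sum>j\<le>p. \<bar>u j\<bar>)"
  have U: "0 \<le> U" "U \<le> R" using u by (auto simp: U_def sum_nonneg)
  note kap = kap_pos'[OF n] kap_square[of n]
  define z where "z i = Z n (X i \<omega>)" for i
  define c1 where "c1 i = K (z i) * ((Y i \<omega> - ginv (ts n (X i \<omega>))) * score_weight (ts n (X i \<omega>)) * wt n (X i \<omega>))" for i
  define c2 where "c2 i = K (z i) * ((wt n (X i \<omega>))\<^sup>2 * ((Y i \<omega> - \<mu> xd) * score_weight' t0 - info0))" for i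
  define c3 where "c3 i = K (z i) * ((1 + \<bar>Y i \<omega>\<bar>) * (wt n (X i \<omega>))\<^sup>2)" for i
  define P where "P i = polyval p u (z i)" for i
  define q where "q i = (Q (ginv (ts n (X i \<omega>) + wt n (X i \<omega>) * P i / kap n)) (Y i \<omega>) - Q (ginv (ts n (X i \<omega>))) (Y i \<omega>)) * K (z i)" for i
  \<comment> \<open>Inside the window the perturbation is at most 2 R / \<open>kap n\<close>, so
    both predictors stay in the neighbourhood of the expansion. Outside it the kernel vanishes and
    nothing has to be expanded.\<close>
  have piece: "\<bar>q i - c1 i * P i / kap n - c2 i * (P i)\<^sup>2 / (2 * (kap n)\<^sup>2)\<bar> \<le> \<epsilon> * c3 i * U\<^sup>2 / (kap n)\<^sup>2" for i
  proof (cases "\<bar>X i \<omega> - x0 n\<bar> \<le> h n")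
    case True
    let ?d = "wt n (X i \<omega>) * P i / kap n" and ?t = "ts n (X i \<omega>)" and ?y = "Y i \<omega>"
    have PU: "\<bar>P i\<bar> \<le> U" unfolding P_def U_def z_def by (rule polyval_bound[OF Z_in[OF True]])
    have "\<bar>?d\<bar> \<le> 2 * R / kap n"
      unfolding abs_divide abs_mult using kap(1) wtn[OF inS True] PU U by (simp add: divide_right_mono mult_mono)
    then have td: "\<bar>?t + ?d - t0\<bar> < \<delta>" "\<bar>?t - t0\<bar> < \<delta>" using tsn[OF inS True] R by linarith+
    have "\<bar>K (z i) * (Q (ginv (?t + ?d)) ?y - Q (ginv ?t) ?y - (?y - ginv ?t) * score_weight ?t * ?d
        - ((?y - \<mu> xd) * score_weight' t0 - info0) * ?d\<^sup>2 / 2)\<bar> \<le> K (z i) * (\<epsilon> * (1 + \<bar>?y\<bar>) * ?d\<^sup>2)"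
      unfolding abs_mult using exp[OF Y_in[OF \<omega>] td(2) td(1)] K_nonneg[of "z i"] by (simp add: mult_left_mono)
    also have "K (z i) * (Q (ginv (?t + ?d)) ?y - Q (ginv ?t) ?y - (?y - ginv ?t) * score_weight ?t * ?d
        - ((?y - \<mu> xd) * score_weight' t0 - info0) * ?d\<^sup>2 / 2)
      = q i - c1 i * P i / kap n - c2 i * (P i)\<^sup>2 / (2 * (kap n)\<^sup>2)"
      unfolding q_def c1_def c2_def power_divide power_mult_distrib
      by (simp add: algebra_simps diff_divide_distrib add_divide_distrib)
    also have "K (z i) * (\<epsilon> * (1 + \<bar>?y\<bar>) * ?d\<^sup>2) = (\<epsilon> * c3 i / (kap n)\<^sup>2) * (P i)\<^sup>2"
      unfolding c3_def power_divide power_mult_distrib by (simp add: mult_ac)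
    also have "\<dots> \<le> (\<epsilon> * c3 i / (kap n)\<^sup>2) * U\<^sup>2"
    proof (rule mult_left_mono)
      show "(P i)\<^sup>2 \<le> U\<^sup>2" using power_mono[OF PU abs_ge_zero, of 2] by simp
      show "0 \<le> \<epsilon> * c3 i / (kap n)\<^sup>2" using \<epsilon> K_nonneg[of "z i"] by (simp add: c3_def)
    qed
    finally show ?thesis by simp
  next
    case False
    then have "z i \<notin> {-1..1}" using scaled_in_window[OF h_gt_0[of n], of "X i \<omega>" "x0 n"] unfolding z_def by blast
    then have "K (z i) = 0" by (rule K_outside)
    then show ?thesis by (simp add: q_def c1_def c2_def c3_def)
  qed
  have crit: "crit n \<omega> u = (\<Sum>i<n. q i)" unfolding crit_def q_def P_def z_def ..
  have s: "(\<Sum>i<n. c1 i * P i / kap n) = (\<Sum>j\<le>p. score j n \<omega> * u j)"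
    unfolding sum_divide_distrib[symmetric] P_def sum_poly_linear score_alt[OF n gp inS] c1_def z_def
    by (subst sum_divide_distrib) simp
  have hs: "(\<Sum>i<n. c2 i * (P i)\<^sup>2 / (2 * (kap n)\<^sup>2)) = (\<Sum>j\<le>p. \<Sum>k\<le>p. hess (j + k) n \<omega> * u j * u k) / 2"
  proof -
    define D where "D l = (\<Sum>i<n. c2 i * z i ^ l)" for l
    have "(\<Sum>i<n. c2 i * (P i)\<^sup>2 / (2 * (kap n)\<^sup>2)) = (\<Sum>j\<le>p. \<Sum>k\<le>p. D (j + k) * u j * u k) / (2 * (kap n)\<^sup>2)"
      unfolding sum_divide_distrib[symmetric] P_def sum_poly_quadratic D_def ..
    also have "\<dots> = (\<Sum>j\<le>p. \<Sum>k\<le>p. D (j + k) / (kap n)\<^sup>2 * u j * u k) / 2"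
      by (simp add: sum_divide_distrib mult.commute[of 2])
    also have "\<dots> = (\<Sum>j\<le>p. \<Sum>k\<le>p. hess (j + k) n \<omega> * u j * u k) / 2"
      unfolding D_def hess_alt kap(2) c2_def z_def ..
    finally show ?thesis .
  qed
  have w: "(\<Sum>i<n. \<epsilon> * c3 i * U\<^sup>2 / (kap n)\<^sup>2) = \<epsilon> * wmass n \<omega> * U\<^sup>2"
    unfolding wmass_def kap(2)[symmetric] c3_def z_def by (simp add: sum_distrib_left sum_distrib_right sum_divide_distrib mult_ac)
  have "\<bar>crit n \<omega> u - (\<Sum>j\<le>p. score j n \<omega> * u j) - (\<Sum>j\<le>p. \<Sum>k\<le>p. hess (j + k) n \<omega> * u j * u k) / 2\<bar>
    = \<bar>\<Sum>i<n. q i - c1 i * P i / kap n - c2 i * (P i)\<^sup>2 / (2 * (kap n)\<^sup>2)\<bar>"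
    unfolding crit s[symmetric] hs[symmetric] by (simp add: sum_subtractf)
  also have "\<dots> \<le> (\<Sum>i<n. \<epsilon> * c3 i * U\<^sup>2 / (kap n)\<^sup>2)"
    by (rule order.trans[OF sum_abs]) (intro sum_mono piece)
  finally have 1: "\<bar>crit n \<omega> u - (\<Sum>j\<le>p. score j n \<omega> * u j) - (\<Sum>j\<le>p. \<Sum>k\<le>p. hess (j + k) n \<omega> * u j * u k) / 2\<bar> \<le> \<epsilon> * wmass n \<omega> * U\<^sup>2"
    unfolding w .
  define E where "E = (\<Sum>j\<le>p. \<Sum>k\<le>p. \<bar>hess (j + k) n \<omega> + lam0 * kernel_moment K (j + k) (Dom n)\<bar>)"
  have "\<bar>(\<Sum>j\<le>p. \<Sum>k\<le>p. hess (j + k) n \<omega> * u j * u k) + (\<Sum>j\<le>p. \<Sum>k\<le>p. lam0 * kernel_moment K (j + k) (Dom n) * u j * u k)\<bar>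
    = \<bar>\<Sum>j\<le>p. \<Sum>k\<le>p. (hess (j + k) n \<omega> + lam0 * kernel_moment K (j + k) (Dom n)) * u j * u k\<bar>"
    by (simp add: sum.distrib[symmetric] distrib_right)
  also have "\<dots> \<le> (\<Sum>j\<le>p. \<Sum>k\<le>p. \<bar>hess (j + k) n \<omega> + lam0 * kernel_moment K (j + k) (Dom n)\<bar> * U\<^sup>2)"
  proof (rule order.trans[OF sum_abs], rule sum_mono, rule order.trans[OF sum_abs], rule sum_mono)
    fix j k assume jk: "j \<in> {..p}" "k \<in> {..p}"
    have "\<bar>u j\<bar> \<le> U" "\<bar>u k\<bar> \<le> U" unfolding U_def using jk by (auto intro!: member_le_sum)
    then have "\<bar>u j\<bar> * \<bar>u k\<bar> \<le> U\<^sup>2" unfolding power2_eq_square by (intro mult_mono) auto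
    from mult_left_mono[OF this abs_ge_zero]
    show "\<bar>(hess (j + k) n \<omega> + lam0 * kernel_moment K (j + k) (Dom n)) * u j * u k\<bar>
      \<le> \<bar>hess (j + k) n \<omega> + lam0 * kernel_moment K (j + k) (Dom n)\<bar> * U\<^sup>2"
      unfolding abs_mult mult.assoc .
  qed
  also have "\<dots> = E * U\<^sup>2" unfolding E_def by (simp add: sum_distrib_right)
  finally have 2: "\<bar>(\<Sum>j\<le>p. \<Sum>k\<le>p. hess (j + k) n \<omega> * u j * u k) + (\<Sum>j\<le>p. \<Sum>k\<le>p. lam0 * kernel_moment K (j + k) (Dom n) * u j * u k)\<bar> \<le> E * U\<^sup>2" .
  have "0 \<le> E * U\<^sup>2" unfolding E_def by (intro mult_nonneg_nonneg sum_nonneg) auto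
  then show ?thesis unfolding U_def[symmetric] E_def[symmetric] distrib_right using 1 2 by linarith
qed

text \<open>An affine change of coefficients: \<open>bs\<close> corresponds to u = 0, where the
  predictor is \<open>ts\<close>, and the factor h^j turns powers of x - x0 into powers of the
  scaled coordinate.\<close>

lemma lik_eq_crit:
  assumes n: "0 < real n * h n" and gp: "gp (x0 n) \<noteq> 0"
  shows "guided_quasi_lik Q ginv K e \<gamma> p n (h n) (x0 n) (\<lambda>i. X i \<omega>) (\<lambda>i. Y i \<omega>) \<beta>
    = (crit n \<omega> (\<lambda>j. kap n * h n ^ j * (\<beta> j - bs n j)) + (\<Sum>i<n. Q (ginv (ts n (X i \<omega>))) (Y i \<omega>) * K (Z n (X i \<omega>)))) / h n"
proof -
  note kap = kap_pos'[OF n]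
  define u where "u j = kap n * h n ^ j * (\<beta> j - bs n j)" for j
  have "e x + ((\<Sum>j\<le>p. \<beta> j * (x - x0 n) ^ j) - e (x0 n)) * guide_power \<gamma> (e x) / guide_power \<gamma> (e (x0 n))
    = ts n x + wt n x * polyval p u (Z n x) / kap n" for x
  proof -
    have hz: "h n * Z n x = x - x0 n" using h_gt_0[of n] by simp
    have pw: "polyval p u (Z n x) / kap n = (\<Sum>j\<le>p. (\<beta> j - bs n j) * (x - x0 n) ^ j)"
      unfolding polyval_def sum_divide_distrib
    proof (intro sum.cong refl)
      fix j
      have "u j * Z n x ^ j / kap n = (\<beta> j - bs n j) * (h n ^ j * Z n x ^ j)"
        unfolding u_def using kap by simp
      then show "u j * Z n x ^ j / kap n = (\<beta> j - bs n j) * (x - x0 n) ^ j"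
        unfolding power_mult_distrib[symmetric] hz .
    qed
    \<comment> \<open>The extra \<open>e (x0 n)\<close> in coefficient 0 cancels the centring by the
      guide at \<open>x0 n\<close> that is built into the family.\<close>
    have b: "(\<Sum>j\<le>p. bs n j * (x - x0 n) ^ j) = gp (x0 n) * taylor n x + e (x0 n)"
    proof -
      have "(\<Sum>j\<le>p. bs n j * (x - x0 n) ^ j) = (\<Sum>j\<le>p. gp (x0 n) * (Dphi j (x0 n) / fact j * (x - x0 n) ^ j)) + (\<Sum>j\<le>p. if j = 0 then e (x0 n) else 0)"
        unfolding sum.distrib[symmetric] by (intro sum.cong refl) (simp add: bs_def algebra_simps)
      then show ?thesis by (simp add: taylor_def sum_distrib_left)
    qed
    have "(\<Sum>j\<le>p. \<beta> j * (x - x0 n) ^ j) - e (x0 n) = gp (x0 n) * taylor n x + polyval p u (Z n x) / kap n"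
      using b unfolding pw by (simp add: left_diff_distrib sum_subtractf)
    then show ?thesis unfolding ts_def wt_def gp_def[symmetric] using gp by (simp add: field_simps)
  qed
  note arg = this
  show ?thesis unfolding guided_quasi_lik_def arg kernel_scaled_def crit_def u_def[symmetric]
    by (simp add: sum_divide_distrib[symmetric] sum.distrib[symmetric] algebra_simps)
qed

text \<open>The definition of the estimator says something only if the original likelihood has a
  maximizer, so existence is first carried back through the change of coefficients.\<close>

lemma bhat_maximizes_crit:
  assumes n: "0 < real n * h n" and gp: "gp (x0 n) \<noteq> 0" and \<omega>: "\<omega> \<in> space M"
    and ex: "\<exists>u. \<forall>w. crit n \<omega> w \<le> crit n \<omega> u"
  shows "crit n \<omega> w \<le> crit n \<omega> (\<lambda>j. kap n * h n ^ j * (bhat n \<omega> j - bs n j))"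
proof -
  note kap = kap_pos'[OF n]
  let ?L = "guided_quasi_lik Q ginv K e \<gamma> p n (h n) (x0 n) (\<lambda>i. X i \<omega>) (\<lambda>i. Y i \<omega>)"
  let ?U = "\<lambda>\<beta> j. kap n * h n ^ j * (\<beta> j - bs n j)"
  define B where "B u j = bs n j + u j / (kap n * h n ^ j)" for u j
  have UB: "?U (B u) = u" for u
    using kap h_gt_0[of n] by (auto simp: B_def)
  have le: "?L \<beta>' \<le> ?L \<beta> \<longleftrightarrow> crit n \<omega> (?U \<beta>') \<le> crit n \<omega> (?U \<beta>)" for \<beta> \<beta>'
    unfolding lik_eq_crit[OF n gp] using h_gt_0[of n] by (simp add: divide_le_cancel)
  obtain u where u: "\<And>w. crit n \<omega> w \<le> crit n \<omega> u" using ex by blast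
  have "?L \<beta>' \<le> ?L (B u)" for \<beta>' unfolding le UB by (rule u)
  then have "\<forall>\<beta>'. ?L \<beta>' \<le> ?L (bhat n \<omega>)"
    using estimator \<omega> unfolding guided_estimator_def Let_def by blast
  then have "?L (B w) \<le> ?L (bhat n \<omega>)" by blast
  then show ?thesis unfolding le UB .
qed

text \<open>One null set for all observations at once, because the expansion is applied to a whole
  sample at a fixed outcome.\<close>

lemma all_in_S: "\<exists>N\<in>events. prob N = 0 \<and> (\<forall>\<omega>\<in>space M - N. \<forall>i. X i \<omega> \<in> S)"
proof -
  have 1: "AE \<omega> in M. X i \<omega> \<in> S" for i
  proof -
    have m: "{q \<in> space borel. fst q \<in> S} \<in> sets (borel :: (real \<times> real) measure)"
    proof -
      have [measurable]: "S \<in> sets borel" using S_closed by simp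
      show ?thesis unfolding borel_prod[symmetric] by measurable
    qed
    have d: "distr M (borel :: (real \<times> real) measure) (\<lambda>\<omega>. (X i \<omega>, Y i \<omega>)) = distr M borel (\<lambda>\<omega>. (X 0 \<omega>, Y 0 \<omega>))"
      using iid unfolding iid_pairs_def by blast
    have "AE q in distr M (borel :: (real \<times> real) measure) (\<lambda>\<omega>. (X 0 \<omega>, Y 0 \<omega>)). fst q \<in> S"
      using AE_X_in_S by (subst AE_distr_iff[OF pair_measurable m]) simp
    then have "AE q in distr M (borel :: (real \<times> real) measure) (\<lambda>\<omega>. (X i \<omega>, Y i \<omega>)). fst q \<in> S"
      unfolding d .
    then show ?thesis by (subst (asm) AE_distr_iff[OF pair_measurable m]) simp
  qed
  then have "AE \<omega> in M. \<forall>i. X i \<omega> \<in> S" by (simp add: AE_all_countable)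
  then obtain N where N: "{\<omega>\<in>space M. \<not> (\<forall>i. X i \<omega> \<in> S)} \<subseteq> N" "emeasure M N = 0" "N \<in> events"
    by (rule AE_E)
  then show ?thesis by (intro bexI[of _ N]) (auto simp: measure_def)
qed

lemma wmass_nonneg: "0 \<le> wmass n \<omega>"
  unfolding wmass_def using K_nonneg h_gt_0[of n] by (intro divide_nonneg_nonneg sum_nonneg) auto

text \<open>Three exceptional events of probability at most \<eta> / 3 each, for a large
  \<open>uhat\<close>, a large \<open>wmass\<close> and a second derivative far from its limit, and
  a null set for the support. Off their union the deterministic lemma on concave maximizers
  applies.\<close>

lemma fit_close: "to_zero_in_prob (\<lambda>n \<omega>. kap n * (bhat n \<omega> 0 - bs n 0) - uhat 0 n \<omega>)"
  unfolding to_zero_in_prob_def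
proof (intro allI impI)
  fix \<delta>' \<eta> :: real assume \<delta>': "0 < \<delta>'" and \<eta>: "0 < \<eta>"
  then have \<eta>3: "0 < \<eta> / 3" by simp
  obtain N where N: "N \<in> events" "prob N = 0" "\<And>\<omega> i. \<omega> \<in> space M - N \<Longrightarrow> X i \<omega> \<in> S"
    using all_in_S by blast
  obtain R0 where R0: "\<forall>\<^sub>F n in sequentially. unlikely (\<eta>/3) (\<lambda>\<omega>. R0 < \<bar>\<Sum>j\<le>p. \<bar>uhat j n \<omega>\<bar>\<bar>)"
    using uhat_bounded \<eta>3 unfolding bounded_in_prob_def by blast
  \<comment> \<open>Room for the maximizer of the quadratic plus a box of radius \<delta>' in p + 1
    coordinates, measured by the sum of absolute values.\<close>
  define R where "R = \<bar>R0\<bar> + (real p + 1) * \<delta>'"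
  have R: "0 < R" using \<delta>' by (simp add: R_def add_nonneg_pos)
  obtain Cw where Cw: "\<forall>\<^sub>F n in sequentially. unlikely (\<eta>/3) (\<lambda>\<omega>. Cw < \<bar>wmass n \<omega>\<bar>)"
    using wmass_bounded \<eta>3 unfolding bounded_in_prob_def by blast
  define lH where "lH = lam0 * l0"
  have lH: "0 < lH" using lam0_pos l0_pos by (simp add: lH_def)
  \<comment> \<open>The largest total error tolerated: 4 \<tau>0 R^2 is half of what the concavity
    argument allows, so the inequality there is strict.\<close>
  define \<tau>0 where "\<tau>0 = lH * \<delta>'\<^sup>2 / (8 * R\<^sup>2)"
  have \<tau>0: "0 < \<tau>0" using lH \<delta>' R by (simp add: \<tau>0_def)
  have \<tau>R: "4 * \<tau>0 * R\<^sup>2 = lH * \<delta>'\<^sup>2 / 2" using R by (simp add: \<tau>0_def)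
  \<comment> \<open>Half of the tolerated error is given to the expansion, whose weight is at most
    |Cw|; the other half is left for the second derivative.\<close>
  define \<epsilon> where "\<epsilon> = \<tau>0 / (2 * (\<bar>Cw\<bar> + 1))"
  have \<epsilon>: "0 < \<epsilon>" using \<tau>0 by (simp add: \<epsilon>_def add_nonneg_pos)
  have "\<epsilon> * (\<bar>Cw\<bar> + 1) = \<tau>0 / 2" unfolding \<epsilon>_def by (simp add: add_nonneg_pos divide_simps)
  then have \<epsilon>C: "\<epsilon> * \<bar>Cw\<bar> \<le> \<tau>0 / 2" using \<epsilon> by (simp add: distrib_left)
  define E where "E n \<omega> = (\<Sum>j\<le>p. \<Sum>k\<le>p. \<bar>hess (j + k) n \<omega> + lam0 * kernel_moment K (j + k) (Dom n)\<bar>)" for n \<omega>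
  have "to_zero_in_prob E" unfolding E_def[abs_def]
    by (intro to_zero_in_prob_sum to_zero_in_prob_abs hess_lln)
  then have Ez: "\<forall>\<^sub>F n in sequentially. unlikely (\<eta>/3) (\<lambda>\<omega>. \<tau>0 / 2 < \<bar>E n \<omega>\<bar>)"
  proof -
    have "0 < \<tau>0 / 2" using \<tau>0 by simp
    with \<open>to_zero_in_prob E\<close> \<eta>3 show ?thesis unfolding to_zero_in_prob_def by blast
  qed
  obtain \<delta> where \<delta>: "0 < \<delta>" and ex: "\<And>y t d. y \<in> YY \<Longrightarrow> \<bar>t - t0\<bar> < \<delta> \<Longrightarrow> \<bar>t + d - t0\<bar> < \<delta> \<Longrightarrow>
      \<bar>Q (ginv (t + d)) y - Q (ginv t) y - (y - ginv t) * score_weight t * d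
        - ((y - \<mu> xd) * score_weight' t0 - info0) * d\<^sup>2 / 2\<bar> \<le> \<epsilon> * (1 + \<bar>y\<bar>) * d\<^sup>2"
    using quasi_second_order_expansion[OF \<epsilon>] by blast
  have \<delta>2: "0 < \<delta> / 2" using \<delta> by simp
  have tsn: "\<forall>\<^sub>F n in sequentially. \<forall>x\<in>S. \<bar>x - x0 n\<bar> \<le> h n \<longrightarrow> \<bar>ts n x - t0\<bar> < \<delta> / 2"
    using tendstoD[OF ts_lim \<delta>2] unfolding eventually_Win by (simp add: dist_real_def)
  have wtn: "\<forall>\<^sub>F n in sequentially. \<forall>x\<in>S. \<bar>x - x0 n\<bar> \<le> h n \<longrightarrow> \<bar>wt n x\<bar> \<le> 2"
    using tendsto_Win_bounded[OF wt_lim] by simp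
  have kapR: "\<forall>\<^sub>F n in sequentially. 4 * R / \<delta> < kap n"
    using kap_lim by (simp add: filterlim_at_top_dense)
  show "\<forall>\<^sub>F n in sequentially. unlikely \<eta> (\<lambda>\<omega>. \<delta>' < \<bar>kap n * (bhat n \<omega> 0 - bs n 0) - uhat 0 n \<omega>\<bar>)"
    using R0 Cw Ez tsn wtn kapR window_Dom gp_x0_nz kap_pos
  proof eventually_elim
    case (elim n)
    obtain B1 where B1: "B1 \<in> events" "prob B1 \<le> \<eta>/3" "{\<omega>\<in>space M. R0 < \<bar>\<Sum>j\<le>p. \<bar>uhat j n \<omega>\<bar>\<bar>} \<subseteq> B1" using elim(1) by blast
    obtain B2 where B2: "B2 \<in> events" "prob B2 \<le> \<eta>/3" "{\<omega>\<in>space M. Cw < \<bar>wmass n \<omega>\<bar>} \<subseteq> B2" using elim(2) by blast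
    obtain B3 where B3: "B3 \<in> events" "prob B3 \<le> \<eta>/3" "{\<omega>\<in>space M. \<tau>0 / 2 < \<bar>E n \<omega>\<bar>} \<subseteq> B3" using elim(3) by blast
    have n: "0 < real n * h n" and kap: "0 < kap n" using elim(9) by blast+
    have Rk: "2 * R / kap n < \<delta> / 2" using elim(6) \<delta> kap by (simp add: field_simps)
    let ?B = "N \<union> (B1 \<union> (B2 \<union> B3))"
    have "prob ?B \<le> prob N + (prob B1 + (prob B2 + prob B3))"
      using N B1 B2 B3 by (intro order.trans[OF measure_Un_le] add_mono order.refl) auto
    then have pB: "prob ?B \<le> \<eta>" using N(2) B1(2) B2(2) B3(2) by linarith
    have "\<bar>kap n * (bhat n \<omega> 0 - bs n 0) - uhat 0 n \<omega>\<bar> \<le> \<delta>'" if \<omega>: "\<omega> \<in> space M" and nB: "\<omega> \<notin> ?B" for \<omega>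
    proof -
      have inS: "X i \<omega> \<in> S" for i using N(3) \<omega> nB by blast
      have "\<not> R0 < \<bar>\<Sum>j\<le>p. \<bar>uhat j n \<omega>\<bar>\<bar>" using B1(3) \<omega> nB by blast
      then have uR: "(\<Sum>j\<le>p. \<bar>uhat j n \<omega>\<bar>) + (real p + 1) * \<delta>' \<le> R" unfolding R_def by linarith
      have "\<not> Cw < \<bar>wmass n \<omega>\<bar>" using B2(3) \<omega> nB by blast
      then have "wmass n \<omega> \<le> \<bar>Cw\<bar>" by linarith
      then have w: "\<epsilon> * wmass n \<omega> \<le> \<tau>0 / 2" using \<epsilon>C \<epsilon> by (meson mult_left_mono order.trans less_imp_le)
      have "\<not> \<tau>0 / 2 < \<bar>E n \<omega>\<bar>" using B3(3) \<omega> nB by blast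
      then have t: "\<epsilon> * wmass n \<omega> + E n \<omega> \<le> \<tau>0" using w by linarith
      have E0: "0 \<le> E n \<omega>" unfolding E_def by (intro sum_nonneg) auto
      have cc: "(\<exists>u. \<forall>w. crit n \<omega> w \<le> crit n \<omega> u) \<and> (\<forall>u. (\<forall>w. crit n \<omega> w \<le> crit n \<omega> u) \<longrightarrow> (\<forall>j\<le>p. \<bar>u j - uhat j n \<omega>\<bar> \<le> \<delta>'))"
      proof (rule concave_argmax_near_quadratic[where H = "\<lambda>j k. lam0 * kernel_moment K (j + k) (Dom n)" and S = "\<lambda>j. score j n \<omega>"
            and v = "\<lambda>j. uhat j n \<omega>" and \<tau> = "\<epsilon> * wmass n \<omega> + E n \<omega>" and l = lH and R = R])
        show "(1 - s) * crit n \<omega> u + s * crit n \<omega> w \<le> crit n \<omega> (\<lambda>j. (1 - s) * u j + s * w j)" if "0 \<le> s" "s \<le> 1" for u w s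
          by (rule crit_concave[OF \<omega> that])
        show "crit n \<omega> u = crit n \<omega> w" if "\<And>j. j \<le> p \<Longrightarrow> u j = w j" for u w by (rule crit_dep[OF that])
        show "continuous_on UNIV (crit n \<omega>)" by (rule crit_continuous[OF \<omega>])
        show "\<bar>crit n \<omega> u - ((\<Sum>j\<le>p. score j n \<omega> * u j) - (\<Sum>j\<le>p. \<Sum>k\<le>p. lam0 * kernel_moment K (j + k) (Dom n) * u j * u k) / 2)\<bar>
           \<le> (\<epsilon> * wmass n \<omega> + E n \<omega>) * (\<Sum>j\<le>p. \<bar>u j\<bar>)\<^sup>2" if "(\<Sum>j\<le>p. \<bar>u j\<bar>) \<le> R" for u
          unfolding E_def by (rule crit_approx[OF \<omega> inS n elim(8) \<epsilon> ex _ _ Rk that]) (use elim(4,5) in blast)+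
        show "lam0 * kernel_moment K (j + k) (Dom n) = lam0 * kernel_moment K (k + j) (Dom n)" for j k by (simp add: add.commute)
        show "lH * (\<Sum>j\<le>p. (u j)\<^sup>2) \<le> (\<Sum>j\<le>p. \<Sum>k\<le>p. lam0 * kernel_moment K (j + k) (Dom n) * u j * u k)" for u
          using mult_left_mono[OF Ni(1)[OF elim(7), of u] less_imp_le[OF lam0_pos]]
          by (simp add: lH_def sum_distrib_left mult.assoc)
        show "(\<Sum>k\<le>p. lam0 * kernel_moment K (j + k) (Dom n) * uhat k n \<omega>) = score j n \<omega>" if "j \<le> p" for j
          by (rule uhat_solves[OF elim(7) that])
        show "(\<Sum>j\<le>p. \<bar>uhat j n \<omega>\<bar>) + (real p + 1) * \<delta>' \<le> R" by (rule uR)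
        show "0 < lH" "0 < \<delta>'" by (rule lH, rule \<delta>')
        show "0 \<le> \<epsilon> * wmass n \<omega> + E n \<omega>" using \<epsilon> wmass_nonneg[of n \<omega>] E0 by simp
        have "4 * (\<epsilon> * wmass n \<omega> + E n \<omega>) * R\<^sup>2 \<le> 4 * \<tau>0 * R\<^sup>2" using t by (intro mult_right_mono) auto
        also have "\<dots> < lH * \<delta>'\<^sup>2" unfolding \<tau>R using lH \<delta>' by simp
        finally show "4 * (\<epsilon> * wmass n \<omega> + E n \<omega>) * R\<^sup>2 < lH * \<delta>'\<^sup>2" .
      qed
      have "\<forall>w. crit n \<omega> w \<le> crit n \<omega> (\<lambda>j. kap n * h n ^ j * (bhat n \<omega> j - bs n j))"
        using bhat_maximizes_crit[OF n elim(8) \<omega> conjunct1[OF cc]] by blast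
      from conjunct2[OF cc, rule_format, OF this[rule_format], of 0] show ?thesis by simp
    qed
    then have "{\<omega>\<in>space M. \<delta>' < \<bar>kap n * (bhat n \<omega> 0 - bs n 0) - uhat 0 n \<omega>\<bar>} \<subseteq> ?B"
      by (auto simp: not_less[symmetric])
    then show ?case using pB N(1) B1(1) B2(1) B3(1) by (intro bexI[of _ ?B]) auto
  qed
qed

section \<open>Linearization and limit law\<close>

definition bias :: "nat \<Rightarrow> real" where "bias n = bias_odd K p \<gamma> eta0 e (x0 n) (h n) (Dom n)"

text \<open>The scalar factors are frozen at \<open>xd\<close>, while the kernel integral follows
  the window.\<close>

definition avar :: "nat \<Rightarrow> real" where
  "avar n = v xd * (deriv g (\<mu> xd))\<^sup>2 / f xd * (LINT z:Dom n|lborel. equiv_kernel K 0 p (Dom n) z * equiv_kernel K 0 p (Dom n) z)"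

text \<open>Three errors are collected: the distance of the fit from the quadratic maximizer, the
  fluctuation of the bias sum, and the change of the bias coefficient from \<open>xd\<close> to
  \<open>x0 n\<close>. The last two are multiplied by \<open>kap n * h n ^ (p + 1)\<close>, which is
  bounded.\<close>

lemma fit_linearization:
  "to_zero_in_prob (\<lambda>n \<omega>. kap n * (bhat n \<omega> 0 - eta0 (x0 n) - bias n) - noise_sum aker n \<omega> / lam0)"
proof -
  obtain C where C: "\<forall>\<^sub>F n in sequentially. \<bar>kap n * h n ^ (p + 1)\<bar> \<le> C" using kap_h by blast
  define J where "J n = (LINT z:Dom n|lborel. aker n z * z ^ (p + 1) * K z)" for n
  have 1: "to_zero_in_prob (\<lambda>n \<omega>. (kap n * h n ^ (p + 1) / lam0) * (bias_sum aker n \<omega> - cB * f xd * J n))"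
    unfolding J_def
  proof (rule to_zero_in_prob_scale[OF bias_sum_lln[OF _ aker_bound], where C = "C / lam0"])
    show "\<forall>\<^sub>F n in sequentially. \<bar>kap n * h n ^ (p + 1) / lam0\<bar> \<le> C / lam0"
      using C by eventually_elim (use lam0_pos in \<open>simp add: abs_divide divide_right_mono\<close>)
  qed simp
  \<comment> \<open>The coefficient of the leading bias. The law of large numbers produces it at
    \<open>xd\<close>, whereas \<open>bias\<close> has it at the moving point.\<close>
  define G where "G x = gp x * Dphi (p + 1) x / fact (p + 1)" for x
  have G: "(\<lambda>n. G xd - G (x0 n)) \<longlonglongrightarrow> G xd - G xd"
    unfolding G_def by (intro tendsto_intros x0_isCont_lim gp_isCont Dphi_isCont) auto
  have "(\<lambda>n. (kap n * h n ^ (p + 1) * J n) * (G xd - G (x0 n))) \<longlonglongrightarrow> 0"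
  proof (rule Lim_null_comparison)
    show "(\<lambda>n. \<bar>C\<bar> * \<bar>Ca\<bar> * \<bar>G xd - G (x0 n)\<bar>) \<longlonglongrightarrow> 0"
      using G by (intro tendsto_mult_right_zero tendsto_rabs_zero) simp
    show "\<forall>\<^sub>F n in sequentially. norm ((kap n * h n ^ (p + 1) * J n) * (G xd - G (x0 n))) \<le> \<bar>C\<bar> * \<bar>Ca\<bar> * \<bar>G xd - G (x0 n)\<bar>"
      using C aker_bound
    proof eventually_elim
      case (elim n)
      have "\<bar>J n\<bar> \<le> Ca" unfolding J_def
      proof (rule window_integral_bound)
        fix z :: real assume z: "z \<in> {-1..1}"
        then have "\<bar>z\<bar> ^ (p + 1) \<le> 1" by (intro power_le_one) auto
        then have "\<bar>aker n z\<bar> * \<bar>z\<bar> ^ (p + 1) \<le> \<bar>aker n z\<bar>" by (intro mult_left_le) auto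
        also have "\<dots> \<le> Ca" using elim z by blast
        finally show "\<bar>aker n z * z ^ (p + 1)\<bar> \<le> Ca" by (simp add: abs_mult power_abs)
      qed simp
      then have "\<bar>kap n * h n ^ (p + 1)\<bar> * \<bar>J n\<bar> \<le> \<bar>C\<bar> * \<bar>Ca\<bar>" using elim by (intro mult_mono) auto
      from mult_right_mono[OF this abs_ge_zero] show ?case unfolding real_norm_def abs_mult[of _ "G xd - G (x0 n)"] abs_mult[of _ "J n"] .
    qed
  qed
  from to_zero_in_prob_add[OF to_zero_in_prob_add[OF fit_close 1] to_zero_in_prob_const[OF this]]
  show ?thesis
  proof (rule to_zero_in_prob_mono, use window_Dom gp_x0_nz in eventually_elim)
    case (elim n)
    have bs0: "bs n 0 = eta0 (x0 n)" using elim(2) by (simp add: bs_def Dphi_def phi_def gp_def)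
    have J: "J n = (LINT z:Dom n|lborel. z ^ (p + 1) * equiv_kernel K 0 p (Dom n) z)"
      unfolding J_def Ni(4)[OF elim(1)] aker_def by (simp add: mult_ac)
    have b: "kap n * bias n = kap n * h n ^ (p + 1) * J n * G (x0 n)"
      unfolding bias_def bias_odd_def J G_def gp_def Dphi_def by (simp add: mult_ac)
    \<comment> \<open>The information and the density cancel, which is why neither appears in the
      leading bias.\<close>
    have cBl: "cB * f xd / lam0 = G xd"
      using lam0_pos f_pos info0_pos by (simp add: cB_def lam0_def G_def)
    have "kap n * (bhat n \<omega> 0 - eta0 (x0 n) - bias n) - noise_sum aker n \<omega> / lam0
      = kap n * (bhat n \<omega> 0 - bs n 0) - uhat 0 n \<omega> + kap n * h n ^ (p + 1) / lam0 * (bias_sum aker n \<omega> - cB * f xd * J n)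
        + kap n * h n ^ (p + 1) * J n * (G xd - G (x0 n))" for \<omega>
      unfolding uhat_0 bs0 cBl[symmetric] right_diff_distrib b
      by (simp add: add_divide_distrib mult_ac)
    then show ?case by simp
  qed
qed

lemma avar_bounds: "\<exists>\<delta>>0. \<forall>\<^sub>F n in sequentially. \<delta> \<le> avar n"
proof (intro exI conjI)
  have c: "0 < v xd * (deriv g (\<mu> xd))\<^sup>2 / f xd" using v_pos f_pos g'w0 by simp
  then show "0 < v xd * (deriv g (\<mu> xd))\<^sup>2 / f xd * (1 / 2)" by simp
  show "\<forall>\<^sub>F n in sequentially. v xd * (deriv g (\<mu> xd))\<^sup>2 / f xd * (1 / 2) \<le> avar n"
    using window_Dom
  proof eventually_elim
    case (elim n)
    have "1 / 2 \<le> (LINT z:Dom n|lborel. equiv_kernel K 0 p (Dom n) z * equiv_kernel K 0 p (Dom n) z)"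
      by (rule equiv_kernel_square_ge[OF elim]) (simp add: Dom_def)
    then show ?case unfolding avar_def using c by (intro mult_left_mono) auto
  qed
qed

lemma bhat_measurable [measurable]: "(\<lambda>\<omega>. bhat n \<omega> 0) \<in> borel_measurable M"
  using estimator unfolding guided_estimator_def by blast

lemma noise_sum_measurable [measurable]: "noise_sum aker n \<in> borel_measurable M"
proof -
  have "(\<lambda>\<omega>. summand aker (\<lambda>n x. 0) noise_wt n (X i \<omega>, Y i \<omega>)) \<in> borel_measurable M" for i
    by (rule measurable_compose[OF pair_measurable summand_measurable[OF _ _ _ aker_bound tendsto_const noise_wt_lim]]) auto
  then show ?thesis unfolding noise_sum_def[abs_def] by measurable
qed

text \<open>Any variance asymptotically equivalent to \<open>avar\<close> and any centring that
  differs from \<open>bias\<close> by less than the order of 1 / \<open>kap n\<close> is allowed.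
  Interior and boundary points and both parities of the degree become choices of \<open>s\<close>
  and \<open>b\<close>.\<close>

theorem fit_asymptotically_normal:
  assumes s: "(\<lambda>n. s n / avar n) \<longlonglongrightarrow> 1" and b: "(\<lambda>n. kap n * (b n - bias n)) \<longlonglongrightarrow> 0"
  shows "weak_conv_m (\<lambda>n. distr M borel (\<lambda>\<omega>. kap n / sqrt (s n) * (bhat n \<omega> 0 - eta0 (x0 n) - b n))) std_normal_distribution"
proof (rule levy_continuity)
  show "real_distribution (distr M borel (\<lambda>\<omega>. kap n / sqrt (s n) * (bhat n \<omega> 0 - eta0 (x0 n) - b n)))" for n
    by (rule real_distribution_distr) measurable
  show "real_distribution std_normal_distribution" by (rule real_dist_normal_dist)
  fix t
  obtain \<delta> where \<delta>: "0 < \<delta>" "\<forall>\<^sub>F n in sequentially. \<delta> \<le> avar n" using avar_bounds by blast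
  define T where "T n = (score_weight t0)\<^sup>2 * v xd * f xd * (LINT z:Dom n|lborel. (aker n z)\<^sup>2 * (K z)\<^sup>2)" for n
  \<comment> \<open>The noise has variance \<open>T n\<close>, and the fit divides it by
    \<open>lam0\<close>. As \<open>score_weight t0\<close> is g' times \<open>info0\<close>, the
    information cancels and v g'^2 / f remains.\<close>
  have T: "\<forall>\<^sub>F n in sequentially. T n = lam0\<^sup>2 * avar n"
    using window_Dom
  proof eventually_elim
    case (elim n)
    have "(LINT z:Dom n|lborel. (aker n z)\<^sup>2 * (K z)\<^sup>2) = (LINT z:Dom n|lborel. equiv_kernel K 0 p (Dom n) z * equiv_kernel K 0 p (Dom n) z)"
      unfolding Ni(4)[OF elim] aker_def by (simp add: power2_eq_square mult_ac)
    moreover have "score_weight t0 = deriv g (\<mu> xd) * info0" using info0_eq g'w0 by simp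
    ultimately show ?case unfolding T_def avar_def lam0_def using f_pos by (simp add: power2_eq_square)
  qed
  have Tb: "\<forall>\<^sub>F n in sequentially. lam0\<^sup>2 * \<delta> \<le> T n"
    using T \<delta>(2) by eventually_elim (simp add: mult_left_mono)
  have l2: "0 < lam0\<^sup>2 * \<delta>" using lam0_pos \<delta> by simp
  define U where "U n \<omega> = noise_sum aker n \<omega> / sqrt (T n)" for n \<omega>
  have Um: "U n \<in> borel_measurable M" for n unfolding U_def[abs_def] by measurable
  have U: "(\<lambda>n. char (distr M borel (U n)) t) \<longlonglongrightarrow> char std_normal_distribution t"
    using noise_clt[OF aker_measurable noise_wt_measurable aker_bound noise_wt_lim T_def l2 Tb]
    unfolding U_def[abs_def] noise_sum_def kap_def by simp
  have half: "\<forall>\<^sub>F n in sequentially. 1 / 2 < s n / avar n" by (rule order_tendstoD(1)[OF s]) simp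
  have sb: "\<forall>\<^sub>F n in sequentially. \<delta> / 2 \<le> s n"
    using half \<delta>(2)
  proof eventually_elim
    case (elim n)
    then have "1 / 2 * avar n < s n" using \<delta>(1) by (simp add: pos_less_divide_eq)
    then show ?case using elim by simp
  qed
  have sq: "\<forall>\<^sub>F n in sequentially. \<bar>1 / sqrt (s n)\<bar> \<le> 1 / sqrt (\<delta> / 2)"
    using sb
  proof eventually_elim
    case (elim n)
    then have "sqrt (\<delta> / 2) \<le> sqrt (s n)" by simp
    then show ?case using \<delta>(1) by (simp add: frac_le abs_divide)
  qed
  \<comment> \<open>The difference between standardizing the noise by \<open>s n\<close> and by
    \<open>avar n\<close>, both after division by \<open>lam0\<close>.\<close>
  define c where "c n = 1 / sqrt (s n) * ((1 - sqrt (s n / avar n)) * (1 / lam0))" for n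
  have "(\<lambda>n. (1 - sqrt (s n / avar n)) * (1 / lam0)) \<longlonglongrightarrow> (1 - sqrt 1) * (1 / lam0)"
    by (intro tendsto_intros s)
  then have c0: "(\<lambda>n. (1 - sqrt (s n / avar n)) * (1 / lam0)) \<longlonglongrightarrow> 0" by simp
  have c: "c \<longlonglongrightarrow> 0"
  proof (rule Lim_null_comparison)
    show "(\<lambda>n. 1 / sqrt (\<delta> / 2) * \<bar>(1 - sqrt (s n / avar n)) * (1 / lam0)\<bar>) \<longlonglongrightarrow> 0"
      by (intro tendsto_mult_right_zero tendsto_rabs_zero c0)
    show "\<forall>\<^sub>F n in sequentially. norm (c n) \<le> 1 / sqrt (\<delta> / 2) * \<bar>(1 - sqrt (s n / avar n)) * (1 / lam0)\<bar>"
      using sq unfolding c_def real_norm_def abs_mult[of "1 / sqrt _"]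
      by eventually_elim (rule mult_right_mono, auto)
  qed
  have b': "(\<lambda>n. - (kap n * (b n - bias n))) \<longlonglongrightarrow> 0" using tendsto_minus[OF b] by simp
  have lin: "to_zero_in_prob (\<lambda>n \<omega>. 1 / sqrt (s n) * ((kap n * (bhat n \<omega> 0 - eta0 (x0 n) - bias n) - noise_sum aker n \<omega> / lam0)
      + - (kap n * (b n - bias n))))"
    by (rule to_zero_in_prob_scale[OF to_zero_in_prob_add[OF fit_linearization to_zero_in_prob_const[OF b']] sq])
  have ns: "to_zero_in_prob (\<lambda>n \<omega>. c n * noise_sum aker n \<omega>)"
    by (rule to_zero_in_prob_null_mult[OF noise_sum_bounded[OF aker_measurable aker_bound] c])
  show "(\<lambda>n. char (distr M borel (\<lambda>\<omega>. kap n / sqrt (s n) * (bhat n \<omega> 0 - eta0 (x0 n) - b n))) t) \<longlonglongrightarrow> char std_normal_distribution t"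
  proof (rule char_slutsky[OF Um _ _ U])
    show "(\<lambda>\<omega>. kap n / sqrt (s n) * (bhat n \<omega> 0 - eta0 (x0 n) - b n)) \<in> borel_measurable M" for n by measurable
    from to_zero_in_prob_add[OF lin ns]
    show "to_zero_in_prob (\<lambda>n \<omega>. kap n / sqrt (s n) * (bhat n \<omega> 0 - eta0 (x0 n) - b n) - U n \<omega>)"
    proof (rule to_zero_in_prob_mono, use T \<delta>(2) sb in eventually_elim)
      case (elim n)
      have sp: "0 < sqrt (s n)" "0 < sqrt (avar n)" using elim \<delta>(1) by auto
      have T': "sqrt (T n) = lam0 * sqrt (avar n)" unfolding elim(1) using lam0_pos by (simp add: real_sqrt_mult)
      have c': "c n = 1 / (lam0 * sqrt (s n)) - 1 / (lam0 * sqrt (avar n))"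
        unfolding c_def real_sqrt_divide using sp lam0_pos by (simp add: field_simps)
      have "kap n / sqrt (s n) * (bhat n \<omega> 0 - eta0 (x0 n) - b n) - U n \<omega>
        = 1 / sqrt (s n) * ((kap n * (bhat n \<omega> 0 - eta0 (x0 n) - bias n) - noise_sum aker n \<omega> / lam0) + - (kap n * (b n - bias n)))
          + c n * noise_sum aker n \<omega>" for \<omega>
        unfolding U_def T' c' by (simp add: algebra_simps diff_divide_distrib add_divide_distrib)
      then show ?case by simp
    qed
  qed
qed

section \<open>The bias term for even degree\<close>

definition even_wt :: "real \<Rightarrow> real" where "even_wt x = info (eta0 x) * (gp x)\<^sup>2"

text \<open>On the support \<open>even_wt\<close> is \<open>rho\<close> times the squared guide
  power. Written through the true predictor it is differentiable in a full neighbourhood of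
  \<open>xd\<close>, even at a boundary point, so that it can be multiplied with the one-sided
  differentiable density.\<close>

lemma even_wt_deriv:
  "\<exists>B. \<forall>\<^sub>F x in nhds xd. \<exists>D. (even_wt has_real_derivative D) (at x) \<and> \<bar>D\<bar> \<le> B \<and> \<bar>even_wt x\<bar> \<le> B"
proof -
  obtain r' where r': "0 < r'" "times_cont_diff_on (p + 2) (phi \<gamma> eta0 e) (ball xd r')"
    "times_cont_diff_on (p + 2) gp (ball xd r')" "\<And>x. x \<in> ball xd r' \<Longrightarrow> gp x \<noteq> 0"
    by (rule local_smoothness) blast
  have g1: "times_cont_diff_on (Suc 0) gp (ball xd r')" by (rule times_cont_diff_on_mono[OF r'(3)]) auto
  have e1: "times_cont_diff_on (Suc 0) eta0 UNIV" by (rule times_cont_diff_on_mono[OF eta0_smooth]) auto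
  define D where "D x = (info' (eta0 x) * deriv eta0 x) * (gp x)\<^sup>2 + (2 * gp x * deriv gp x) * info (eta0 x)" for x
  have c1: "isCont (deriv gp) xd"
    using times_cont_diff_on_SucE(2)[OF g1] r'(1) by (simp add: times_cont_diff_on_0 continuous_on_eq_continuous_at)
  have c2: "isCont (deriv eta0) xd"
    using times_cont_diff_on_SucE(2)[OF e1] by (simp add: times_cont_diff_on_0 continuous_on_eq_continuous_at)
  have ce: "isCont eta0 xd" using eta0_continuous by (simp add: continuous_on_eq_continuous_at)
  have ci: "isCont info t0" by (rule DERIV_isCont[OF info_deriv]) (use w0 g'w0 in simp)
  have ci1: "isCont (\<lambda>x. info (eta0 x)) xd" by (rule isCont_o2[OF ce ci])
  have ci2: "isCont (\<lambda>x. info' (eta0 x)) xd" by (rule isCont_o2[OF ce info'_isCont])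
  have cD: "isCont D xd" unfolding D_def[abs_def] by (intro continuous_intros c1 c2 ci1 ci2 gp_isCont)
  have cw: "isCont even_wt xd" unfolding even_wt_def[abs_def] by (intro continuous_intros ci1 gp_isCont)
  have bd: "\<forall>\<^sub>F x in nhds xd. \<bar>F x\<bar> \<le> \<bar>F xd\<bar> + 1" if F: "isCont F xd" for F :: "real \<Rightarrow> real"
  proof -
    obtain d where d: "0 < d" "\<And>t. \<bar>t - xd\<bar> < d \<Longrightarrow> \<bar>F t - F xd\<bar> < 1"
      by (rule isCont_realD[OF F, of 1]) auto
    show ?thesis unfolding eventually_nhds_metric
    proof (intro exI[of _ d] conjI allI impI)
      fix t assume "dist t xd < d"
      then show "\<bar>F t\<bar> \<le> \<bar>F xd\<bar> + 1" using d(2)[of t] by (simp add: dist_real_def)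
    qed (rule d(1))
  qed
  have nz: "\<forall>\<^sub>F x in nhds xd. deriv g (ginv (eta0 x)) \<noteq> 0"
  proof -
    have "isCont (\<lambda>t. deriv g (ginv t)) t0"
      using continuous_ginv_comp[OF deriv_g_continuous] by (simp add: continuous_on_eq_continuous_at)
    then have "isCont (\<lambda>x. deriv g (ginv (eta0 x))) xd" by (rule isCont_o2[OF ce])
    then have "((\<lambda>x. deriv g (ginv (eta0 x))) \<longlongrightarrow> deriv g (ginv (eta0 xd))) (nhds xd)"
      by (simp add: continuous_at tendsto_nhds_iff isCont_def)
    then show ?thesis by (rule tendsto_imp_eventually_ne) (use w0 g'w0 in simp)
  qed
  have inb: "\<forall>\<^sub>F x in nhds xd. x \<in> ball xd r'"
    by (rule eventually_nhds_in_open) (use r' in auto)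
  have der: "\<forall>\<^sub>F x in nhds xd. (even_wt has_real_derivative D x) (at x)"
    using nz inb
  proof eventually_elim
    case (elim x)
    have 1: "((\<lambda>x. info (eta0 x)) has_real_derivative info' (eta0 x) * deriv eta0 x) (at x)"
      by (rule DERIV_chain2[OF info_deriv[OF elim(1)] times_cont_diff_on_SucE(1)[OF e1]]) simp
    have 2: "((\<lambda>x. (gp x)\<^sup>2) has_real_derivative 2 * gp x * deriv gp x) (at x)"
      by (rule DERIV_cong[OF DERIV_power[OF times_cont_diff_on_SucE(1)[OF g1 elim(2)], of 2]]) simp
    show ?case unfolding even_wt_def[abs_def] D_def by (rule DERIV_mult[OF 1 2])
  qed
  have "\<forall>\<^sub>F x in nhds xd. \<exists>d. (even_wt has_real_derivative d) (at x) \<and>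
      \<bar>d\<bar> \<le> max (\<bar>D xd\<bar> + 1) (\<bar>even_wt xd\<bar> + 1) \<and> \<bar>even_wt x\<bar> \<le> max (\<bar>D xd\<bar> + 1) (\<bar>even_wt xd\<bar> + 1)"
    using der bd[OF cD] bd[OF cw]
  proof eventually_elim
    case (elim x)
    then show ?case by (intro exI[of _ "D x"]) auto
  qed
  then show ?thesis by blast
qed

text \<open>Since \<open>n h ^ (2 p + 3)\<close> is bounded, a term of order \<open>h ^ (p + 2)\<close> vanishes after scaling; the
  only point is that the derivative relative to the support stays bounded.\<close>

lemma bias_even_negligible:
  assumes S: "S = supp f" and f1: "cont_diff_within f S" and x0S: "\<forall>\<^sub>F n in sequentially. x0 n \<in> S"
  shows "(\<lambda>n. kap n * bias_even K p \<gamma> eta0 e (rho g V \<mu>) f (x0 n) (h n) UNIV) \<longlonglongrightarrow> 0"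
proof -
  obtain f' where f': "\<And>x. x \<in> S \<Longrightarrow> (f has_real_derivative f' x) (at x within S)" "continuous_on S f'"
    using f1 unfolding cont_diff_within_def by blast
  have conv: "(\<lambda>n. F (x0 n)) \<longlonglongrightarrow> F xd" if "continuous_on S F" for F :: "real \<Rightarrow> real"
    by (rule continuous_on_tendsto_compose[OF that x0_lim xd_in x0S])
  define F where "F x = rho g V \<mu> x * (guide_power \<gamma> (e x))\<^sup>2 * f x" for x
  define VD where "VD n = vector_derivative F (at (x0 n) within S)" for n
  obtain B where B: "\<forall>\<^sub>F x in nhds xd. \<exists>D. (even_wt has_real_derivative D) (at x) \<and> \<bar>D\<bar> \<le> B \<and> \<bar>even_wt x\<bar> \<le> B"
    using even_wt_deriv by blast
  have FS: "even_wt x * f x = F x" if "x \<in> S" for x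
    unfolding F_def even_wt_def using rho_eq_info[of \<mu> x, OF \<mu>_in[OF that]] by (simp add: gp_def)
  \<comment> \<open>The bound from the product rule, with values near those at \<open>xd\<close>
    estimated by the limit plus 1.\<close>
  define BV where "BV = \<bar>B\<bar> * (\<bar>f xd\<bar> + 1) + \<bar>B\<bar> * (\<bar>f' xd\<bar> + 1)"
  have VD: "\<forall>\<^sub>F n in sequentially. \<bar>VD n\<bar> \<le> BV"
    using eventually_compose_filterlim[OF B x0_lim] x0S window_Dom eventually_bounded_of_tendsto[OF conv[OF f_cont]]
      eventually_bounded_of_tendsto[OF conv[OF f'(2)]]
  proof eventually_elim
    case (elim n)
    obtain D where D: "(even_wt has_real_derivative D) (at (x0 n))" "\<bar>D\<bar> \<le> B" "\<bar>even_wt (x0 n)\<bar> \<le> B" using elim(1) by blast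
    have "((\<lambda>x. even_wt x * f x) has_real_derivative D * f (x0 n) + f' (x0 n) * even_wt (x0 n)) (at (x0 n) within S)"
      by (rule DERIV_mult[OF has_field_derivative_at_within[OF D(1)] f'(1)[OF elim(2)]])
    then have "(F has_real_derivative D * f (x0 n) + f' (x0 n) * even_wt (x0 n)) (at (x0 n) within S)"
      by (rule has_field_derivative_transform_within[where d = 1]) (use elim(2) in \<open>simp_all add: FS\<close>)
    then have vd: "(F has_vector_derivative D * f (x0 n) + f' (x0 n) * even_wt (x0 n)) (at (x0 n) within S)"
      by (simp add: has_real_derivative_iff_has_vector_derivative)
    \<comment> \<open>A derivative relative to \<open>S\<close> is unique only at limit points of
      \<open>S\<close>; elsewhere the vector derivative in the bias would be an arbitrary value.
      Half of the window supplies a nondegenerate interval in \<open>S\<close> that contains the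
      point.\<close>
    have "x0 n islimpt S"
    proof -
      obtain a b where ab: "a < b" "x0 n \<in> {a..b}" "{a..b} \<subseteq> S"
      proof -
        from elim(3) consider "{0..1} \<subseteq> Dom n" | "{-1..0} \<subseteq> Dom n" unfolding window_def by blast
        then show ?thesis
        proof cases
          case 1
          have "{x0 n..x0 n + h n} \<subseteq> S"
          proof
            fix x assume x: "x \<in> {x0 n..x0 n + h n}"
            then have "Z n x \<in> {0..1}" using h_gt_0[of n] by (simp add: pos_divide_le_eq)
            then have "x0 n + h n * Z n x \<in> S" using 1 unfolding Dom_def by blast
            then show "x \<in> S" using h_gt_0[of n] by simp
          qed
          then show ?thesis using that[of "x0 n" "x0 n + h n"] h_gt_0[of n] by simp
        next
          case 2
          have "{x0 n - h n..x0 n} \<subseteq> S"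
          proof
            fix x assume x: "x \<in> {x0 n - h n..x0 n}"
            then have "Z n x \<in> {-1..0}" using h_gt_0[of n] by (simp add: pos_le_divide_eq divide_nonpos_pos)
            then have "x0 n + h n * Z n x \<in> S" using 2 unfolding Dom_def by blast
            then show "x \<in> S" using h_gt_0[of n] by simp
          qed
          then show ?thesis using that[of "x0 n - h n" "x0 n"] h_gt_0[of n] by simp
        qed
      qed
      have "x0 n islimpt {a..b}" using ab by (intro connected_imp_perfect) auto
      then show ?thesis using ab(3) by (rule islimpt_subset)
    qed
    then have "at (x0 n) within S \<noteq> bot" by (simp add: trivial_limit_within)
    then have "VD n = D * f (x0 n) + f' (x0 n) * even_wt (x0 n)"
      unfolding VD_def by (rule vector_derivative_within[OF _ vd])
    also have "\<bar>\<dots>\<bar> \<le> \<bar>D\<bar> * \<bar>f (x0 n)\<bar> + \<bar>even_wt (x0 n)\<bar> * \<bar>f' (x0 n)\<bar>"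
      by (rule order.trans[OF abs_triangle_ineq]) (simp add: abs_mult mult.commute)
    also have "\<dots> \<le> BV" unfolding BV_def
      using D(2,3) elim(4,5) by (intro add_mono mult_mono) auto
    finally show ?case .
  qed
  define I where "I = (LINT z:UNIV|lborel. z ^ (p + 2) * equiv_kernel K 0 p UNIV z)"
  define q1 where "q1 n = I * (1 / fact (p + 2)) * Dphi (p + 2) (x0 n) * gp (x0 n)" for n
  define q2 where "q2 n = 1 / fact (p + 1) * Dphi (p + 1) (x0 n) * (1 / (info (eta0 (x0 n)) * gp (x0 n) * f (x0 n))) * I" for n
  have ce: "isCont eta0 xd" using eta0_continuous by (simp add: continuous_on_eq_continuous_at)
  have ci: "isCont info t0" by (rule DERIV_isCont[OF info_deriv]) (use w0 g'w0 in simp)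
  have l1: "q1 \<longlonglongrightarrow> I * (1 / fact (p + 2)) * Dphi (p + 2) xd * gp xd"
    unfolding q1_def[abs_def] by (intro tendsto_intros x0_isCont_lim Dphi_isCont gp_isCont) auto
  have "(\<lambda>n. info (eta0 (x0 n)) * gp (x0 n) * f (x0 n)) \<longlonglongrightarrow> info t0 * gp xd * f xd"
    by (intro tendsto_intros x0_isCont_lim[OF isCont_o2[OF ce ci]] x0_isCont_lim[OF gp_isCont] conv[OF f_cont])
  then have l3: "(\<lambda>n. 1 / (info (eta0 (x0 n)) * gp (x0 n) * f (x0 n))) \<longlonglongrightarrow> 1 / (info t0 * gp xd * f xd)"
    by (rule tendsto_divide[OF tendsto_const]) (use info_w0 info0_pos gp_nz f_pos in simp)
  have l2: "q2 \<longlonglongrightarrow> 1 / fact (p + 1) * Dphi (p + 1) xd * (1 / (info t0 * gp xd * f xd)) * I"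
    unfolding q2_def[abs_def] by (intro tendsto_mult[OF tendsto_mult[OF tendsto_mult[OF tendsto_const] l3] tendsto_const]
        x0_isCont_lim Dphi_isCont) simp
  define c1 where "c1 = \<bar>I * (1 / fact (p + 2)) * Dphi (p + 2) xd * gp xd\<bar> + 1"
  define c2 where "c2 = \<bar>1 / fact (p + 1) * Dphi (p + 1) xd * (1 / (info t0 * gp xd * f xd)) * I\<bar> + 1"
  have eq: "\<forall>\<^sub>F n in sequentially. bias_even K p \<gamma> eta0 e (rho g V \<mu>) f (x0 n) (h n) UNIV = (q1 n + q2 n * VD n) * h n ^ (p + 2)"
    using x0S
  proof eventually_elim
    case (elim n)
    have r: "rho g V \<mu> (x0 n) = info (eta0 (x0 n))" by (rule rho_eq_info[of \<mu> "x0 n", OF \<mu>_in[OF elim]])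
    show ?case
      unfolding bias_even_def q1_def q2_def VD_def I_def[symmetric] S[symmetric] F_def[symmetric] r gp_def Dphi_def
      by (simp add: mult_ac)
  qed
  obtain C where C: "\<forall>\<^sub>F n in sequentially. \<bar>kap n * h n ^ (p + 1)\<bar> \<le> C" using kap_h by blast
  show ?thesis
  proof (rule Lim_null_comparison)
    show "(\<lambda>n. \<bar>C\<bar> * (c1 + c2 * BV) * h n) \<longlonglongrightarrow> 0" by (rule tendsto_mult_right_zero[OF h_lim])
    show "\<forall>\<^sub>F n in sequentially. norm (kap n * bias_even K p \<gamma> eta0 e (rho g V \<mu>) f (x0 n) (h n) UNIV) \<le> \<bar>C\<bar> * (c1 + c2 * BV) * h n"
      using eq C VD eventually_bounded_of_tendsto[OF l1, folded c1_def] eventually_bounded_of_tendsto[OF l2, folded c2_def]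
    proof eventually_elim
      case (elim n)
      have "\<bar>q1 n + q2 n * VD n\<bar> \<le> c1 + c2 * BV"
      proof -
        have "\<bar>q2 n * VD n\<bar> \<le> c2 * BV" unfolding abs_mult using elim(3,5) by (intro mult_mono) auto
        then show ?thesis using elim(4) by linarith
      qed
      moreover have "\<bar>kap n * h n ^ (p + 1)\<bar> \<le> \<bar>C\<bar>" using elim(2) by linarith
      ultimately have "\<bar>kap n * h n ^ (p + 1)\<bar> * \<bar>q1 n + q2 n * VD n\<bar> * h n \<le> \<bar>C\<bar> * (c1 + c2 * BV) * h n"
        using h_gt_0[of n] by (intro mult_right_mono mult_mono) auto
      moreover have "norm (kap n * ((q1 n + q2 n * VD n) * h n ^ (p + 2))) = \<bar>kap n * h n ^ (p + 1)\<bar> * \<bar>q1 n + q2 n * VD n\<bar> * h n"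
        using h_gt_0[of n] by (simp add: abs_mult mult_ac)
      ultimately show ?case unfolding elim(1) by simp
    qed
  qed
qed

text \<open>The kernel integrals are the same and cancel, although they need not converge; only the
  scalar factor at \<open>x0 n\<close> has to approach its value at \<open>xd\<close>.\<close>

lemma avar_ratio:
  assumes x0S: "\<forall>\<^sub>F n in sequentially. x0 n \<in> S"
    and s: "\<forall>\<^sub>F n in sequentially. s n = v (x0 n) * (deriv g (\<mu> (x0 n)))\<^sup>2 * inverse (f (x0 n))
       * (LINT z:Dom n|lborel. equiv_kernel K 0 p (Dom n) z * equiv_kernel K 0 p (Dom n) z)"
  shows "(\<lambda>n. s n / avar n) \<longlonglongrightarrow> 1"
proof -
  have conv: "(\<lambda>n. F (x0 n)) \<longlonglongrightarrow> F xd" if "continuous_on S F" for F :: "real \<Rightarrow> real"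
    by (rule continuous_on_tendsto_compose[OF that x0_lim xd_in x0S])
  have gc: "continuous_on S (\<lambda>x. deriv g (\<mu> x))"
    by (rule continuous_on_compose2[OF deriv_g_continuous \<mu>_cont]) (use \<mu>_in in auto)
  define k where "k x = v x * (deriv g (\<mu> x))\<^sup>2 * inverse (f x)" for x
  have kd: "k xd \<noteq> 0" using v_pos f_pos g'w0 by (simp add: k_def)
  have "(\<lambda>n. k (x0 n)) \<longlonglongrightarrow> k xd"
    unfolding k_def using f_pos by (intro tendsto_intros conv v_cont f_cont gc) auto
  then have "(\<lambda>n. k (x0 n) / k xd) \<longlonglongrightarrow> k xd / k xd" by (intro tendsto_divide tendsto_const kd)
  then have "(\<lambda>n. k (x0 n) / k xd) \<longlonglongrightarrow> 1" using kd by simp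
  moreover obtain \<delta> where \<delta>: "0 < \<delta>" "\<forall>\<^sub>F n in sequentially. \<delta> \<le> avar n" using avar_bounds by blast
  have "\<forall>\<^sub>F n in sequentially. k (x0 n) / k xd = s n / avar n"
    using s \<delta>(2)
  proof eventually_elim
    case (elim n)
    let ?L = "LINT z:Dom n|lborel. equiv_kernel K 0 p (Dom n) z * equiv_kernel K 0 p (Dom n) z"
    have a: "avar n = k xd * ?L" unfolding avar_def k_def by (simp add: divide_inverse)
    then have "?L \<noteq> 0" using elim(2) \<delta>(1) by auto
    then show ?case unfolding a elim(1) k_def[symmetric] using kd by simp
  qed
  ultimately show ?thesis by (rule Lim_transform_eventually)
qed

lemma asymp_normalI:
  assumes "(\<lambda>n. s n / avar n) \<longlonglongrightarrow> 1" "(\<lambda>n. kap n * (b n - bias n)) \<longlonglongrightarrow> 0"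
  shows "asymp_normal M h x0 bhat eta0 s b"
  unfolding asymp_normal_def
  by (rule exI[of _ "\<lambda>_. 0"]) (use fit_asymptotically_normal[OF assms] in \<open>simp add: kap_def\<close>)

end

section \<open>Interior and boundary points\<close>

locale guided_model = prob_space M + kernel K + quasi_link I YY g ginv V Q
  for M :: "'a measure" and K :: "real \<Rightarrow> real" and I YY :: "real set" and g ginv V :: "real \<Rightarrow> real" and Q :: "real \<Rightarrow> real \<Rightarrow> real" +
  fixes X Y :: "nat \<Rightarrow> 'a \<Rightarrow> real" and f \<mu> v e :: "real \<Rightarrow> real" and p :: nat and \<gamma> :: real and h :: "nat \<Rightarrow> real"
  assumes iid: "iid_pairs M X Y" and Y_in: "\<And>i \<omega>. \<omega> \<in> space M \<Longrightarrow> Y i \<omega> \<in> YY"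
    and f_nonneg: "\<And>x. 0 \<le> f x" and X_density: "distributed M lborel (X 0) (\<lambda>x. ennreal (f x))"
    and regression: "regression_function M (X 0) (Y 0) \<mu>"
    and cond_var: "conditional_variance M (X 0) (Y 0) \<mu> v"
    and \<mu>_in: "\<And>x. x \<in> supp f \<Longrightarrow> \<mu> x \<in> I"
    and f_smooth: "cont_diff_within f (supp f)"
    and eta0_smooth: "times_cont_diff_on (p + 2) (\<lambda>x. g (\<mu> x)) UNIV" and e_smooth: "times_cont_diff_on (p + 2) e UNIV"
    and v_cont: "continuous_on (supp f) v"
    and A3: "\<And>x. x \<in> supp f \<Longrightarrow> v x \<noteq> 0 \<and> deriv g (\<mu> x) \<noteq> 0"
    and A5: "\<And>xd. xd \<in> frontier (supp f) \<Longrightarrow> \<exists>C. is_interval C \<and> xd \<in> C \<and> interior C \<noteq> {} \<and> 0 < (INF x\<in>C. f x)"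
    and h_gt_0: "\<And>n. 0 < h n" and h_lim: "h \<longlonglongrightarrow> 0"
    and nh1: "filterlim (\<lambda>n. real n * h n ^ (2 * p + 1)) at_top sequentially"
    and nh3: "Bseq (\<lambda>n. real n * h n ^ (2 * p + 3))"
begin

abbreviation "S \<equiv> supp f"

lemma S_closed: "closed S" by (simp add: supp_def)

lemma f_outside: "x \<notin> S \<Longrightarrow> f x = 0"
  using closure_subset[of "{x. f x \<noteq> 0}"] unfolding supp_def by auto

lemma f_cont: "continuous_on S f"
  using f_smooth unfolding cont_diff_within_def
  by (meson DERIV_continuous continuous_on_eq_continuous_within)

lemma \<mu>_cont: "continuous_on S \<mu>"
proof (rule continuous_on_eq)
  show "continuous_on S (\<lambda>x. ginv (g (\<mu> x)))"
    by (rule continuous_on_compose2[OF ginv_continuous continuous_on_subset[OF times_cont_diff_on_continuous[OF eta0_smooth]]]) auto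
qed (use \<mu>_in in simp)

lemma nh_lim: "filterlim (\<lambda>n. real n * h n) at_top sequentially"
proof (rule filterlim_at_top_mono[OF nh1])
  have "\<forall>\<^sub>F n in sequentially. h n < 1" using order_tendstoD(2)[OF h_lim, of 1] by simp
  then show "\<forall>\<^sub>F n in sequentially. real n * h n ^ (2 * p + 1) \<le> real n * h n"
  proof eventually_elim
    case (elim n)
    have "h n ^ (2 * p) \<le> 1" using elim h_gt_0[of n] by (intro power_le_one) auto
    then have "h n * h n ^ (2 * p) \<le> h n" using h_gt_0[of n] by (intro mult_left_le) auto
    then show ?case by (intro mult_left_mono) auto
  qed
qed

text \<open>The local bounds come from compactness: the closed support meets the unit ball around
  \<open>xd\<close> in a compact set, on which density, variance and mean are continuous. Hence the
  radius 1.\<close>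

lemma fit_at:
  assumes xd: "xd \<in> S" "0 < f xd" and lind: "lindeberg_at M (X 0) (Y 0) \<mu> xd" and x0: "x0 \<longlonglongrightarrow> xd"
    and win: "\<forall>\<^sub>F n in sequentially. window ({z. x0 n + h n * z \<in> S} \<inter> {-1..1})"
    and e_nz: "\<gamma> \<noteq> 0 \<longrightarrow> e xd \<noteq> 0" and est: "guided_estimator M X Y Q ginv K e \<gamma> p h x0 bhat"
  shows "\<exists>r Cb. guided_fit M K X Y f \<mu> v S xd r Cb x0 h I YY g ginv V Q e \<gamma> p bhat"
proof -
  have bd: "\<exists>B. \<forall>x\<in>S. \<bar>x - xd\<bar> \<le> 1 \<longrightarrow> \<bar>F x\<bar> \<le> B" if F: "continuous_on S F" for F :: "real \<Rightarrow> real"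
  proof -
    have "compact (S \<inter> cball xd 1)" using S_closed by (intro closed_Int_compact) auto
    then have "bounded (F ` (S \<inter> cball xd 1))"
      by (intro compact_imp_bounded compact_continuous_image continuous_on_subset[OF F]) auto
    then obtain B where "\<And>y. y \<in> F ` (S \<inter> cball xd 1) \<Longrightarrow> \<bar>y\<bar> \<le> B" unfolding bounded_iff by auto
    then show ?thesis by (intro exI[of _ B]) (auto simp: dist_real_def abs_minus_commute)
  qed
  obtain B1 where B1: "\<forall>x\<in>S. \<bar>x - xd\<bar> \<le> 1 \<longrightarrow> \<bar>f x\<bar> \<le> B1" using bd[OF f_cont] by blast
  obtain B2 where B2: "\<forall>x\<in>S. \<bar>x - xd\<bar> \<le> 1 \<longrightarrow> \<bar>v x\<bar> \<le> B2" using bd[OF v_cont] by blast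
  obtain B3 where B3: "\<forall>x\<in>S. \<bar>x - xd\<bar> \<le> 1 \<longrightarrow> \<bar>\<mu> x\<bar> \<le> B3" using bd[OF \<mu>_cont] by blast
  define Cb where "Cb = \<bar>B1\<bar> + \<bar>B2\<bar> + \<bar>B3\<bar>"
  have v0: "0 \<le> v xd" using cond_var by (simp add: conditional_variance_def)
  have "guided_fit M K X Y f \<mu> v S xd 1 Cb x0 h I YY g ginv V Q e \<gamma> p bhat"
  proof unfold_locales
    show "f x \<le> Cb \<and> v x \<le> Cb \<and> \<bar>\<mu> x\<bar> \<le> Cb" if "x \<in> S" "\<bar>x - xd\<bar> \<le> 1" for x
      using B1 B2 B3 that unfolding Cb_def by fastforce
    show "0 \<le> Cb" by (simp add: Cb_def)
    show "0 < v xd" using v0 A3[OF xd(1)] by simp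
    show "\<mu> xd \<in> I" "deriv g (\<mu> xd) \<noteq> 0" using \<mu>_in A3 xd(1) by auto
  qed (use assms iid Y_in f_nonneg X_density regression cond_var \<mu>_in eta0_smooth e_smooth v_cont h_gt_0 h_lim nh3
      S_closed f_outside f_cont \<mu>_cont nh_lim in simp_all)
  then show ?thesis by blast
qed

text \<open>Eventually the window lies in the support, and the moving kernel constants equal those
  over the whole line. For even \<open>p\<close> the bias that was derived is then 0 by symmetry,
  and the stated one is negligible at the scale of the limit law.\<close>

lemma interior_case:
  assumes x0: "x0 \<in> interior S" "e x0 \<noteq> 0" "0 < f x0" and lind: "lindeberg_at M (X 0) (Y 0) \<mu> x0"
    and est: "guided_estimator M X Y Q ginv K e \<gamma> p h (\<lambda>n. x0) bhat"
  shows "asymp_normal M h (\<lambda>n. x0) bhat (\<lambda>x. g (\<mu> x))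
      (\<lambda>n. asym_var K 0 0 p v g \<mu> f x0 UNIV)
      (\<lambda>n. if odd p then bias_odd K p \<gamma> (\<lambda>x. g (\<mu> x)) e x0 (h n) UNIV
           else bias_even K p \<gamma> (\<lambda>x. g (\<mu> x)) e (rho g V \<mu>) f x0 (h n) UNIV)"
proof -
  have x0S: "x0 \<in> S" using x0(1) interior_subset by blast
  obtain d where d: "0 < d" "ball x0 d \<subseteq> S" using x0(1) unfolding mem_interior by blast
  have full: "\<forall>\<^sub>F n in sequentially. {z. x0 + h n * z \<in> S} \<inter> {-1..1} = {-1..1}"
    using order_tendstoD(2)[OF h_lim d(1)]
  proof eventually_elim
    case (elim n)
    have "x0 + h n * z \<in> S" if "z \<in> {-1..1}" for z
    proof (rule subsetD[OF d(2)])
      have "\<bar>z\<bar> \<le> 1" using that by auto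
      then have "\<bar>h n * z\<bar> \<le> h n" using h_gt_0[of n] by (simp add: abs_mult mult_left_le)
      then show "x0 + h n * z \<in> ball x0 d" using elim by (simp add: dist_real_def)
    qed
    then show ?case by blast
  qed
  have win: "\<forall>\<^sub>F n in sequentially. window ({z. x0 + h n * z \<in> S} \<inter> {-1..1})"
    using full by eventually_elim (simp add: window_def)
  obtain r Cb where "guided_fit M K X Y f \<mu> v S x0 r Cb (\<lambda>n. x0) h I YY g ginv V Q e \<gamma> p bhat"
    using fit_at[OF x0S x0(3) lind tendsto_const win _ est] x0(2) by blast
  then interpret G: guided_fit M K X Y f \<mu> v S x0 r Cb "\<lambda>n. x0" h I YY g ginv V Q e \<gamma> p bhat .
  have cut: "\<forall>\<^sub>F n in sequentially. G.Dom n \<inter> {-1..1} = UNIV \<inter> {-1..1}"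
    using full unfolding G.Dom_def by eventually_elim blast
  have L: "\<forall>\<^sub>F n in sequentially. (LINT z:G.Dom n|lborel. m z * equiv_kernel K 0 p (G.Dom n) z) = (LINT z:UNIV|lborel. m z * equiv_kernel K 0 p UNIV z)" for m
    using cut
  proof eventually_elim
    case (elim n)
    show ?case unfolding equiv_kernel_cong[OF elim]
      by (rule window_integral_cong[OF elim]) (simp add: equiv_kernel_outside)
  qed
  have bias: "\<forall>\<^sub>F n in sequentially. G.bias n = bias_odd K p \<gamma> (\<lambda>x. g (\<mu> x)) e x0 (h n) UNIV"
    using L[of "\<lambda>z. z ^ (p + 1)"] unfolding G.bias_def bias_odd_def by eventually_elim simp
  show ?thesis
  proof (rule G.asymp_normalI)
    show "(\<lambda>n. asym_var K 0 0 p v g \<mu> f x0 UNIV / G.avar n) \<longlonglongrightarrow> 1"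
    proof (rule G.avar_ratio)
      show "\<forall>\<^sub>F n in sequentially. x0 \<in> S" using x0S by simp
      show "\<forall>\<^sub>F n in sequentially. asym_var K 0 0 p v g \<mu> f x0 UNIV = v x0 * (deriv g (\<mu> x0))\<^sup>2 * inverse (f x0)
         * (LINT z:G.Dom n|lborel. equiv_kernel K 0 p (G.Dom n) z * equiv_kernel K 0 p (G.Dom n) z)"
        using cut
      proof eventually_elim
        case (elim n)
        have "(LINT z:G.Dom n|lborel. equiv_kernel K 0 p (G.Dom n) z * equiv_kernel K 0 p (G.Dom n) z)
          = (LINT z:UNIV|lborel. equiv_kernel K 0 p UNIV z * equiv_kernel K 0 p UNIV z)"
          unfolding equiv_kernel_cong[OF elim] by (rule window_integral_cong[OF elim]) (simp add: equiv_kernel_outside)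
        then show ?case unfolding asym_var_def by simp
      qed
    qed
    show "(\<lambda>n. G.kap n * ((if odd p then bias_odd K p \<gamma> (\<lambda>x. g (\<mu> x)) e x0 (h n) UNIV
           else bias_even K p \<gamma> (\<lambda>x. g (\<mu> x)) e (rho g V \<mu>) f x0 (h n) UNIV) - G.bias n)) \<longlonglongrightarrow> 0"
    proof (cases "odd p")
      case True
      have "\<forall>\<^sub>F n in sequentially. G.kap n * (bias_odd K p \<gamma> (\<lambda>x. g (\<mu> x)) e x0 (h n) UNIV - G.bias n) = 0"
        using bias by eventually_elim simp
      then show ?thesis using True by (simp add: tendsto_eventually)
    next
      case False
      then have "odd (p + 1)" by simp
      then have z: "bias_odd K p \<gamma> (\<lambda>x. g (\<mu> x)) e x0 (h n) UNIV = 0" for n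
        unfolding bias_odd_def equiv_kernel_odd_moment[OF \<open>odd (p + 1)\<close>] by simp
      have "(\<lambda>n. G.kap n * bias_even K p \<gamma> (\<lambda>x. g (\<mu> x)) e (rho g V \<mu>) f x0 (h n) UNIV) \<longlonglongrightarrow> 0"
        by (rule G.bias_even_negligible[OF refl f_smooth]) (use x0S in simp)
      moreover have "\<forall>\<^sub>F n in sequentially. G.kap n * bias_even K p \<gamma> (\<lambda>x. g (\<mu> x)) e (rho g V \<mu>) f x0 (h n) UNIV
        = G.kap n * ((if odd p then bias_odd K p \<gamma> (\<lambda>x. g (\<mu> x)) e x0 (h n) UNIV
           else bias_even K p \<gamma> (\<lambda>x. g (\<mu> x)) e (rho g V \<mu>) f x0 (h n) UNIV) - G.bias n)"
        using bias by eventually_elim (use False z in simp)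
      ultimately show ?thesis by (rule Lim_transform_eventually)
    qed
  qed
qed

text \<open>Condition A5 puts an interval on one side of \<open>xd\<close> into the support. The
  segment condition forces \<open>c\<close> to point to the same side or to be 0, for otherwise the
  two pieces would make \<open>xd\<close> an interior point. Half of the window then stays inside
  the interval.\<close>

lemma frontier_window:
  assumes xd: "xd \<in> frontier S" and seg: "\<forall>\<^sub>F n in sequentially. closed_segment xd (xd + c * h n) \<subseteq> S"
  shows "0 < f xd" "\<forall>\<^sub>F n in sequentially. window ({z. (xd + c * h n) + h n * z \<in> S} \<inter> {-1..1})"
proof -
  obtain C where C: "is_interval C" "xd \<in> C" "interior C \<noteq> {}" "0 < (INF x\<in>C. f x)" using A5[OF xd] by blast
  have pos: "0 < f x" if "x \<in> C" for x
  proof -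
    \<comment> \<open>The infimum bounds the values only for a set bounded below; nonnegativity of
      the density provides this.\<close>
    have "bdd_below (f ` C)" using f_nonneg by (intro bdd_belowI[of _ 0]) auto
    then have "(INF x\<in>C. f x) \<le> f x" using that by (rule cINF_lower)
    then show ?thesis using C(4) by simp
  qed
  show "0 < f xd" by (rule pos[OF C(2)])
  have CS: "C \<subseteq> S" using pos f_outside by force
  have nint: "xd \<notin> interior S" using xd by (simp add: frontier_def)
  have "\<exists>y\<in>C. y \<noteq> xd"
  proof (rule ccontr)
    assume "\<not> ?thesis"
    then have "interior C \<subseteq> {xd}" using interior_subset by blast
    then have "interior C = {}" using interior_mono[of "interior C" "{xd}"] by simp
    then show False using C(3) by simp
  qed
  then obtain y where y: "y \<in> C" "y \<noteq> xd" by blast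
  have seg_n: "\<exists>n. closed_segment xd (xd + c * h n) \<subseteq> S"
    by (rule eventually_happens'[OF sequentially_bot seg])
  have Sm [measurable]: "S \<in> sets borel" using S_closed by simp
  have meas: "{z. a + b * z \<in> S} \<inter> {-1..1} \<in> sets borel" for a b
  proof -
    have "{z. a + b * z \<in> S} = (\<lambda>z. a + b * z) -` S \<inter> space borel" by auto
    also have "\<dots> \<in> sets borel" by (rule measurable_sets[of _ borel borel]) auto
    finally show ?thesis by auto
  qed
  consider "xd < y" | "y < xd" using y(2) by linarith
  then show "\<forall>\<^sub>F n in sequentially. window ({z. (xd + c * h n) + h n * z \<in> S} \<inter> {-1..1})"
  proof cases
    case 1
    have yS: "{xd..y} \<subseteq> S" using mem_is_interval_1_I[OF C(1,2) y(1)] CS by auto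
    \<comment> \<open>If \<open>c\<close> were negative, the segment to the left and the interval to
      the right would cover a neighbourhood of \<open>xd\<close>. A single n suffices, since the
      sign of c h is that of \<open>c\<close>.\<close>
    have c: "0 \<le> c"
    proof (rule ccontr)
      assume "\<not> 0 \<le> c"
      obtain n where n: "closed_segment xd (xd + c * h n) \<subseteq> S" using seg_n by blast
      have neg: "c * h n < 0" using \<open>\<not> 0 \<le> c\<close> h_gt_0[of n] by (simp add: mult_neg_pos)
      have "{xd + c * h n<..<y} \<subseteq> S"
      proof
        fix x assume x: "x \<in> {xd + c * h n<..<y}"
        show "x \<in> S"
        proof (cases "x \<le> xd")
          case True
          then have "x \<in> closed_segment xd (xd + c * h n)" using x neg by (simp add: closed_segment_eq_real_ivl)
          then show ?thesis using n by blast
        qed (use x yS in auto)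
      qed
      then have "xd \<in> interior S" using neg 1 by (intro interiorI[of "{xd + c * h n<..<y}"]) auto
      then show False using nint by simp
    qed
    \<comment> \<open>From \<open>xd\<close>, the right half of the window reaches at most to
      distance (c + 1) h.\<close>
    have lim: "(\<lambda>n. (c + 1) * h n) \<longlonglongrightarrow> 0" by (rule tendsto_mult_right_zero[OF h_lim])
    have "0 < y - xd" using 1 by simp
    from order_tendstoD(2)[OF lim this] show ?thesis
    proof eventually_elim
      case (elim n)
      have "xd + c * h n + h n * z \<in> S" if z: "z \<in> {0..1}" for z
      proof (rule subsetD[OF yS])
        have "0 \<le> c * h n" "0 \<le> h n * z" "h n * z \<le> h n" using c z h_gt_0[of n] by (auto simp: mult_left_le)
        then show "xd + c * h n + h n * z \<in> {xd..y}" using elim by (simp add: algebra_simps)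
      qed
      then show ?case using meas unfolding window_def by auto
    qed
  next
    case 2
    have yS: "{y..xd} \<subseteq> S" using mem_is_interval_1_I[OF C(1) y(1) C(2)] CS by auto
    have c: "c \<le> 0"
    proof (rule ccontr)
      assume "\<not> c \<le> 0"
      obtain n where n: "closed_segment xd (xd + c * h n) \<subseteq> S" using seg_n by blast
      have neg: "0 < c * h n" using \<open>\<not> c \<le> 0\<close> h_gt_0[of n] by simp
      have "{y<..<xd + c * h n} \<subseteq> S"
      proof
        fix x assume x: "x \<in> {y<..<xd + c * h n}"
        show "x \<in> S"
        proof (cases "xd \<le> x")
          case True
          then have "x \<in> closed_segment xd (xd + c * h n)" using x neg by (simp add: closed_segment_eq_real_ivl)
          then show ?thesis using n by blast
        qed (use x yS in auto)
      qed
      then have "xd \<in> interior S" using neg 2 by (intro interiorI[of "{y<..<xd + c * h n}"]) auto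
      then show False using nint by simp
    qed
    have lim: "(\<lambda>n. (1 - c) * h n) \<longlonglongrightarrow> 0" by (rule tendsto_mult_right_zero[OF h_lim])
    have "0 < xd - y" using 2 by simp
    from order_tendstoD(2)[OF lim this] show ?thesis
    proof eventually_elim
      case (elim n)
      have "xd + c * h n + h n * z \<in> S" if z: "z \<in> {-1..0}" for z
      proof (rule subsetD[OF yS])
        have "c * h n \<le> 0" using c h_gt_0[of n] by (simp add: mult_nonpos_nonneg)
        moreover have "h n * z \<le> 0" using z h_gt_0[of n] by (simp add: mult_nonneg_nonpos)
        moreover have "h n * (- 1) \<le> h n * z" using z h_gt_0[of n] by (intro mult_left_mono) auto
        ultimately show "xd + c * h n + h n * z \<in> {y..xd}" using elim by (simp add: algebra_simps)
      qed
      then show ?case using meas unfolding window_def by auto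
    qed
  qed
qed

text \<open>The domain \<open>D n\<close> is the mirror image of the window used in the fit. The
  variance is unchanged under reflection, and the leading bias acquires the sign (-1)^(p+1), which
  is 1 for odd \<open>p\<close>. For even \<open>p\<close> the leading term is negligible by
  assumption, so its sign has no effect on the limit.\<close>

lemma boundary_case:
  assumes xd: "xd \<in> frontier S" and x0: "x0 = (\<lambda>n. xd + c * h n)" and D: "D = (\<lambda>n. local_dom f (x0 n) (h n))"
    and e_nz: "\<gamma> \<noteq> 0 \<longrightarrow> e xd \<noteq> 0" and seg: "\<forall>\<^sub>F n in sequentially. closed_segment xd (x0 n) \<subseteq> S"
    and lind: "lindeberg_at M (X 0) (Y 0) \<mu> xd"
    and neg: "even p \<longrightarrow> (\<lambda>n. sqrt (real n * h n) * bias_odd K p \<gamma> (\<lambda>x. g (\<mu> x)) e (x0 n) (h n) (D n)) \<longlonglongrightarrow> 0"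
    and est: "guided_estimator M X Y Q ginv K e \<gamma> p h x0 bhat"
  shows "asymp_normal M h x0 bhat (\<lambda>x. g (\<mu> x)) (\<lambda>n. asym_var K 0 0 p v g \<mu> f (x0 n) (D n))
      (\<lambda>n. if odd p then bias_odd K p \<gamma> (\<lambda>x. g (\<mu> x)) e (x0 n) (h n) (D n)
           else bias_even K p \<gamma> (\<lambda>x. g (\<mu> x)) e (rho g V \<mu>) f (x0 n) (h n) UNIV)"
proof -
  note fw = frontier_window[OF xd seg[unfolded x0]]
  have win: "\<forall>\<^sub>F n in sequentially. window ({z. x0 n + h n * z \<in> S} \<inter> {-1..1})" using fw(2) unfolding x0 .
  have xdS: "xd \<in> S" using xd S_closed by (simp add: frontier_def)
  have x0S: "\<forall>\<^sub>F n in sequentially. x0 n \<in> S" using seg by eventually_elim auto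
  have x0_lim: "x0 \<longlonglongrightarrow> xd"
    using tendsto_add[OF tendsto_const tendsto_mult_right_zero[OF h_lim], of xd c] unfolding x0 by simp
  obtain r Cb where "guided_fit M K X Y f \<mu> v S xd r Cb x0 h I YY g ginv V Q e \<gamma> p bhat"
    using fit_at[OF xdS fw(1) lind x0_lim win e_nz est] by blast
  then interpret G: guided_fit M K X Y f \<mu> v S xd r Cb x0 h I YY g ginv V Q e \<gamma> p bhat .
  have DD: "D n = uminus ` G.Dom n" for n
  proof (intro subset_antisym subsetI)
    fix z assume "z \<in> D n"
    then show "z \<in> uminus ` G.Dom n" unfolding D local_dom_def G.Dom_def by (intro image_eqI[of _ _ "- z"]) auto
  qed (auto simp: D local_dom_def G.Dom_def)
  \<comment> \<open>Reflection turns z into -z in the power only: the reflected equivalent kernel,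
    evaluated at the reflected point, is the original one.\<close>
  have bo: "\<forall>\<^sub>F n in sequentially. bias_odd K p \<gamma> (\<lambda>x. g (\<mu> x)) e (x0 n) (h n) (D n) = (-1) ^ (p + 1) * G.bias n"
    using G.window_Dom
  proof eventually_elim
    case (elim n)
    have "(LINT z:D n|lborel. z ^ (p + 1) * equiv_kernel K 0 p (D n) z) = (LINT z:G.Dom n|lborel. (-1) ^ (p + 1) * (z ^ (p + 1) * equiv_kernel K 0 p (G.Dom n) z))"
      unfolding DD set_integral_uminus equiv_kernel_uminus[OF elim]
    proof (rule arg_cong[where f = "set_lebesgue_integral lborel (G.Dom n)"], rule ext)
      fix z show "(- z) ^ (p + 1) * equiv_kernel K 0 p (G.Dom n) (- (- z)) = (-1) ^ (p + 1) * (z ^ (p + 1) * equiv_kernel K 0 p (G.Dom n) z)"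
        by (simp only: power_minus[of z] minus_minus mult.assoc)
    qed
    also have "\<dots> = (-1) ^ (p + 1) * (LINT z:G.Dom n|lborel. z ^ (p + 1) * equiv_kernel K 0 p (G.Dom n) z)"
      by (rule set_integral_mult_right)
    finally show ?case unfolding G.bias_def bias_odd_def by (simp only: mult_ac)
  qed
  show ?thesis
  proof (rule G.asymp_normalI)
    show "(\<lambda>n. asym_var K 0 0 p v g \<mu> f (x0 n) (D n) / G.avar n) \<longlonglongrightarrow> 1"
    proof (rule G.avar_ratio[OF x0S], use G.window_Dom in eventually_elim)
      case (elim n)
      show ?case unfolding asym_var_def DD set_integral_uminus equiv_kernel_uminus[OF elim] by simp
    qed
    show "(\<lambda>n. G.kap n * ((if odd p then bias_odd K p \<gamma> (\<lambda>x. g (\<mu> x)) e (x0 n) (h n) (D n)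
           else bias_even K p \<gamma> (\<lambda>x. g (\<mu> x)) e (rho g V \<mu>) f (x0 n) (h n) UNIV) - G.bias n)) \<longlonglongrightarrow> 0"
    proof (cases "odd p")
      case True
      have "\<forall>\<^sub>F n in sequentially. G.kap n * (bias_odd K p \<gamma> (\<lambda>x. g (\<mu> x)) e (x0 n) (h n) (D n) - G.bias n) = 0"
        using bo by eventually_elim (use True in simp)
      then show ?thesis using True by (simp add: tendsto_eventually)
    next
      case False
      have "(\<lambda>n. G.kap n * bias_even K p \<gamma> (\<lambda>x. g (\<mu> x)) e (rho g V \<mu>) f (x0 n) (h n) UNIV
          + G.kap n * bias_odd K p \<gamma> (\<lambda>x. g (\<mu> x)) e (x0 n) (h n) (D n)) \<longlonglongrightarrow> 0 + 0"
        using neg False by (intro tendsto_add G.bias_even_negligible[OF refl f_smooth x0S]) (simp add: G.kap_def)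
      then have "(\<lambda>n. G.kap n * bias_even K p \<gamma> (\<lambda>x. g (\<mu> x)) e (rho g V \<mu>) f (x0 n) (h n) UNIV
          + G.kap n * bias_odd K p \<gamma> (\<lambda>x. g (\<mu> x)) e (x0 n) (h n) (D n)) \<longlonglongrightarrow> 0" by simp
      moreover have "\<forall>\<^sub>F n in sequentially. G.kap n * bias_even K p \<gamma> (\<lambda>x. g (\<mu> x)) e (rho g V \<mu>) f (x0 n) (h n) UNIV
          + G.kap n * bias_odd K p \<gamma> (\<lambda>x. g (\<mu> x)) e (x0 n) (h n) (D n)
        = G.kap n * ((if odd p then bias_odd K p \<gamma> (\<lambda>x. g (\<mu> x)) e (x0 n) (h n) (D n)
           else bias_even K p \<gamma> (\<lambda>x. g (\<mu> x)) e (rho g V \<mu>) f (x0 n) (h n) UNIV) - G.bias n)"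
        using bo by eventually_elim (use False in \<open>simp add: right_diff_distrib\<close>)
      ultimately show ?thesis by (rule Lim_transform_eventually)
    qed
  qed
qed

end

theorem theorem1:
  fixes M :: "'a measure"
    and X Y :: "nat \<Rightarrow> 'a \<Rightarrow> real"
    and YY I :: "real set"
    and f \<mu> v g ginv eta0 e V K :: "real \<Rightarrow> real"
    and Q :: "real \<Rightarrow> real \<Rightarrow> real"
    and eta :: "real \<Rightarrow> real ^ 'q \<Rightarrow> real"
    and AA :: "(real ^ 'q) set"
    and \<alpha> :: "real ^ 'q"
    and p :: nat and \<gamma> :: real and h :: "nat \<Rightarrow> real"
  (* model *)
  assumes "prob_space M"
    and "iid_pairs M X Y"
    and "\<forall>i. \<forall>\<omega>\<in>space M. Y i \<omega> \<in> YY"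
    and "\<forall>x. 0 \<le> f x"
    and "distributed M lborel (X 0) (\<lambda>x. ennreal (f x))"
    and "regression_function M (X 0) (Y 0) \<mu>"
    and "conditional_variance M (X 0) (Y 0) \<mu> v"
    and "open I" and "is_interval I"
    and "mono_on I g \<or> antimono_on I g" and "bij_betw g I UNIV"
    and "\<forall>x\<in>supp f. \<mu> x \<in> I"
    and "\<forall>w\<in>I. 0 < V w"
    and "\<forall>w\<in>I. \<forall>y\<in>YY. ((\<lambda>w. Q w y) has_real_derivative (y - w) / V w) (at w)"
    and "\<alpha> \<in> AA"
    and "ginv = the_inv_into I g" and "eta0 = (\<lambda>x. g (\<mu> x))" and "e = (\<lambda>x. eta x \<alpha>)"
  (* A1 *)
    and "\<forall>y\<in>YY. \<forall>x. (\<forall>i<2. (\<lambda>x. quasi_deriv Q ginv i x y) differentiable (at x)) \<and>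
                    quasi_deriv Q ginv 2 x y < 0"
  (* A2 *)
    and "cont_diff_within f (supp f)"
    and "times_cont_diff_on (p + 2) eta0 UNIV"
    and "times_cont_diff_on (p + 2) e UNIV"
    and "continuous_on (supp f) v"
    and "times_cont_diff_on 2 V I"
    and "times_cont_diff_on 3 g I"
  (* A3 *)
    and "\<forall>x\<in>supp f. rho g V \<mu> x \<noteq> 0 \<and> v x \<noteq> 0 \<and> deriv g (\<mu> x) \<noteq> 0"
  (* A4; square integrability makes the asymptotic variance well defined *)
    and "\<forall>z. 0 \<le> K z" and "\<forall>z. K (- z) = K z"
    and "integrable lborel K" and "(LINT z|lborel. K z) = 1"
    and "supp K = {-1..1}"
    and "integrable lborel (\<lambda>z. (K z)\<^sup>2)"
  (* A5 *)
    and "\<forall>xd\<in>frontier (supp f). \<exists>C. is_interval C \<and> xd \<in> C \<and> interior C \<noteq> {} \<and>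
                                     0 < (INF x\<in>C. f x)"
  (* degree, exponent and bandwidth *)
    and "0 < p" and "0 \<le> \<gamma>"
    and "\<forall>n. 0 < h n" and "h \<longlonglongrightarrow> 0"
    and "filterlim (\<lambda>n. real n * h n ^ (2 * p + 1)) at_top sequentially"
    and "Bseq (\<lambda>n. real n * h n ^ (2 * p + 3))"
  (* In the second part, the last premise before the estimator (even p only) says that the term of
     order h ^ (p + 1), which vanishes by symmetry at interior points, is negligible. *)
  shows
    "(\<forall>x0 bhat.
        x0 \<in> interior (supp f) \<and> e x0 \<noteq> 0 \<and>
        0 < f x0 \<and> lindeberg_at M (X 0) (Y 0) \<mu> x0 \<and>
        guided_estimator M X Y Q ginv K e \<gamma> p h (\<lambda>n. x0) bhat
        \<longrightarrow> asymp_normal M h (\<lambda>n. x0) bhat eta0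
              (\<lambda>n. asym_var K 0 0 p v g \<mu> f x0 UNIV)
              (\<lambda>n. if odd p then bias_odd K p \<gamma> eta0 e x0 (h n) UNIV
                   else bias_even K p \<gamma> eta0 e (rho g V \<mu>) f x0 (h n) UNIV))
     \<and>
     (\<forall>xd c bhat x0 D.
        xd \<in> frontier (supp f) \<and> c \<in> {-1..1} \<and>
        x0 = (\<lambda>n. xd + c * h n) \<and> D = (\<lambda>n. local_dom f (x0 n) (h n)) \<and>
        (\<forall>\<^sub>F n in sequentially. e (x0 n) \<noteq> 0) \<and> (\<gamma> \<noteq> 0 \<longrightarrow> e xd \<noteq> 0) \<and>
        (\<forall>\<^sub>F n in sequentially. closed_segment xd (x0 n) \<subseteq> supp f) \<and>
        lindeberg_at M (X 0) (Y 0) \<mu> xd \<and>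
        (even p \<longrightarrow>
           (\<lambda>n. sqrt (real n * h n) * bias_odd K p \<gamma> eta0 e (x0 n) (h n) (D n)) \<longlonglongrightarrow> 0) \<and>
        guided_estimator M X Y Q ginv K e \<gamma> p h x0 bhat
        \<longrightarrow> asymp_normal M h x0 bhat eta0
              (\<lambda>n. asym_var K 0 0 p v g \<mu> f (x0 n) (D n))
              (\<lambda>n. if odd p then bias_odd K p \<gamma> eta0 e (x0 n) (h n) (D n)
                   else bias_even K p \<gamma> eta0 e (rho g V \<mu>) f (x0 n) (h n) UNIV))"
proof -
  have eta0: "eta0 = (\<lambda>x. g (\<mu> x))" by fact
  interpret prob_space M by fact
  interpret kernel K by (unfold_locales) (use assms in simp_all)
  interpret quasi_link I YY g ginv V Q by unfold_locales (use assms in simp_all)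
  interpret guided_model M K I YY g ginv V Q X Y f \<mu> v e p \<gamma> h
    by unfold_locales (use assms in simp_all)
  show ?thesis
  proof (intro conjI allI impI; elim conjE)
    fix x0 :: real and bhat :: "nat \<Rightarrow> 'a \<Rightarrow> nat \<Rightarrow> real"
    assume "x0 \<in> interior (supp f)" "e x0 \<noteq> 0" "0 < f x0" "lindeberg_at M (X 0) (Y 0) \<mu> x0"
      "guided_estimator M X Y Q ginv K e \<gamma> p h (\<lambda>n. x0) bhat"
    then show "asymp_normal M h (\<lambda>n. x0) bhat eta0
              (\<lambda>n. asym_var K 0 0 p v g \<mu> f x0 UNIV)
              (\<lambda>n. if odd p then bias_odd K p \<gamma> eta0 e x0 (h n) UNIV
                   else bias_even K p \<gamma> eta0 e (rho g V \<mu>) f x0 (h n) UNIV)"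
      unfolding eta0 by (rule interior_case)
  next
    fix xd c :: real and bhat :: "nat \<Rightarrow> 'a \<Rightarrow> nat \<Rightarrow> real" and x0 :: "nat \<Rightarrow> real" and D :: "nat \<Rightarrow> real set"
    assume a: "xd \<in> frontier (supp f)" "x0 = (\<lambda>n. xd + c * h n)" "D = (\<lambda>n. local_dom f (x0 n) (h n))"
      "\<gamma> \<noteq> 0 \<longrightarrow> e xd \<noteq> 0" "\<forall>\<^sub>F n in sequentially. closed_segment xd (x0 n) \<subseteq> supp f"
      "lindeberg_at M (X 0) (Y 0) \<mu> xd"
      "even p \<longrightarrow> (\<lambda>n. sqrt (real n * h n) * bias_odd K p \<gamma> eta0 e (x0 n) (h n) (D n)) \<longlonglongrightarrow> 0"
      "guided_estimator M X Y Q ginv K e \<gamma> p h x0 bhat"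
    show "asymp_normal M h x0 bhat eta0
              (\<lambda>n. asym_var K 0 0 p v g \<mu> f (x0 n) (D n))
              (\<lambda>n. if odd p then bias_odd K p \<gamma> eta0 e (x0 n) (h n) (D n)
                   else bias_even K p \<gamma> eta0 e (rho g V \<mu>) f (x0 n) (h n) UNIV)"
      unfolding eta0 by (rule boundary_case[OF a(1-6) a(7)[unfolded eta0] a(8)])
  qed
qed

end
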